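(* There is an algorithm (called HirschNumber) which, given a number field $\mathbb{P}$, a positive integer $n$, and a finite subset $\mathcal{S}$ of $\mathrm{GL}(n,\mathbb{P})$ such that $G=\langle\mathcal{S}\rangle$ is solvable-by-finite, returns the torsion-free rank $\mathrm{h}(G)$ of $G$.
   Context: A group is solvable-by-finite if it has a solvable normal subgroup of finite index. A group has finite torsion-free rank if it has a subnormal series of finite length whose factors are either periodic (torsion) or infinite cyclic; the number $\mathrm{h}(G)$ of infinite cyclic factors in such a series is the Hirsch number, or torsion-free rank, of $G$ (independent of the series). Finitely generated solvable-by-finite subgroups of $\mathrm{GL}(n,\mathbb{P})$ have finite torsion-free rank. The number field is given explicitly as $\mathbb{P}=\mathbb{Q}(\alpha)$ by the minimal polynomial of $\alpha$ over $\mathbb{Q}$, and the matrices in $\mathcal{S}$ are given explicitly by their entries. *)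

theory Defs
  imports
    Complex_Main
    "HOL-Library.Nat_Bijection"
    "HOL-Computational_Algebra.Polynomial"
    "HOL-Algebra.Solvable_Groups"
    "HOL-Algebra.Elementary_Groups"
    "HOL-Algebra.Generated_Fields"
    "HOL-Algebra.Algebraic_Closure_Type"
    "Jordan_Normal_Form.Matrix"
begin

subsection \<open>Algorithms: partial recursive functions\<close>

text \<open>
  Programs are terms for Kleene's partial recursive functions. Arities are not part of the
  syntax: \<open>Zero\<close> is constant on argument lists of every length, \<open>Proj i\<close> is defined on all lists of
  length greater than \<open>i\<close>, and a program whose rules do not match its arguments has no value.
\<close>

datatype recf =
    Zero
  | Succ
  | Proj nat
  | Comp recf "recf list"
  | PrimRec recf recf
  | Minim recf

text \<open>\<open>evaluates p xs y\<close>: the program \<open>p\<close> halts on the arguments \<open>xs\<close> and returns \<open>y\<close>.\<close>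

inductive evaluates :: "recf \<Rightarrow> nat list \<Rightarrow> nat \<Rightarrow> bool" where
  zero: "evaluates Zero xs 0"
| succ: "evaluates Succ [x] (Suc x)"
| proj: "i < length xs \<Longrightarrow> evaluates (Proj i) xs (xs ! i)"
| comp: "list_all2 (\<lambda>g y. evaluates g xs y) gs ys \<Longrightarrow> evaluates f ys z \<Longrightarrow>
    evaluates (Comp f gs) xs z"
| primrec_0: "evaluates f xs y \<Longrightarrow> evaluates (PrimRec f g) (0 # xs) y"
| primrec_Suc: "evaluates (PrimRec f g) (n # xs) r \<Longrightarrow> evaluates g (n # r # xs) y \<Longrightarrow>
    evaluates (PrimRec f g) (Suc n # xs) y"
| minim: "(\<And>k. k < m \<Longrightarrow> \<exists>y. evaluates f (k # xs) (Suc y)) \<Longrightarrow> evaluates f (m # xs) 0 \<Longrightarrow>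
    evaluates (Minim f) xs m"

lemma evaluates_deterministic:
  assumes "evaluates p xs y" and "evaluates p xs z"
  shows "y = z"
  using assms
proof (induction arbitrary: z)
  case (zero xs)
  then show ?case by (auto elim: evaluates.cases)
next
  case (succ x)
  then show ?case by (auto elim: evaluates.cases)
next
  case (proj i xs)
  from proj(2) show ?case by (auto elim: evaluates.cases)
next
  case (comp xs gs ys f w)
  from comp.prems obtain ys' where
    a: "list_all2 (\<lambda>g y. evaluates g xs y) gs ys'" and b: "evaluates f ys' z"
    by (auto elim: evaluates.cases)
  have "ys = ys'"
    using comp.IH(1) a by (auto simp: list_all2_conv_all_nth intro: nth_equalityI)
  with b comp.IH(2) show ?case by simp
next
  case (primrec_0 f xs y g)
  from primrec_0.prems have "evaluates f xs z" by (auto elim: evaluates.cases)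
  then show ?case by (rule primrec_0.IH)
next
  case (primrec_Suc f g n xs r y)
  from primrec_Suc.prems obtain r' where
    "evaluates (PrimRec f g) (n # xs) r'" "evaluates g (n # r' # xs) z"
    by (auto elim: evaluates.cases)
  then show ?case using primrec_Suc.IH by blast
next
  case (minim m f xs)
  from minim.prems have a: "\<And>k. k < z \<Longrightarrow> \<exists>y. evaluates f (k # xs) (Suc y)"
    and b: "evaluates f (z # xs) 0"
    by (auto elim: evaluates.cases)
  have "\<not> z < m" using minim.IH(1) b by fastforce
  moreover have "\<not> m < z" using minim.IH(2) a by fastforce
  ultimately show ?case by simp
qed


subsection \<open>Number fields and general linear groups\<close>

text \<open>
  Number fields are taken as subfields \<open>\<rat>(\<alpha>)\<close> of the complex numbers; every number field embeds
  there, and algorithms receive only the minimal polynomial of \<open>\<alpha>\<close>, not the embedding.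
\<close>

definition rat_adjoin :: "complex \<Rightarrow> complex set" where
  "rat_adjoin \<alpha> = generate_field ring_of_type_algebra {\<alpha>}"

definition eval_rat_poly :: "complex \<Rightarrow> rat poly \<Rightarrow> complex" where
  "eval_rat_poly \<alpha> q = poly (map_poly of_rat q) \<alpha>"

definition minimal_polynomial :: "rat poly \<Rightarrow> complex \<Rightarrow> bool" where
  "minimal_polynomial m \<alpha> \<longleftrightarrow> lead_coeff m = 1 \<and> eval_rat_poly \<alpha> m = 0 \<and>
     (\<forall>q. q \<noteq> 0 \<and> eval_rat_poly \<alpha> q = 0 \<longrightarrow> degree m \<le> degree q)"

definition mat_monoid :: "nat \<Rightarrow> complex set \<Rightarrow> complex mat monoid" where
  "mat_monoid n P =
     \<lparr>carrier = {A \<in> carrier_mat n n. elements_mat A \<subseteq> P}, monoid.mult = (*), one = 1\<^sub>m n\<rparr>"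

definition GL :: "nat \<Rightarrow> complex set \<Rightarrow> complex mat monoid" where
  "GL n P = units_of (mat_monoid n P)"


subsection \<open>Solvable-by-finite groups and torsion-free rank\<close>

definition solvable_by_finite :: "('a, 'b) monoid_scheme \<Rightarrow> bool" where
  "solvable_by_finite G \<longleftrightarrow>
     (\<exists>N. N \<lhd> G \<and> solvable (G\<lparr>carrier := N\<rparr>) \<and> finite (rcosets\<^bsub>G\<^esub> N))"

definition subnormal_series :: "('a, 'b) monoid_scheme \<Rightarrow> 'a set list \<Rightarrow> bool" where
  "subnormal_series G Hs \<longleftrightarrow> Hs \<noteq> [] \<and> hd Hs = {\<one>\<^bsub>G\<^esub>} \<and> last Hs = carrier G \<and>
     (\<forall>H\<in>set Hs. subgroup H G) \<and>
     (\<forall>i. Suc i < length Hs \<longrightarrow> Hs ! i \<lhd> G\<lparr>carrier := Hs ! Suc i\<rparr>)"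

definition series_factor ::
    "('a, 'b) monoid_scheme \<Rightarrow> 'a set list \<Rightarrow> nat \<Rightarrow> 'a set monoid" where
  "series_factor G Hs i = G\<lparr>carrier := Hs ! Suc i\<rparr> Mod Hs ! i"

definition periodic_group :: "('a, 'b) monoid_scheme \<Rightarrow> bool" where
  "periodic_group G \<longleftrightarrow> (\<forall>x\<in>carrier G. \<exists>k::nat. k > 0 \<and> x [^]\<^bsub>G\<^esub> k = \<one>\<^bsub>G\<^esub>)"

definition infinite_cyclic_group :: "('a, 'b) monoid_scheme \<Rightarrow> bool" where
  "infinite_cyclic_group G \<longleftrightarrow> G \<cong> integer_group"

definition finite_rank_series :: "('a, 'b) monoid_scheme \<Rightarrow> 'a set list \<Rightarrow> bool" where
  "finite_rank_series G Hs \<longleftrightarrow> subnormal_series G Hs \<and>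
     (\<forall>i. Suc i < length Hs \<longrightarrow>
        periodic_group (series_factor G Hs i) \<or> infinite_cyclic_group (series_factor G Hs i))"

definition finite_torsion_free_rank :: "('a, 'b) monoid_scheme \<Rightarrow> bool" where
  "finite_torsion_free_rank G \<longleftrightarrow> (\<exists>Hs. finite_rank_series G Hs)"

text \<open>
  The description is proper for groups of finite torsion-free rank, since the number of infinite
  cyclic factors does not depend on the series.
\<close>

definition hirsch_number :: "('a, 'b) monoid_scheme \<Rightarrow> nat" where
  "hirsch_number G = (THE h. \<exists>Hs. finite_rank_series G Hs \<and>
     h = card {i. Suc i < length Hs \<and> infinite_cyclic_group (series_factor G Hs i)})"


subsection \<open>Input data and its encoding by natural numbers\<close>

text \<open>
  An element of \<open>\<rat>(\<alpha>)\<close> is given by the unique rational polynomial in \<open>\<alpha>\<close> of degree less than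
  that of the minimal polynomial, and a finite set of matrices by a list enumerating it.
\<close>

definition presents_matrices ::
    "rat poly \<Rightarrow> complex \<Rightarrow> nat \<Rightarrow> rat poly mat list \<Rightarrow> complex mat set \<Rightarrow> bool" where
  "presents_matrices m \<alpha> n Ms S \<longleftrightarrow>
     (\<forall>M\<in>set Ms. M \<in> carrier_mat n n \<and> (\<forall>q\<in>elements_mat M. degree q < degree m)) \<and>
     S = map_mat (eval_rat_poly \<alpha>) ` set Ms"

definition encode_rat :: "rat \<Rightarrow> nat" where
  "encode_rat r = (case quotient_of r of (a, b) \<Rightarrow> prod_encode (int_encode a, nat b))"

definition encode_poly :: "rat poly \<Rightarrow> nat" where
  "encode_poly q = list_encode (map encode_rat (coeffs q))"

definition encode_mat :: "rat poly mat \<Rightarrow> nat" where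
  "encode_mat M = list_encode (map (\<lambda>row. list_encode (map encode_poly row)) (mat_to_list M))"

definition encode_input :: "rat poly \<Rightarrow> nat \<Rightarrow> rat poly mat list \<Rightarrow> nat list" where
  "encode_input m n Ms = [encode_poly m, n, list_encode (map encode_mat Ms)]"

end

theory Submission
 imports Defs "Jordan_Normal_Form.Schur_Decomposition" "Jordan_Normal_Form.Char_Poly"
begin

text \<open>The rank is found by an unbounded search for a pair consisting of a number and a certificate for it.
 Certificates are sound and exist whenever \<open>G\<close> is solvable-by-finite, so the search ends with the rank.

 Restriction of scalars turns \<open>G\<close> into a group of rational matrices. A certificate exhibits a subgroup \<open>T\<close>
 of finite index with a normal subgroup \<open>N\<close> that is unipotent in a suitable basis and has abelian quotient; such
 \<open>T\<close> exist by Mal'cev's theorem. The rank of \<open>N\<close> is the length of a basis of its rational (Mal'cev) hull,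
 and the rank of \<open>T / N\<close> is the number of elements of \<open>T\<close> that are independent modulo \<open>N\<close> and
 generate \<open>T / N\<close> up to torsion.

 Only independence is not visibly semidecidable. If a product of powers of these elements lies in \<open>N\<close>, then by
 Dirichlet approximation some product with exponents in an explicit box has eigenvalues of small height;
 finitely many power traces of it are then integers of absolute value at most the dimension. Conversely,
 such traces force the eigenvalues to be roots of unity (Kronecker), which independence forbids once
 \<open>J\<close> is large enough. So independence is equivalent to a finite check on the traces of the box.\<close>

text \<open>The argument has no bound for the index of Mal'cev's subgroup, nor directly for the size
  of a relation modulo \<open>N\<close>. The first is left to the search. So the triangular form
  over the complex numbers is never computed: it enters completeness only through consequences free
  of the basis, namely characters seen as eigenvalues and vanishing products of matrices
  \<open>x - 1\<close>, from which a rational basis is rebuilt. The second cannot be left to a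
  search, since it concerns the absence of relations; there heights decide. Modulo \<open>N\<close>,
  the \<open>m\<close>-th power of the approximating product is a product of \<open>r\<close> powers
  with exponents at most \<open>m / Q\<close>. The value \<open>Q = n * (n * D * r * J)\<close> is
  chosen so that the \<open>m\<close>-th roots of its eigenvalues and their first \<open>J\<close>
  powers stay below \<open>1 + 1/n\<close>, and no denominator of 2 or more survives in a trace.
  \<open>J\<close> is named by the certificate: soundness holds for each value, and completeness
  supplies one that depends on the dimension alone.\<close>

notation mult_mat_vec (infixl "*v" 70) and pow_mat (infixr "^m" 75) and
 smult_vec (infixl "*s" 70) and smult_mat (infixl "*m" 70) and one_mat ("1m") and zero_mat ("0m") and zero_vec ("0v")
notation monoid.mult (infixl "**\<index>" 70)
notation (input) iff (infixr "<->" 25)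
abbreviation sqm :: "nat => 'a mat set" where "sqm n == carrier_mat n n"

subsection \<open>Computable functions\<close>

definition rf :: "nat => (nat list => nat) => bool" where
 "rf k F <-> (EX p. ALL xs. length xs = k --> evaluates p xs (F xs))"

lemma rf_zero: "rf k (%xs. 0)"
 unfolding rf_def by (blast intro: evaluates.zero)

lemma rf_proj: "i < k ==> rf k (%xs. xs ! i)"
 unfolding rf_def by (blast intro: evaluates.proj)

lemma rf_comp1:
 assumes "rf 1 (%xs. h (xs ! 0))" "rf k f"
 shows "rf k (%xs. h (f xs))"
proof -
 obtain p q where p: "!!xs. length xs = 1 ==> evaluates p xs (h (xs ! 0))"
  and q: "!!xs. length xs = k ==> evaluates q xs (f xs)"
  using assms unfolding rf_def by blast
 have "evaluates (Comp p [q]) xs (h (f xs))" if "length xs = k" for xs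
  using evaluates.comp[of xs "[q]" "[f xs]" p "h (f xs)"] p[of "[f xs]"] q[OF that] by simp
 thus ?thesis unfolding rf_def by blast
qed

lemma rf_Suc:
 assumes "rf k f"
 shows "rf k (%xs. Suc (f xs))"
proof (rule rf_comp1[OF _ assms])
 have "evaluates Succ xs (Suc (xs ! 0))" if "length xs = 1" for xs
  using that by (cases xs) (auto intro: evaluates.succ)
 thus "rf 1 (%xs. Suc (xs ! 0))" unfolding rf_def by blast
qed

lemma rf_const: "rf k (%xs. c)"
 by (induction c) (auto intro: rf_zero rf_Suc)

lemma list_all2_Proj:
 "n <= length xs ==> list_all2 (%g y. evaluates g xs y) (map Proj [0..<n]) (take n xs)"
 by (auto simp: list_all2_conv_all_nth intro: evaluates.proj)

lemma rf_rec:
 assumes n: "rf k n" and z: "rf k z"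
  and s: "rf (Suc (Suc k)) (%xs. s (xs ! 0) (xs ! 1) (drop 2 xs))"
 shows "rf k (%xs. rec_nat (z xs) (%i r. s i r xs) (n xs))"
proof -
 obtain p q r where p: "!!xs. length xs = k ==> evaluates p xs (n xs)"
  and q: "!!xs. length xs = k ==> evaluates q xs (z xs)"
  and r: "!!xs. length xs = Suc (Suc k) ==> evaluates r xs (s (xs ! 0) (xs ! 1) (drop 2 xs))"
  using assms unfolding rf_def by blast
 have a: "evaluates (PrimRec q r) (m # xs) (rec_nat (z xs) (%i r. s i r xs) m)"
  if l: "length xs = k" for m xs
 proof (induction m)
  case 0
  show ?case using q[OF l] by (auto intro: evaluates.primrec_0)
 next
  case (Suc m)
  show ?case
   using evaluates.primrec_Suc[OF Suc, of "rec_nat (z xs) (%i r. s i r xs) (Suc m)"] r[of "m # _ # xs"] l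
   by simp
 qed
 \<comment> \<open>\<open>PrimRec\<close> recurses on the head of its arguments, so the computed
   number of rounds is put in front of the unchanged list.\<close>
 have "evaluates (Comp (PrimRec q r) (p # map Proj [0..<k])) xs
   (rec_nat (z xs) (%i r. s i r xs) (n xs))" if l: "length xs = k" for xs
  by (rule evaluates.comp[of xs _ "n xs # xs"])
   (use p[OF l] list_all2_Proj[of k xs] l a[OF l] in auto)
 thus ?thesis unfolding rf_def by blast
qed

lemma rf_drop2:
 assumes "rf k f"
 shows "rf (Suc (Suc k)) (%xs. f (drop 2 xs))"
proof -
 obtain p where p: "!!xs. length xs = k ==> evaluates p xs (f xs)"
  using assms unfolding rf_def by blast
 have "evaluates (Comp p (map Proj [2..<Suc (Suc k)])) xs (f (drop 2 xs))"
  if l: "length xs = Suc (Suc k)" for xs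
 proof (rule evaluates.comp[of xs _ "drop 2 xs"])
  show "list_all2 (%g. evaluates g xs) (map Proj [2..<Suc (Suc k)]) (drop 2 xs)"
   unfolding list_all2_conv_all_nth
  proof (intro conjI allI impI)
   fix i assume "i < length (map Proj [2..<Suc (Suc k)])"
   hence "i < k" by (simp del: upt_Suc)
   thus "evaluates (map Proj [2..<Suc (Suc k)] ! i) xs (drop 2 xs ! i)"
    using l evaluates.proj[of "2 + i" xs] by (simp del: upt_Suc)
  qed (use l in "simp del: upt_Suc")
 next
  show "evaluates p (drop 2 xs) (f (drop 2 xs))" using p l by simp
 qed
 thus ?thesis unfolding rf_def by blast
qed

lemma rf_add: "rf k f ==> rf k g ==> rf k (%xs. f xs + g xs)"
proof -
 assume f: "rf k f" and g: "rf k g"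
 have "rf k (%xs. rec_nat (g xs) (%i r. Suc r) (f xs))"
  by (rule rf_rec[OF f g]) (intro rf_Suc rf_proj, simp)
 moreover have "rec_nat b (%i r. Suc r) a = a + b" for a b by (induction a) auto
 ultimately show ?thesis by simp
qed

lemma rf_pred: "rf k f ==> rf k (%xs. f xs - 1)"
proof -
 assume f: "rf k f"
 have "rf k (%xs. rec_nat 0 (%i r. i) (f xs))"
  by (rule rf_rec[OF f rf_zero]) (intro rf_proj, simp)
 moreover have "rec_nat 0 (%i r. i) a = a - 1" for a :: nat by (cases a) auto
 ultimately show ?thesis by simp
qed

lemma rf_diff: "rf k f ==> rf k g ==> rf k (%xs. f xs - g xs)"
proof -
 assume f: "rf k f" and g: "rf k g"
 have "rf k (%xs. rec_nat (f xs) (%i r. r - 1) (g xs))"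
  by (rule rf_rec[OF g f]) (intro rf_pred rf_proj, simp)
 moreover have "rec_nat a (%i r. r - 1) b = a - b" for a b :: nat by (induction b) auto
 ultimately show ?thesis by simp
qed

lemma rf_mult: "rf k f ==> rf k g ==> rf k (%xs. f xs * g xs)"
proof -
 assume f: "rf k f" and g: "rf k g"
 have "rf k (%xs. rec_nat 0 (%i r. r + g xs) (f xs))"
  by (rule rf_rec[OF f rf_zero]) (intro rf_add rf_proj rf_drop2 g, simp)
 moreover have "rec_nat 0 (%i r. r + b) a = a * b" for a b :: nat by (induction a) auto
 ultimately show ?thesis by simp
qed

lemma rf_if: "rf k c ==> rf k f ==> rf k g ==> rf k (%xs. if c xs = 0 then f xs else g xs)"
proof -
 assume c: "rf k c" and f: "rf k f" and g: "rf k g"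
 have "rf k (%xs. rec_nat (f xs) (%i r. g xs) (c xs))"
  by (rule rf_rec[OF c f]) (intro rf_drop2 g)
 moreover have "rec_nat a (%i r. b) c = (if c = 0 then a else b)" for a b c :: nat by (cases c) auto
 ultimately show ?thesis by simp
qed

lemma rf_triangle: "rf k f ==> rf k (%xs. triangle (f xs))"
proof -
 assume f: "rf k f"
 have "rf k (%xs. rec_nat 0 (%i r. r + Suc i) (f xs))"
  by (rule rf_rec[OF f rf_zero]) (intro rf_add rf_Suc rf_proj, auto)
 moreover have "rec_nat 0 (%i r. r + Suc i) a = triangle a" for a :: nat by (induction a) auto
 ultimately show ?thesis by simp
qed

text \<open>\<open>Minim\<close> requires a value at every smaller argument; these exist because
  \<open>f\<close> is computed on every list of the right length.\<close>

lemma rf_Least: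
 assumes f: "rf (Suc k) (%xs. f (hd xs) (tl xs))"
  and ex: "!!xs. length xs = k ==> EX m. f m xs = 0"
 shows "rf k (%xs. LEAST m. f m xs = 0)"
proof -
 obtain p where p: "!!xs. length xs = Suc k ==> evaluates p xs (f (hd xs) (tl xs))"
  using f unfolding rf_def by blast
 have "evaluates (Minim p) xs (LEAST m. f m xs = 0)" if l: "length xs = k" for xs
 proof (rule evaluates.minim)
  fix j assume "j < (LEAST m. f m xs = 0)"
  hence "f j xs ~= 0" by (rule not_less_Least)
  then obtain y where "f j xs = Suc y" by (cases "f j xs") auto
  thus "EX y. evaluates p (j # xs) (Suc y)" using p[of "j # xs"] l by auto
 next
  have "f (LEAST m. f m xs = 0) xs = 0" using ex[OF l] by (rule LeastI_ex)
  thus "evaluates p ((LEAST m. f m xs = 0) # xs) 0"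
   using p[of "(LEAST m. f m xs = 0) # xs"] l by simp
 qed
 thus ?thesis unfolding rf_def by blast
qed

lemma rf_hd: "rf (Suc k) hd"
proof -
 have "evaluates (Proj 0) xs (hd xs)" if "length xs = Suc k" for xs
  using evaluates.proj[of 0 xs] that by (cases xs) auto
 thus ?thesis unfolding rf_def by blast
qed

lemma rf_tl:
 assumes "rf k f"
 shows "rf (Suc k) (%xs. f (tl xs))"
proof -
 obtain p where p: "!!xs. length xs = k ==> evaluates p xs (f xs)"
  using assms unfolding rf_def by blast
 have "evaluates (Comp p (map Proj [1..<Suc k])) xs (f (tl xs))"
  if l: "length xs = Suc k" for xs
 proof (rule evaluates.comp[of xs _ "tl xs"])
  show "list_all2 (%g. evaluates g xs) (map Proj [1..<Suc k]) (tl xs)"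
   unfolding list_all2_conv_all_nth
  proof (intro conjI allI impI)
   fix i assume "i < length (map Proj [1..<Suc k])"
   hence "i < k" by (simp del: upt_Suc)
   thus "evaluates (map Proj [1..<Suc k] ! i) xs (tl xs ! i)"
    using l evaluates.proj[of "Suc i" xs] by (simp add: nth_tl del: upt_Suc)
  qed (use l in "simp del: upt_Suc")
 next
  show "evaluates p (tl xs) (f (tl xs))" using p l by simp
 qed
 thus ?thesis unfolding rf_def by blast
qed

text \<open>\<open>prod_encode (m, n)\<close> is \<open>triangle (m + n) + m\<close>, so this search
  finds the diagonal \<open>m + n\<close> of a pair code. The condition
  \<open>c < triangle (Suc s)\<close> is written as a vanishing truncated difference because
  \<open>Minim\<close> looks for a zero.\<close>

definition triroot :: "nat => nat" where
 "triroot c = (LEAST s. Suc c - triangle (Suc s) = 0)"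

lemma triangle_mono: "a <= b ==> triangle a <= triangle b"
 unfolding triangle_def by (intro div_le_mono mult_le_mono) auto

lemma triroot_prod_encode: "triroot (prod_encode (m, n)) = m + n"
 unfolding triroot_def
proof (rule Least_equality)
 show "Suc (prod_encode (m, n)) - triangle (Suc (m + n)) = 0"
  by (simp add: prod_encode_def)
next
 fix s assume a: "Suc (prod_encode (m, n)) - triangle (Suc s) = 0"
 show "m + n <= s"
 proof (rule ccontr)
  assume "~ m + n <= s"
  hence "triangle (Suc s) <= triangle (m + n)" by (intro triangle_mono) simp
  thus False using a by (simp add: prod_encode_def)
 qed
qed

lemma rf_triroot:
 assumes "rf k f"
 shows "rf k (%xs. triroot (f xs))"
proof (rule rf_comp1[OF _ assms])
 define F where "F m xs = Suc (xs ! 0) - triangle (Suc m)" for m and xs :: "nat list"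
 have "rf (Suc 1) (%xs. F (hd xs) (tl xs))"
  unfolding F_def using rf_tl[OF rf_proj[of 0 1]]
  by (intro rf_diff rf_Suc rf_triangle rf_hd) simp
 moreover have "Suc c - triangle (Suc c) = 0" for c by (induction c) auto
 hence "EX m. F m xs = 0" for xs unfolding F_def by blast
 ultimately have "rf 1 (%xs. LEAST m. F m xs = 0)" by (rule rf_Least)
 thus "rf 1 (%xs. triroot (xs ! 0))" unfolding triroot_def F_def .
qed

text \<open>Arithmetic forms of the components of \<open>prod_decode\<close>; for them computability
  follows from the closure lemmas above.\<close>

definition pfst :: "nat => nat" where "pfst c = c - triangle (triroot c)"
definition psnd :: "nat => nat" where "psnd c = triroot c - pfst c"

lemma pfst_prod_encode [simp]: "pfst (prod_encode (m, n)) = m"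
 unfolding pfst_def triroot_prod_encode by (simp add: prod_encode_def)

lemma psnd_prod_encode [simp]: "psnd (prod_encode (m, n)) = n"
 unfolding psnd_def by (simp add: triroot_prod_encode)

lemma prod_encode_pfst_psnd [simp]: "prod_encode (pfst c, psnd c) = c"
proof -
 obtain m n where "c = prod_encode (m, n)"
  using prod_decode_inverse[of c] by (cases "prod_decode c") auto
 thus ?thesis by simp
qed

lemma rf_pfst: "rf k f ==> rf k (%xs. pfst (f xs))"
 unfolding pfst_def by (intro rf_diff rf_triangle rf_triroot)

lemma rf_psnd: "rf k f ==> rf k (%xs. psnd (f xs))"
 unfolding psnd_def by (intro rf_diff rf_pfst rf_triroot)

lemma rf_prod_encode: "rf k f ==> rf k g ==> rf k (%xs. prod_encode (f xs, g xs))"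
 unfolding prod_encode_def prod.case by (intro rf_add rf_triangle)

section \<open>Computability for functions between encoded types\<close>

class enc =
 fixes enc :: "'a => nat"
 assumes inj_enc: "inj enc"

lemma enc_eq_iff [simp]: "enc x = enc y <-> x = y"
 using inj_enc by (auto dest: injD)

instantiation nat :: enc begin
definition "enc_nat (n :: nat) = n"
instance by standard (auto simp: enc_nat_def inj_on_def)
end

text \<open>\<open>True\<close> has code 0, the value at which \<open>Minim\<close> stops.\<close>

instantiation bool :: enc begin
definition "enc_bool (b :: bool) = (if b then 0 else 1 :: nat)"
instance by standard (auto simp: enc_bool_def inj_on_def split: if_splits)
end

instantiation int :: enc begin
definition "enc_int (i :: int) = int_encode i"
instance by standard (auto simp: enc_int_def int_encode_eq intro!: injI)
end

instantiation prod :: (enc, enc) enc begin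
definition "enc_prod (p :: 'a \<times> 'b) = prod_encode (enc (fst p), enc (snd p))"
instance by standard (auto simp: enc_prod_def inj_on_def)
end

instantiation list :: (enc) enc begin
definition "enc_list (l :: 'a list) = list_encode (map enc l)"
instance
 by standard (auto simp: enc_list_def list_encode_eq inj_map_eq_map[OF inj_enc] intro!: injI)
end

text \<open>Rationals are coded by \<open>encode_rat\<close> and lists by
  \<open>list_encode\<close>, so the codes of the input data are literally values of
  \<open>enc\<close>.\<close>

instantiation rat :: enc begin
definition "enc_rat (r :: rat) = encode_rat r"
instance
proof (standard, rule injI)
 fix r s :: rat assume a: "enc r = enc s"
 obtain a b c d where q: "quotient_of r = (a, b)" "quotient_of s = (c, d)" by fastforce
 have "b > 0" "d > 0" using q by (auto dest: quotient_of_denom_pos)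
 moreover have "a = c" "nat b = nat d" using a q
  by (auto simp: enc_rat_def encode_rat_def int_encode_eq)
 ultimately have "quotient_of r = quotient_of s" using q by auto
 thus "r = s" by (simp add: quotient_of_inject)
qed
end

text \<open>All arguments are packed into one tuple, so a single rule per operation suffices. An
  operation that binds a variable has a premise on pairs, whose first component carries the point
  \<open>x\<close> as a parameter.\<close>

definition tcomp :: "('a :: enc => 'b :: enc) => bool" where
 "tcomp f <-> (EX p. ALL x. evaluates p [enc x] (enc (f x)))"

named_theorems tc

lemma tcomp_id [tc]: "tcomp (%x. x)"
 unfolding tcomp_def using evaluates.proj[of 0] by (metis length_Cons nth_Cons_0 zero_less_Suc)

lemma tcomp_comp: "tcomp f ==> tcomp g ==> tcomp (%x. f (g x))"
proof -
 assume "tcomp f" "tcomp g"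
 then obtain p q where p: "!!x. evaluates p [enc x] (enc (f x))" and q: "!!x. evaluates q [enc x] (enc (g x))"
  unfolding tcomp_def by blast
 have "evaluates (Comp p [q]) [enc x] (enc (f (g x)))" for x
  using evaluates.comp[of "[enc x]" "[q]" "[enc (g x)]" p] p[of "g x"] q[of x] by simp
 thus ?thesis unfolding tcomp_def by blast
qed

text \<open>Programs see only codes, so a function can be replaced by one into another type with the
  same codes. This is how computability is carried from \<open>nat\<close> to \<open>int\<close>,
  \<open>rat\<close> and lists.\<close>

lemma tcomp_enc_eq: "tcomp f ==> (!!x. enc (g x) = enc (f x)) ==> tcomp g"
 unfolding tcomp_def by simp

lemma tcomp_lift1:
 assumes h: "rf 1 (%xs. h (xs ! 0))" and f: "tcomp f" and e: "!!x. enc (g x) = h (enc (f x))"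
 shows "tcomp g"
proof -
 obtain p q where p: "!!xs. length xs = 1 ==> evaluates p xs (h (xs ! 0))"
  and q: "!!x. evaluates q [enc x] (enc (f x))"
  using h f unfolding rf_def tcomp_def by blast
 have "evaluates (Comp p [q]) [enc x] (enc (g x))" for x
  using evaluates.comp[of "[enc x]" "[q]" "[enc (f x)]" p] p[of "[enc (f x)]"] q[of x] e by simp
 thus ?thesis unfolding tcomp_def by blast
qed

lemma tcomp_lift2:
 assumes h: "rf 2 (%xs. h (xs ! 0) (xs ! 1))" and f: "tcomp f" and f': "tcomp f'"
  and e: "!!x. enc (g x) = h (enc (f x)) (enc (f' x))"
 shows "tcomp g"
proof -
 obtain p q r where p: "!!xs. length xs = 2 ==> evaluates p xs (h (xs ! 0) (xs ! 1))"
  and q: "!!x. evaluates q [enc x] (enc (f x))" and r: "!!x. evaluates r [enc x] (enc (f' x))"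
  using h f f' unfolding rf_def tcomp_def by blast
 have "evaluates (Comp p [q, r]) [enc x] (enc (g x))" for x
  using evaluates.comp[of "[enc x]" "[q, r]" "[enc (f x), enc (f' x)]" p] p[of "[enc (f x), enc (f' x)]"]
   q[of x] r[of x] e by simp
 thus ?thesis unfolding tcomp_def by blast
qed

lemma tcomp_const [tc]: "tcomp (%x. c)"
 by (rule tcomp_lift1[OF rf_const[of 1 "enc c"] tcomp_id]) simp

lemma tcomp_Pair [tc]: "tcomp f ==> tcomp g ==> tcomp (%x. (f x, g x))"
 by (rule tcomp_lift2[of "%a b. prod_encode (a, b)" f g])
  (auto simp: enc_prod_def intro!: rf_prod_encode rf_proj)

lemma tcomp_fst [tc]: "tcomp f ==> tcomp (%x. fst (f x))"
 by (rule tcomp_lift1[of pfst]) (auto simp: enc_prod_def intro!: rf_pfst rf_proj)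

lemma tcomp_snd [tc]: "tcomp f ==> tcomp (%x. snd (f x))"
 by (rule tcomp_lift1[of psnd]) (auto simp: enc_prod_def intro!: rf_psnd rf_proj)

lemma tcomp_Suc [tc]: "tcomp f ==> tcomp (%x. Suc (f x))"
 by (rule tcomp_lift1[of Suc]) (auto simp: enc_nat_def intro!: rf_Suc rf_proj)

lemma tcomp_add_nat [tc]: "tcomp f ==> tcomp g ==> tcomp (%x. f x + g x :: nat)"
 by (rule tcomp_lift2[of "(+)" f g]) (auto simp: enc_nat_def intro!: rf_add rf_proj)

lemma tcomp_diff_nat [tc]: "tcomp f ==> tcomp g ==> tcomp (%x. f x - g x :: nat)"
 by (rule tcomp_lift2[of "(-)" f g]) (auto simp: enc_nat_def intro!: rf_diff rf_proj)

lemma tcomp_mult_nat [tc]: "tcomp f ==> tcomp g ==> tcomp (%x. f x * g x :: nat)"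
 by (rule tcomp_lift2[of "(*)" f g]) (auto simp: enc_nat_def intro!: rf_mult rf_proj)

lemma tcomp_not [tc]: "tcomp f ==> tcomp (%x. ~ f x)"
 by (rule tcomp_lift1[of "%a. 1 - a"]) (auto simp: enc_bool_def intro!: rf_diff rf_proj rf_const)

lemma tcomp_conj [tc]: "tcomp f ==> tcomp g ==> tcomp (%x. f x & g x)"
 by (rule tcomp_lift2[of "%a b. if a = 0 then b else 1" f g])
  (auto simp: enc_bool_def intro!: rf_if rf_proj rf_const)

lemma tcomp_disj [tc]: "tcomp f ==> tcomp g ==> tcomp (%x. f x | g x)"
 by (rule tcomp_lift2[of "%a b. if a = 0 then 0 else b" f g])
  (auto simp: enc_bool_def intro!: rf_if rf_proj rf_const)

lemma tcomp_imp [tc]: "tcomp f ==> tcomp g ==> tcomp (%x. f x --> g x)"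
 unfolding imp_conv_disj by (intro tc)

lemma tcomp_le [tc]: "tcomp f ==> tcomp g ==> tcomp (%x. f x <= (g x :: nat))"
 by (rule tcomp_lift2[of "%a b. if a - b = 0 then 0 else 1" f g])
  (auto simp: enc_bool_def enc_nat_def simp del: diff_is_0_eq intro!: rf_if rf_diff rf_proj rf_const)

lemma tcomp_less [tc]: "tcomp f ==> tcomp g ==> tcomp (%x. f x < (g x :: nat))"
 unfolding Suc_le_eq[symmetric] by (intro tc)

lemma tcomp_eq [tc]: "tcomp f ==> tcomp g ==> tcomp (%x. f x = g x)"
proof -
 assume f: "tcomp f" and g: "tcomp g"
 have "tcomp (%x. enc (f x))" "tcomp (%x. enc (g x))"
  using f g by (auto intro: tcomp_enc_eq simp: enc_nat_def)
 hence "tcomp (%x. enc (f x) <= enc (g x) & enc (g x) <= enc (f x))" by (intro tc)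
 thus ?thesis by (simp add: order_eq_iff[symmetric])
qed

lemma tcomp_If [tc]:
 assumes b: "tcomp b" and f: "tcomp f" and g: "tcomp g"
 shows "tcomp (%x. if b x then f x else g x)"
proof -
 \<comment> \<open>The two branches travel as one pair, which leaves two arguments for the binary
   lifting rule.\<close>
 have p: "tcomp (%x. (enc (f x), enc (g x)))"
  by (rule tcomp_enc_eq[OF tcomp_Pair[OF f g]]) (simp add: enc_prod_def enc_nat_def)
 have h: "rf 2 (%xs. if xs ! 0 = 0 then pfst (xs ! 1) else psnd (xs ! 1))"
  by (intro rf_if rf_proj rf_pfst rf_psnd) auto
 show ?thesis
  by (rule tcomp_lift2[OF h b p]) (auto simp: enc_bool_def enc_nat_def enc_prod_def)
qed

lemma tcomp_rec_nat:
 assumes n: "tcomp n" and z: "tcomp z"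
  and s: "tcomp (%p. s (fst p) (fst (snd p)) (snd (snd p)))"
 shows "tcomp (%x. rec_nat (z x) (%i r. s x i r) (n x))"
proof -
 obtain p q r where p: "!!x. evaluates p [enc x] (enc (n x))"
  and q: "!!x. evaluates q [enc x] (enc (z x))"
  and r: "!!x. evaluates r [enc x] (enc (s (fst x) (fst (snd x)) (snd (snd x))))"
  using assms unfolding tcomp_def by blast
 \<comment> \<open>\<open>PrimRec\<close> hands over counter, previous value and parameter in this
   order, whereas the program for \<open>s\<close> expects the parameter first and everything in one
   code.\<close>
 have "rf 3 (%xs. prod_encode (xs ! 2, prod_encode (xs ! 0, xs ! 1)))"
  by (intro rf_prod_encode rf_proj) auto
 then obtain t where t: "!!xs. length xs = 3 ==>
   evaluates t xs (prod_encode (xs ! 2, prod_encode (xs ! 0, xs ! 1)))"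
  unfolding rf_def by blast
 have r': "evaluates (Comp r [t]) [i, enc a, enc x] (enc (s x i a))" for i a x
  using evaluates.comp[of "[i, enc a, enc x]" "[t]" "[enc (x, i, a)]" r] r[of "(x, i, a)"]
   t[of "[i, enc a, enc x]"] by (simp add: enc_prod_def enc_nat_def)
 have a: "evaluates (PrimRec q (Comp r [t])) [m, enc x] (enc (rec_nat (z x) (%i r. s x i r) m))" for m x
 proof (induction m)
  case 0
  show ?case using q by (auto intro: evaluates.primrec_0)
 next
  case (Suc m)
  show ?case
   using evaluates.primrec_Suc[OF Suc] r' by simp
 qed
 have "evaluates (Comp (PrimRec q (Comp r [t])) [p, Proj 0]) [enc x]
   (enc (rec_nat (z x) (%i r. s x i r) (n x)))" for x
  by (rule evaluates.comp[of _ _ "[n x, enc x]"])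
   (use p[of x] evaluates.proj[of 0 "[enc x]"] a in "auto simp: enc_nat_def")
 thus ?thesis unfolding tcomp_def by blast
qed

text \<open>At a point without a witness the program may diverge and nothing is claimed; the final
  search rests on this partial form.\<close>

lemma computes_Least:
 fixes P :: "'a :: enc => nat => bool"
 assumes P: "tcomp (%p. P (fst p) (snd p))"
 shows "EX p. ALL x. (EX n. P x n) --> evaluates p [enc x] (enc (LEAST n. P x n))"
proof -
 obtain p where p: "!!x. evaluates p [enc x] (enc (P (fst x) (snd x)))"
  using P unfolding tcomp_def by blast
 have "rf 2 (%xs. prod_encode (xs ! 1, xs ! 0))" by (intro rf_prod_encode rf_proj) auto
 then obtain t where t: "!!xs. length xs = 2 ==> evaluates t xs (prod_encode (xs ! 1, xs ! 0))"
  unfolding rf_def by blast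
 have p': "evaluates (Comp p [t]) [n, enc x] (enc (P x n))" for n x
  using evaluates.comp[of "[n, enc x]" "[t]" "[enc (x, n)]" p] p[of "(x, n)"] t[of "[n, enc x]"]
  by (simp add: enc_prod_def enc_nat_def)
 have "evaluates (Minim (Comp p [t])) [enc x] (enc (LEAST n. P x n))" if ex: "EX n. P x n" for x
 proof -
  have "evaluates (Minim (Comp p [t])) [enc x] (LEAST n. P x n)"
  proof (rule evaluates.minim)
   fix j assume "j < (LEAST m. P x m)"
   hence "~ P x j" by (rule not_less_Least)
   thus "EX y. evaluates (Comp p [t]) [j, enc x] (Suc y)" using p'[of j x] by (auto simp: enc_bool_def)
  next
   have "P x (LEAST m. P x m)" using ex by (rule LeastI_ex)
   thus "evaluates (Comp p [t]) [LEAST m. P x m, enc x] 0" using p'[of "LEAST m. P x m" x]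
    by (simp add: enc_bool_def)
  qed
  thus ?thesis by (simp add: enc_nat_def)
 qed
 thus ?thesis by blast
qed

lemma tcomp_Least:
 fixes P :: "'a :: enc => nat => bool"
 assumes "tcomp (%p. P (fst p) (snd p))" and "!!x. EX n. P x n"
 shows "tcomp (%x. LEAST n. P x n)"
 using computes_Least[OF assms(1)] assms(2) unfolding tcomp_def by blast

lemma tcomp_all_less [tc]:
 fixes P :: "'a :: enc => nat => bool"
 assumes "tcomp n" and "tcomp (%p. P (fst p) (snd p))"
 shows "tcomp (%x. ALL i < n x. P x i)"
proof -
 have "tcomp (%p :: 'a \<times> nat \<times> bool. (%q. P (fst q) (snd q)) (fst p, fst (snd p)))"
  by (rule tcomp_comp[OF assms(2)]) (intro tc)
 hence "tcomp (%x. rec_nat True (%i r. P x i & r) (n x))"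
  by (intro tcomp_rec_nat assms tc) simp
 moreover have "rec_nat True (%i r. P x i & r) m = (ALL i < m. P x i)" for x m
  by (induction m) (auto simp: less_Suc_eq)
 ultimately show ?thesis by simp
qed

section \<open>Lists and further arithmetic of natural numbers\<close>

lemma psnd_0: "psnd 0 = 0"
 using psnd_prod_encode[of 0 0] by (simp add: prod_encode_def)

lemma tcomp_list_code: "tcomp f ==> tcomp (%x. enc (f x))"
 by (auto intro: tcomp_enc_eq simp: enc_nat_def)

lemma enc_Nil: "enc [] = 0" and enc_Cons: "enc (x # xs) = Suc (prod_encode (enc x, enc xs))"
 by (simp_all add: enc_list_def)

lemma enc_eq_0_iff [simp]: "enc (l :: 'a :: enc list) = 0 <-> l = []"
 by (cases l) (simp_all add: enc_Nil enc_Cons)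

lemma tcomp_Cons [tc]: "tcomp f ==> tcomp g ==> tcomp (%x. f x # g x)"
 by (rule tcomp_lift2[of "%a b. Suc (prod_encode (a, b))" f g])
  (auto simp: enc_Cons intro!: rf_Suc rf_prod_encode rf_proj)

lemma tcomp_tl [tc]: "tcomp f ==> tcomp (%x. tl (f x))"
proof -
 assume f: "tcomp f"
 have e: "enc (tl (f x)) = psnd (enc (f x) - 1)" for x
  by (cases "f x") (auto simp: enc_Nil enc_Cons psnd_0)
 show ?thesis
  by (rule tcomp_lift1[of "%a. psnd (a - 1)", OF _ f e]) (intro rf_psnd rf_diff rf_proj rf_const, simp)
qed

lemma tcomp_hd [tc]: "tcomp f ==> tcomp (%x. hd (f x))"
proof -
 assume f: "tcomp f"
 have e: "enc (hd (f x)) = (if enc (f x) = 0 then enc (hd [] :: 'b) else pfst (enc (f x) - 1))" for x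
  by (cases "f x") (auto simp: enc_Nil enc_Cons)
 show ?thesis
  by (rule tcomp_lift1[of "%a. if a = 0 then enc (hd [] :: 'b) else pfst (a - 1)", OF _ f e]) (intro rf_pfst rf_if rf_diff rf_proj rf_const, simp_all)
qed

text \<open>Supplies a computable number of rounds that is large enough for a fold over the
  list.\<close>

lemma length_le_enc: "length l <= enc l"
proof (induction l)
 case (Cons a l)
 have "enc l <= prod_encode (enc a, enc l)" by (rule le_prod_encode_2)
 thus ?case using Cons by (simp add: enc_Cons)
qed simp

lemma tcomp_fold:
 fixes l :: "'a :: enc => 'b :: enc list" and z :: "'a => 'c :: enc"
 assumes l: "tcomp l" and z: "tcomp z"
  and f: "tcomp (%p. f (fst p) (fst (snd p)) (snd (snd p)))"
 shows "tcomp (%x. fold (f x) (l x) (z x))"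
proof -
 \<comment> \<open>The state holds the unread rest of the list and the accumulator. Rounds after the
   end of the list change nothing, so any sufficiently large number of them gives the fold.\<close>
 define s where "s x r = (if fst r = [] then r else (tl (fst r), f x (hd (fst r)) (snd r)))"
  for x :: 'a and r :: "'b list \<times> 'c"
 have "rec_nat (k, a) (%_. s x) n = (drop n k, fold (f x) (take n k) a)" for x n k a
 proof (induction n)
  case (Suc n)
  show ?case
  proof (cases "n < length k")
   case True
   thus ?thesis using Suc
    by (auto simp: s_def take_Suc_conv_app_nth hd_drop_conv_nth tl_drop drop_Suc)
  qed (use Suc in "auto simp: s_def")
 qed simp
 from this[of "l x" "z x" x "enc (l x)" for x] length_le_enc[of "l x" for x]
 have eq: "fold (f x) (l x) (z x) = snd (rec_nat (l x, z x) (%_. s x) (enc (l x)))" for x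
  by simp
 have "tcomp (%p :: 'a \<times> nat \<times> 'b list \<times> 'c. (%p. f (fst p) (fst (snd p)) (snd (snd p)))
   (fst p, hd (fst (snd (snd p))), snd (snd (snd p))))"
  by (rule tcomp_comp[OF f]) (intro tc)
 hence "tcomp (%p :: 'a \<times> nat \<times> 'b list \<times> 'c. s (fst p) (snd (snd p)))"
  unfolding s_def by (intro tc) simp
 thus ?thesis unfolding eq
  by (intro tcomp_snd tcomp_rec_nat tcomp_list_code l tcomp_Pair z)
qed

lemma tcomp_rev [tc]: "tcomp l ==> tcomp (%x. rev (l x))"
proof -
 assume "tcomp l"
 hence "tcomp (%x. fold (%a r. a # r) (l x) [])" by (intro tcomp_fold tc | assumption)+
 thus ?thesis by (simp add: rev_conv_fold)
qed

lemma tcomp_append [tc]: "tcomp l ==> tcomp k ==> tcomp (%x. l x @ k x)"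
proof -
 assume "tcomp l" "tcomp k"
 hence "tcomp (%x. fold (%a r. a # r) (rev (l x)) (k x))" by (intro tcomp_fold tc | assumption)+
 moreover have "fold (%a r. a # r) (rev a) b = a @ b" for a b :: "'b list"
  by (induction a arbitrary: b) (auto simp: fold_append)
 ultimately show ?thesis by simp
qed

lemma tcomp_map [tc]:
 assumes l: "tcomp l" and f: "tcomp (%p. f (fst p) (snd p))"
 shows "tcomp (%x. map (f x) (l x))"
proof -
 have "tcomp (%p :: 'a \<times> 'b \<times> 'c list. (%p. f (fst p) (snd p)) (fst p, fst (snd p)))"
  by (rule tcomp_comp[OF f]) (intro tc)
 hence "tcomp (%x. rev (fold (%a r. f x a # r) (l x) []))"
  by (intro tcomp_rev tcomp_fold l) (intro tc, simp)+
 moreover have "fold (%a r. f x a # r) k r = rev (map (f x) k) @ r" for x k r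
  by (induction k arbitrary: r) auto
 ultimately show ?thesis by simp
qed

lemma tcomp_list_all [tc]:
 assumes l: "tcomp l" and f: "tcomp (%p. f (fst p) (snd p))"
 shows "tcomp (%x. ALL a:set (l x). f x a)"
proof -
 have "tcomp (%p :: 'a \<times> 'b \<times> bool. (%p. f (fst p) (snd p)) (fst p, fst (snd p)))"
  by (rule tcomp_comp[OF f]) (intro tc)
 hence "tcomp (%x. fold (%a r. f x a & r) (l x) True)"
  by (intro tcomp_fold l) (intro tc, simp)+
 moreover have "fold (%a r. f x a & r) k r = ((ALL a:set k. f x a) & r)" for x k r
  by (induction k arbitrary: r) auto
 ultimately show ?thesis by simp
qed

lemma tcomp_list_ex [tc]:
 assumes l: "tcomp l" and f: "tcomp (%p. f (fst p) (snd p))"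
 shows "tcomp (%x. EX a:set (l x). f x a)"
proof -
 have "tcomp (%x. ~ (ALL a:set (l x). ~ f x a))" by (intro tc assms)
 thus ?thesis by simp
qed

lemma tcomp_length [tc]: "tcomp l ==> tcomp (%x. length (l x))"
proof -
 assume "tcomp l"
 hence "tcomp (%x. fold (%a r. Suc r) (l x) 0)" by (intro tcomp_fold tc | assumption)+
 moreover have "fold (%a r. Suc r) k r = length k + r" for k :: "'b list" and r
  by (induction k arbitrary: r) auto
 ultimately show ?thesis by simp
qed

lemma tcomp_drop [tc]: "tcomp n ==> tcomp l ==> tcomp (%x. drop (n x) (l x))"
proof -
 assume "tcomp n" "tcomp l"
 hence "tcomp (%x. rec_nat (l x) (%i r. tl r) (n x))" by (intro tcomp_rec_nat tc | assumption)+
 moreover have "rec_nat k (%i r. tl r) m = drop m k" for k :: "'b list" and m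
  by (induction m) (auto simp: drop_Suc tl_drop)
 ultimately show ?thesis by simp
qed

lemma tcomp_nth_default [tc]:
 "tcomp d ==> tcomp l ==> tcomp i ==> tcomp (%x. nth_default (d x) (l x) (i x))"
proof -
 assume "tcomp d" "tcomp l" "tcomp i"
 hence "tcomp (%x. if i x < length (l x) then hd (drop (i x) (l x)) else d x)" by (intro tc)
 thus ?thesis by (rule tcomp_enc_eq) (simp add: nth_default_def hd_drop_conv_nth)
qed

lemma tcomp_upt [tc]: "tcomp n ==> tcomp (%x. [0..<n x])"
proof -
 assume "tcomp n"
 hence "tcomp (%x. rec_nat [] (%i r. r @ [i]) (n x))" by (intro tcomp_rec_nat tc | assumption)+
 moreover have "rec_nat [] (%i r. r @ [i]) m = [0..<m]" for m
  by (induction m) auto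
 ultimately show ?thesis by simp
qed

lemma tcomp_concat [tc]: "tcomp l ==> tcomp (%x. concat (l x))"
proof -
 assume "tcomp l"
 hence "tcomp (%x. fold (%a r. r @ a) (l x) [])" by (intro tcomp_fold tc | assumption)+
 moreover have "fold (%a r. r @ a) k r = r @ concat k" for k and r :: "'b list"
  by (induction k arbitrary: r) auto
 ultimately show ?thesis by simp
qed

lemma tcomp_power_nat [tc]: "tcomp f ==> tcomp n ==> tcomp (%x. f x ^ n x :: nat)"
proof -
 assume f: "tcomp f" and n: "tcomp n"
 have "tcomp (%p :: 'a \<times> nat \<times> nat. f (fst p))" by (rule tcomp_comp[OF f]) (intro tc)
 hence "tcomp (%x. rec_nat 1 (%i r. f x * r) (n x))" by (intro tcomp_rec_nat n tc | assumption)+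
 moreover have "rec_nat 1 (%i r. a * r) m = a ^ m" for a m :: nat
  by (induction m) auto
 ultimately show ?thesis by simp
qed

lemma tcomp_div [tc]: "tcomp f ==> tcomp g ==> tcomp (%x. f x div g x :: nat)"
proof -
 assume f: "tcomp f" and g: "tcomp g"
 have "tcomp (%p :: 'a \<times> nat. f (fst p))" "tcomp (%p :: 'a \<times> nat. g (fst p))"
  by (rule tcomp_comp[OF f] tcomp_comp[OF g], intro tc)+
 \<comment> \<open>For \<open>g x = 0\<close> the first disjunct holds at once and the search
   returns 0, the value of division by 0.\<close>
 hence "tcomp (%x. LEAST q. g x = 0 | f x < Suc q * g x)"
 proof (intro tcomp_Least tc)
  fix x show "EX q. g x = 0 | f x < Suc q * g x"
   by (rule exI[of _ "f x"]) (cases "g x", auto)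
 qed
 moreover have "(LEAST q. b = 0 | a < Suc q * b) = a div b" for a b :: nat
 proof (cases "b = 0")
  case False
  show ?thesis
  proof (rule Least_equality)
   show "b = 0 | a < Suc (a div b) * b" using False dividend_less_div_times[of b a] by simp
   fix q assume "b = 0 | a < Suc q * b"
   hence "a div b < Suc q" using False by (metis gr0I less_mult_imp_div_less)
   thus "a div b <= q" by simp
  qed
 qed simp
 ultimately show ?thesis by simp
qed

lemma tcomp_mod [tc]: "tcomp f ==> tcomp g ==> tcomp (%x. f x mod g x :: nat)"
 unfolding modulo_nat_def by (intro tc)

lemma tcomp_dvd [tc]: "tcomp f ==> tcomp g ==> tcomp (%x. f x dvd (g x :: nat))"
 unfolding dvd_eq_mod_eq_0 by (intro tc)

section \<open>Integers and rationals\<close>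

lemma tcomp_nat [tc]: "tcomp f ==> tcomp (%x. nat (f x))"
proof -
 assume "tcomp f"
 \<comment> \<open>\<open>int_encode\<close> puts nonnegative integers on the even codes and
   negative ones on the odd codes.\<close>
 hence "tcomp (%x. if enc (f x) mod 2 = 0 then enc (f x) div 2 else 0)"
  by (intro tc tcomp_list_code)
 thus ?thesis
  by (rule tcomp_enc_eq) (auto simp: enc_nat_def enc_int_def int_encode_def sum_encode_def split: if_splits)
qed

lemma tcomp_nat_uminus [tc]: "tcomp f ==> tcomp (%x. nat (- f x))"
proof -
 assume "tcomp f"
 hence "tcomp (%x. if enc (f x) mod 2 = 0 then 0 else Suc (enc (f x) div 2))"
  by (intro tc tcomp_list_code)
 thus ?thesis
  by (rule tcomp_enc_eq) (auto simp: enc_nat_def enc_int_def int_encode_def sum_encode_def split: if_splits)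
qed

lemma tcomp_int_diff: "tcomp f ==> tcomp g ==> tcomp (%x. int (f x) - int (g x))"
proof -
 assume "tcomp f" "tcomp g"
 hence "tcomp (%x. if g x <= f x then 2 * (f x - g x) else Suc (2 * (g x - f x - 1)))"
  by (intro tc)
 thus ?thesis
  by (rule tcomp_enc_eq) (auto simp: enc_nat_def enc_int_def int_encode_def sum_encode_def nat_diff_distrib)
qed

lemma tcomp_int [tc]: "tcomp f ==> tcomp (%x. int (f x))"
 using tcomp_int_diff[of f "%_. 0"] by (simp add: tcomp_const)

lemma int_eq_nat_diff: "(i :: int) = int (nat i) - int (nat (- i))" by simp

lemma tcomp_minus_int [tc]: "tcomp f ==> tcomp g ==> tcomp (%x. f x - g x :: int)"
proof -
 assume "tcomp f" "tcomp g"
 hence "tcomp (%x. int (nat (f x) + nat (- g x)) - int (nat (g x) + nat (- f x)))"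
  by (intro tcomp_int_diff tc)
 thus ?thesis by (rule tcomp_enc_eq) simp
qed

lemma tcomp_plus_int [tc]: "tcomp f ==> tcomp g ==> tcomp (%x. f x + g x :: int)"
proof -
 assume "tcomp f" "tcomp g"
 hence "tcomp (%x. f x - (int 0 - g x))" by (intro tc)
 thus ?thesis by simp
qed

lemma tcomp_times_int [tc]: "tcomp f ==> tcomp g ==> tcomp (%x. f x * g x :: int)"
proof -
 assume "tcomp f" "tcomp g"
 hence "tcomp (%x. int (nat (f x) * nat (g x) + nat (- f x) * nat (- g x)) -
   int (nat (f x) * nat (- g x) + nat (- f x) * nat (g x)))"
  by (intro tcomp_int_diff tc)
 moreover have "int (nat a * nat b + nat (- a) * nat (- b)) - int (nat a * nat (- b) + nat (- a) * nat b) = a * b"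
  for a b by (subst (9) int_eq_nat_diff, subst (10) int_eq_nat_diff) (simp add: algebra_simps)
 ultimately show ?thesis by simp
qed

lemma tcomp_le_int [tc]: "tcomp f ==> tcomp g ==> tcomp (%x. f x <= (g x :: int))"
proof -
 assume "tcomp f" "tcomp g"
 hence "tcomp (%x. nat (f x - g x) = 0)" by (intro tc)
 thus ?thesis by simp
qed

definition rnum :: "rat => int" where "rnum r = fst (quotient_of r)"
definition rden :: "rat => nat" where "rden r = nat (snd (quotient_of r))"

lemma enc_rat_eq: "enc r = prod_encode (int_encode (rnum r), rden r)"
 by (simp add: enc_rat_def encode_rat_def rnum_def rden_def split: prod.split)

lemma rden_pos: "rden r > 0"
 by (metis prod.collapse quotient_of_denom_pos rden_def zero_less_nat_eq)

lemma rat_eq_Fract: "r = Rat.Fract (rnum r) (int (rden r))"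
 unfolding rnum_def rden_def
 by (metis Fract_of_int_quotient int_nat_eq less_imp_le prod.collapse quotient_of_denom_pos quotient_of_div)

lemma coprime_rnum_rden: "coprime (rnum r) (int (rden r))"
 unfolding rnum_def rden_def
 by (metis int_nat_eq less_imp_le prod.collapse quotient_of_coprime quotient_of_denom_pos)

lemma rnum_rden_unique:
 assumes "n > 0" "coprime i (int n)" "r = Rat.Fract i (int n)"
 shows "rnum r = i" "rden r = n"
 using assms by (auto simp: rnum_def rden_def quotient_of_Fract normalize_stable)

lemma tcomp_rnum [tc]: "tcomp f ==> tcomp (%x. rnum (f x))"
 by (rule tcomp_lift1[of pfst f]) (auto simp: enc_rat_eq enc_int_def intro!: rf_pfst rf_proj)

lemma tcomp_rden [tc]: "tcomp f ==> tcomp (%x. rden (f x))"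
 by (rule tcomp_lift1[of psnd f]) (auto simp: enc_rat_eq enc_nat_def intro!: rf_psnd rf_proj)

lemma tcomp_pfst [tc]: "tcomp f ==> tcomp (%x. pfst (f x))"
 by (rule tcomp_lift1[of pfst f]) (auto simp: enc_nat_def intro!: rf_pfst rf_proj)

lemma tcomp_psnd [tc]: "tcomp f ==> tcomp (%x. psnd (f x))"
 by (rule tcomp_lift1[of psnd f]) (auto simp: enc_nat_def intro!: rf_psnd rf_proj)

lemma tcomp_int_decode [tc]: "tcomp f ==> tcomp (%x. int_decode (f x))"
 by (erule tcomp_enc_eq) (simp add: enc_nat_def enc_int_def)

lemma coprime_int_iff_all_less:
 "n > 0 ==> coprime i (int n) <-> (ALL k<Suc n. k dvd n --> k dvd nat (i) + nat (- i) --> k = 1)"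
proof -
 assume n: "n > 0"
 have "coprime i (int n) <-> coprime (nat i + nat (- i)) n"
  by (cases "i >= 0") (auto simp: coprime_int_iff[symmetric] simp del: coprime_int_iff)
 also have "... <-> (ALL k<Suc n. k dvd n --> k dvd nat (i) + nat (- i) --> k = 1)"
  using n by (auto simp: coprime_def dest: dvd_imp_le)
   (metis dvd_imp_le le_imp_less_Suc One_nat_def)
 finally show ?thesis .
qed

text \<open>No gcd is computed: the code of the reduced fraction is searched for. It exists and is
  unique, so the least code that passes the test is the right one.\<close>

lemma tcomp_Fract [tc]:
 assumes a: "tcomp a" and b: "tcomp b"
 shows "tcomp (%x. Rat.Fract (a x) (int (b x)))"
proof -
 define P where "P a b c <-> b = 0 | (psnd c > 0 &
   (ALL k<Suc (psnd c). k dvd psnd c --> k dvd nat (int_decode (pfst c)) + nat (- int_decode (pfst c)) --> k = 1) &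
   int_decode (pfst c) * int b = a * int (psnd c))" for a b c
 have ex: "P a b (enc (Rat.Fract a (int b)))" for a b
 proof (cases "b = 0")
  case False
  define r where "r = Rat.Fract a (int b)"
  have "rnum r * int b = a * int (rden r)"
   using rat_eq_Fract[of r] False rden_pos[of r] unfolding r_def
   by (metis eq_rat(1) of_nat_0_less_iff not_gr0 less_numeral_extra(3) of_nat_eq_0_iff)
  thus ?thesis using coprime_rnum_rden[of r] rden_pos[of r]
   unfolding P_def r_def[symmetric] by (simp add: enc_rat_eq coprime_int_iff_all_less)
 qed (simp add: P_def)
 have un: "c = enc (Rat.Fract a (int b))" if "P a b c" "b > 0" for a b c
 proof -
  let ?i = "int_decode (pfst c)" and ?n = "psnd c"
  have *: "?n > 0" "coprime ?i (int ?n)" "?i * int b = a * int ?n"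
   using that coprime_int_iff_all_less[of ?n ?i] unfolding P_def by auto
  hence "Rat.Fract a (int b) = Rat.Fract ?i (int ?n)" using that by (simp add: eq_rat)
  from rnum_rden_unique[OF *(1,2) this] show ?thesis by (simp add: enc_rat_eq)
 qed
 have "tcomp (%p :: 'a \<times> nat. a (fst p))" "tcomp (%p :: 'a \<times> nat. b (fst p))"
  by (rule tcomp_comp[OF a] tcomp_comp[OF b], intro tc)+
 hence "tcomp (%p :: 'a \<times> nat. P (a (fst p)) (b (fst p)) (snd p))"
  unfolding P_def by (intro tc)
 hence L: "tcomp (%x. LEAST c. P (a x) (b x) c)"
  by (rule tcomp_Least) (use ex in blast)
 \<comment> \<open>\<open>Rat.Fract a 0\<close> is 0. For \<open>b x = 0\<close> the predicate
   \<open>P\<close> holds everywhere, which keeps the search total, and its result is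
   overridden.\<close>
 have "tcomp (%x. if b x = 0 then enc (0 :: rat) else (LEAST c. P (a x) (b x) c))"
  by (intro tc b L)
 thus ?thesis
 proof (rule tcomp_enc_eq)
  fix x show "enc (Rat.Fract (a x) (int (b x))) = enc (if b x = 0 then enc (0 :: rat) else (LEAST c. P (a x) (b x) c))"
  proof (cases "b x = 0")
   case False
   have "P (a x) (b x) (LEAST c. P (a x) (b x) c)" using ex by (rule LeastI)
   from un[OF this] False show ?thesis by (simp add: enc_nat_def)
  qed (simp add: enc_nat_def rat_number_collapse)
 qed
qed

lemma tcomp_plus_rat [tc]: "tcomp f ==> tcomp g ==> tcomp (%x. f x + g x :: rat)"
proof -
 assume "tcomp f" "tcomp g"
 hence "tcomp (%x. Rat.Fract (rnum (f x) * int (rden (g x)) + rnum (g x) * int (rden (f x))) (int (rden (f x) * rden (g x))))"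
  by (intro tc)
 moreover have "Rat.Fract (rnum r * int (rden s) + rnum s * int (rden r)) (int (rden r * rden s)) = r + s" for r s
  using rden_pos[of r] rden_pos[of s] by (subst (5) rat_eq_Fract, subst (7) rat_eq_Fract) simp
 ultimately show ?thesis by simp
qed

lemma tcomp_minus_rat [tc]: "tcomp f ==> tcomp g ==> tcomp (%x. f x - g x :: rat)"
proof -
 assume "tcomp f" "tcomp g"
 hence "tcomp (%x. Rat.Fract (rnum (f x) * int (rden (g x)) - rnum (g x) * int (rden (f x))) (int (rden (f x) * rden (g x))))"
  by (intro tc)
 moreover have "Rat.Fract (rnum r * int (rden s) - rnum s * int (rden r)) (int (rden r * rden s)) = r - s" for r s
  using rden_pos[of r] rden_pos[of s] by (subst (5) rat_eq_Fract, subst (7) rat_eq_Fract) simp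
 ultimately show ?thesis by simp
qed

lemma tcomp_times_rat [tc]: "tcomp f ==> tcomp g ==> tcomp (%x. f x * g x :: rat)"
proof -
 assume "tcomp f" "tcomp g"
 hence "tcomp (%x. Rat.Fract (rnum (f x) * rnum (g x)) (int (rden (f x) * rden (g x))))"
  by (intro tc)
 moreover have "Rat.Fract (rnum r * rnum s) (int (rden r * rden s)) = r * s" for r s
  by (subst (3) rat_eq_Fract, subst (4) rat_eq_Fract) simp
 ultimately show ?thesis by simp
qed

lemma tcomp_le_rat [tc]: "tcomp f ==> tcomp g ==> tcomp (%x. f x <= (g x :: rat))"
proof -
 assume "tcomp f" "tcomp g"
 hence "tcomp (%x. rnum (f x) * int (rden (g x)) <= rnum (g x) * int (rden (f x)))"
  by (intro tc)
 moreover have "rnum r * int (rden s) <= rnum s * int (rden r) <-> r <= s" for r s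
 proof -
  have "0 < int (rden r) * int (rden s)" using rden_pos[of r] rden_pos[of s] by simp
  thus ?thesis
   by (subst (5) rat_eq_Fract, subst (6) rat_eq_Fract) (simp add: mult.assoc[symmetric] le_rat rden_pos mult_le_cancel_right)
 qed
 ultimately show ?thesis by simp
qed

lemma tcomp_rat_of_int [tc]: "tcomp f ==> tcomp (%x. rat_of_int (f x))"
proof -
 assume "tcomp f"
 hence "tcomp (%x. Rat.Fract (f x) (int 1))" by (intro tc)
 thus ?thesis by (simp add: of_int_rat)
qed

lemma rden_eq_1_iff: "rden r = 1 <-> r : \<int>"
proof
 assume "rden r = 1"
 thus "r : \<int>" using rat_eq_Fract[of r] by (metis Ints_of_int Rat.of_int_rat of_nat_1)
next
 assume "r : \<int>"
 then obtain i where "r = of_int i" by (auto elim: Ints_cases)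
 thus "rden r = 1" by (intro rnum_rden_unique(2)[of 1 i]) (auto simp: of_int_rat)
qed

lemma tcomp_Ints [tc]: "tcomp f ==> tcomp (%x. f x : (\<int> :: rat set))"
 unfolding rden_eq_1_iff[symmetric] by (intro tc)

text \<open>\<open>dec\<close> is defined on every natural number, so that an existential quantifier
  over the type becomes a search over all of them.\<close>

class decodable = enc +
 fixes dec :: "nat => 'a"
 assumes dec_enc: "dec (enc x) = x"
  and computable_dec: "EX p. ALL c. evaluates p [c] (enc (dec c))"

lemma tcomp_dec: "tcomp (dec :: nat => 'a :: decodable)"
 using computable_dec unfolding tcomp_def enc_nat_def by blast

lemma tcompD: "tcomp f ==> EX p. ALL c. evaluates p [c] (enc (f c))" for f :: "nat => 'a :: enc"
 unfolding tcomp_def by (simp add: enc_nat_def)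

instantiation nat :: decodable begin
definition "dec_nat (n :: nat) = n"
instance by standard (simp add: dec_nat_def enc_nat_def, unfold dec_nat_def, intro tcompD tc)
end

instantiation int :: decodable begin
definition "dec_int (n :: nat) = int_decode n"
instance
 by standard (simp add: dec_int_def enc_int_def, unfold dec_int_def, intro tcompD tc)
end

instantiation prod :: (decodable, decodable) decodable begin
definition "dec_prod (n :: nat) = (dec (pfst n) :: 'a, dec (psnd n) :: 'b)"
instance
 by standard (simp add: dec_prod_def enc_prod_def dec_enc, unfold dec_prod_def,
  intro tcompD tcomp_Pair tcomp_comp[OF tcomp_dec] tc)
end

instantiation rat :: decodable begin
definition "dec_rat (n :: nat) = Rat.Fract (int_decode (pfst n)) (int (psnd n))"
instance
 by standard (simp add: dec_rat_def enc_rat_eq rat_eq_Fract[symmetric], unfold dec_rat_def,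
  intro tcompD tc)
end

instantiation list :: (decodable) decodable begin
definition "dec_list (n :: nat) = map (dec :: nat => 'a) (list_decode n)"
instance
proof
 fix x :: "'a list"
 show "dec (enc x) = x" by (simp add: dec_list_def enc_list_def dec_enc comp_def)
next
 \<comment> \<open>\<open>list_decode n\<close> has code \<open>n\<close>, so the identity program
   computes it.\<close>
 have "tcomp (%n. list_decode n)"
  by (rule tcomp_enc_eq[OF tcomp_id]) (simp add: enc_list_def enc_nat_def[abs_def])
 hence "tcomp (%n. map (dec :: nat => 'a) (list_decode n))"
  by (rule tcomp_map) (intro tcomp_comp[OF tcomp_dec] tc)
 thus "EX p. ALL c. evaluates p [c] (enc (dec c :: 'a list))"
  unfolding dec_list_def by (rule tcompD)
qed
end

subsection \<open>Semidecidable predicates\<close>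

definition re :: "('a :: enc => bool) => bool" where
 "re P <-> (EX D :: 'a \<times> nat => bool. tcomp D & (ALL x. P x <-> (EX w. D (x, w))))"

lemma reE:
 assumes "re P"
 obtains D where "tcomp D" and "!!x. P x <-> (EX w :: nat. D (x, w))"
 using assms unfolding re_def by blast

lemma re_tcomp: "tcomp P ==> re P"
 unfolding re_def by (intro exI[of _ "%p. P (fst p)"]) (simp add: tcomp_comp[of P] tc)

lemma re_conj: "re P ==> re Q ==> re (%x. P x & Q x)"
proof -
 assume "re P" "re Q"
 obtain D where D: "tcomp D" "!!x. P x <-> (EX w :: nat. D (x, w))" using \<open>re P\<close> by (rule reE) (rule that)
 obtain E where E: "tcomp E" "!!x. Q x <-> (EX w :: nat. E (x, w))" using \<open>re Q\<close> by (rule reE) (rule that)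
 have "tcomp (%p :: 'a \<times> nat. D (fst p, pfst (snd p)) & E (fst p, psnd (snd p)))"
  by (intro tcomp_conj tcomp_comp[OF D(1)] tcomp_comp[OF E(1)] tc)
 moreover have "(P x & Q x) <-> (EX w. D (x, pfst w) & E (x, psnd w))" for x
  unfolding D E by (metis pfst_prod_encode psnd_prod_encode)
 ultimately show ?thesis unfolding re_def by fastforce
qed

lemma re_disj: "re P ==> re Q ==> re (%x. P x | Q x)"
proof -
 assume "re P" "re Q"
 obtain D where D: "tcomp D" "!!x. P x <-> (EX w :: nat. D (x, w))" using \<open>re P\<close> by (rule reE) (rule that)
 obtain E where E: "tcomp E" "!!x. Q x <-> (EX w :: nat. E (x, w))" using \<open>re Q\<close> by (rule reE) (rule that)
 have "tcomp (%p. D p | E p)" by (intro tcomp_disj D(1) E(1))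
 thus ?thesis unfolding re_def using D(2) E(2) by fast
qed

lemma re_comp: "re P ==> tcomp f ==> re (%x. P (f x))"
proof -
 assume "re P" and f: "tcomp f"
 obtain D where D: "tcomp D" "!!x. P x <-> (EX w :: nat. D (x, w))" using \<open>re P\<close> by (rule reE) (rule that)
 have "tcomp (%p :: 'b \<times> nat. D (f (fst p), snd p))"
  by (intro tcomp_comp[OF D(1)] tcomp_comp[OF f] tc)
 thus ?thesis unfolding re_def using D(2) by fastforce
qed

lemma re_ex:
 fixes P :: "'a :: enc => 'b :: decodable => bool"
 assumes "re (%p. P (fst p) (snd p))"
 shows "re (%x. EX y. P x y)"
proof -
 obtain D where D: "tcomp D" "!!p. P (fst p) (snd p) <-> (EX w :: nat. D (p, w))"
  using assms(1) by (rule reE) (rule that)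
 have "tcomp (%p :: 'a \<times> nat. D ((fst p, dec (pfst (snd p))), psnd (snd p)))"
  by (intro tcomp_comp[OF D(1)] tcomp_comp[OF tcomp_dec] tc)
 moreover have "(EX y. P x y) <-> (EX w. D ((x, dec (pfst w)), psnd w))" for x
  using D(2)[of "(x, _)"] by simp (metis dec_enc pfst_prod_encode psnd_prod_encode)
 ultimately show ?thesis unfolding re_def by fastforce
qed

lemma re_ball_list:
 fixes l :: "'a :: enc => 'b :: enc list"
 assumes "re (%p. P (fst p) (snd p))" and l: "tcomp l"
 shows "re (%x. ALL a:set (l x). P x a)"
proof -
 obtain D where D: "tcomp D" "!!p. P (fst p) (snd p) <-> (EX w :: nat. D (p, w))"
  using assms(1) by (rule reE) (rule that)
 \<comment> \<open>One list gathers witnesses for all members of \<open>l x\<close>; each member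
   looks for its own among them, so their order is immaterial.\<close>
 have "tcomp (%p :: 'a \<times> nat list. ALL a:set (l (fst p)). EX w:set (snd p). D ((fst p, a), w))"
  by (intro tcomp_list_all tcomp_list_ex tcomp_comp[OF D(1)] tcomp_comp[OF l] tc)
 hence "re (%x. EX ws :: nat list. ALL a:set (l x). EX w:set ws. D ((x, a), w))"
  by (intro re_ex re_tcomp)
 moreover have "(EX ws. ALL a:set (l x). EX w:set ws. D ((x, a), w)) <-> (ALL a:set (l x). P x a)" for x
 proof
  assume "ALL a:set (l x). P x a"
  hence "ALL a:set (l x). EX w. D ((x, a), w)" using D(2)[of "(x, _)"] by simp
  then obtain w where "ALL a:set (l x). D ((x, a), w a)" by metis
  thus "EX ws. ALL a:set (l x). EX w:set ws. D ((x, a), w)"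
   by (intro exI[of _ "map w (l x)"]) auto
 qed (use D(2)[of "(x, _)"] in auto)
 ultimately show ?thesis by simp
qed

text \<open>A value and a witness for it are searched together. The least code of such a pair says
  nothing about its first component in general; it is the right value because \<open>k\<close> is
  unique.\<close>

lemma re_search:
 assumes "re P"
 shows "EX p. ALL x k. P (x, k) --> (ALL j. P (x, j) --> j = k) --> evaluates p [enc x] k"
proof -
 obtain D where D: "tcomp D" "!!x. P x <-> (EX w :: nat. D (x, w))"
  using assms by (rule reE) (rule that)
 define E where "E x n = D ((x, pfst n), psnd n)" for x n
 have E: "tcomp (%p. E (fst p) (snd p))"
  unfolding E_def by (intro tcomp_comp[OF D(1)] tc)
 obtain p where p: "!!x. EX n. E x n ==> evaluates p [enc x] (enc (LEAST n. E x n))"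
  using computes_Least[OF E] by blast
 obtain q where q: "!!n :: nat. evaluates q [enc n] (enc (pfst n))"
  using tcomp_pfst[OF tcomp_id] unfolding tcomp_def by blast
 have "evaluates (Comp q [p]) [enc x] k" if k: "P (x, k)" "ALL j. P (x, j) --> j = k" for x k
 proof -
  have "EX n. E x n" using k(1) unfolding D(2) E_def by (metis pfst_prod_encode psnd_prod_encode)
  moreover from this have "E x (LEAST n. E x n)" by (rule LeastI_ex)
  hence "pfst (LEAST n. E x n) = k" using k(2) D(2) unfolding E_def by blast
  ultimately show ?thesis using p[of x] q[of "LEAST n. E x n"]
   by (intro evaluates.comp[of _ _ "[LEAST n. E x n]"]) (auto simp: enc_nat_def)
 qed
 thus ?thesis by blast
qed

subsection \<open>Torsion-free rank\<close>

context group
begin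

lemma inv_cancel:
 assumes "x : carrier G" "y : carrier G"
 shows "inv x ** (x ** y) = y" "x ** (inv x ** y) = y"
 using assms by (simp_all add: m_assoc[symmetric])

text \<open>Everything stays inside the ambient group \<open>G\<close>: normality and the two kinds
  of factor are stated for subsets, without a new group structure or a quotient for each step of a
  series.\<close>

definition nrm :: "'a set => 'a set => bool" where
 "nrm K H <-> subgroup K G & subgroup H G & K <= H & (ALL h:H. ALL k:K. h ** k ** inv h : K)"

lemma nrmI:
 assumes "subgroup K G" "subgroup H G" "K <= H" "!!h k. h : H ==> k : K ==> h ** k ** inv h : K"
 shows "nrm K H"
 using assms unfolding nrm_def by auto

definition per :: "'a set => 'a set => bool" where
 "per K H <-> (ALL x:H. EX n::nat. n > 0 & x [^] n : K)"

text \<open>\<open>H / K\<close> is infinite cyclic, expressed by a homomorphism onto the integers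
  with kernel \<open>K\<close>.\<close>

definition cyc :: "'a set => 'a set => bool" where
 "cyc K H <-> (EX f :: 'a => int. (ALL x:H. ALL y:H. f (x ** y) = f x + f y) &
   (ALL x:H. f x = 0 <-> x : K) & (EX g:H. f g = 1))"

inductive ser :: "'a set => 'a set => nat => bool" for K where
 ser_refl: "subgroup K G ==> ser K K 0"
| ser_per: "ser K H h ==> nrm H H' ==> per H H' ==> ser K H' h"
| ser_cyc: "ser K H h ==> nrm H H' ==> cyc H H' ==> ser K H' (Suc h)"

lemma subgroup_nat_pow: "subgroup H G ==> x : H ==> x [^] (n::nat) : H"
 by (induction n) (auto simp: subgroup.one_closed subgroup.m_closed)

lemma ser_subset: "ser K H h ==> K <= H"
 by (induction rule: ser.induct) (auto simp: nrm_def)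

lemma ser_subgroup: "ser K H h ==> subgroup H G"
 by (induction rule: ser.induct) (auto simp: nrm_def)

lemma ser_trans: "ser H H' b ==> ser K H a ==> ser K H' (a + b)"
proof (induction rule: ser.induct)
 case (ser_per H' b H'')
 thus ?case by (blast intro: ser.ser_per)
next
 case (ser_cyc H' b H'')
 thus ?case using ser.ser_cyc[of K H' "a + b" H''] by simp
qed simp

lemma pow_hom_int:
 assumes "subgroup H G" "ALL x:H. ALL y:H. f (x ** y) = f x + (f y :: 'r :: ring_1)"
 shows "f \<one> = 0" "x : H ==> f (x [^] (n::nat)) = of_nat n * f x" "x : H ==> f (inv x) = - f x"
  "x : H ==> f (x [^] (i::int)) = of_int i * f x"
proof -
 interpret H: subgroup H G by fact
 have "f (\<one> ** \<one>) = f \<one> + f \<one>" using assms(2) H.one_closed by blast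
 thus 1: "f \<one> = 0" by simp
 show n: "f (x [^] (n::nat)) = of_nat n * f x" if "x : H" for x n
  using that assms 1 by (induction n) (auto simp: subgroup_nat_pow algebra_simps)
 show i: "f (inv x) = - f x" if "x : H" for x
  using assms(2) that 1 H.m_inv_closed[OF that] r_inv[OF H.mem_carrier[OF that]]
  by (metis add_eq_0_iff)
 show "f (x [^] (i::int)) = of_int i * f x" if "x : H" for x
 proof (cases i rule: int_cases)
  case (nonneg m)
  thus ?thesis using n[OF that, of m] by (simp add: int_pow_int)
 next
  case (neg m)
  have "f (x [^] i) = f (inv (x [^] Suc m))" unfolding neg by (simp only: int_pow_neg_int[OF H.mem_carrier[OF that]])
  also have "... = - f (x [^] Suc m)" by (rule i[OF subgroup_nat_pow[OF assms(1) that]])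
  also have "... = of_int i * f x" unfolding neg n[OF that] by (simp add: algebra_simps)
  finally show ?thesis .
 qed
qed

lemma cyc_gen:
 assumes "cyc K H" "subgroup H G"
 obtains g where "g : H" "!!x. x : H ==> EX i::int. x ** inv (g [^] i) : K"
  "!!i::int. g [^] i : K ==> i = 0"
proof -
 interpret H: subgroup H G by fact
 obtain f :: "'a => int" and g where f: "ALL x:H. ALL y:H. f (x ** y) = f x + f y"
  "ALL x:H. f x = 0 <-> x : K" "g : H" "f g = 1"
  using assms(1) unfolding cyc_def by blast
 note h = pow_hom_int[OF assms(2) f(1)]
 have gi: "g [^] i : H" for i :: int using f(3) assms(2) by (rule subgroup_int_pow_closed[rotated])
 show thesis
 proof (rule that[OF f(3)])
  fix x assume x: "x : H"
  have "f (x ** inv (g [^] f x)) = 0"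
   using f x gi h(3)[OF gi] h(4)[OF f(3)] by simp
  thus "EX i::int. x ** inv (g [^] i) : K" using f(2) x gi by blast
 next
  fix i :: int assume "g [^] i : K"
  thus "i = 0" using f(2) gi h(4)[OF f(3)] f(4) by (metis mult.right_neutral of_int_eq_id id_apply)
 qed
qed

text \<open>The exponent of the power of \<open>g\<close> that is congruent to \<open>x\<close> is
  unique by the last hypothesis, and normality of \<open>K\<close> makes it additive in
  \<open>x\<close>.\<close>

lemma cycI:
 assumes n: "nrm K H" and g: "g : H" "!!x. x : H ==> EX i::int. x ** inv (g [^] i) : K"
  "!!i::int. g [^] i : K ==> i = 0"
 shows "cyc K H"
proof -
 interpret H: subgroup H G using n unfolding nrm_def by blast
 interpret K: subgroup K G using n unfolding nrm_def by blast
 have gi: "g [^] i : H" for i :: int using g(1) by (rule subgroup_int_pow_closed[OF H.subgroup_axioms])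
 have KH: "K <= H" and nm: "h : H ==> k : K ==> h ** k ** inv h : K" for h k
  using n unfolding nrm_def by auto
 define f where "f x = (SOME i::int. x ** inv (g [^] i) : K)" for x
 have f: "x ** inv (g [^] f x) : K" if "x : H" for x
  unfolding f_def using g(2)[OF that] by (rule someI_ex)
 have un: "i = j" if "x : H" "x ** inv (g [^] i) : K" "x ** inv (g [^] j) : K" for x and i j :: int
 proof -
  have "inv (x ** inv (g [^] i)) ** (x ** inv (g [^] j)) : K" using that by blast
  also have "inv (x ** inv (g [^] i)) ** (x ** inv (g [^] j)) = g [^] i ** inv (g [^] j)"
   using that(1) gi by (simp add: inv_mult_group H.mem_carrier m_assoc[symmetric])
    (simp add: m_assoc H.mem_carrier)
  also have "... = g [^] (i - j)" using g(1) by (simp add: int_pow_diff H.mem_carrier)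
  finally show ?thesis using g(3) by fastforce
 qed
 have "f (x ** y) = f x + f y" if x: "x : H" and y: "y : H" for x y
 proof (rule un[of "x ** y"])
  let ?a = "x ** inv (g [^] f x)" and ?b = "y ** inv (g [^] f y)"
  have "?a ** (g [^] f x ** ?b ** inv (g [^] f x)) : K"
   using f[OF x] nm[OF gi f[OF y]] by blast
  also have "?a ** (g [^] f x ** ?b ** inv (g [^] f x)) = x ** y ** (inv (g [^] f y) ** inv (g [^] f x))"
   using x y gi by (simp add: H.mem_carrier m_assoc inv_cancel)
  also have "inv (g [^] f y) ** inv (g [^] f x) = inv (g [^] (f x + f y))"
   using g(1) by (simp add: int_pow_mult inv_mult_group H.mem_carrier)
  finally show "x ** y ** inv (g [^] (f x + f y)) : K" .
 qed (use f x y in auto)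
 moreover have "f x = 0 <-> x : K" if x: "x : H" for x
  using f[OF x] un[OF x f[OF x], of 0] x by (auto simp: H.mem_carrier)
 moreover have "f g = 1"
  by (rule un[OF g(1) f[OF g(1)]]) (use g(1) in "simp add: H.mem_carrier")
 ultimately show ?thesis unfolding cyc_def using g(1) by blast
qed

definition pr :: "'a set => 'a set => 'a set" where
 "pr N K = {n ** k | n k. n : N & k : K}"

lemma prI: "n : N ==> k : K ==> n ** k : pr N K"
 unfolding pr_def by blast

lemma pr_subgroup:
 assumes "nrm N H" "subgroup K G" "K <= H"
 shows "subgroup (pr N K) G" "N <= pr N K" "K <= pr N K" "pr N K <= H"
proof -
 interpret H: subgroup H G using assms unfolding nrm_def by blast
 interpret N: subgroup N G using assms unfolding nrm_def by blast
 interpret K: subgroup K G by fact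
 have NH: "N <= H" and nm: "h : H ==> k : N ==> h ** k ** inv h : N" for h k
  using assms unfolding nrm_def by auto
 show "N <= pr N K"
 proof
  fix x assume "x : N"
  thus "x : pr N K" using prI[OF _ K.one_closed, of x N] by (simp add: N.mem_carrier)
 qed
 show KP: "K <= pr N K"
 proof
  fix x assume "x : K"
  thus "x : pr N K" using prI[OF N.one_closed, of x K] by (simp add: K.mem_carrier)
 qed
 show "pr N K <= H" unfolding pr_def using NH assms(3) by blast
 show "subgroup (pr N K) G"
 proof (rule subgroupI)
  show "pr N K <= carrier G" unfolding pr_def using N.mem_carrier K.mem_carrier by blast
  show "pr N K ~= {}" using KP K.one_closed by blast
  fix a b assume "a : pr N K" "b : pr N K"
  then obtain n k m l where nk: "n : N" "k : K" "a = n ** k" "m : N" "l : K" "b = m ** l"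
   unfolding pr_def by blast
  have c: "n : carrier G" "k : carrier G" "m : carrier G" "l : carrier G"
   using nk N.mem_carrier K.mem_carrier by auto
  have "inv a = (inv k ** inv n ** inv (inv k)) ** inv k" using nk c
   by (simp add: inv_mult_group m_assoc)
  moreover have "inv k ** inv n ** inv (inv k) : N" using nm nk assms(3) by blast
  ultimately show "inv a : pr N K" unfolding pr_def using nk by blast
  have "a ** b = (n ** (k ** m ** inv k)) ** (k ** l)" using nk c
   by (simp add: m_assoc inv_cancel)
  moreover have "n ** (k ** m ** inv k) : N" using nm nk assms(3) by blast
  ultimately show "a ** b : pr N K" unfolding pr_def using nk by blast
 qed
qed

lemma nrm_pow:
 assumes "nrm N H" "y : H" "n : N"
 shows "EX n':N. (n ** y) [^] (m::nat) = n' ** y [^] m"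
proof (induction m)
 case 0
 show ?case using assms by (intro bexI[of _ \<one>]) (auto simp: nrm_def subgroup.one_closed)
next
 case (Suc m)
 interpret H: subgroup H G using assms unfolding nrm_def by blast
 interpret N: subgroup N G using assms unfolding nrm_def by blast
 obtain n' where n': "n' : N" "(n ** y) [^] m = n' ** y [^] m" using Suc by blast
 have ym: "y [^] m : H" using assms(2) by (rule subgroup_nat_pow[OF H.subgroup_axioms])
 have "(n ** y) [^] Suc m = (n' ** (y [^] m ** n ** inv (y [^] m))) ** (y [^] m ** y)"
  using n' assms ym by (simp add: m_assoc H.mem_carrier N.mem_carrier inv_cancel)
 moreover have "n' ** (y [^] m ** n ** inv (y [^] m)) : N"
  using assms n' ym unfolding nrm_def by blast
 ultimately show ?case by auto
qed

lemma nrm_pr: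
 assumes N: "nrm N H" and KK: "nrm K K'" and K': "K' <= H"
 shows "nrm (pr N K) (pr N K')"
proof -
 interpret H: subgroup H G using N unfolding nrm_def by blast
 interpret N: subgroup N G using N unfolding nrm_def by blast
 interpret K: subgroup K G using KK unfolding nrm_def by blast
 interpret K': subgroup K' G using KK unfolding nrm_def by blast
 have sub: "K <= K'" "N <= H" using N KK unfolding nrm_def by auto
 have nm: "h : H ==> n : N ==> h ** n ** inv h : N" for h n using N unfolding nrm_def by auto
 have P: "subgroup (pr N K) G" "N <= pr N K"
  using pr_subgroup[OF N K.subgroup_axioms] sub K' by auto
 interpret P: subgroup "pr N K" G by (rule P)
 have c: "h ** p ** inv h : pr N K" if "h : pr N K'" "p : pr N K" for h p
 proof -
  obtain n k m l where nk: "n : N" "k : K'" "h = n ** k" "m : N" "l : K" "p = m ** l"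
   using \<open>h : pr N K'\<close> \<open>p : pr N K\<close> unfolding pr_def by blast
  have c: "n : carrier G" "k : carrier G" "m : carrier G" "l : carrier G"
   using nk N.mem_carrier K.mem_carrier K'.mem_carrier by auto
  let ?q = "(k ** m ** inv k) ** (k ** l ** inv k)"
  have e: "h ** p ** inv h = n ** ?q ** inv n" using nk c
   by (simp add: m_assoc inv_mult_group inv_cancel)
  have "k ** m ** inv k : N" using nm nk(2,4) K' by blast
  moreover have "k ** l ** inv k : K" using KK nk(2,5) unfolding nrm_def by blast
  ultimately have "?q : pr N K" unfolding pr_def by blast
  thus ?thesis unfolding e using P(2) nk(1) by (meson P.m_closed P.m_inv_closed subsetD)
 qed
 have "pr N K <= pr N K'" using sub unfolding pr_def by blast
 from nrmI[OF P(1) pr_subgroup(1)[OF N K'.subgroup_axioms K'] this c] show ?thesis .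
qed

text \<open>Multiplication by \<open>N\<close> carries every factor to one of the same kind. A
  cyclic factor could collapse only through elements of \<open>N\<close>, and
  \<open>N \<inter> K <= L\<close> keeps these in the bottom term.\<close>

lemma ser_pr:
 assumes N: "nrm N H" and S: "ser L K b" and "K <= H" "N \<inter> K <= L"
 shows "ser (pr N L) (pr N K) b"
 using S assms(3,4)
proof (induction rule: ser.induct)
 case ser_refl
 thus ?case using pr_subgroup(1)[OF N] by (auto intro: ser.ser_refl)
next
 case (ser_per K b K')
 hence "K <= K'" by (auto simp: nrm_def)
 hence IH: "ser (pr N L) (pr N K) b" using ser_per by blast
 have "per (pr N K) (pr N K')"
  unfolding per_def
 proof
  fix x assume "x : pr N K'"
  then obtain n k where nk: "n : N" "k : K'" "x = n ** k" unfolding pr_def by blast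
  obtain m :: nat where "m > 0" "k [^] m : K" using ser_per(3) nk(2) unfolding per_def by blast
  moreover obtain n' where "n' : N" "x [^] m = n' ** k [^] m"
   using nrm_pow[OF N _ nk(1), of k m] nk ser_per.prems by blast
  ultimately show "EX m::nat. m > 0 & x [^] m : pr N K" unfolding pr_def by blast
 qed
 thus ?case by (rule ser.ser_per[OF IH nrm_pr[OF N ser_per(2) ser_per.prems(1)]])
next
 case (ser_cyc K b K')
 hence KK': "K <= K'" by (auto simp: nrm_def)
 hence IH: "ser (pr N L) (pr N K) b" using ser_cyc by blast
 interpret K: subgroup K G using ser_cyc unfolding nrm_def by blast
 interpret K': subgroup K' G using ser_cyc unfolding nrm_def by blast
 interpret N: subgroup N G using N unfolding nrm_def by blast
 obtain g where g: "g : K'" "!!x. x : K' ==> EX i::int. x ** inv (g [^] i) : K"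
  "!!i::int. g [^] i : K ==> i = 0"
  using cyc_gen[OF ser_cyc(3) K'.subgroup_axioms] by blast
 have gi: "g [^] i : K'" for i :: int using g(1) by (rule subgroup_int_pow_closed[OF K'.subgroup_axioms])
 have n: "nrm (pr N K) (pr N K')" by (rule nrm_pr[OF N ser_cyc(2) ser_cyc.prems(1)])
 have "cyc (pr N K) (pr N K')"
 proof (rule cycI[OF n, of g])
  show "g : pr N K'" using g(1) pr_subgroup(3)[OF N K'.subgroup_axioms ser_cyc.prems(1)] by blast
 next
  fix x assume "x : pr N K'"
  then obtain n k where nk: "n : N" "k : K'" "x = n ** k" unfolding pr_def by blast
  obtain i :: int where "k ** inv (g [^] i) : K" using g(2)[OF nk(2)] by blast
  moreover have "x ** inv (g [^] i) = n ** (k ** inv (g [^] i))"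
   using nk gi by (simp add: m_assoc N.mem_carrier K'.mem_carrier)
  ultimately show "EX i::int. x ** inv (g [^] i) : pr N K" unfolding pr_def using nk(1) by blast
 next
  fix i :: int assume "g [^] i : pr N K"
  then obtain n k where nk: "n : N" "k : K" "g [^] i = n ** k" unfolding pr_def by blast
  have "n = g [^] i ** inv k" using nk gi by (simp add: N.mem_carrier K.mem_carrier K'.mem_carrier m_assoc)
  hence "n : K'" using gi nk(2) KK' by blast
  hence "n : K" using nk(1) ser_cyc.prems ser_subset[OF ser_cyc(1)] by blast
  thus "i = 0" using g(3) nk by auto
 qed
 thus ?case by (rule ser.ser_cyc[OF IH n])
qed

lemma nrm_Int:
 assumes "nrm N H'" "subgroup H G" "H <= H'"
 shows "nrm (N \<inter> H) H"
proof -
 interpret H: subgroup H G by fact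
 have "subgroup N G" using assms unfolding nrm_def by simp
 hence "subgroup (N \<inter> H) G" using assms(2) by (rule subgroups_Inter_pair)
 thus ?thesis using assms unfolding nrm_def by (auto simp: subset_iff)
qed

text \<open>Additivity of the rank along a normal subgroup. A cyclic top factor is credited to the
  quotient if \<open>N\<close> lies in the previous term; otherwise it is credited to
  \<open>N\<close>, and what is left of it above \<open>N\<close> is periodic.\<close>

lemma ser_split:
 assumes "ser {\<one>} H h"
 shows "nrm N H ==> EX a b. h = a + b & ser {\<one>} N a & ser N H b"
 using assms
proof (induction arbitrary: N rule: ser.induct)
 case ser_refl
 hence "N = {\<one>}" unfolding nrm_def using subgroup.one_closed by blast
 thus ?case using ser_refl.hyps ser.ser_refl by (intro exI[of _ 0]) auto
next
 case (ser_per H h H')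
 have HH': "subgroup H G" "subgroup H' G" "H <= H'" "subgroup N G" "N <= H'"
  using ser_per unfolding nrm_def by auto
 define N1 where "N1 = N \<inter> H"
 have N1: "nrm N1 H" unfolding N1_def by (rule nrm_Int[OF ser_per.prems HH'(1,3)])
 obtain a b where ab: "h = a + b" "ser {\<one>} N1 a" "ser N1 H b" using ser_per.IH[OF N1] by blast
 have "pr N N1 = N"
 proof -
  interpret N: subgroup N G by fact
  have "N <= pr N N1" using pr_subgroup(2)[OF ser_per.prems, of N1] N1 HH' unfolding nrm_def N1_def by blast
  thus ?thesis unfolding pr_def N1_def by blast
 qed
 hence s: "ser N (pr N H) b" using ser_pr[OF ser_per.prems ab(3) HH'(3)] N1_def by auto
 have "nrm H' H'" using HH'(2) unfolding nrm_def by (auto simp: subgroup.m_closed subgroup.m_inv_closed)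
 hence "pr N H' = H'" using pr_subgroup(3,4)[OF ser_per.prems HH'(2)] by auto
 hence n: "nrm (pr N H) H'" using nrm_pr[OF ser_per.prems ser_per(2)] by auto
 have "H <= pr N H" using pr_subgroup(3)[OF ser_per.prems HH'(1,3)] .
 hence "per (pr N H) H'" using ser_per(3) unfolding per_def by blast
 hence 1: "ser N H' b" using s n by (auto intro: ser.ser_per)
 have n2: "nrm N1 N" using nrm_Int[OF ser_per(2) HH'(4,5)] unfolding N1_def by (simp add: Int_commute)
 have "per N1 N" unfolding per_def
 proof
  fix x assume x: "x : N"
  then obtain n :: nat where "n > 0" "x [^] n : H" using ser_per(3) HH'(5) unfolding per_def by blast
  thus "EX n::nat. n > 0 & x [^] n : N1" using subgroup_nat_pow[OF HH'(4) x] unfolding N1_def by blast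
 qed
 hence "ser {\<one>} N a" using ab(2) n2 by (auto intro: ser.ser_per)
 thus ?case using 1 ab(1) by blast
next
 case (ser_cyc H h H')
 have HH': "subgroup H G" "subgroup H' G" "H <= H'" "subgroup N G" "N <= H'"
  using ser_cyc unfolding nrm_def by auto
 interpret N: subgroup N G by fact
 interpret H': subgroup H' G by fact
 define N1 where "N1 = N \<inter> H"
 have N1: "nrm N1 H" unfolding N1_def by (rule nrm_Int[OF ser_cyc.prems HH'(1,3)])
 obtain a b where ab: "h = a + b" "ser {\<one>} N1 a" "ser N1 H b" using ser_cyc.IH[OF N1] by blast
 have "pr N N1 = N"
 proof -
  have "N <= pr N N1" using pr_subgroup(2)[OF ser_cyc.prems, of N1] N1 HH' unfolding nrm_def N1_def by blast
  thus ?thesis unfolding pr_def N1_def by blast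
 qed
 hence s: "ser N (pr N H) b" using ser_pr[OF ser_cyc.prems ab(3) HH'(3)] N1_def by auto
 obtain f :: "'a => int" and g where f: "ALL x:H'. ALL y:H'. f (x ** y) = f x + f y"
  "ALL x:H'. f x = 0 <-> x : H" "g : H'" "f g = 1"
  using ser_cyc(3) unfolding cyc_def by blast
 note h = pow_hom_int[OF HH'(2) f(1)]
 show ?case
 proof (cases "N <= H")
  case True
  hence "N1 = N" "pr N H = H" using HH' pr_subgroup(3)[OF ser_cyc.prems HH'(1,3)]
   unfolding N1_def pr_def by (auto simp: subgroup.m_closed)
  hence "ser {\<one>} N a" "ser N H' (Suc b)" using ab s ser_cyc(2,3) by (auto intro: ser.ser_cyc)
  thus ?thesis using ab(1) by (intro exI[of _ a] exI[of _ "Suc b"]) simp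
 next
  case False
  \<comment> \<open>\<open>f\<close> maps \<open>N\<close> onto the multiples of the least such
    \<open>d\<close>; an element of \<open>N\<close> with value \<open>d\<close> then generates
    \<open>N\<close> modulo \<open>N1\<close>.\<close>
  define P where "P d <-> d > 0 & (EX n:N. f n = int d)" for d :: nat
  obtain n where n: "n : N" "f n ~= 0" using False f(2) HH'(5) by blast
  have exP: "EX d. P d"
  proof (cases "f n > 0")
   case True
   thus ?thesis unfolding P_def using n by (intro exI[of _ "nat (f n)"]) auto
  next
   case False
   thus ?thesis unfolding P_def using n h(3)[of n] HH'(5)
    by (intro exI[of _ "nat (- f n)"] conjI bexI[of _ "inv n"]) auto
  qed
  define d where "d = (LEAST d. P d)"
  have Pd: "P d" unfolding d_def using exP by (rule LeastI_ex)
  have least: "~ P e" if "e < d" for e using that unfolding d_def by (rule not_less_Least)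
  obtain n0 where n0: "n0 : N" "f n0 = int d" "d > 0" using Pd unfolding P_def by blast
  have n0i: "n0 [^] i : N" for i :: int using n0(1) by (rule subgroup_int_pow_closed[OF HH'(4)])
  have n2: "nrm N1 N" using nrm_Int[OF ser_cyc(2) HH'(4,5)] unfolding N1_def by (simp add: Int_commute)
  have "cyc N1 N"
  proof (rule cycI[OF n2 n0(1)])
   fix x assume x: "x : N"
   define q where "q = f x div int d"
   let ?y = "x ** inv (n0 [^] q)"
   have y: "?y : N" using x n0i by blast
   have "f ?y = f x - q * int d"
    using f(1) x n0i HH'(5) h(3)[of "n0 [^] q"] h(4)[of n0 q] n0 by (simp add: subset_iff)
   hence fy: "f ?y = f x mod int d" unfolding q_def by (simp add: minus_div_mult_eq_mod)
   have "f ?y = 0"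
   proof (rule ccontr)
    assume "f ?y ~= 0"
    moreover have "0 <= f ?y" "f ?y < int d" unfolding fy using n0(3) by auto
    ultimately have "P (nat (f ?y))" "nat (f ?y) < d" unfolding P_def using y by auto
    thus False using least by blast
   qed
   hence "?y : N1" using f(2) y HH'(5) unfolding N1_def by blast
   thus "EX i::int. x ** inv (n0 [^] i) : N1" by blast
  next
   fix i :: int assume "n0 [^] i : N1"
   hence "f (n0 [^] i) = 0" using f(2) HH'(5) n0i unfolding N1_def by blast
   thus "i = 0" using h(4)[of n0 i] n0 HH'(5) by auto
  qed
  hence 1: "ser {\<one>} N (Suc a)" using ab(2) n2 by (auto intro: ser.ser_cyc)
  have "pr N H' = H'" using pr_subgroup(3,4)[OF ser_cyc.prems HH'(2)] by auto
  hence nn: "nrm (pr N H) H'" using nrm_pr[OF ser_cyc.prems ser_cyc(2)] by auto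
  have "per (pr N H) H'" unfolding per_def
  proof
   fix x assume x: "x : H'"
   \<comment> \<open>Under \<open>f\<close>, both \<open>x [^] d\<close> and
     \<open>n0 [^] f x\<close> have the value \<open>d * f x\<close>, so they differ by an element
     of \<open>H\<close>.\<close>
   let ?y = "inv (n0 [^] f x) ** x [^] d"
   have xd: "x [^] d : H'" using x by (rule subgroup_nat_pow[OF HH'(2)])
   have y: "?y : H'" using xd n0i HH'(5) by blast
   have "f ?y = - (f x * int d) + int d * f x"
    using f(1) xd n0i[of "f x"] HH'(5) h(3)[of "n0 [^] f x"] h(4)[of n0 "f x"] h(2)[OF x, of d] n0
    by (simp add: subset_iff)
   hence "?y : H" using f(2) y by simp
   moreover have "x [^] d = n0 [^] f x ** ?y" using xd n0i[of "f x"]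
    by (simp add: m_assoc[symmetric] N.mem_carrier H'.mem_carrier)
   ultimately have "x [^] d : pr N H" unfolding pr_def using n0i by blast
   thus "EX n::nat. n > 0 & x [^] n : pr N H" using n0(3) by blast
  qed
  hence "ser N H' b" using s nn by (auto intro: ser.ser_per)
  thus ?thesis using 1 ab(1) by (intro exI[of _ "Suc a"] exI[of _ b]) simp
 qed
qed

lemma ser_per_0: "ser N H b ==> per N H ==> b = 0"
proof (induction rule: ser.induct)
 case (ser_cyc H h H')
 then obtain f :: "'a => int" and g where f: "ALL x:H'. ALL y:H'. f (x ** y) = f x + f y"
  "ALL x:H'. f x = 0 <-> x : H" "g : H'" "f g = 1" unfolding cyc_def by blast
 have s: "subgroup H' G" using ser_cyc unfolding nrm_def by blast
 obtain n :: nat where n: "n > 0" "g [^] n : N" using ser_cyc.prems f(3) unfolding per_def by blast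
 have "g [^] n : H" using n ser_subset[OF ser_cyc(1)] by blast
 hence "f (g [^] n) = 0" using f(2) subgroup_nat_pow[OF s f(3)] by blast
 hence False using pow_hom_int(2)[OF s f(1) f(3), of n] n f(4) by simp
 thus ?case ..
qed (auto simp: per_def nrm_def)

lemma ser_cyc_1:
 assumes f: "ALL x:H. ALL y:H. f (x ** y) = f x + (f y :: int)" "ALL x:H. f x = 0 <-> x : N"
  and H: "subgroup H G"
 shows "ser N K b ==> K <= H ==> (b = 0 & K = N) | (b = 1 & (EX x:K. f x ~= 0))"
proof (induction rule: ser.induct)
 case (ser_per K b K')
 have KK: "K <= K'" "subgroup K' G" using ser_per unfolding nrm_def by auto
 show ?case
 proof (cases "b = 0 & K = N")
  case True
  have "x : N" if x: "x : K'" for x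
  proof -
   obtain n :: nat where n: "n > 0" "x [^] n : N" using ser_per(3) x True unfolding per_def by blast
   have "x : H" using x ser_per.prems by blast
   moreover from this have "f (x [^] n) = 0" using n f(2) subgroup_nat_pow[OF H] by blast
   ultimately show ?thesis using pow_hom_int(2)[OF H f(1), of x n] n f(2) by auto
  qed
  thus ?thesis using True KK by auto
 next
  case False
  thus ?thesis using ser_per KK by blast
 qed
next
 case (ser_cyc K b K')
 have KK: "K <= K'" "subgroup K' G" "subgroup K G" using ser_cyc unfolding nrm_def by auto
 obtain f2 :: "'a => int" and g where f2: "ALL x:K'. ALL y:K'. f2 (x ** y) = f2 x + f2 y"
  "ALL x:K'. f2 x = 0 <-> x : K" "g : K'" "f2 g = 1" using ser_cyc(3) unfolding cyc_def by blast
 have gH: "g : H" using f2(3) ser_cyc.prems by blast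
 show ?case
 proof (cases "b = 0 & K = N")
  case True
  have "g ~: N" using f2(2-4) True by auto
  thus ?thesis using True f(2) gH f2(3) by auto
 next
  case False
  then obtain x where x: "x : K" "f x ~= 0" using ser_cyc KK by blast
  have xH: "x : H" using x KK ser_cyc.prems by blast
  \<comment> \<open>This combination is killed by \<open>f\<close>, hence lies in \<open>N\<close>.
    A second cyclic factor would then force \<open>f x = 0\<close>: subgroups of the integers have
    rank at most one.\<close>
  let ?y = "g [^] f x ** inv (x [^] f g)"
  have m: "g [^] f x : K'" "x [^] f g : K"
   using subgroup_int_pow_closed[OF KK(2) f2(3)] subgroup_int_pow_closed[OF KK(3) x(1)] by auto
  have i: "inv (x [^] f g) : K" using m(2) KK(3) by (simp add: subgroup.m_inv_closed)
  have y: "?y : K'" using m i KK by (meson subgroup.m_closed subsetD)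
  have "f ?y = 0"
   using f(1) m i ser_cyc.prems KK pow_hom_int(3)[OF H f(1), of "x [^] f g"]
    pow_hom_int(4)[OF H f(1) gH] pow_hom_int(4)[OF H f(1) xH] by (simp add: subset_iff)
  hence "?y : N" using f(2) y ser_cyc.prems by blast
  hence "f2 ?y = 0" using ser_subset[OF ser_cyc(1)] f2(2) y by blast
  moreover have "f2 (inv (x [^] f g)) = 0" using i f2(2) KK by blast
  ultimately have "f x = 0" using f2(1) m i KK pow_hom_int(4)[OF KK(2) f2(1) f2(3), of "f x"] f2(4)
   by (simp add: subset_iff)
  thus ?thesis using x by simp
 qed
qed simp

text \<open>The second series is split at the last proper term of the first. The induction
  hypothesis settles the part below, and the top factor allows only one count.\<close>

lemma ser_unique: "ser {\<one>} H h ==> ser {\<one>} H h' ==> h' = h"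
proof (induction arbitrary: h' rule: ser.induct)
 case ser_refl
 have "per {\<one>} {\<one>}" unfolding per_def by (auto intro!: exI[of _ 1])
 thus ?case using ser_refl.prems ser_per_0 by blast
next
 case (ser_per H h H')
 obtain a b where "h' = a + b" "ser {\<one>} H a" "ser H H' b"
  using ser_split[OF ser_per.prems ser_per(2)] by blast
 thus ?case using ser_per ser_per_0 by fastforce
next
 case (ser_cyc H h H')
 obtain a b where ab: "h' = a + b" "ser {\<one>} H a" "ser H H' b"
  using ser_split[OF ser_cyc.prems ser_cyc(2)] by blast
 obtain f :: "'a => int" and g where f: "ALL x:H'. ALL y:H'. f (x ** y) = f x + f y"
  "ALL x:H'. f x = 0 <-> x : H" "g : H'" "f g = 1"
  using ser_cyc(3) unfolding cyc_def by blast
 have "subgroup H' G" using ser_cyc unfolding nrm_def by blast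
 from ser_cyc_1[OF f(1,2) this ab(3)] have "b = 1" using f(2-4) by auto
 thus ?case using ab ser_cyc by auto
qed

end

section \<open>Comparison with subnormal series and quotient groups\<close>

context group
begin

lemma nrm_normal: "nrm K H <-> subgroup H G & K \<lhd> G(|carrier := H|)"
proof
 assume n: "nrm K H"
 hence s: "subgroup H G" "subgroup K G" "K <= H" unfolding nrm_def by auto
 interpret HG: group "G(|carrier := H|)" by (rule subgroup_imp_group[OF s(1)])
 have "subgroup K (G(|carrier := H|))" using s by (intro subgroup_incl)
 moreover have "inv\<^bsub>G(|carrier := H|)\<^esub> h = inv h" if "h : H" for h
  using that s(1) by (simp add: m_inv_consistent)
 ultimately have "K \<lhd> G(|carrier := H|)"
  using n by (auto simp: HG.normal_inv_iff nrm_def)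
 thus "subgroup H G & K \<lhd> G(|carrier := H|)" using s by blast
next
 assume a: "subgroup H G & K \<lhd> G(|carrier := H|)"
 hence s: "subgroup H G" by blast
 interpret HG: group "G(|carrier := H|)" by (rule subgroup_imp_group[OF s])
 have k: "subgroup K (G(|carrier := H|))" using a unfolding normal_def by blast
 have i: "inv\<^bsub>G(|carrier := H|)\<^esub> h = inv h" if "h : H" for h
  using that s by (simp add: m_inv_consistent)
 have "K <= H" using subgroup.subset[OF k] by simp
 moreover have "subgroup K G" using incl_subgroup[OF s k] .
 ultimately show "nrm K H" using a i s unfolding HG.normal_inv_iff by (intro nrmI) auto
qed

lemma Mod_pow:
 assumes "nrm K H" "x : H"
 shows "(K #> x) [^]\<^bsub>G(|carrier := H|) Mod K\<^esub> (n::nat) = K #> (x [^] n)"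
proof -
 interpret N: normal K "G(|carrier := H|)" using assms nrm_normal by blast
 have s: "subgroup H G" using assms nrm_normal by blast
 have rc: "r_coset (G(|carrier := H|)) K y = K #> y" for y by (simp add: r_coset_def)
 have "r_coset (G(|carrier := H|)) K x [^]\<^bsub>G(|carrier := H|) Mod K\<^esub> n = r_coset (G(|carrier := H|)) K (x [^]\<^bsub>G(|carrier := H|)\<^esub> n)"
  by (rule N.FactGroup_pow) (use assms(2) in simp)
 thus ?thesis by (simp add: rc nat_pow_consistent[symmetric])
qed

lemma coset_eq_K: "nrm K H ==> x : H ==> K #> x = K <-> x : K"
 by (metis coset_join1 coset_join2 nrm_def subgroup.mem_carrier)

lemma periodic_Mod_iff:
 assumes "nrm K H"
 shows "periodic_group (G(|carrier := H|) Mod K) <-> per K H"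
proof -
 have s: "subgroup H G" using assms nrm_normal by blast
 have rc: "r_coset (G(|carrier := H|)) K y = K #> y" for y by (simp add: r_coset_def)
 have "carrier (G(|carrier := H|) Mod K) = (%x. K #> x) ` H"
  by (auto simp: carrier_FactGroup rc)
 moreover have "\<one>\<^bsub>G(|carrier := H|) Mod K\<^esub> = K" by (simp add: FactGroup_def)
 ultimately show ?thesis
  unfolding periodic_group_def per_def
  using Mod_pow[OF assms] coset_eq_K[OF assms subgroup_nat_pow[OF s]] by auto
qed

lemma infinite_cyclic_Mod_iff:
 assumes n: "nrm K H"
 shows "infinite_cyclic_group (G(|carrier := H|) Mod K) <-> cyc K H"
proof
 assume "cyc K H"
 then obtain f :: "'a => int" and g where f: "ALL x:H. ALL y:H. f (x ** y) = f x + f y"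
  "ALL x:H. f x = 0 <-> x : K" "g : H" "f g = 1" unfolding cyc_def by blast
 have s: "subgroup H G" "K <= H" using n unfolding nrm_def by auto
 have "f : hom (G(|carrier := H|)) integer_group"
  using f(1) by (auto simp: hom_def integer_group_def)
 then interpret F: group_hom "G(|carrier := H|)" integer_group f
  by (intro group_hom.intro group_hom_axioms.intro subgroup_imp_group[OF s(1)] group_integer_group)
 have k: "kernel (G(|carrier := H|)) integer_group f = K"
  using f(2) s by (auto simp: kernel_def)
 have "i : f ` H" for i
 proof
  show "g [^] i : H" using f(3) s(1) by (simp add: subgroup_int_pow_closed)
  show "i = f (g [^] i)" using pow_hom_int(4)[OF s(1) f(1,3)] f(4) by simp
 qed
 hence "f ` carrier (G(|carrier := H|)) = carrier integer_group" by auto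
 from F.FactGroup_iso[OF this] show "infinite_cyclic_group (G(|carrier := H|) Mod K)"
  unfolding infinite_cyclic_group_def k .
next
 assume "infinite_cyclic_group (G(|carrier := H|) Mod K)"
 then obtain \<phi> where phi: "\<phi> : iso (G(|carrier := H|) Mod K) integer_group"
  unfolding infinite_cyclic_group_def is_iso_def by blast
 interpret N: normal K "G(|carrier := H|)" using n nrm_normal by blast
 have s: "subgroup H G" "K <= H" using n unfolding nrm_def by auto
 have rc: "r_coset (G(|carrier := H|)) K y = K #> y" for y by (simp add: r_coset_def)
 have car: "carrier (G(|carrier := H|) Mod K) = (%x. K #> x) ` H"
  by (auto simp: carrier_FactGroup rc)
 have mult: "(K #> x) \<otimes>\<^bsub>G(|carrier := H|) Mod K\<^esub> (K #> y) = K #> (x ** y)" if "x : H" "y : H" for x y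
  using N.rcos_sum[of x y] that by (simp add: rc set_mult_def FactGroup_def)
 have hom: "\<phi> ((K #> x) \<otimes>\<^bsub>G(|carrier := H|) Mod K\<^esub> (K #> y)) = \<phi> (K #> x) + \<phi> (K #> y)"
  if "x : H" "y : H" for x y
  using phi that unfolding iso_def hom_def car by auto
 have inj: "inj_on \<phi> ((%x. K #> x) ` H)" and surj: "\<phi> ` (%x. K #> x) ` H = UNIV"
  using phi unfolding iso_def bij_betw_def car by auto
 define f where "f x = \<phi> (K #> x)" for x
 have f: "ALL x:H. ALL y:H. f (x ** y) = f x + f y" using mult hom unfolding f_def by metis
 have one: "\<one> : H" "f \<one> = 0" using pow_hom_int(1)[OF s(1) f] s(1) by (auto simp: subgroup.one_closed)
 have "f x = 0 <-> x : K" if "x : H" for x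
 proof -
  have "f x = 0 <-> K #> x = K #> \<one>"
   using inj that one unfolding f_def by (metis imageI inj_on_contraD)
  also have "K #> \<one> = K" using n s(1) coset_eq_K[OF n one(1)] by (auto simp: nrm_def subgroup.one_closed)
  finally show ?thesis using coset_eq_K[OF n that] by simp
 qed
 moreover have "1 : f ` H" using surj unfolding f_def by (auto simp: image_image)
 hence "EX g:H. f g = 1" by force
 ultimately show "cyc K H" unfolding cyc_def using f by blast
qed

lemma finite_rank_series_ser:
 assumes "finite_rank_series G Hs"
 shows "ser {\<one>} (carrier G) (card {i. Suc i < length Hs & infinite_cyclic_group (series_factor G Hs i)})"
proof -
 have sn: "Hs ~= []" "Hs ! 0 = {\<one>}" "Hs ! (length Hs - 1) = carrier G"
  "!!H. H : set Hs ==> subgroup H G"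
  "!!i. Suc i < length Hs ==> Hs ! i \<lhd> G(|carrier := Hs ! Suc i|)"
  "!!i. Suc i < length Hs ==> periodic_group (series_factor G Hs i) | infinite_cyclic_group (series_factor G Hs i)"
  using assms unfolding finite_rank_series_def subnormal_series_def
  by (auto simp: hd_conv_nth last_conv_nth)
 have nr: "nrm (Hs ! i) (Hs ! Suc i)" if "Suc i < length Hs" for i
  unfolding nrm_normal using sn(4,5) that by simp
 let ?C = "%i. infinite_cyclic_group (series_factor G Hs i)"
 have "ser {\<one>} (Hs ! j) (card {i. i < j & ?C i})" if "j < length Hs" for j
  using that
 proof (induction j)
  case 0
  thus ?case using sn(2) ser.ser_refl triv_subgroup by auto
 next
  case (Suc j)
  hence IH: "ser {\<one>} (Hs ! j) (card {i. i < j & ?C i})" by simp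
  show ?case
  proof (cases "?C j")
   case True
   hence "cyc (Hs ! j) (Hs ! Suc j)"
    using infinite_cyclic_Mod_iff[OF nr[OF Suc.prems]] by (simp add: series_factor_def)
   moreover have "{i. i < Suc j & ?C i} = insert j {i. i < j & ?C i}" using True by (auto simp: less_Suc_eq)
   ultimately show ?thesis using ser.ser_cyc[OF IH nr[OF Suc.prems]] by simp
  next
   case False
   hence "per (Hs ! j) (Hs ! Suc j)"
    using sn(6)[OF Suc.prems] periodic_Mod_iff[OF nr[OF Suc.prems]] by (simp add: series_factor_def)
   moreover have "{i. i < Suc j & ?C i} = {i. i < j & ?C i}" using False by (auto simp: less_Suc_eq)
   ultimately show ?thesis using ser.ser_per[OF IH nr[OF Suc.prems]] by simp
  qed
 qed
 from this[of "length Hs - 1"] sn(1,3) have "ser {\<one>} (carrier G) (card {i. i < length Hs - 1 & ?C i})" by simp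
 moreover have "i < length Hs - 1 <-> Suc i < length Hs" for i by auto
 ultimately show ?thesis by simp
qed

definition is_ser :: "'a set list => 'a set => bool" where
 "is_ser Hs H <-> Hs ~= [] & hd Hs = {\<one>} & last Hs = H & (ALL H:set Hs. subgroup H G) &
   (ALL i. Suc i < length Hs --> nrm (Hs ! i) (Hs ! Suc i) &
    (per (Hs ! i) (Hs ! Suc i) | cyc (Hs ! i) (Hs ! Suc i)))"

lemma is_ser_snoc:
 assumes Hs: "is_ser Hs H" and n: "nrm H H'" and pc: "per H H' | cyc H H'"
 shows "is_ser (Hs @ [H']) H'"
proof -
 have "nrm ((Hs @ [H']) ! i) ((Hs @ [H']) ! Suc i) &
   (per ((Hs @ [H']) ! i) ((Hs @ [H']) ! Suc i) | cyc ((Hs @ [H']) ! i) ((Hs @ [H']) ! Suc i))"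
  if i: "Suc i < length (Hs @ [H'])" for i
 proof (cases "Suc i = length Hs")
  case True
  hence "i = length Hs - 1" by simp
  hence "(Hs @ [H']) ! i = H" using Hs True last_conv_nth[of Hs] unfolding is_ser_def by (simp add: nth_append)
  moreover have "(Hs @ [H']) ! Suc i = H'" using True by simp
  ultimately show ?thesis using n pc by simp
 next
  case False
  thus ?thesis using i Hs unfolding is_ser_def by (simp add: nth_append)
 qed
 moreover have "subgroup H' G" using n unfolding nrm_def by simp
 ultimately show ?thesis using Hs unfolding is_ser_def by simp
qed

lemma ser_series:
 assumes "ser {\<one>} H h"
 shows "EX Hs. is_ser Hs H"
 using assms
proof (induction rule: ser.induct)
 case ser_refl
 thus ?case by (intro exI[of _ "[{\<one>}]"]) (simp add: is_ser_def)
next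
 case (ser_per H h H')
 thus ?case using is_ser_snoc[OF _ ser_per(2)] by metis
next
 case (ser_cyc H h H')
 thus ?case using is_ser_snoc[OF _ ser_cyc(2)] by metis
qed

lemma ser_hirsch_number:
 assumes "ser {\<one>} (carrier G) k"
 shows "finite_torsion_free_rank G" "hirsch_number G = k"
proof -
 obtain Hs where Hs: "Hs ~= []" "hd Hs = {\<one>}" "last Hs = carrier G" "ALL H:set Hs. subgroup H G"
  "!!i. Suc i < length Hs ==> nrm (Hs ! i) (Hs ! Suc i) &
   (per (Hs ! i) (Hs ! Suc i) | cyc (Hs ! i) (Hs ! Suc i))"
  using ser_series[OF assms] unfolding is_ser_def by metis
 have f: "finite_rank_series G Hs"
  unfolding finite_rank_series_def subnormal_series_def
 proof (intro conjI allI impI)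
  fix i assume i: "Suc i < length Hs"
  show "Hs ! i \<lhd> G(|carrier := Hs ! Suc i|)" using Hs(5)[OF i] nrm_normal by blast
  show "periodic_group (series_factor G Hs i) | infinite_cyclic_group (series_factor G Hs i)"
   using Hs(5)[OF i] periodic_Mod_iff infinite_cyclic_Mod_iff unfolding series_factor_def by blast
 qed (use Hs in auto)
 thus "finite_torsion_free_rank G" unfolding finite_torsion_free_rank_def by blast
 show "hirsch_number G = k" unfolding hirsch_number_def
 proof (rule the_equality)
  show "EX Hs. finite_rank_series G Hs &
   k = card {i. Suc i < length Hs & infinite_cyclic_group (series_factor G Hs i)}"
   using f finite_rank_series_ser[OF f] ser_unique[OF assms] by blast
 next
  fix h assume "EX Hs. finite_rank_series G Hs &
   h = card {i. Suc i < length Hs & infinite_cyclic_group (series_factor G Hs i)}"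
  thus "h = k" using finite_rank_series_ser ser_unique[OF assms] by blast
 qed
qed

text \<open>Two different powers of \<open>x\<close> share a representative; their quotient is a
  positive power of \<open>x\<close> in \<open>T\<close>.\<close>

lemma fin_index_pow:
 assumes T: "subgroup T G" and R: "finite R" "R <= carrier G" and cov: "!!x. x : carrier G ==> EX r:R. x ** inv r : T"
  and x: "x : carrier G"
 shows "EX m::nat. m > 0 & x [^] m : T"
proof -
 interpret T: subgroup T G by fact
 have "ALL i::nat. EX r:R. x [^] i ** inv r : T" using cov x by simp
 then obtain r where r: "!!i::nat. r i : R" "!!i. x [^] i ** inv (r i) : T" by metis
 have "finite (range r)" using R(1) r(1) by (meson finite_subset image_subset_iff)
 hence "~ inj r" using finite_imageD infinite_UNIV_nat by blast
 then obtain i j where "i ~= j" "r i = r j" unfolding inj_def by blast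
 then obtain i j where ij: "i < j" "r i = r j" by (metis nat_neq_iff)
 have c: "r j : carrier G" using r R by blast
 have "(x [^] j ** inv (r j)) ** inv (x [^] i ** inv (r i)) : T" using r(2) by blast
 also have "(x [^] j ** inv (r j)) ** inv (x [^] i ** inv (r i)) = x [^] j ** inv (x [^] i)"
  using x c ij(2) by (simp add: inv_mult_group m_assoc inv_cancel)
 also have "x [^] j = x [^] (j - i) ** x [^] i" using x ij(1) by (simp add: nat_pow_mult)
 also have "x [^] (j - i) ** x [^] i ** inv (x [^] i) = x [^] (j - i)" using x by (simp add: m_assoc)
 finally show ?thesis using ij(1) by (intro exI[of _ "j - i"]) auto
qed

lemma conj_pow: "x : carrier G ==> r : carrier G ==> (r ** x ** inv r) [^] (n::nat) = r ** x [^] n ** inv r"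
 by (induction n) (simp_all add: m_assoc inv_cancel)

text \<open>\<open>T\<close> may fail to be normal. The rank is carried over through its core
  \<open>K\<close>, which is normal in \<open>G\<close>; both \<open>T\<close> and \<open>G\<close>
  are periodic over \<open>K\<close>.\<close>

lemma ser_fin_index:
 assumes T: "ser {\<one>} T h" and R: "finite R" "R <= carrier G" "\<one> : R"
  and cov: "!!x. x : carrier G ==> EX r:R. x ** inv r : T"
 shows "ser {\<one>} (carrier G) h"
proof -
 interpret T: subgroup T G using ser_subgroup[OF T] .
 define K where "K = {x : carrier G. ALL r:R. r ** x ** inv r : T}"
 have RG: "r : carrier G" if "r : R" for r using that R by blast
 have K: "subgroup K G"
 proof (rule subgroupI)
  show "K ~= {}" using RG unfolding K_def by (auto intro!: exI[of _ \<one>])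
  fix a b assume ab: "a : K" "b : K"
  have c: "a : carrier G" "b : carrier G" using ab unfolding K_def by auto
  have "r ** inv a ** inv r : T" if "r : R" for r
  proof -
   have "inv (r ** a ** inv r) : T" using ab that unfolding K_def by blast
   thus ?thesis using c RG[OF that] by (simp add: inv_mult_group m_assoc)
  qed
  thus "inv a : K" using c unfolding K_def by blast
  have "r ** (a ** b) ** inv r : T" if "r : R" for r
  proof -
   have "(r ** a ** inv r) ** (r ** b ** inv r) : T" using ab that unfolding K_def by blast
   thus ?thesis using c RG[OF that] by (simp add: m_assoc inv_cancel)
  qed
  thus "a ** b : K" using c unfolding K_def by blast
 qed (auto simp: K_def)
 have KT: "K <= T" using R(3) unfolding K_def by force
 have nG: "nrm K (carrier G)"
 proof (rule nrmI[OF K subgroup_self])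
  show "K <= carrier G" unfolding K_def by blast
  fix g x assume g: "g : carrier G" and x: "x : K"
  have xc: "x : carrier G" using x unfolding K_def by blast
  have "r ** (g ** x ** inv g) ** inv r : T" if r: "r : R" for r
  proof -
   have rc: "r : carrier G" by (rule RG[OF r])
   \<comment> \<open>\<open>r ** g\<close> is an element of \<open>T\<close> times a representative
     \<open>r'\<close>, so conjugation by it is conjugation by \<open>r'\<close> followed by one
     inside \<open>T\<close>.\<close>
   obtain r' where r': "r' : R" "r ** g ** inv r' : T" using cov[of "r ** g"] rc g by auto
   let ?t = "r ** g ** inv r'"
   have "?t ** (r' ** x ** inv r') ** inv ?t : T" using r' x unfolding K_def by blast
   thus ?thesis using rc g RG[OF r'(1)] xc by (simp add: m_assoc inv_mult_group inv_cancel)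
  qed
  thus "g ** x ** inv g : K" using g xc unfolding K_def by blast
 qed
 have per: "per K (carrier G)" unfolding per_def
 proof
  fix x assume x: "x : carrier G"
  have "EX m::nat. m > 0 & r ** x [^] m ** inv r : T" if "r : R" for r
   using fin_index_pow[OF T.subgroup_axioms R(1,2) cov, of "r ** x ** inv r"] x RG[OF that]
   by (simp add: conj_pow)
  then obtain m :: "'a => nat" where m: "!!r. r : R ==> m r > 0" "!!r. r : R ==> r ** x [^] m r ** inv r : T"
   by metis
  \<comment> \<open>One exponent that works for the conjugates by all representatives.\<close>
  define M where "M = prod m R"
  have "M > 0" unfolding M_def using m(1) R(1) by (simp add: prod_pos)
  moreover have "r ** x [^] M ** inv r : T" if r: "r : R" for r
  proof -
   have "M = m r * prod m (R - {r})" unfolding M_def using R(1) r by (simp add: prod.remove)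
   hence "r ** x [^] M ** inv r = (r ** x [^] m r ** inv r) [^] prod m (R - {r})"
    using x RG[OF r] by (simp add: conj_pow nat_pow_pow)
   thus ?thesis using m(2)[OF r] subgroup_nat_pow[OF T.subgroup_axioms] by simp
  qed
  hence "x [^] M : K" using x unfolding K_def by simp
  ultimately show "EX n::nat. n > 0 & x [^] n : K" by blast
 qed
 have nT: "nrm K T"
  using nG KT T.subset T.subgroup_axioms unfolding nrm_def by (simp add: subset_iff)
 obtain a b where ab: "h = a + b" "ser {\<one>} K a" "ser K T b" using ser_split[OF T nT] by blast
 have "per K T" using per T.subset unfolding per_def by (simp add: subset_iff)
 hence "b = 0" using ser_per_0[OF ab(3)] by blast
 thus ?thesis using ab ser.ser_per[OF _ nG per] by simp
qed

text \<open>The image is a subgroup of the rationals that contains 1. The preimage \<open>M\<close>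
  of the integers contributes the infinite cyclic factor, and everything above \<open>M\<close> is
  periodic because denominators can be cleared.\<close>

lemma ser_hom_rat:
 assumes H: "subgroup H G" and f: "ALL x:H. ALL y:H. f (x ** y) = f x + (f y :: rat)"
  and K: "K = {x : H. f x = 0}" and g: "g : H" "f g = 1"
 shows "ser K H 1"
proof -
 interpret H: subgroup H G by fact
 note h = pow_hom_int[OF H f]
 define M where "M = {x : H. f x : \<int>}"
 have sK: "subgroup K G"
  unfolding K using f h H.subset by (intro subgroupI) (auto intro!: exI[of _ \<one>])
 have sM: "subgroup M G"
  unfolding M_def using f h H.subset by (intro subgroupI) (auto intro!: exI[of _ \<one>])
 have cj: "f (x ** y ** inv x) = f y" if "x : H" "y : H" for x y using that f h(3) by simp
 have KM: "nrm K M"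
  by (rule nrmI[OF sK sM]) (use K cj M_def in auto)
 have MH: "nrm M H"
  by (rule nrmI[OF sM H]) (use cj M_def in auto)
 have "cyc K M" unfolding cyc_def
 proof (intro exI[of _ "%x. \<lfloor>f x\<rfloor>"] conjI ballI)
  fix x y assume "x : M" "y : M"
  thus "\<lfloor>f (x ** y)\<rfloor> = \<lfloor>f x\<rfloor> + \<lfloor>f y\<rfloor>" using f unfolding M_def by (auto elim!: Ints_cases)
 next
  fix x assume "x : M"
  thus "(\<lfloor>f x\<rfloor> = 0) = (x : K)" unfolding M_def K by (auto elim!: Ints_cases)
 next
  show "EX g:M. \<lfloor>f g\<rfloor> = 1" using g unfolding M_def by (auto intro!: bexI[of _ g])
 qed
 hence 1: "ser K M 1" using ser.ser_cyc[OF ser.ser_refl[OF sK] KM] by simp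
 have "per M H" unfolding per_def
 proof
  fix x assume x: "x : H"
  obtain a b where ab: "f x = of_int a / of_int b" "b > 0"
   by (metis quotient_of_denom_pos quotient_of_div surj_pair)
  have "f (x [^] nat b) = of_int a" using ab h(2)[OF x, of "nat b"] by (simp add: of_nat_nat)
  hence "x [^] nat b : M" unfolding M_def using subgroup_nat_pow[OF H x] by simp
  thus "EX n::nat. n > 0 & x [^] n : M" using ab(2) by (intro exI[of _ "nat b"]) auto
 qed
 thus ?thesis by (rule ser.ser_per[OF 1 MH])
qed

end

section \<open>Abelian factors and independent elements\<close>

context group
begin

fun prod_pow :: "'a list => int list => 'a" where
 "prod_pow (d # ds) (e # es) = d [^] e ** prod_pow ds es"
| "prod_pow _ _ = \<one>"

lemma prod_pow_closed: "subgroup T G ==> set ds <= T ==> prod_pow ds es : T"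
 by (induction ds es rule: prod_pow.induct)
  (auto simp: subgroup.one_closed subgroup.m_closed subgroup_int_pow_closed)

end

text \<open>An abelian quotient \<open>T / N\<close>, handled by congruence of elements instead of
  cosets.\<close>

locale abelian_mod = group G for G (structure) +
 fixes N T
 assumes nrm: "nrm N T" and comm: "x : T ==> y : T ==> x ** y ** inv x ** inv y : N"
begin

definition eqv (infix "\<doteq>" 50) where "x \<doteq> y <-> x ** inv y : N"

lemma sub: "subgroup N G" "subgroup T G" "N <= T"
 using nrm unfolding nrm_def by auto

sublocale N: subgroup N G by (rule sub)
sublocale T: subgroup T G by (rule sub)

lemma conj_N: "x : T ==> n : N ==> x ** n ** inv x : N"
 using nrm unfolding nrm_def by auto

lemma eqv_refl [intro]: "x : T ==> x \<doteq> x"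
 unfolding eqv_def by simp

lemma eqv_sym: "x : T ==> y : T ==> x \<doteq> y ==> y \<doteq> x"
 unfolding eqv_def using N.m_inv_closed[of "x ** inv y"] by (simp add: inv_mult_group)

lemma eqv_trans [trans]: "x \<doteq> y ==> y \<doteq> z ==> x : T ==> y : T ==> z : T ==> x \<doteq> z"
 unfolding eqv_def using N.m_closed[of "x ** inv y" "y ** inv z"] by (simp add: m_assoc inv_cancel)

lemma eqv_mult:
 assumes "x \<doteq> x'" "y \<doteq> y'" "x : T" "x' : T" "y : T" "y' : T"
 shows "x ** y \<doteq> x' ** y'"
proof -
 have "(x ** (y ** inv y') ** inv x) ** (x ** inv x') : N"
  using assms conj_N unfolding eqv_def by blast
 thus ?thesis using assms unfolding eqv_def by (simp add: m_assoc inv_cancel inv_mult_group)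
qed

lemma eqv_comm: "x : T ==> y : T ==> x ** y \<doteq> y ** x"
 unfolding eqv_def using comm[of x y] by (simp add: m_assoc inv_mult_group)

lemma eqv_one: "x : T ==> x \<doteq> \<one> <-> x : N"
 unfolding eqv_def by simp

lemma eqv_4:
 assumes "a : T" "b : T" "c : T" "d : T"
 shows "(a ** b) ** (c ** d) \<doteq> (a ** c) ** (b ** d)"
proof -
 have "a ** ((b ** c) ** d) \<doteq> a ** ((c ** b) ** d)"
  using assms by (intro eqv_mult eqv_comm eqv_refl) auto
 thus ?thesis using assms by (simp add: m_assoc)
qed

lemma prod_pow_add:
 assumes "set ds <= T" "length es = length ds" "length fs = length ds"
 shows "prod_pow ds es ** prod_pow ds fs \<doteq> prod_pow ds (map2 (+) es fs)"
 using assms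
proof (induction ds arbitrary: es fs)
 case (Cons d ds)
 obtain e es' f fs' where es: "es = e # es'" "fs = f # fs'"
  using Cons.prems by (cases es; cases fs) auto
 have c: "prod_pow ds k : T" for k using prod_pow_closed[OF sub(2)] Cons.prems by simp
 have d: "d [^] (k::int) : T" for k using Cons.prems subgroup_int_pow_closed[OF sub(2)] by simp
 have "prod_pow (d # ds) es ** prod_pow (d # ds) fs \<doteq> (d [^] e ** d [^] f) ** (prod_pow ds es' ** prod_pow ds fs')"
  unfolding es using eqv_4[OF d c d c] by simp
 also have "... \<doteq> d [^] (e + f) ** prod_pow ds (map2 (+) es' fs')"
  using Cons d c es by (intro eqv_mult) (auto simp: int_pow_mult)
 finally show ?case using c d es by simp
qed auto

lemma prod_pow_neg:
 assumes "set ds <= T" "length es = length ds"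
 shows "prod_pow ds es ** prod_pow ds (map uminus es) : N"
proof -
 have "prod_pow ds (map2 (+) es (map uminus es)) = \<one>"
  using assms(2,1)
 proof (induction es ds rule: list_induct2)
  case (Cons e es d ds)
  thus ?case by simp
 qed simp
 moreover have "prod_pow ds k : T" for k using prod_pow_closed[OF sub(2) assms(1)] .
 ultimately show ?thesis using prod_pow_add[OF assms, of "map uminus es"] assms eqv_one by simp
qed

text \<open>The subgroup generated by \<open>N\<close> and \<open>ds\<close>, in the normal form
  that an abelian quotient allows.\<close>

definition spn :: "'a list => 'a set" where
 "spn ds = {x : T. EX es. length es = length ds & x \<doteq> prod_pow ds es}"

lemma spn_subgroup:
 assumes ds: "set ds <= T"
 shows "subgroup (spn ds) G" "N <= spn ds" "spn ds <= T"
proof -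
 have c: "prod_pow ds k : T" for k using prod_pow_closed[OF sub(2) ds] .
 have z: "prod_pow ds (map (%_. 0) ds) = \<one>" using ds by (induction ds) auto
 show "spn ds <= T" unfolding spn_def by blast
 show NS: "N <= spn ds"
  unfolding spn_def using sub(3) z eqv_one by (auto intro!: exI[of _ "map (%_. 0) ds"])
 show "subgroup (spn ds) G"
 proof (rule subgroupI)
  show "spn ds <= carrier G" unfolding spn_def using T.subset by blast
  show "spn ds ~= {}" using NS N.one_closed by blast
  fix a b assume "a : spn ds" "b : spn ds"
  then obtain es fs where ab: "a : T" "b : T" "length es = length ds" "length fs = length ds"
   "a \<doteq> prod_pow ds es" "b \<doteq> prod_pow ds fs" unfolding spn_def by blast
  have "a ** b \<doteq> prod_pow ds es ** prod_pow ds fs" using ab c by (intro eqv_mult)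
  also have "... \<doteq> prod_pow ds (map2 (+) es fs)" using ab ds by (intro prod_pow_add)
  finally have "a ** b \<doteq> prod_pow ds (map2 (+) es fs)" using ab c by simp
  thus "a ** b : spn ds" unfolding spn_def using ab by (auto intro!: exI[of _ "map2 (+) es fs"])
  let ?m = "prod_pow ds (map uminus es)"
  have "a ** ?m \<doteq> prod_pow ds es ** ?m" using ab c by (intro eqv_mult) auto
  also have "prod_pow ds es ** ?m \<doteq> \<one>" using prod_pow_neg[OF ds ab(3)] c eqv_one by simp
  finally have "a ** ?m \<doteq> \<one>" using ab(1) c by simp
  hence "inv a ** (a ** ?m) \<doteq> inv a ** \<one>" using ab c by (intro eqv_mult) auto
  hence "?m \<doteq> inv a" using ab c by (simp add: inv_cancel)
  hence "inv a \<doteq> ?m" using ab(1) c eqv_sym[of ?m "inv a"] by simp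
  thus "inv a : spn ds" unfolding spn_def using ab by (auto intro!: exI[of _ "map uminus es"])
 qed
qed

lemma nrm_between:
 assumes "subgroup A G" "subgroup B G" "N <= A" "A <= B" "B <= T"
 shows "nrm A B"
proof (rule nrmI[OF assms(1,2,4)])
 interpret A: subgroup A G by fact
 fix h k assume hk: "h : B" "k : A"
 hence t: "h : T" "k : T" using assms by auto
 have "h ** k ** inv h ** inv k : A" using comm[OF t] assms(3) by blast
 hence "h ** k ** inv h ** inv k ** k : A" using hk(2) by blast
 thus "h ** k ** inv h : A" using t by (simp add: m_assoc)
qed

text \<open>By independence, no nonzero power of a list element lies in the span of those after it,
  so each element contributes one infinite cyclic factor.\<close>

lemma ser_spn:
 assumes "set ds <= T"
  and "!!es. length es = length ds ==> prod_pow ds es : N ==> ALL e:set es. e = 0"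
 shows "ser N (spn ds) (length ds)"
 using assms
proof (induction ds)
 case Nil
 have "spn [] = N" unfolding spn_def using eqv_one sub(3) by auto
 thus ?case using ser.ser_refl[OF sub(1)] by simp
next
 case (Cons d ds)
 have ds: "set ds <= T" and dT: "d : T" using Cons.prems by auto
 have c: "prod_pow ds k : T" for k using prod_pow_closed[OF sub(2) ds] .
 have di: "d [^] (k::int) : T" for k using dT subgroup_int_pow_closed[OF sub(2)] by simp
 have "ser N (spn ds) (length ds)"
 proof (rule Cons.IH[OF ds])
  fix es assume "length es = length ds" "prod_pow ds es : N"
  thus "ALL e:set es. e = 0" using Cons.prems(2)[of "0 # es"] c by simp
 qed
 moreover have n: "nrm (spn ds) (spn (d # ds))"
 proof (rule nrm_between)
  show "spn ds <= spn (d # ds)"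
  proof
   fix x assume "x : spn ds"
   then obtain es where "x : T" "length es = length ds" "x \<doteq> prod_pow ds es" unfolding spn_def by blast
   thus "x : spn (d # ds)" unfolding spn_def using c by (auto intro!: exI[of _ "0 # es"])
  qed
 qed (use spn_subgroup[OF ds] spn_subgroup[OF Cons.prems(1)] in auto)
 moreover have "cyc (spn ds) (spn (d # ds))"
 proof (rule cycI[OF n, of d])
  show "d : spn (d # ds)"
  proof -
   have z: "prod_pow ds (map (%_. 0) ds) = \<one>" using ds by (induction ds) auto
   have "d \<doteq> prod_pow (d # ds) (1 # map (%_. 0) ds)" using dT z by auto
   thus ?thesis unfolding spn_def using dT by (auto intro!: exI[of _ "1 # map (%_. 0) ds"])
  qed
 next
  fix x assume "x : spn (d # ds)"
  then obtain es where es: "x : T" "length es = Suc (length ds)" "x \<doteq> prod_pow (d # ds) es"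
   unfolding spn_def by auto
  then obtain e fs where ef: "es = e # fs" by (cases es) auto
  have "x ** inv (d [^] e) \<doteq> (d [^] e ** prod_pow ds fs) ** inv (d [^] e)"
   using es ef c di by (intro eqv_mult) auto
  also have "... \<doteq> inv (d [^] e) ** (d [^] e ** prod_pow ds fs)"
   using c di by (intro eqv_comm) auto
  finally have "x ** inv (d [^] e) \<doteq> prod_pow ds fs" using es c di by (simp add: inv_cancel)
  thus "EX i::int. x ** inv (d [^] i) : spn ds"
   unfolding spn_def using es ef di by (intro exI[of _ e]) auto
 next
  fix i :: int assume "d [^] i : spn ds"
  then obtain es where es: "length es = length ds" "d [^] i \<doteq> prod_pow ds es"
   unfolding spn_def by auto
  let ?m = "prod_pow ds (map uminus es)"
  have "d [^] i ** ?m \<doteq> prod_pow ds es ** ?m" using es c di by (intro eqv_mult) auto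
  also have "prod_pow ds es ** ?m \<doteq> \<one>" using prod_pow_neg[OF ds es(1)] c eqv_one by simp
  finally have "d [^] i ** ?m \<doteq> \<one>" using c di by simp
  hence "prod_pow (d # ds) (i # map uminus es) : N" using eqv_one c di by simp
  thus "i = 0" using Cons.prems(2)[of "i # map uminus es"] es by simp
 qed
 ultimately show ?case using ser.ser_cyc by fastforce
qed

lemma ser_abelian:
 assumes "set ds <= T"
  and "!!es. length es = length ds ==> prod_pow ds es : N ==> ALL e:set es. e = 0"
  and per: "per (spn ds) T"
 shows "ser N T (length ds)"
 using ser.ser_per[OF ser_spn[OF assms(1,2)] nrm_between per] spn_subgroup[OF assms(1)] sub by blast

end

subsection \<open>Rational unitriangular matrices\<close>

lemma mat_mult_index:
 assumes "A : sqm N" "B : sqm N" "i < N" "j < N"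
 shows "(A * B) $$ (i, j) = (SUM k<N. A $$ (i, k) * B $$ (k, j))"
 using assms by (simp add: scalar_prod_def atLeast0LessThan)

text \<open>The parameter \<open>p\<close> refines the filtration by superdiagonals to single
  entries, so that consecutive terms are separated by at most one rational coordinate.\<close>

definition unitri :: "nat => nat => rat mat set" where
 "unitri N p = {u : sqm N. (ALL i<N. u $$ (i, i) = 1) & (ALL i<N. ALL j<i. u $$ (i, j) = 0) &
   (ALL j<N. ALL i<j. (j - i) * N + i < p --> u $$ (i, j) = 0)}"

text \<open>The positions \<open>(i, j)\<close> above the diagonal are numbered by \<open>(j - i) * N + i\<close>.\<close>

definition entry_at :: "nat => nat => rat mat => rat" where
 "entry_at N p u = (if 0 < p div N & p mod N + p div N < N then u $$ (p mod N, p mod N + p div N) else 0)"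

lemma unitri_carrier: "u : unitri N p ==> u : sqm N"
 unfolding unitri_def by simp

lemma unitri_zero: "u : unitri N p ==> i < j ==> j < N ==> (j - i) * N + i < p ==> u $$ (i, j) = 0"
 unfolding unitri_def by simp

lemma unitri_mono: "p <= q ==> unitri N q <= unitri N p"
 unfolding unitri_def by auto

lemma pos_less:
 assumes "i < j" "j < (N :: nat)"
 shows "(j - i) * N + i < N * N"
proof -
 have "(j - i) * N + i < (j - i) * N + N" using assms by simp
 also have "... = (Suc (j - i)) * N" by simp
 also have "... <= N * N" using assms by (intro mult_le_mono1) simp
 finally show ?thesis .
qed

lemma unitri_last: "u : unitri N (N * N) ==> u = 1m N"
 using pos_less unfolding unitri_def
 by (intro eq_matI) (auto simp: nat_neq_iff)

lemma one_unitri [simp]: "1m N : unitri N p"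
 unfolding unitri_def by auto

text \<open>An intermediate index leads through an entry closer to the diagonal, which vanishes. On
  the first position that may be nonzero, multiplication of matrices is therefore addition.\<close>

lemma unitri_mult_entry:
 assumes u: "u : unitri N p" and v: "v : unitri N p" and ij: "i < j" "j < N" "(j - i) * N + i <= p"
 shows "(u * v) $$ (i, j) = u $$ (i, j) + v $$ (i, j)"
proof -
 have z: "u $$ (i, k) * v $$ (k, j) = 0" if k: "k < N" "k ~= i" "k ~= j" for k
 proof -
  consider "k < i" | "k > j" | "i < k" "k < j" using k by linarith
  thus ?thesis
  proof cases
   case 3
   have "(k - i) * N < (j - i) * N" using 3 ij by simp
   hence "(k - i) * N + i < p" using ij(3) by linarith
   hence "u $$ (i, k) = 0" using unitri_zero[OF u, of i k] 3 ij(2) by simp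
   thus ?thesis by simp
  qed (use u v k ij in "auto simp: unitri_def")
 qed
 have "(u * v) $$ (i, j) = (SUM k<N. u $$ (i, k) * v $$ (k, j))"
  using u v ij by (intro mat_mult_index) (auto simp: unitri_def)
 also have "... = (SUM k:{i, j}. u $$ (i, k) * v $$ (k, j))"
  using ij z by (intro sum.mono_neutral_right) auto
 also have "... = u $$ (i, j) + v $$ (i, j)" using ij u v by (auto simp: unitri_def)
 finally show ?thesis .
qed

lemma unitri_mult [intro]:
 assumes u: "u : unitri N p" and v: "v : unitri N p"
 shows "u * v : unitri N p"
proof -
 have c: "u : sqm N" "v : sqm N" using u v unfolding unitri_def by auto
 have "(u * v) $$ (i, i) = 1" if i: "i < N" for i
 proof -
  have "u $$ (i, k) * v $$ (k, i) = (if k = i then 1 else 0)" if "k < N" for k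
   using u v that i unfolding unitri_def by (cases k i rule: linorder_cases) auto
  thus ?thesis using mat_mult_index[OF c i i] i by simp
 qed
 moreover have "(u * v) $$ (i, j) = 0" if i: "i < N" "j < i" for i j
 proof -
  have "u $$ (i, k) * v $$ (k, j) = 0" if "k < N" for k
   using u v that i unfolding unitri_def by (cases "k < i") auto
  thus ?thesis using mat_mult_index[OF c, of i j] i by (simp add: sum.neutral)
 qed
 moreover have "(u * v) $$ (i, j) = 0" if "j < N" "i < j" "(j - i) * N + i < p" for i j
  using unitri_mult_entry[OF u v that(2,1)] that u v unfolding unitri_def by auto
 ultimately show ?thesis using c unfolding unitri_def by auto
qed

lemma entry_at_mult:
 assumes u: "u : unitri N p" and v: "v : unitri N p"
 shows "entry_at N p (u * v) = entry_at N p u + entry_at N p v"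
proof (cases "0 < p div N & p mod N + p div N < N")
 case True
 have "(p mod N + p div N - p mod N) * N + p mod N = p" by simp
 thus ?thesis using unitri_mult_entry[OF u v, of "p mod N" "p mod N + p div N"] True
  unfolding entry_at_def by simp
qed (auto simp: entry_at_def)

lemma entry_at_one [simp]: "entry_at N p (1m N) = 0"
 unfolding entry_at_def by auto

lemma unitri_Suc: "u : unitri N (Suc p) <-> u : unitri N p & entry_at N p u = 0"
proof
 assume a: "u : unitri N (Suc p)"
 have "(p mod N + p div N - p mod N) * N + p mod N = p" by simp
 thus "u : unitri N p & entry_at N p u = 0" using a unitri_mono[of p "Suc p" N]
  unfolding entry_at_def unitri_def by auto
next
 assume a: "u : unitri N p & entry_at N p u = 0"
 have "u $$ (i, j) = 0" if ij: "j < N" "i < j" "(j - i) * N + i < Suc p" for i j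
 proof (cases "(j - i) * N + i = p")
  case True
  hence "p div N = j - i" "p mod N = i" using ij by (auto simp flip: True)
  thus ?thesis using a ij unfolding entry_at_def by auto
 next
  case False
  thus ?thesis using a ij unfolding unitri_def by auto
 qed
 thus "u : unitri N (Suc p)" using a unfolding unitri_def by auto
qed

lemma unitri_pow: "u : unitri N p ==> u ^m n : unitri N p"
 by (induction n) (auto simp: unitri_carrier[THEN carrier_matD(1)])

lemma entry_at_pow: "u : unitri N p ==> entry_at N p (u ^m n) = of_nat n * entry_at N p u"
 by (induction n) (auto simp: unitri_carrier[THEN carrier_matD(1)] entry_at_mult unitri_pow algebra_simps)

section \<open>Polynomial curves and rational powers\<close>

definition polyfun :: "(rat => rat) => bool" where
 "polyfun f <-> (EX q. f = poly q)"

lemma polyfun_const [intro]: "polyfun (%y. c)"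
 unfolding polyfun_def by (intro exI[of _ "[:c:]"]) auto

lemma polyfun_id [intro]: "polyfun (%y. y)"
 unfolding polyfun_def by (intro exI[of _ "[:0, 1:]"]) auto

lemma polyfun_add [intro]: "polyfun f ==> polyfun g ==> polyfun (%y. f y + g y)"
proof -
 assume "polyfun f" "polyfun g"
 then obtain p q where "f = poly p" "g = poly q" unfolding polyfun_def by auto
 thus ?thesis unfolding polyfun_def by (intro exI[of _ "p + q"]) auto
qed

lemma polyfun_mult [intro]: "polyfun f ==> polyfun g ==> polyfun (%y. f y * g y)"
proof -
 assume "polyfun f" "polyfun g"
 then obtain p q where "f = poly p" "g = poly q" unfolding polyfun_def by auto
 thus ?thesis unfolding polyfun_def by (intro exI[of _ "p * q"]) auto
qed

lemma polyfun_sum [intro]: "(!!k. k : A ==> polyfun (f k)) ==> polyfun (%y. SUM k:A. f k y)"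
 by (induction A rule: infinite_finite_induct) auto

lemma polyfun_prod [intro]: "(!!k. k : A ==> polyfun (f k)) ==> polyfun (%y. PROD k:A. f k y)"
 by (induction A rule: infinite_finite_induct) auto

lemma polyfun_gbinomial [intro]: "polyfun f ==> polyfun (%y. f y gchoose k)"
proof -
 assume f: "polyfun f"
 have "polyfun (%y. inverse (fact k) * (PROD i:{0..<k}. f y + - of_nat i))"
  using f by (intro polyfun_mult polyfun_const polyfun_prod polyfun_add)
 thus ?thesis by (simp add: gbinomial_prod_rev divide_inverse mult.commute)
qed

text \<open>Identities are checked at natural numbers, where rational powers are ordinary powers,
  and extend to rational exponents because a nonzero polynomial has finitely many roots.\<close>

lemma polyfun_eq:
 assumes "polyfun f" "polyfun g" "!!n :: nat. f (of_nat n) = g (of_nat n)"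
 shows "f = g"
proof -
 obtain p q where pq: "f = poly p" "g = poly q" using assms unfolding polyfun_def by blast
 have "range (of_nat :: nat => rat) <= {x. poly (p - q) x = 0}" using assms(3) pq by auto
 hence "infinite {x. poly (p - q) x = 0}"
  by (rule infinite_super) (simp add: finite_image_iff inj_of_nat)
 hence "p - q = 0" using poly_roots_finite[of "p - q"] by auto
 thus ?thesis using pq by simp
qed

definition polycurve :: "nat => (rat => rat mat) => bool" where
 "polycurve N c <-> (ALL y. c y : sqm N) & (ALL i<N. ALL j<N. polyfun (%y. c y $$ (i, j)))"

lemma polycurve_const [intro]: "A : sqm N ==> polycurve N (%y. A)"
 unfolding polycurve_def by auto

lemma polycurve_mult [intro]:
 assumes "polycurve N c" "polycurve N d"
 shows "polycurve N (%y. c y * d y)"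
proof -
 have "polyfun (%y. (c y * d y) $$ (i, j))" if "i < N" "j < N" for i j
 proof -
  have eq: "(%y. (c y * d y) $$ (i, j)) = (%y. SUM k<N. c y $$ (i, k) * d y $$ (k, j))"
   using assms that by (intro ext mat_mult_index) (auto simp: polycurve_def)
  show ?thesis unfolding eq
   using assms that by (intro polyfun_sum polyfun_mult) (auto simp: polycurve_def)
 qed
 thus ?thesis using assms unfolding polycurve_def by (auto intro: mult_carrier_mat)
qed

lemma polycurve_eq:
 assumes "polycurve N c" "polycurve N d" "!!n :: nat. c (of_nat n) = d (of_nat n)"
 shows "c y = d y"
proof (rule eq_matI)
 have c: "c y : sqm N" "d y : sqm N" using assms unfolding polycurve_def by auto
 fix i j assume "i < dim_row (d y)" "j < dim_col (d y)"
 hence ij: "i < N" "j < N" using c by auto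
 have "(%y. c y $$ (i, j)) = (%y. d y $$ (i, j))"
  using assms ij by (intro polyfun_eq) (auto simp: polycurve_def)
 thus "c y $$ (i, j) = d y $$ (i, j)" by (rule fun_cong)
next
 have "c y : sqm N" "d y : sqm N" using assms unfolding polycurve_def by auto
 thus "dim_row (c y) = dim_row (d y)" "dim_col (c y) = dim_col (d y)" by auto
qed

lemma polyfun_entry_at: "polycurve N c ==> polyfun (%y. entry_at N p (c y))"
 by (cases "0 < p div N & p mod N + p div N < N") (auto simp: entry_at_def polycurve_def)

text \<open>The binomial series for a rational power of a unipotent matrix; it stops before
  \<open>N\<close> because the \<open>N\<close>-th power of \<open>b - 1m N\<close>
  vanishes.\<close>

definition upow :: "nat => rat mat => rat => rat mat" where
 "upow N b x = mat N N (%(i, j). SUM k<N. (x gchoose k) * ((b - 1m N) ^m k) $$ (i, j))"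

lemma upow_carrier [simp]: "upow N b x : sqm N"
 unfolding upow_def by simp

lemma upow_dim [simp]: "dim_row (upow N b x) = N" "dim_col (upow N b x) = N"
 unfolding upow_def by auto

lemma polycurve_upow [intro]: "polyfun f ==> polycurve N (%y. upow N b (f y))"
 unfolding polycurve_def upow_def by (auto intro!: polyfun_sum polyfun_mult)

lemma strict_pow:
 assumes "b : unitri N 0" "i < N" "j < N" "j < i + k"
 shows "((b - 1m N) ^m k) $$ (i, j) = 0"
 using assms(3,4)
proof (induction k arbitrary: j)
 case 0
 thus ?case using assms by (auto simp: unitri_def)
next
 case (Suc k)
 have c: "b - 1m N : sqm N" using assms(1) by (auto simp: unitri_def)
 have "((b - 1m N) ^m k) $$ (i, l) * (b - 1m N) $$ (l, j) = 0" if "l < N" for l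
 proof (cases "l < i + k")
  case True
  thus ?thesis using Suc.IH that by simp
 next
  case False
  hence "j <= l" using Suc.prems by simp
  thus ?thesis using assms(1) that Suc.prems by (cases "j = l") (auto simp: unitri_def)
 qed
 thus ?case using mat_mult_index[OF pow_carrier_mat[OF c] c assms(2) Suc.prems(1)]
  by (simp add: sum.neutral)
qed

lemma upow_0: "b : unitri N 0 ==> upow N b 0 = 1m N"
proof (rule eq_matI)
 fix i j assume b: "b : unitri N 0" and ij: "i < dim_row (1m N :: rat mat)" "j < dim_col (1m N :: rat mat)"
 have "dim_row b = N" using b by (auto simp: unitri_def)
 have "(SUM k<N. (0 gchoose k) * ((b - 1m N) ^m k) $$ (i, j)) =
   (SUM k:{0}. (0 gchoose k) * ((b - 1m N) ^m k) $$ (i, j))"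
  using ij by (intro sum.mono_neutral_right) (auto simp: gbinomial_0_left)
 also have "... = 1m N $$ (i, j)" using \<open>dim_row b = N\<close> ij by simp
 finally show "upow N b 0 $$ (i, j) = 1m N $$ (i, j)" using ij unfolding upow_def by simp
qed auto

lemma upow_plus_1:
 assumes b: "b : unitri N 0"
 shows "upow N b (x + 1) = upow N b x * b"
proof (rule eq_matI)
 have cb: "b : sqm N" and c: "b - 1m N : sqm N" using b by (auto simp: unitri_def)
 let ?X = "b - 1m N"
 have be: "b = 1m N + ?X" using cb by (intro eq_matI) auto
 fix i j assume "i < dim_row (upow N b x * b)" "j < dim_col (upow N b x * b)"
 hence ij: "i < N" "j < N" using cb by auto
 hence N: "0 < N" by simp
 have "(upow N b x * ?X) $$ (i, j) = (SUM l<N. (SUM k<N. (x gchoose k) * (?X ^m k) $$ (i, l)) * ?X $$ (l, j))"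
  using mat_mult_index[OF upow_carrier c ij] ij unfolding upow_def by simp
 also have "... = (SUM k<N. (x gchoose k) * (SUM l<N. (?X ^m k) $$ (i, l) * ?X $$ (l, j)))"
  unfolding sum_distrib_right sum_distrib_left by (subst sum.swap) (simp add: mult.assoc)
 also have "... = (SUM k<N. (x gchoose k) * (?X ^m Suc k) $$ (i, j))"
  using mat_mult_index[OF pow_carrier_mat[OF c] c ij] by simp
 \<comment> \<open>The last term contains \<open>(b - 1m N) ^m N\<close>, which is 0; dropping it
   aligns the two sums for Pascal's rule.\<close>
 also have "... = (SUM k<N - 1. (x gchoose k) * (?X ^m Suc k) $$ (i, j))"
 proof (rule sum.mono_neutral_right)
  show "ALL k:{..<N} - {..<N - 1}. (x gchoose k) * (?X ^m Suc k) $$ (i, j) = 0"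
  proof
   fix k assume "k : {..<N} - {..<N - 1}"
   hence "Suc k = N" by auto
   thus "(x gchoose k) * (?X ^m Suc k) $$ (i, j) = 0" using strict_pow[OF b ij, of "Suc k"] ij by simp
  qed
 qed auto
 finally have 1: "(upow N b x * ?X) $$ (i, j) = (SUM k<N - 1. (x gchoose k) * (?X ^m Suc k) $$ (i, j))" .
 obtain M where M: "N = Suc M" using N by (cases N) auto
 have "upow N b (x + 1) $$ (i, j) = (?X ^m 0) $$ (i, j) + (SUM k<M. (x + 1 gchoose Suc k) * (?X ^m Suc k) $$ (i, j))"
  using ij unfolding upow_def M by (simp add: sum.lessThan_Suc_shift del: pow_mat.simps sum.lessThan_Suc)
 also have "... = ((?X ^m 0) $$ (i, j) + (SUM k<M. (x gchoose Suc k) * (?X ^m Suc k) $$ (i, j))) +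
   (SUM k<M. (x gchoose k) * (?X ^m Suc k) $$ (i, j))"
  unfolding gbinomial_Suc_Suc by (simp add: algebra_simps sum.distrib del: pow_mat.simps)
 also have "(?X ^m 0) $$ (i, j) + (SUM k<M. (x gchoose Suc k) * (?X ^m Suc k) $$ (i, j)) = upow N b x $$ (i, j)"
  using ij unfolding upow_def M by (simp add: sum.lessThan_Suc_shift del: pow_mat.simps sum.lessThan_Suc)
 also have "(SUM k<M. (x gchoose k) * (?X ^m Suc k) $$ (i, j)) = (upow N b x * ?X) $$ (i, j)"
  using 1 M by simp
 also have "upow N b x $$ (i, j) + (upow N b x * ?X) $$ (i, j) = (upow N b x * (1m N + ?X)) $$ (i, j)"
  using ij c by (simp add: mult_add_distrib_mat[of _ N N _ N] del: index_mult_mat(1))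
 finally show "upow N b (x + 1) $$ (i, j) = (upow N b x * b) $$ (i, j)" using be by simp
qed (use b in "auto simp: unitri_def")

lemma upow_of_nat: "b : unitri N 0 ==> upow N b (of_nat n) = b ^m n"
proof (induction n)
 case (Suc n)
 have "upow N b (of_nat (Suc n)) = upow N b (of_nat n + 1)" by (simp add: add.commute)
 thus ?case using Suc upow_plus_1 by simp
qed (auto simp: upow_0 unitri_def)

lemma upow_1: "b : unitri N 0 ==> upow N b 1 = b"
 using upow_of_nat[of b N 1] by (auto simp: unitri_def)

text \<open>Both sides are polynomial in \<open>y\<close>, so induction on natural \<open>y\<close>
  is enough.\<close>

lemma upow_add:
 assumes b: "b : unitri N 0"
 shows "upow N b (x + y) = upow N b x * upow N b y"
proof (rule polycurve_eq[of N "%y. upow N b (x + y)" "%y. upow N b x * upow N b y"])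
 show "upow N b (x + of_nat n) = upow N b x * upow N b (of_nat n)" for n
 proof (induction n)
  case 0
  thus ?case using b by (simp add: upow_0)
 next
  case (Suc n)
  have cb: "b : sqm N" using b by (rule unitri_carrier)
  have "upow N b (x + of_nat (Suc n)) = upow N b (x + of_nat n + 1)" by (simp add: algebra_simps)
  also have "... = upow N b x * (upow N b (of_nat n) * b)"
   unfolding upow_plus_1[OF b] Suc using cb by (simp add: assoc_mult_mat[of _ N N _ N _ N])
  also have "upow N b (of_nat n) * b = upow N b (of_nat n + 1)" by (simp add: upow_plus_1[OF b])
  finally show ?case by (simp add: add.commute)
 qed
qed (auto intro!: polycurve_mult polycurve_upow)

lemma upow_minus:
 assumes "b : unitri N 0"
 shows "upow N b x * upow N b (- x) = 1m N" "upow N b (- x) * upow N b x = 1m N"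
 using upow_add[OF assms, of x "- x"] upow_add[OF assms, of "- x" x] upow_0[OF assms] by auto

lemma upow_pow:
 assumes "b : unitri N 0"
 shows "upow N b x ^m n = upow N b (of_nat n * x)"
proof (induction n)
 case (Suc n)
 have "upow N b (of_nat (Suc n) * x) = upow N b (of_nat n * x + x)" by (simp add: algebra_simps)
 thus ?case using Suc upow_add[OF assms] by simp
qed (simp add: upow_0[OF assms])

text \<open>Zariski closedness tested along polynomial curves. It turns closure under natural powers
  into closure under rational ones.\<close>

definition polyclosed :: "nat => rat mat set => bool" where
 "polyclosed N A <-> (ALL c. polycurve N c --> (ALL n :: nat. c (of_nat n) : A) --> (ALL y. c y : A))"

lemma polyclosedD: "polyclosed N A ==> polycurve N c ==> (!!n :: nat. c (of_nat n) : A) ==> c y : A"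
 unfolding polyclosed_def by blast

lemma polyclosed_unitri: "polyclosed N (unitri N p)"
 unfolding polyclosed_def
proof (intro allI impI)
 fix c y assume c: "polycurve N c" and n: "ALL n :: nat. c (of_nat n) : unitri N p"
 have e: "c y $$ (i, j) = v" if "i < N" "j < N" "!!n :: nat. c (of_nat n) $$ (i, j) = v" for i j v
 proof -
  have "(%y. c y $$ (i, j)) = (%y. v)"
   using c that by (intro polyfun_eq) (auto simp: polycurve_def)
  thus ?thesis by (rule fun_cong)
 qed
 show "c y : unitri N p" using n c e unfolding unitri_def polycurve_def by simp
qed

lemma upow_unitri:
 assumes "b : unitri N p"
 shows "upow N b x : unitri N p"
proof (rule polyclosedD[OF polyclosed_unitri polycurve_upow[OF polyfun_id]])
 have "b : unitri N 0" using assms unitri_mono[of 0 p N] by auto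
 thus "upow N b (of_nat n) : unitri N p" for n
  using unitri_pow[OF assms] by (simp add: upow_of_nat)
qed

lemma entry_at_upow:
 assumes "b : unitri N p"
 shows "entry_at N p (upow N b x) = x * entry_at N p b"
proof -
 have "b : unitri N 0" using assms unitri_mono[of 0 p N] by auto
 hence "(%x. entry_at N p (upow N b x)) = (%x. x * entry_at N p b)"
  using entry_at_pow[OF assms]
  by (intro polyfun_eq polyfun_entry_at polycurve_upow polyfun_id polyfun_mult polyfun_const) (simp add: upow_of_nat)
 thus ?thesis by (rule fun_cong)
qed

section \<open>Mal'cev bases and rational hulls\<close>

fun rhull :: "nat => rat mat list => rat mat set" where
 "rhull N [] = {1m N}"
| "rhull N (b # bs) = {upow N b x * e | x e. e : rhull N bs}"

text \<open>A Mal'cev basis: leading positions increase strictly and each element normalises the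
  hull of the later ones, so \<open>rhull\<close> consists of products in Mal'cev coordinates of the
  second kind. Normalisation is asked only on the later basis elements, in both directions;
  \<open>hull_conj\<close> extends it to their hull.\<close>

fun mbasis :: "nat => nat => rat mat list => bool" where
 "mbasis N q [] <-> True"
| "mbasis N q (b # bs) <-> (EX p>=q. b : unitri N p & entry_at N p b ~= 0 & mbasis N (Suc p) bs &
   (ALL b':set bs. b * b' * upow N b (-1) : rhull N bs & upow N b (-1) * b' * b : rhull N bs))"

definition matgrp :: "nat => rat mat set => bool" where
 "matgrp N E <-> E <= sqm N & 1m N : E & (ALL x:E. ALL y:E. x * y : E) &
   (ALL x:E. EX y:E. x * y = 1m N & y * x = 1m N)"

lemma matgrp_mult: "matgrp N E ==> x : E ==> y : E ==> x * y : E"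
 unfolding matgrp_def by blast

lemma matgrp_pow: "matgrp N E ==> u : E ==> u ^m n : E"
proof (induction n)
 case 0
 thus ?case unfolding matgrp_def by auto
next
 case (Suc n)
 thus ?case unfolding matgrp_def by simp
qed

lemma conj_mult:
 assumes "t : sqm N" "t' : sqm N" "t' * t = 1m N" "x : sqm N" "y : sqm N"
 shows "t * (x * y) * t' = (t * x * t') * (t * y * t' :: 'a :: semiring_1 mat)"
proof -
 note [simp] = assoc_mult_mat[of _ N N _ N _ N]
 have "t' * (t * (y * t')) = (t' * t) * (y * t')" using assms(1,2,4,5) by simp
 also have "... = y * t'" unfolding assms(3) using assms(2,5) by simp
 finally show ?thesis using assms(1,2,4,5) by simp
qed

lemma conj_pow_mat:
 assumes "t : sqm N" "t' : sqm N" "t' * t = 1m N" "t * t' = 1m N" "x : sqm N"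
 shows "(t * x * t') ^m n = t * (x ^m n) * (t' :: 'a :: semiring_1 mat)"
proof (induction n)
 case 0
 thus ?case using assms by simp
next
 case (Suc n)
 thus ?case using conj_mult[OF assms(1-3) pow_carrier_mat[OF assms(5), of n] assms(5)] by simp
qed

text \<open>The conjugates of the rational powers of a basis element form a polynomial curve, so the
  conjugates of its natural powers decide.\<close>

lemma hull_conj:
 assumes G: "matgrp N G" "polyclosed N G"
  and t: "t : sqm N" "t' : sqm N" "t' * t = 1m N" "t * t' = 1m N"
  and bs: "!!b. b : set bs ==> b : unitri N 0" "!!b. b : set bs ==> t * b * t' : G"
 shows "e : rhull N bs ==> t * e * t' : G & e : sqm N"
 using bs
proof (induction bs arbitrary: e)
 case Nil
 thus ?case using t G unfolding matgrp_def by simp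
next
 case (Cons b bs)
 obtain x f where f: "f : rhull N bs" "e = upow N b x * f" using Cons.prems by auto
 have b: "b : unitri N 0" "t * b * t' : G" using Cons.prems by auto
 have f': "t * f * t' : G" "f : sqm N" using Cons.IH[OF f(1)] Cons.prems by auto
 have "t * upow N b x * t' : G"
 proof (rule polyclosedD[OF G(2), of "%x. t * upow N b x * t'"])
  show "polycurve N (%x. t * upow N b x * t')"
   using t by (intro polycurve_mult polycurve_const polycurve_upow polyfun_id)
  show "t * upow N b (of_nat n) * t' : G" for n
   using conj_pow_mat[OF t unitri_carrier[OF b(1)], of n] matgrp_pow[OF G(1) b(2), of n]
   by (simp add: upow_of_nat[OF b(1)])
 qed
 hence "(t * upow N b x * t') * (t * f * t') : G" using G(1) f' unfolding matgrp_def by blast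
 thus ?case using conj_mult[OF t(1-3) upow_carrier f'(2)] f(2) mult_carrier_mat[OF upow_carrier f'(2)] by simp
qed

text \<open>Rational powers of \<open>b\<close> normalise \<open>E\<close> because the conjugate of
  \<open>e\<close> by \<open>upow N b y\<close> is a polynomial curve in \<open>y\<close>. Along a
  curve in \<open>F\<close>, the exponent of \<open>b\<close> is the entry number \<open>p\<close>
  divided by that of \<open>b\<close>; hence it is polynomial and the factor can be split off, which
  gives closedness of \<open>F\<close>.\<close>

lemma hull_step:
 assumes E: "matgrp N E" "polyclosed N E" "E <= unitri N (Suc p)"
  and b: "b : unitri N p" "entry_at N p b ~= 0"
  and c: "!!e. e : E ==> b * e * upow N b (-1) : E" "!!e. e : E ==> upow N b (-1) * e * b : E"
 defines "F \<equiv> {upow N b x * e | x e. e : E}"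
 shows "matgrp N F" "polyclosed N F" "F <= unitri N p" "E <= F" "!!x. upow N b x : F"
  "!!u. u : F ==> entry_at N p u = 0 <-> u : E"
proof -
 note [simp] = assoc_mult_mat[of _ N N _ N _ N] mult_carrier_mat[of _ N N _ N]
 have b0: "b : unitri N 0" using b(1) unitri_mono[of 0 p N] by auto
 have bc: "b : sqm N" by (rule unitri_carrier[OF b(1)])
 have Ec: "e : sqm N" if "e : E" for e using E(1) that unfolding matgrp_def by blast
 have Em: "x * y : E" if "x : E" "y : E" for x y using E(1) that unfolding matgrp_def by blast
 have E1: "1m N : E" using E(1) unfolding matgrp_def by blast
 have Ep: "e : unitri N p" "entry_at N p e = 0" if "e : E" for e
  using E(3) that unitri_Suc[of e N p] by auto
 have cn: "upow N b (of_nat n) * e * upow N b (- of_nat n) : E" if e: "e : E" for n e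
 proof (induction n)
  case 0
  thus ?case using e Ec[OF e] by (simp add: upow_0[OF b0])
 next
  case (Suc n)
  let ?e = "upow N b (of_nat n) * e * upow N b (- of_nat n)"
  have "upow N b (of_nat (Suc n)) = b * upow N b (of_nat n)"
   using upow_add[OF b0, of 1 "of_nat n"] upow_1[OF b0] by simp
  moreover have "upow N b (- of_nat (Suc n)) = upow N b (- of_nat n) * upow N b (-1)"
   using upow_add[OF b0, of "- of_nat n" "-1"] by (simp add: algebra_simps)
  ultimately have "upow N b (of_nat (Suc n)) * e * upow N b (- of_nat (Suc n)) = b * ?e * upow N b (-1)"
   using bc Ec[OF e] by simp
  thus ?case using c(1)[OF Suc] by simp
 qed
 have cy: "upow N b y * e * upow N b (- y) : E" if e: "e : E" for y e
 proof (rule polyclosedD[OF E(2), of "%y. upow N b y * e * upow N b (- y)"])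
  have "polyfun (%y. (-1) * y)" by (intro polyfun_mult polyfun_const polyfun_id)
  hence "polyfun (%y. - y)" by simp
  thus "polycurve N (%y. upow N b y * e * upow N b (- y))"
   using Ec[OF e] by (intro polycurve_mult polycurve_const polycurve_upow polyfun_id)
 qed (use cn[OF e] in auto)
 show Fu: "F <= unitri N p"
  unfolding F_def using upow_unitri[OF b(1)] Ep(1) by auto
 show "E <= F"
 proof
  fix e assume e: "e : E"
  have "e = upow N b 0 * e" using Ec[OF e] by (simp add: upow_0[OF b0])
  thus "e : F" unfolding F_def using e by blast
 qed
 show "upow N b x : F" for x
 proof -
  have "upow N b x = upow N b x * 1m N" by simp
  thus ?thesis unfolding F_def using E1 by blast
 qed
 have ent: "entry_at N p (upow N b x * e) = x * entry_at N p b" if "e : E" for x e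
  using entry_at_mult[OF upow_unitri[OF b(1)] Ep(1)[OF that]] Ep(2)[OF that] entry_at_upow[OF b(1)] by simp
 show "entry_at N p u = 0 <-> u : E" if uF: "u : F" for u
 proof -
  obtain x e where u: "e : E" "u = upow N b x * e" using uF unfolding F_def by blast
  have "u = e" if "x = 0" using that u Ec[OF u(1)] by (simp add: upow_0[OF b0])
  thus ?thesis using ent[OF u(1)] b(2) Ep(2)[of u] u by auto
 qed
 show "matgrp N F" unfolding matgrp_def
 proof (intro conjI ballI)
  show "F <= sqm N" using Fu unitri_carrier by blast
  show "1m N : F" using \<open>E <= F\<close> E1 by blast
 next
  fix u v assume "u : F" "v : F"
  then obtain x e y f where uv: "e : E" "u = upow N b x * e" "f : E" "v = upow N b y * f"
   unfolding F_def by blast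
  let ?e = "upow N b (- y) * e * upow N b y"
  have e: "?e : E" using cy[OF uv(1), of "- y"] by simp
  have "u * v = upow N b x * (upow N b y * upow N b (- y)) * e * upow N b y * f"
   using uv Ec by (simp add: upow_minus[OF b0])
  also have "... = (upow N b x * upow N b y) * (?e * f)" using uv Ec by simp
  also have "... = upow N b (x + y) * (?e * f)" by (simp only: upow_add[OF b0])
  finally show "u * v : F" unfolding F_def using Em[OF e uv(3)] by blast
 next
  fix u assume "u : F"
  then obtain x e where u: "e : E" "u = upow N b x * e" unfolding F_def by blast
  obtain f where f: "f : E" "e * f = 1m N" "f * e = 1m N" using E(1) u(1) unfolding matgrp_def by blast
  let ?g = "upow N b x * f * upow N b (- x)"
  have g: "upow N b (- x) * ?g : F" unfolding F_def using cy[OF f(1), of x] by blast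
  have eq: "upow N b (- x) * ?g = f * upow N b (- x)"
  proof -
   have "upow N b (- x) * ?g = (upow N b (- x) * upow N b x) * f * upow N b (- x)" using Ec[OF f(1)] by simp
   thus ?thesis using Ec[OF f(1)] by (simp only: upow_minus[OF b0]) simp
  qed
  have fe: "e : sqm N" "f : sqm N" using Ec u(1) f(1) by auto
  have "e * (f * upow N b (- x)) = (e * f) * upow N b (- x)" using fe by simp
  hence "e * (f * upow N b (- x)) = upow N b (- x)" by (simp only: f(2)) simp
  hence 1: "u * (f * upow N b (- x)) = 1m N" using u(2) fe by (simp add: upow_minus[OF b0])
  have "upow N b (- x) * (upow N b x * e) = (upow N b (- x) * upow N b x) * e" using fe by simp
  hence "upow N b (- x) * (upow N b x * e) = e" using fe by (simp only: upow_minus[OF b0]) simp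
  hence 2: "(f * upow N b (- x)) * u = 1m N" using u(2) fe f(3) by simp
  show "EX v:F. u * v = 1m N & v * u = 1m N" using g 1 2 unfolding eq by blast
 qed
 show "polyclosed N F" unfolding polyclosed_def
 proof (intro allI impI)
  fix c y assume pc: "polycurve N c" and cF: "ALL n :: nat. c (of_nat n) : F"
  define x where "x y = entry_at N p (c y) * inverse (entry_at N p b)" for y
  have px: "polyfun x" unfolding x_def by (intro polyfun_mult polyfun_entry_at[OF pc] polyfun_const)
  have "polyfun (%y. (-1) * x y)" by (intro polyfun_mult polyfun_const px)
  hence "polyfun (%y. - x y)" by simp
  hence pd: "polycurve N (%y. upow N b (- x y) * c y)" by (intro polycurve_mult polycurve_upow pc)
  have "upow N b (- x y) * c y : E"
  proof (rule polyclosedD[OF E(2) pd])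
   fix n :: nat
   obtain z e where z: "e : E" "c (of_nat n) = upow N b z * e" using cF unfolding F_def by blast
   have "x (of_nat n) = z" unfolding x_def z(2) ent[OF z(1)] using b(2) by simp
   moreover have "upow N b (- z) * (upow N b z * e) = (upow N b (- z) * upow N b z) * e" using Ec[OF z(1)] by simp
   hence "upow N b (- z) * (upow N b z * e) = e" using Ec[OF z(1)] by (simp only: upow_minus[OF b0]) simp
   ultimately show "upow N b (- x (of_nat n)) * c (of_nat n) : E" using z by simp
  qed
  moreover have "c y = upow N b (x y) * (upow N b (- x y) * c y)"
  proof -
   have cy: "c y : sqm N" using pc unfolding polycurve_def by blast
   have "upow N b (x y) * (upow N b (- x y) * c y) = (upow N b (x y) * upow N b (- x y)) * c y" using cy by simp
   thus ?thesis using cy by (simp only: upow_minus[OF b0]) simp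
  qed
  ultimately show "c y : F" unfolding F_def by blast
 qed
qed

lemma mbasis_hull:
 assumes "mbasis N q bs"
 shows "matgrp N (rhull N bs)" "polyclosed N (rhull N bs)" "rhull N bs <= unitri N q"
  "!!b. b : set bs ==> b : unitri N q"
  "!!b x. b : set bs ==> upow N b x : rhull N bs"
 using assms
proof (induction bs arbitrary: q)
 case Nil
 {
  case 1
  thus ?case by (auto simp: matgrp_def)
 next
  case 2
  have "c y = 1m N" if "polycurve N c" "ALL n :: nat. c (of_nat n) = 1m N" for c y
   using polycurve_eq[OF that(1) polycurve_const[of "1m N"], of y] that(2) by simp
  thus ?case by (auto simp: polyclosed_def)
 next
  case 3
  thus ?case by auto
 next
  case 4
  thus ?case by auto
 next
  case 5
  thus ?case by auto
 }
next
 case (Cons b bs)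
 have *: "matgrp N (rhull N (b # bs)) & polyclosed N (rhull N (b # bs)) & rhull N (b # bs) <= unitri N q &
  (ALL a:set (b # bs). a : unitri N q & (ALL x. upow N a x : rhull N (b # bs)))" if mb: "mbasis N q (b # bs)" for q
 proof -
  obtain p where p: "p >= q" "b : unitri N p" "entry_at N p b ~= 0" "mbasis N (Suc p) bs"
   "!!b'. b' : set bs ==> b * b' * upow N b (-1) : rhull N bs"
   "!!b'. b' : set bs ==> upow N b (-1) * b' * b : rhull N bs" using mb by auto
  note IH = Cons.IH(1-3)[OF p(4)] Cons.IH(4,5)[OF _ p(4)]
  have b0: "b : unitri N 0" using p(2) unitri_mono[of 0 p N] by auto
  have inv: "upow N b (-1) * b = 1m N" "b * upow N b (-1) = 1m N"
   using upow_minus[OF b0, of 1] upow_1[OF b0] by auto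
  have bs0: "b' : unitri N 0" if "b' : set bs" for b' using IH(4)[OF that] unitri_mono[of 0 "Suc p" N] by auto
  have c1: "b * e * upow N b (-1) : rhull N bs" if "e : rhull N bs" for e
   using hull_conj[OF IH(1,2) unitri_carrier[OF b0] upow_carrier inv bs0 p(5) that] by blast
  have c2: "upow N b (-1) * e * b : rhull N bs" if "e : rhull N bs" for e
   using hull_conj[OF IH(1,2) upow_carrier unitri_carrier[OF b0] inv(2,1) bs0 p(6) that] by blast
  note st = hull_step[OF IH(1-3) p(2,3) c1 c2]
  have "rhull N (b # bs) = {upow N b x * e | x e. e : rhull N bs}" by simp
  moreover have "a : unitri N q" if "a : set (b # bs)" for a
   using that IH(4) p(2) unitri_mono[of q p N] unitri_mono[of q "Suc p" N] p(1) by auto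
  moreover have "upow N a x : rhull N (b # bs)" if "a : set (b # bs)" for a x
  proof (cases "a = b")
   case False
   hence "upow N a x : rhull N bs" using that IH(5) by simp
   from subsetD[OF st(4) this] show ?thesis by simp
  qed (use st(5) in simp)
  ultimately show ?thesis using st(1-3) unitri_mono[OF p(1), of N] by auto
 qed
 {
  case 1
  thus ?case using * by blast
 next
  case 2
  thus ?case using * by blast
 next
  case 3
  thus ?case using * by blast
 next
  case 4
  thus ?case using * by blast
 next
  case 5
  thus ?case using * by blast
 }
qed

text \<open>The curve \<open>upow N u (of_nat m * y)\<close> lies in \<open>E\<close> for natural
  \<open>y\<close>; the root \<open>u\<close> is its value at \<open>1 / m\<close>.\<close>

lemma hull_root:
 assumes E: "polyclosed N E" "matgrp N E" and u: "u : unitri N 0" "m > 0" "u ^m m : E"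
 shows "u : E"
proof -
 have "upow N u (of_nat m * y) : E" for y
 proof (rule polyclosedD[OF E(1), of "%y. upow N u (of_nat m * y)"])
  show "polycurve N (%y. upow N u (of_nat m * y))"
   by (intro polycurve_upow polyfun_mult polyfun_const polyfun_id)
  show "upow N u (of_nat m * of_nat n) : E" for n
   using matgrp_pow[OF E(2) u(3), of n] upow_pow[OF u(1), of "of_nat m" n] upow_of_nat[OF u(1), of m]
   by (simp add: mult.commute)
 qed
 from this[of "1 / of_nat m"] show ?thesis using u(2) upow_1[OF u(1)] by simp
qed

text \<open>Membership in the hull in a form that finite data can witness: each factor is a rational
  power of a basis element, recognised as a root of a natural power of it or of the inverse of
  one.\<close>

definition hull_witness :: "nat => rat mat list => rat mat => bool" where
 "hull_witness N bs u <-> (EX ws. u = foldr (*) ws (1m N) & (ALL w:set ws. w : unitri N 0 &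
   (EX b:set bs. EX m>0. EX e. w ^m m = b ^m e | w ^m m * b ^m e = 1m N)))"

lemma hull_witness_iff:
 assumes mb: "mbasis N q bs"
 shows "hull_witness N bs u <-> u : rhull N bs"
proof
 note H = mbasis_hull[OF mb]
 assume "hull_witness N bs u"
 then obtain ws where ws: "u = foldr (*) ws (1m N)" "ALL w:set ws. w : unitri N 0 &
   (EX b:set bs. EX m>0. EX e. w ^m m = b ^m e | w ^m m * b ^m e = 1m N)" unfolding hull_witness_def by blast
 have w: "w : rhull N bs" if w: "w : set ws" for w
 proof -
  obtain b m e where b: "b : set bs" "m > 0" "w ^m m = b ^m e | w ^m m * b ^m e = 1m N" "w : unitri N 0"
   using ws(2) w by blast
  have b0: "b : unitri N 0" using H(4)[OF b(1)] unitri_mono[of 0 q N] by auto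
  have be: "b ^m e : rhull N bs" using H(5)[OF b(1), of "of_nat e"] by (simp add: upow_of_nat[OF b0])
  have "w ^m m : rhull N bs"
  proof (cases "w ^m m = b ^m e")
   case False
   obtain f where f: "f : rhull N bs" "b ^m e * f = 1m N" using be H(1) unfolding matgrp_def by blast
   have fc: "f : sqm N" "b ^m e : sqm N" using f be H(1) unfolding matgrp_def by auto
   have wc: "w ^m m : sqm N" using b(4) by (simp add: unitri_carrier)
   have "w ^m m * (b ^m e * f) = (w ^m m * b ^m e) * f"
    by (rule assoc_mult_mat[symmetric, OF wc fc(2,1)])
   hence "w ^m m * 1m N = 1m N * f" using False b(3) f(2) by simp
   hence "w ^m m = f" unfolding right_mult_one_mat[OF wc] left_mult_one_mat[OF fc(1)] .
   thus ?thesis using f(1) by simp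
  qed (use be in simp)
  thus ?thesis using hull_root[OF H(2,1) b(4,2)] by blast
 qed
 have "foldr (*) vs (1m N) : rhull N bs" if "set vs <= set ws" for vs
  using that H(1) w by (induction vs) (auto simp: matgrp_def)
 thus "u : rhull N bs" using ws(1) by blast
next
 assume "u : rhull N bs"
 moreover have "ALL b:set bs. b : unitri N 0" using mbasis_hull(4)[OF mb] unitri_mono[of 0 q N] by auto
 ultimately show "hull_witness N bs u"
 proof (induction bs arbitrary: u)
  case Nil
  thus ?case unfolding hull_witness_def by (intro exI[of _ "[]"]) auto
 next
  case (Cons b bs)
  then obtain x e where u: "e : rhull N bs" "u = upow N b x * e" by auto
  have b0: "b : unitri N 0" using Cons.prems by auto
  obtain ws where ws: "e = foldr (*) ws (1m N)" "ALL w:set ws. w : unitri N 0 &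
   (EX b:set bs. EX m>0. EX e. w ^m m = b ^m e | w ^m m * b ^m e = 1m N)"
   using Cons.IH[OF u(1)] Cons.prems unfolding hull_witness_def by auto
  obtain a d where ad: "x = of_int a / of_int d" "d > 0"
   by (metis quotient_of_denom_pos quotient_of_div surj_pair)
  have *: "upow N b x ^m nat d = upow N b (of_int a)"
   using ad by (simp add: upow_pow[OF b0] of_nat_nat)
  have "upow N b x ^m nat d = b ^m nat a | upow N b x ^m nat d * b ^m nat (- a) = 1m N"
  proof (cases "a >= 0")
   case True
   thus ?thesis using * upow_of_nat[OF b0, of "nat a"] by simp
  next
   case False
   hence "b ^m nat (- a) = upow N b (- of_int a)" using upow_of_nat[OF b0, of "nat (- a)"] by simp
   thus ?thesis using * upow_minus[OF b0] by simp
  qed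
  hence "EX m>0. EX e. upow N b x ^m m = b ^m e | upow N b x ^m m * b ^m e = 1m N"
   using ad(2) by (intro exI[of _ "nat d"]) auto
  hence "EX b':set (b # bs). EX m>0. EX e. upow N b x ^m m = b' ^m e | upow N b x ^m m * b' ^m e = 1m N"
   by auto
  thus ?case unfolding hull_witness_def
   using u ws upow_unitri[OF b0] by (intro exI[of _ "upow N b x # ws"]) auto
 qed
qed

text \<open>\<open>U\<close> may be infinitely generated. At each position one element with nonzero
  entry is enough because entries are rational: any other element has a power that agrees there with
  a power of the chosen one, and hulls admit roots.\<close>

lemma mbasis_exists:
 assumes U: "matgrp N U" "U <= unitri N 0"
 shows "q <= N * N ==> EX bs. mbasis N q bs & set bs <= U & U \<inter> unitri N q <= rhull N bs"
proof (induction rule: inc_induct)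
 case base
 show ?case using unitri_last by (intro exI[of _ "[]"]) auto
next
 case (step q)
 then obtain bs where bs: "mbasis N (Suc q) bs" "set bs <= U" "U \<inter> unitri N (Suc q) <= rhull N bs" by blast
 show ?case
 proof (cases "EX b:U \<inter> unitri N q. entry_at N q b ~= 0")
  case False
  hence "U \<inter> unitri N q <= unitri N (Suc q)" using unitri_Suc by blast
  moreover have "mbasis N q bs" using bs(1) by (cases bs) (auto intro: Suc_leD)
  ultimately show ?thesis using bs by blast
 next
  case True
  then obtain b where b: "b : U" "b : unitri N q" "entry_at N q b ~= 0" by blast
  have b0: "b : unitri N 0" using U b by blast
  have inv: "upow N b (-1) * b = 1m N" "b * upow N b (-1) = 1m N"
   using upow_minus[OF b0, of 1] upow_1[OF b0] by auto
  have bi: "upow N b (-1) : U"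
  proof -
   obtain c where c: "c : U" "b * c = 1m N" using U(1) b(1) unfolding matgrp_def by blast
   have cc: "c : sqm N" "b : sqm N" using c(1) b(1) U(1) unfolding matgrp_def by auto
   have "upow N b (-1) * (b * c) = (upow N b (-1) * b) * c"
    by (rule assoc_mult_mat[symmetric, OF upow_carrier cc(2,1)])
   hence "upow N b (-1) = c" using cc inv c by simp
   thus ?thesis using c by simp
  qed
  have ebi: "upow N b (-1) : unitri N q" "entry_at N q (upow N b (-1)) = - entry_at N q b"
   using upow_unitri[OF b(2)] entry_at_upow[OF b(2)] by auto
  have Um: "x * y : U" if "x : U" "y : U" for x y using U(1) that unfolding matgrp_def by blast
  have cj: "b * b' * upow N b (-1) : rhull N bs & upow N b (-1) * b' * b : rhull N bs" if b': "b' : set bs" for b'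
  proof -
   have b'2: "b' : unitri N q" "entry_at N q b' = 0" using mbasis_hull(4)[OF bs(1) b'] unitri_Suc by auto
   have "b * b' * upow N b (-1) : unitri N (Suc q)" "upow N b (-1) * b' * b : unitri N (Suc q)"
    using b'2 ebi b(2) unfolding unitri_Suc by (auto simp: entry_at_mult unitri_mult)
   moreover have "b * b' * upow N b (-1) : U" "upow N b (-1) * b' * b : U" using Um b(1) bi b' bs(2) by auto
   ultimately show ?thesis using bs(3) by blast
  qed
  have mb: "mbasis N q (b # bs)" using b bs(1) cj by auto
  note H = mbasis_hull[OF mb]
  have "u : rhull N (b # bs)" if u: "u : U" "u : unitri N q" for u
  proof -
   obtain e m where em: "entry_at N q u / entry_at N q b = of_int e / of_int m" "m > 0"
    by (metis quotient_of_denom_pos quotient_of_div surj_pair)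
   hence em': "of_int m * entry_at N q u = of_int e * entry_at N q b" using b(3) by (simp add: field_simps)
   \<comment> \<open>The exponents are chosen so that \<open>u ^m nat m\<close> and the
     \<open>e\<close>-th power of \<open>b\<close> have the same entry number \<open>q\<close>; thus
     \<open>v\<close> falls into the next term of the filtration.\<close>
   define v where "v = u ^m nat m * upow N b (- of_int e)"
   have "upow N b (- of_int e) : U"
   proof (cases "e <= 0")
    case True
    thus ?thesis using upow_of_nat[OF b0, of "nat (- e)"] matgrp_pow[OF U(1) b(1)] by simp
   next
    case False
    hence "upow N b (- of_int e) = upow N b (-1) ^m nat e" by (simp add: upow_pow[OF b0])
    thus ?thesis using matgrp_pow[OF U(1) bi] by simp
   qed
   hence vU: "v : U" unfolding v_def using matgrp_pow[OF U(1) u(1)] Um by blast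
   have "entry_at N q v = 0" "v : unitri N q" unfolding v_def
    using entry_at_mult[OF unitri_pow[OF u(2)] upow_unitri[OF b(2)]] entry_at_pow[OF u(2)] entry_at_upow[OF b(2)] em em'
     unitri_mult[OF unitri_pow[OF u(2)] upow_unitri[OF b(2)]] by (auto simp: of_nat_nat)
   hence v: "v : rhull N bs" using vU bs(3) unitri_Suc by blast
   have sub: "rhull N bs <= rhull N (b # bs)"
   proof
    fix f assume f: "f : rhull N bs"
    have "f : sqm N" using f mbasis_hull(1)[OF bs(1)] unfolding matgrp_def by blast
    hence "f = upow N b 0 * f" by (simp add: upow_0[OF b0])
    thus "f : rhull N (b # bs)" using f by auto
   qed
   have uc: "u : sqm N" using u(2) by (rule unitri_carrier)
   have "v * upow N b (of_int e) = u ^m nat m * (upow N b (- of_int e) * upow N b (of_int e))"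
    unfolding v_def by (rule assoc_mult_mat[OF pow_carrier_mat[OF uc] upow_carrier upow_carrier])
   hence "v * upow N b (of_int e) = u ^m nat m" using uc by (simp add: upow_minus[OF b0])
   moreover have "v * upow N b (of_int e) : rhull N (b # bs)"
    by (rule matgrp_mult[OF H(1)]) (use v sub H(5)[of b] in "auto simp del: rhull.simps")
   ultimately have um: "u ^m nat m : rhull N (b # bs)" by simp
   have u0: "u : unitri N 0" using u U by blast
   show ?thesis by (rule hull_root[OF H(2,1) u0 _ um]) (use em(2) in simp)
  qed
  hence "U \<inter> unitri N q <= rhull N (b # bs)" by blast
  moreover have "set (b # bs) <= U" using b(1) bs(2) by simp
  ultimately show ?thesis using mb by blast
 qed
qed

subsection \<open>Simultaneous triangularisation by deflation\<close>

definition utri :: "nat => 'a :: field mat => bool" where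
 "utri n A <-> A : sqm n & (ALL i<n. ALL j<i. A $$ (i, j) = 0)"

text \<open>A change of basis that carries its inverse along explicitly.\<close>

definition inv_pair :: "nat => 'a :: field mat => 'a mat => bool" where
 "inv_pair n g h <-> g : sqm n & h : sqm n & g * h = 1m n & h * g = 1m n"

lemma inv_pair_sym: "inv_pair n g h ==> inv_pair n h g"
 unfolding inv_pair_def by auto

lemma inv_pair_mult:
 assumes "inv_pair n a b" "inv_pair n c d"
 shows "inv_pair n (a * c) (d * b)"
proof -
 have c: "a : sqm n" "b : sqm n" "c : sqm n" "d : sqm n"
  using assms unfolding inv_pair_def by auto
 note [simp] = assoc_mult_mat[of _ n n _ n _ n] mult_carrier_mat[of _ n n _ n]
 have "c * (d * b) = (c * d) * b" "b * (a * c) = (b * a) * c" using c by simp_all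
 hence "c * (d * b) = b" "b * (a * c) = c" using assms c unfolding inv_pair_def by auto
 thus ?thesis using assms c unfolding inv_pair_def by simp
qed

lemma mult_mat_vec_index:
 assumes "A : carrier_mat n m" "v : carrier_vec m" "i < n"
 shows "(A *v v) $ i = (SUM k<m. A $$ (i, k) * v $ k)"
 using assms by (simp add: scalar_prod_def atLeast0LessThan)

lemma inv_pair_exists:
 fixes A :: "'a :: field mat"
 assumes A: "A : sqm n" and inj: "!!w. w : carrier_vec n ==> A *v w = 0v n ==> w = 0v n"
 shows "EX B. inv_pair n A B"
proof -
 have "det A ~= 0" using det_0_iff_vec_prod_zero_field[OF A] inj by blast
 from det_non_zero_imp_unit[OF A this, of "()"] show ?thesis
  using A unfolding Units_def ring_mat_def inv_pair_def by auto
qed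

lemma basis_completion_vec:
 fixes v :: "'a :: field vec"
 assumes v: "v : carrier_vec (Suc n)" "v ~= 0v (Suc n)"
 shows "EX g h. inv_pair (Suc n) g h & (ALL i<Suc n. h $$ (i, 0) = v $ i)"
proof -
 have "EX i<Suc n. v $ i ~= 0"
 proof (rule ccontr)
  assume "~ ?thesis"
  hence "v = 0v (Suc n)" using v(1) by (intro eq_vecI) auto
  thus False using v(2) by simp
 qed
 then obtain r where r: "r < Suc n" "v $ r ~= 0" by blast
 \<comment> \<open>The identity with column 0 replaced by \<open>v\<close>. If \<open>r\<close> is
   not 0, the lost unit vector reappears in column \<open>r\<close>, where \<open>v\<close> has a
   nonzero coordinate.\<close>
 define h where "h = mat (Suc n) (Suc n) (%(j, k). if k = 0 then v $ j else if k = r then (if j = 0 then 1 else 0)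
  else if j = k then 1 else 0)"
 have h: "h : sqm (Suc n)" unfolding h_def by simp
 have "EX g. inv_pair (Suc n) h g"
 proof (rule inv_pair_exists[OF h])
  fix w assume w: "w : carrier_vec (Suc n)" "h *v w = 0v (Suc n)"
  have e: "(SUM k<Suc n. h $$ (i, k) * w $ k) = 0" if "i < Suc n" for i
   using mult_mat_vec_index[OF h w(1) that] w(2) that by simp
  have "(SUM k<Suc n. h $$ (r, k) * w $ k) = (SUM k:{0}. h $$ (r, k) * w $ k)"
   by (rule sum.mono_neutral_right) (use r in "auto simp: h_def")
  hence w0: "w $ 0 = 0" using e[OF r(1)] r by (simp add: h_def)
  have hw: "w $ k = 0" if k: "k < Suc n" "k ~= 0" for k
  proof -
   define j where "j = (if k = r then 0 else k)"
   have j: "j < Suc n" using k unfolding j_def by simp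
   have "(SUM k<Suc n. h $$ (j, k) * w $ k) = (SUM l:{k}. h $$ (j, l) * w $ l)"
   proof (rule sum.mono_neutral_right)
    show "ALL l:{..<Suc n} - {k}. h $$ (j, l) * w $ l = 0"
    proof
     fix l assume l: "l : {..<Suc n} - {k}"
     show "h $$ (j, l) * w $ l = 0"
      using w0 l k j unfolding h_def j_def by (cases "l = 0") auto
    qed
   qed (use k in auto)
   moreover have "h $$ (j, k) = 1" using k j unfolding h_def j_def by auto
   ultimately show ?thesis using e[OF j] by simp
  qed
  show "w = 0v (Suc n)"
  proof (rule eq_vecI)
   fix i assume "i < dim_vec (0v (Suc n) :: 'a vec)"
   thus "w $ i = 0v (Suc n) $ i" using w0 hw by (cases "i = 0") auto
  qed (use w in auto)
 qed
 then obtain g where "inv_pair (Suc n) h g" ..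
 moreover have "ALL i<Suc n. h $$ (i, 0) = v $ i" unfolding h_def by simp
 ultimately show ?thesis using inv_pair_sym by blast
qed

text \<open>Under \<open>col0\<close>, this is the action on the quotient by the line of the first
  basis vector.\<close>

definition low :: "nat => 'a :: field mat => 'a mat" where
 "low n A = mat n n (%(i, j). A $$ (Suc i, Suc j))"

definition emb :: "nat => 'a :: field mat => 'a mat" where
 "emb n A = mat (Suc n) (Suc n) (%(i, j). if i = 0 | j = 0 then (if i = j then 1 else 0) else A $$ (i - 1, j - 1))"

lemma low_carrier [simp]: "low n A : sqm n" unfolding low_def by simp
lemma emb_carrier [simp]: "emb n A : sqm (Suc n)" unfolding emb_def by simp

definition col0 :: "nat => 'a :: field mat => bool" where
 "col0 n A <-> A : sqm (Suc n) & (ALL i<n. A $$ (Suc i, 0) = 0)"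

lemma low_mult:
 assumes "col0 n A" "col0 n B"
 shows "low n (A * B) = low n A * low n B" "col0 n (A * B)" "(A * B) $$ (0, 0) = A $$ (0, 0) * B $$ (0, 0)"
proof -
 have c: "A : sqm (Suc n)" "B : sqm (Suc n)"
  using assms unfolding col0_def by auto
 show "low n (A * B) = low n A * low n B"
 proof (rule eq_matI)
  fix i j assume "i < dim_row (low n A * low n B)" "j < dim_col (low n A * low n B)"
  hence ij: "i < n" "j < n" by (auto simp: low_def)
  have "low n (A * B) $$ (i, j) = (SUM k<Suc n. A $$ (Suc i, k) * B $$ (k, Suc j))"
   unfolding low_def using ij mat_mult_index[OF c, of "Suc i" "Suc j"] by simp
  also have "... = (SUM k<n. A $$ (Suc i, Suc k) * B $$ (Suc k, Suc j))"
   using assms ij by (simp add: sum.lessThan_Suc_shift col0_def del: sum.lessThan_Suc)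
  also have "... = (low n A * low n B) $$ (i, j)"
   using mat_mult_index[OF low_carrier low_carrier ij, of A B] ij by (simp add: low_def)
  finally show "low n (A * B) $$ (i, j) = (low n A * low n B) $$ (i, j)" .
 qed (auto simp: low_def)
 have "(A * B) $$ (Suc i, 0) = 0" if "i < n" for i
  using mat_mult_index[OF c, of "Suc i" 0] that assms
  by (simp add: sum.lessThan_Suc_shift col0_def del: sum.lessThan_Suc)
 thus "col0 n (A * B)" using c unfolding col0_def by auto
 show "(A * B) $$ (0, 0) = A $$ (0, 0) * B $$ (0, 0)"
  using mat_mult_index[OF c, of 0 0] assms
  by (simp add: sum.lessThan_Suc_shift col0_def del: sum.lessThan_Suc)
qed

lemma low_one: "low n (1m (Suc n)) = 1m n"
 unfolding low_def by (intro eq_matI) auto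

lemma emb_props:
 assumes "A : sqm n"
 shows "low n (emb n A) = A" "col0 n (emb n A)" "emb n A $$ (0, 0) = 1"
 using assms unfolding low_def emb_def col0_def by (auto intro!: eq_matI)

lemma inv_pair_emb:
 assumes "inv_pair n g h"
 shows "inv_pair (Suc n) (emb n g) (emb n h)"
proof -
 have "emb n g * emb n h = 1m (Suc n)" if gh: "g : sqm n" "h : sqm n" "g * h = 1m n" for g h :: "'a mat"
 proof (rule eq_matI)
  fix i j assume "i < dim_row (1m (Suc n) :: 'a mat)" "j < dim_col (1m (Suc n) :: 'a mat)"
  hence ij: "i < Suc n" "j < Suc n" by auto
  have "(emb n g * emb n h) $$ (i, j) = (SUM k<Suc n. emb n g $$ (i, k) * emb n h $$ (k, j))"
   by (rule mat_mult_index[OF emb_carrier emb_carrier ij])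
  also have "... = emb n g $$ (i, 0) * emb n h $$ (0, j) + (SUM k<n. emb n g $$ (i, Suc k) * emb n h $$ (Suc k, j))"
   by (simp add: sum.lessThan_Suc_shift del: sum.lessThan_Suc)
  also have "... = 1m (Suc n) $$ (i, j)"
  proof (cases "i = 0 | j = 0")
   case True
   thus ?thesis using ij by (auto simp: emb_def)
  next
   case False
   then obtain i' j' where i': "i = Suc i'" "j = Suc j'" by (metis not0_implies_Suc)
   have "(SUM k<n. g $$ (i', k) * h $$ (k, j')) = 1m n $$ (i', j')"
    using mat_mult_index[OF gh(1,2), of i' j'] gh(3) ij i' by simp
   thus ?thesis using ij i' by (simp add: emb_def)
  qed
  finally show "(emb n g * emb n h) $$ (i, j) = 1m (Suc n) $$ (i, j)" .
 qed (auto simp: emb_def)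
 thus ?thesis using assms unfolding inv_pair_def by auto
qed

text \<open>The base change depends on \<open>v\<close> alone, so it serves all matrices with this
  eigenvector at once.\<close>

lemma deflate:
 assumes v: "v : carrier_vec (Suc n)" "v ~= 0v (Suc n)"
 shows "EX g h. inv_pair (Suc n) g h & (ALL A. A : sqm (Suc n) -->
  (EX c. A *v v = c *s v) --> col0 n (g * A * h))"
proof -
 obtain g h where gh: "inv_pair (Suc n) g h" "!!i. i < Suc n ==> h $$ (i, 0) = v $ i"
  using basis_completion_vec[OF v] by auto
 have c: "g : sqm (Suc n)" "h : sqm (Suc n)" "g * h = 1m (Suc n)"
  using gh unfolding inv_pair_def by auto
 have "col0 n (g * A * h)" if A: "A : sqm (Suc n)" "A *v v = k *s v" for A k
 proof -
  have e: "(A * h) $$ (i, 0) = k * h $$ (i, 0)" if "i < Suc n" for i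
  proof -
   have "(A * h) $$ (i, 0) = (SUM l<Suc n. A $$ (i, l) * v $ l)"
    using mat_mult_index[OF A(1) c(2) that, of 0] gh(2) by simp
   also have "... = (A *v v) $ i" using mult_mat_vec_index[OF A(1) v(1) that] by simp
   also have "... = k * h $$ (i, 0)" using A(2) that v(1) gh(2) by simp
   finally show ?thesis .
  qed
  have Ah: "A * h : sqm (Suc n)" using A(1) c(2) by simp
  have "(g * (A * h)) $$ (Suc i, 0) = 0" if i: "i < n" for i
  proof -
   have "(g * (A * h)) $$ (Suc i, 0) = (SUM l<Suc n. g $$ (Suc i, l) * (k * h $$ (l, 0)))"
    using mat_mult_index[OF c(1) Ah, of "Suc i" 0] i e by simp
   also have "... = k * (SUM l<Suc n. g $$ (Suc i, l) * h $$ (l, 0))"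
    unfolding sum_distrib_left by (simp add: mult.left_commute)
   also have "(SUM l<Suc n. g $$ (Suc i, l) * h $$ (l, 0)) = (g * h) $$ (Suc i, 0)"
    using mat_mult_index[OF c(1,2), of "Suc i" 0] i by simp
   finally show ?thesis using c(3) i by simp
  qed
  moreover have "g * A * h = g * (A * h)" by (rule assoc_mult_mat[OF c(1) A(1) c(2)])
  ultimately show ?thesis unfolding col0_def using Ah c(1) by (metis mult_carrier_mat)
 qed
 thus ?thesis using gh(1) by blast
qed

lemma col0_utri:
 assumes A: "col0 n A" and gh: "inv_pair n g h" and u: "utri n (g * low n A * h)"
 shows "utri (Suc n) (emb n g * A * emb n h)"
proof -
 have c: "g : sqm n" "h : sqm n" using gh unfolding inv_pair_def by auto
 note e = emb_props[OF c(1)] emb_props[OF c(2)]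
 have l: "low n (emb n g * A * emb n h) = g * low n A * h"
  using low_mult(1)[OF low_mult(2)[OF e(2) A] e(5)] low_mult(1)[OF e(2) A] e by simp
 have c0: "col0 n (emb n g * A * emb n h)" using low_mult(2)[OF low_mult(2)[OF e(2) A] e(5)] .
 show ?thesis unfolding utri_def
 proof (intro conjI allI impI)
  fix i j assume ij: "i < Suc n" "j < i"
  then obtain i' where i': "i = Suc i'" "i' < n" by (cases i) auto
  show "(emb n g * A * emb n h) $$ (i, j) = 0"
  proof (cases j)
   case 0
   thus ?thesis using c0 i' unfolding col0_def by simp
  next
   case (Suc j')
   have "(emb n g * A * emb n h) $$ (Suc i', Suc j') = low n (emb n g * A * emb n h) $$ (i', j')"
    using i' Suc ij by (simp add: low_def)
   thus ?thesis using u i' Suc ij unfolding l utri_def by simp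
  qed
 qed (use c0 in "auto simp: col0_def")
qed

lemma conj_conj:
 assumes "inv_pair n g h" "inv_pair n g' h'" "A : sqm n"
 shows "g' * (g * A * h) * h' = (g' * g) * A * (h * h')"
proof -
 have "g : sqm n" "h : sqm n" "g' : sqm n" "h' : sqm n"
  using assms unfolding inv_pair_def by auto
 thus ?thesis using assms(3) by (simp add: assoc_mult_mat[of _ n n _ n _ n] mult_carrier_mat[of _ n n _ n])
qed

lemma prod_low:
 assumes "ALL A:set As. col0 n A"
 shows "low n (foldr (*) As (1m (Suc n))) = foldr (*) (map (low n) As) (1m n) & col0 n (foldr (*) As (1m (Suc n)))"
 using assms
proof (induction As)
 case Nil
 show ?case by (simp add: low_one) (simp add: col0_def)
qed (auto simp: low_mult)

lemma prod_conj:
 assumes gh: "inv_pair n g h" and "set As <= sqm n"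
 shows "foldr (*) (map (%A. g * A * h) As) (1m n) = g * foldr (*) As (1m n) * h &
  foldr (*) As (1m n) : sqm n"
 using assms(2)
proof (induction As)
 case Nil
 have "g : sqm n" "g * h = 1m n" using gh unfolding inv_pair_def by auto
 thus ?case by simp
next
 case (Cons A As)
 have c: "g : sqm n" "h : sqm n" "h * g = 1m n" using gh unfolding inv_pair_def by auto
 have "g * (A * foldr (*) As (1m n)) * h = (g * A * h) * (g * foldr (*) As (1m n) * h)"
 proof -
  note [simp] = assoc_mult_mat[of _ n n _ n _ n] mult_carrier_mat[of _ n n _ n]
  let ?P = "foldr (*) As (1m n)"
  have P: "?P : sqm n" "A : sqm n" using Cons by auto
  have "h * (g * (?P * h)) = (h * g) * (?P * h)"
   by (rule assoc_mult_mat[symmetric, OF c(2,1) mult_carrier_mat[OF P(1) c(2)]])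
  also have "... = ?P * h" using c P by (simp only: c(3)) simp
  finally show ?thesis using c P by simp
 qed
 thus ?case using Cons mult_carrier_mat by auto
qed

text \<open>In the spirit of Engel's theorem: a nonzero column of a longest nonvanishing product is
  annihilated by all of \<open>M\<close> and can be split off as first basis vector.\<close>

lemma nil_triangular:
 fixes M :: "'a :: field mat set"
 assumes "M <= sqm n" "!!As. set As <= M ==> length As = len ==> foldr (*) As (1m n) = 0m n n"
 shows "EX g h. inv_pair n g h & (ALL A:M. utri n (g * A * h))"
 using assms
proof (induction n arbitrary: M)
 case 0
 have "inv_pair 0 (1m 0) (1m 0 :: 'a mat)" unfolding inv_pair_def by auto
 thus ?case using 0 unfolding utri_def by (intro exI[of _ "1m 0"]) auto
next
 case (Suc n)
 define P where "P l <-> (EX As. set As <= M & length As = l & foldr (*) As (1m (Suc n)) ~= 0m (Suc n) (Suc n))" for l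
 have fc: "foldr (*) As (1m (Suc n)) : sqm (Suc n)" if "set As <= M" for As
  using that Suc.prems(1) by (induction As) (auto intro: mult_carrier_mat)
 have "P 0"
 proof -
  have "(1m (Suc n) :: 'a mat) $$ (0, 0) ~= 0m (Suc n) (Suc n) $$ (0, 0)" by simp
  hence "(1m (Suc n) :: 'a mat) ~= 0m (Suc n) (Suc n)" by metis
  thus ?thesis unfolding P_def by (intro exI[of _ "[]"]) auto
 qed
 moreover have "~ P len"
 proof
  assume "P len"
  then obtain As where "set As <= M" "length As = len" "foldr (*) As (1m (Suc n)) ~= 0m (Suc n) (Suc n)"
   unfolding P_def by auto
  thus False using Suc.prems(2)[of As] by simp
 qed
 moreover have "P len" if "P 0" "!!l. P l ==> P (Suc l)" using that by (induction len) auto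
 ultimately have "EX l. P l & ~ P (Suc l)" by auto
 then obtain l where l: "P l" "~ P (Suc l)" by blast
 then obtain As where As: "set As <= M" "length As = l" "foldr (*) As (1m (Suc n)) ~= 0m (Suc n) (Suc n)"
  unfolding P_def by auto
 let ?Q = "foldr (*) As (1m (Suc n))"
 have Qc: "?Q : sqm (Suc n)" using fc As by blast
 have AQ: "A * ?Q = 0m (Suc n) (Suc n)" if "A : M" for A
 proof (rule ccontr)
  assume "A * ?Q ~= 0m (Suc n) (Suc n)"
  hence "P (Suc l)" unfolding P_def using As(1,2) that by (intro exI[of _ "A # As"]) auto
  thus False using l(2) by simp
 qed
 have "EX j<Suc n. col ?Q j ~= 0v (Suc n)"
 proof (rule ccontr)
  assume "~ ?thesis"
  hence "?Q = 0m (Suc n) (Suc n)" using Qc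
   by (intro mat_col_eqI) auto
  thus False using As(3) by blast
 qed
 then obtain j where j: "j < Suc n" "col ?Q j ~= 0v (Suc n)" by blast
 define v where "v = col ?Q j"
 have v: "v : carrier_vec (Suc n)" "v ~= 0v (Suc n)" using j Qc unfolding v_def by auto
 have Av: "A *v v = 0 *s v" if A: "A : M" for A
 proof -
  have "A *v v = col (A * ?Q) j"
   unfolding v_def by (rule col_mult2[symmetric, OF subsetD[OF Suc.prems(1) A] Qc j(1)])
  thus ?thesis using AQ[OF A] j v by (auto intro!: eq_vecI)
 qed
 obtain g h where gh: "inv_pair (Suc n) g h" "!!A. A : M ==> col0 n (g * A * h)"
  using deflate[OF v] Av Suc.prems(1) by (metis subsetD)
 define Y where "Y = (%A. low n (g * A * h)) ` M"
 have "EX g h. inv_pair n g h & (ALL A:Y. utri n (g * A * h))"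
 proof (rule Suc.IH)
  show "Y <= sqm n" unfolding Y_def by auto
  fix Bs assume Bs: "set Bs <= Y" "length Bs = len"
  have "Bs : lists Y" using Bs(1) by auto
  hence "Bs : map (%A. low n (g * A * h)) ` lists M" unfolding Y_def lists_image .
  then obtain As where As: "set As <= M" "Bs = map (%A. low n (g * A * h)) As" by auto
  have "foldr (*) Bs (1m n) = low n (foldr (*) (map (%A. g * A * h) As) (1m (Suc n)))"
   using prod_low[of "map (%A. g * A * h) As" n] gh(2) As by (auto simp: comp_def subset_iff)
  also have "foldr (*) (map (%A. g * A * h) As) (1m (Suc n)) = g * foldr (*) As (1m (Suc n)) * h"
   using prod_conj[OF gh(1), of As] As(1) Suc.prems(1) by blast
  also have "foldr (*) As (1m (Suc n)) = 0m (Suc n) (Suc n)" using Suc.prems(2)[OF As(1)] Bs As by simp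
  also have "g * 0m (Suc n) (Suc n) * h = 0m (Suc n) (Suc n)"
  proof -
   have "g : sqm (Suc n)" "h : sqm (Suc n)"
    using gh(1) unfolding inv_pair_def by auto
   thus ?thesis by simp
  qed
  also have "low n (0m (Suc n) (Suc n)) = 0m n n" unfolding low_def by (intro eq_matI) auto
  finally show "foldr (*) Bs (1m n) = 0m n n" .
 qed
 then obtain g' h' where g': "inv_pair n g' h'" "ALL A:M. utri n (g' * low n (g * A * h) * h')"
  unfolding Y_def by auto
 have "utri (Suc n) ((emb n g' * g) * A * (h * emb n h'))" if A: "A : M" for A
  using col0_utri[OF gh(2)[OF A] g'(1)] g'(2) A conj_conj[OF gh(1) inv_pair_emb[OF g'(1)], of A] Suc.prems(1) by auto
 moreover have "inv_pair (Suc n) (emb n g' * g) (h * emb n h')"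
  by (rule inv_pair_mult[OF inv_pair_emb[OF g'(1)] gh(1)])
 ultimately show ?case by blast
qed

subsection \<open>Linear dependence and weights\<close>

lemma dependent_family:
 fixes f :: "'j => 'i => 'a :: field"
 assumes "finite D" "finite J" "card D < card J"
 shows "EX c. (EX j:J. c j ~= 0) & (ALL i:D. (SUM j:J. c j * f j i) = 0)"
 using assms
proof (induction D arbitrary: J f rule: finite_induct)
 case empty
 hence "J ~= {}" by auto
 thus ?case by (intro exI[of _ "%_. 1"]) auto
next
 case (insert d D)
 show ?case
 proof (cases "ALL j:J. f j d = 0")
  case True
  have "card D < card J" using insert by simp
  from insert.IH[OF insert.prems(1) this, of f]
  obtain c where "EX j:J. c j ~= 0" "ALL i:D. (SUM j:J. c j * f j i) = 0" by auto
  thus ?thesis using True by (intro exI[of _ c]) auto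
 next
  case False
  then obtain k where k: "k : J" "f k d ~= 0" by blast
  define J' where "J' = J - {k}"
  have J': "finite J'" "card D < card J'" "k ~: J'" "J = insert k J'"
   using insert k unfolding J'_def by (auto simp: card_Diff_singleton)
  \<comment> \<open>Gaussian elimination of the coordinate \<open>d\<close> with pivot
    \<open>k\<close>.\<close>
  define f' where "f' j i = f j i - f j d / f k d * f k i" for j i
  obtain c where c: "EX j:J'. c j ~= 0" "ALL i:D. (SUM j:J'. c j * f' j i) = 0"
   using insert.IH[OF J'(1,2), of f'] by auto
  define c' where "c' j = (if j = k then - (SUM j:J'. c j * f j d) / f k d else c j)" for j
  have s: "(SUM j:J. c' j * f j i) = (SUM j:J'. c j * f' j i)" for i
  proof -
   have "(SUM j:J. c' j * f j i) = c' k * f k i + (SUM j:J'. c' j * f j i)"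
    unfolding J'(4) using J'(1,3) by simp
   also have "(SUM j:J'. c' j * f j i) = (SUM j:J'. c j * f j i)"
    using J'(3) by (intro sum.cong) (auto simp: c'_def)
   also have "c' k * f k i = - (SUM j:J'. c j * (f j d / f k d * f k i))"
    by (simp add: c'_def sum_distrib_right sum_divide_distrib mult.assoc)
   finally show ?thesis by (simp add: f'_def algebra_simps sum_subtractf)
  qed
  have "EX j:J. c' j ~= 0" using c(1) J' unfolding c'_def by auto
  moreover have "(SUM j:J'. c j * f' j d) = 0" using k(2) by (simp add: f'_def)
  ultimately show ?thesis using s c(2) by (intro exI[of _ c']) auto
 qed
qed

text \<open>Linearity enters only through \<open>cl\<close>: multiplying each coefficient by its
  weight preserves relations. This covers column vectors under matrices as well as matrices under
  conjugation.\<close>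

lemma weights_independent:
 fixes f :: "'j => 'i => 'a :: field" and w :: "'j => 'b => 'a"
 assumes fin: "finite J"
  and nz: "!!j. j : J ==> EX i:D. f j i ~= 0"
  and ds: "!!j k. j : J ==> k : J ==> j ~= k ==> EX a:A. w j a ~= w k a"
  and cl: "!!c a. a : A ==> ALL i:D. (SUM j:J. c j * f j i) = 0 ==> ALL i:D. (SUM j:J. c j * w j a * f j i) = 0"
  and rel: "ALL i:D. (SUM j:J. c j * f j i) = 0"
 shows "ALL j:J. c j = 0"
 using rel
proof (induction "card {j:J. c j ~= 0}" arbitrary: c rule: less_induct)
 case less
 show ?case
 proof (rule ccontr)
  assume "~ (ALL j:J. c j = 0)"
  then obtain k where k: "k : J" "c k ~= 0" by blast
  obtain i where i: "i : D" "f k i ~= 0" using nz[OF k(1)] by blast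
  have "EX l:J. l ~= k & c l ~= 0"
  proof (rule ccontr)
   assume "~ ?thesis"
   hence "(SUM j:J. c j * f j i) = (SUM j:{k}. c j * f j i)"
    using k fin by (intro sum.mono_neutral_right) auto
   thus False using less.prems i k by auto
  qed
  then obtain l where l: "l : J" "l ~= k" "c l ~= 0" by blast
  obtain a where a: "a : A" "w l a ~= w k a" using ds[OF l(1) k(1) l(2)] by blast
  \<comment> \<open>This combination of the relation and its weighted form loses the term
    \<open>k\<close> and keeps the term \<open>l\<close>, so it is a shorter nontrivial
    relation.\<close>
  define d where "d j = c j * (w j a - w k a)" for j
  have "(SUM j:J. d j * f j i) = (SUM j:J. c j * w j a * f j i) - w k a * (SUM j:J. c j * f j i)" for i
   by (simp add: d_def algebra_simps sum_subtractf sum_distrib_left)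
  hence "ALL i:D. (SUM j:J. d j * f j i) = 0" using cl[OF a(1) less.prems] less.prems by simp
  moreover have "{j:J. d j ~= 0} \<subset> {j:J. c j ~= 0}" using k unfolding d_def by auto
  hence "card {j:J. d j ~= 0} < card {j:J. c j ~= 0}" using fin by (intro psubset_card_mono) auto
  ultimately have "ALL j:J. d j = 0" using less.hyps by blast
  thus False using l a unfolding d_def by auto
 qed
qed

lemma weights_finite:
 fixes f :: "'j => 'i => 'a :: field" and w :: "'j => 'b => 'a"
 assumes D: "finite D"
  and nz: "!!j. j : J ==> EX i:D. f j i ~= 0"
  and ds: "!!j k. j : J ==> k : J ==> j ~= k ==> EX a:A. w j a ~= w k a"
  and cl: "!!F c a. F <= J ==> finite F ==> a : A ==> ALL i:D. (SUM j:F. c j * f j i) = 0 ==>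
   ALL i:D. (SUM j:F. c j * w j a * f j i) = 0"
 shows "finite J"
proof (rule ccontr)
 assume "infinite J"
 then obtain F where F: "F <= J" "finite F" "card F = Suc (card D)"
  by (metis infinite_arbitrarily_large)
 obtain c where c: "EX j:F. c j ~= 0" "ALL i:D. (SUM j:F. c j * f j i) = 0"
  using dependent_family[OF D F(2), of f] F(3) by auto
 have "ALL j:F. c j = 0"
 proof (rule weights_independent[OF F(2), of D f A w])
  fix c a assume "a : A" "ALL i:D. (SUM j:F. c j * f j i) = 0"
  thus "ALL i:D. (SUM j:F. c j * w j a * f j i) = 0" by (rule cl[OF F(1,2)])
 next
  fix j k assume "j : F" "k : F" "j ~= k"
  thus "EX a:A. w j a ~= w k a" using ds[of j k] F(1) by blast
 qed (use F nz c in auto)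
 thus False using c(1) by blast
qed

text \<open>The columns of such a matrix are a basis of the subspace they span; subspaces are
  handled through such matrices.\<close>

definition mat_inj :: "nat => nat => 'a :: field mat => bool" where
 "mat_inj n k M <-> M : carrier_mat n k & (ALL w:carrier_vec k. M *v w = 0v n --> w = 0v k)"

lemma mat_inj_le:
 fixes M :: "'a :: field mat"
 assumes "mat_inj n k M"
 shows "k <= n"
proof (rule ccontr)
 assume "~ k <= n"
 hence kn: "card {..<n} < card {..<k}" by simp
 have M: "M : carrier_mat n k" using assms unfolding mat_inj_def by blast
 obtain c where c: "EX j:{..<k}. c j ~= 0" "ALL i:{..<n}. (SUM j<k. c j * M $$ (i, j)) = 0"
  using dependent_family[OF _ _ kn, of "%j i. M $$ (i, j)"] by auto
 have "M *v vec k c = 0v n"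
  using c(2) M by (intro eq_vecI) (auto simp: mult_mat_vec_index[OF M] mult.commute simp del: index_mult_mat_vec)
 hence "vec k c = 0v k" using assms unfolding mat_inj_def by auto
 thus False using c(1) by (metis index_vec index_zero_vec(1) lessThan_iff)
qed

definition subsp :: "nat => 'a :: field vec set => bool" where
 "subsp n W <-> W <= carrier_vec n & (ALL u:W. ALL v:W. u + v : W) & (ALL c. ALL v:W. c *s v : W) & 0v n : W"

definition ext_col :: "nat => nat => 'a mat => 'a vec => 'a mat" where
 "ext_col n k M v = mat n (Suc k) (%(i, j). if j < k then M $$ (i, j) else v $ i)"

lemma ext_col_mult:
 fixes M :: "'a :: field mat"
 assumes "M : carrier_mat n k" "v : carrier_vec n" "w : carrier_vec (Suc k)"
 shows "ext_col n k M v *v w = M *v vec k (%j. w $ j) + (w $ k) *s v"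
proof (rule eq_vecI)
 fix i assume "i < dim_vec (M *v vec k (%j. w $ j) + (w $ k) *s v)"
 hence i: "i < n" using assms by simp
 have c: "ext_col n k M v : carrier_mat n (Suc k)" unfolding ext_col_def by simp
 show "(ext_col n k M v *v w) $ i = (M *v vec k (%j. w $ j) + (w $ k) *s v) $ i"
  using assms i mult_mat_vec_index[OF c assms(3) i] mult_mat_vec_index[OF assms(1) _ i, of "vec k (%j. w $ j)"]
  by (simp add: ext_col_def mult.commute)
qed (use assms in "auto simp: ext_col_def")

text \<open>Injective matrices into \<open>W\<close> have at most \<open>n\<close> columns. To one
  with the largest number of columns, a vector of \<open>W\<close> outside its image could be
  appended as a further column.\<close>

lemma subspace_basis:
 fixes W :: "'a :: field vec set"
 assumes W: "subsp n W"
 shows "EX k M. mat_inj n k M & (ALL v. v : W <-> (EX w:carrier_vec k. v = M *v w))"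
proof -
 define P where "P k <-> (EX M. mat_inj n k M & (ALL w:carrier_vec k. M *v w : W))" for k
 have "P 0" unfolding P_def mat_inj_def
 proof (intro exI[of _ "mat n 0 (%_. 0)"] conjI ballI impI)
  fix w :: "'a vec" assume w: "w : carrier_vec 0"
  thus "w = 0v 0" by auto
  have "mat n 0 (%_. 0) *v w = 0v n" using w by (intro eq_vecI) (auto simp: scalar_prod_def)
  thus "mat n 0 (%_. 0) *v w : W" using W unfolding subsp_def by simp
 qed auto
 moreover have "k <= n" if "P k" for k using that mat_inj_le unfolding P_def by blast
 ultimately have "EX k. P k & (ALL l. P l --> l <= k)"
  using ex_has_greatest_nat[of P 0 "%x. x" "Suc n"] by (auto simp: less_Suc_eq_le)
 then obtain k where k: "P k" "~ P (Suc k)" by (metis Suc_n_not_le_n)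
 then obtain M where M: "mat_inj n k M" "!!w. w : carrier_vec k ==> M *v w : W" unfolding P_def by blast
 have Mc: "M : carrier_mat n k" using M(1) unfolding mat_inj_def by blast
 have "EX w:carrier_vec k. v = M *v w" if v: "v : W" for v
 proof (rule ccontr)
  assume no: "~ ?thesis"
  have vc: "v : carrier_vec n" using v W unfolding subsp_def by blast
  have "mat_inj n (Suc k) (ext_col n k M v)" unfolding mat_inj_def
  proof (intro conjI ballI impI)
   fix w assume w: "w : carrier_vec (Suc k)" "ext_col n k M v *v w = 0v n"
   let ?w = "vec k (%j. w $ j)"
   have e: "M *v ?w + (w $ k) *s v = 0v n" using ext_col_mult[OF Mc vc w(1)] w(2) by simp
   have wk: "w $ k = 0"
   proof (rule ccontr)
    assume nz: "w $ k ~= 0"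
    have "v = M *v ((- inverse (w $ k)) *s ?w)"
    proof (rule eq_vecI)
     fix i assume "i < dim_vec (M *v ((- inverse (w $ k)) *s ?w))"
     hence i: "i < n" using Mc by simp
     have "(M *v ?w + (w $ k) *s v) $ i = 0" using e i by simp
     hence "(M *v ?w) $ i + w $ k * v $ i = 0" using i Mc vc by simp
     hence "v $ i = - inverse (w $ k) * (M *v ?w) $ i" using nz by (simp add: field_simps add_eq_0_iff)
     thus "v $ i = (M *v ((- inverse (w $ k)) *s ?w)) $ i"
      using i Mc by (simp add: mult_mat_vec[of _ n k])
    qed (use Mc vc in auto)
    thus False using no by (metis smult_carrier_vec vec_carrier)
   qed
   have "0 *s v = 0v n" using vc by (intro eq_vecI) auto
   hence "M *v ?w = 0v n" using e Mc wk by simp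
   hence "?w = 0v k" using M(1) unfolding mat_inj_def by auto
   hence "w $ j = 0" if "j < k" for j using that by (metis index_vec index_zero_vec(1))
   thus "w = 0v (Suc k)" using wk w(1) by (intro eq_vecI) (auto simp: less_Suc_eq)
  qed (simp add: ext_col_def)
  moreover have "ext_col n k M v *v w : W" if "w : carrier_vec (Suc k)" for w
   using ext_col_mult[OF Mc vc that] M(2)[of "vec k (%j. w $ j)"] v W unfolding subsp_def by auto
  ultimately show False using k(2) unfolding P_def by blast
 qed
 thus ?thesis using M by (intro exI[of _ k] exI[of _ M]) auto
qed

lemma mat_inj_cancel:
 fixes M :: "'a :: field mat"
 assumes M: "mat_inj n k M" and A: "A : carrier_mat k m" "B : carrier_mat k m" "M * A = M * B"
 shows "A = B"
proof (rule mat_col_eqI)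
 fix j assume "j < dim_col B"
 hence j: "j < m" using A by simp
 have Mc: "M : carrier_mat n k" using M unfolding mat_inj_def by blast
 have "M *v col A j = M *v col B j" using col_mult2[OF Mc A(1) j] col_mult2[OF Mc A(2) j] A(3) by simp
 hence "M *v (col A j - col B j) = 0v n" using A Mc j by (simp add: mult_minus_distrib_mat_vec[of _ n k])
 hence "col A j - col B j = 0v k" using M A j unfolding mat_inj_def by auto
 show "col A j = col B j"
 proof (rule eq_vecI)
  fix i assume "i < dim_vec (col B j)"
  hence i: "i < k" using A by simp
  have "(col A j - col B j) $ i = 0" using \<open>col A j - col B j = 0v k\<close> i by simp
  thus "col A j $ i = col B j $ i" using i A j by simp
 qed (use A in auto)
qed (use A in auto)

lemma mat_inj_image_subset:
 fixes M :: "'a :: field mat"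
 assumes M: "mat_inj n k M" and A: "A : sqm n"
  and inv: "!!w. w : carrier_vec k ==> EX u:carrier_vec k. A *v (M *v w) = M *v u"
 shows "EX B:sqm k. A * M = M * B"
proof -
 have Mc: "M : carrier_mat n k" using M unfolding mat_inj_def by blast
 have "ALL j<k. EX u:carrier_vec k. A *v (M *v unit_vec k j) = M *v u" using inv by auto
 then obtain u where u: "!!j. j < k ==> u j : carrier_vec k" "!!j. j < k ==> A *v (M *v unit_vec k j) = M *v u j"
  by metis
 define B where "B = mat k k (%(i, j). u j $ i)"
 have B: "B : sqm k" unfolding B_def by simp
 have cB: "col B j = u j" if "j < k" for j using u(1)[OF that] that unfolding B_def by (intro eq_vecI) auto
 have "A * M = M * B"
 proof (rule mat_col_eqI)
  fix j assume "j < dim_col (M * B)"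
  hence j: "j < k" using B by simp
  have "M *v unit_vec k j = col M j" using Mc j by (intro eq_vecI) auto
  thus "col (A * M) j = col (M * B) j"
   using col_mult2[OF A Mc j] col_mult2[OF Mc B j] u(2)[OF j] cB[OF j] by simp
 qed (use A Mc B in auto)
 thus ?thesis using B by blast
qed

subsection \<open>Mal'cev's theorem\<close>

definition scalar_mat :: "nat => 'a :: field mat => bool" where
 "scalar_mat n A <-> (EX c. A = c *m 1m n)"

lemma smult_one_mult_vec: "v : carrier_vec n ==> (c *m 1m n) *v v = c *s (v :: 'a :: field vec)"
proof (rule eq_vecI)
 fix i assume v: "v : carrier_vec n" and "i < dim_vec (c *s v)"
 hence i: "i < n" by simp
 have "((c *m 1m n) *v v) $ i = (SUM k<n. (if i = k then c * v $ k else 0))"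
  unfolding mult_mat_vec_index[OF smult_carrier_mat[OF one_carrier_mat] v i] using i
  by (intro sum.cong) auto
 thus "((c *m 1m n) *v v) $ i = (c *s v) $ i" using i v by simp
qed auto

lemma mult_mat_zero_vec: "A : carrier_mat n m ==> A *v 0v m = (0v n :: 'a :: field vec)"
 by (intro eq_vecI) (auto simp: mult_mat_vec_index simp del: index_mult_mat_vec)

lemma scalar_matI:
 assumes A: "A : sqm n" and "!!v. v : carrier_vec n ==> A *v v = c *s (v :: 'a :: field vec)"
 shows "A = c *m 1m n"
proof (rule mat_col_eqI)
 fix j assume "j < dim_col (c *m 1m n)"
 hence j: "j < n" by simp
 have "A *v unit_vec n j = col A j" using A j by (intro eq_vecI) auto
 hence "col A j = c *s unit_vec n j" using assms(2)[of "unit_vec n j"] by simp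
 thus "col A j = col (c *m 1m n) j" using j by (intro eq_vecI) (auto simp: unit_vec_def)
qed (use A in auto)

definition wspace :: "nat => ('b => 'a :: field mat) => 'b set => ('b => 'a) => 'a vec set" where
 "wspace n f A w = {v : carrier_vec n. ALL a:A. f a *v v = w a *s v}"

lemma subsp_wspace:
 assumes "!!a. a : A ==> f a : sqm n"
 shows "subsp n (wspace n f A w)"
 unfolding subsp_def wspace_def
 using assms by (auto simp: mult_mat_zero_vec[of _ n n] mult_add_distrib_mat_vec[of _ n n] mult_mat_vec[of _ n n] smult_add_distrib_vec[of _ n]
  smult_smult_assoc mult.commute intro!: eq_vecI)

lemma eigen_exists:
 assumes A: "A : sqm n" and n: "n > 0"
 shows "EX c v. v : carrier_vec n & v ~= 0v n & A *v v = c *s (v :: complex vec)"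
proof -
 have "degree (char_poly A) = n" using degree_monic_char_poly[OF A] by simp
 hence "~ constant (poly (char_poly A))" using n by (simp add: constant_degree)
 then obtain c where "poly (char_poly A) c = 0" using fundamental_theorem_of_algebra by blast
 hence "eigenvalue A c" using eigenvalue_root_char_poly[OF A] by simp
 thus ?thesis using A unfolding eigenvalue_def eigenvector_def by auto
qed

lemma eigen_finite:
 assumes A: "A : sqm n"
 shows "finite {c. EX v. v : carrier_vec n & v ~= 0v n & A *v v = c *s (v :: complex vec)}"
proof (rule finite_subset)
 show "{c. EX v. v : carrier_vec n & v ~= 0v n & A *v v = c *s v} <= {c. poly (char_poly A) c = 0}"
  using A unfolding eigenvalue_root_char_poly[OF A, symmetric] eigenvalue_def eigenvector_def by auto
 have "char_poly A ~= 0" using degree_monic_char_poly[OF A] by auto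
 thus "finite {c. poly (char_poly A) c = 0}" by (rule poly_roots_finite)
qed

lemma proper_subspace_basis:
 fixes W :: "'a :: field vec set"
 assumes sW: "subsp n W" and v: "v : W" "v ~= 0v n" and W: "W ~= carrier_vec n"
 shows "EX k M. 0 < k & k < n & mat_inj n k M & (ALL v. v : W <-> (EX w:carrier_vec k. v = M *v w))"
proof -
 obtain k M where M: "mat_inj n k M" "!!v. v : W <-> (EX w:carrier_vec k. v = M *v w)"
  using subspace_basis[OF sW] by blast
 have Mc: "M : carrier_mat n k" using M unfolding mat_inj_def by blast
 have k0: "k > 0"
 proof (rule ccontr)
  assume "~ k > 0"
  then obtain w where "w : carrier_vec 0" "v = M *v w" using v M(2) by auto
  hence "v = 0v n" using Mc \<open>~ k > 0\<close> by (intro eq_vecI) (auto simp: scalar_prod_def)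
  thus False using v by simp
 qed
 have kn: "k < n"
 proof (rule ccontr)
  assume "~ k < n"
  hence "k = n" using mat_inj_le[OF M(1)] by simp
  have "EX B. inv_pair n M B"
   using M(1) \<open>k = n\<close> unfolding mat_inj_def by (intro inv_pair_exists) auto
  then obtain B where B: "inv_pair n M B" ..
  have "u : W" if u: "u : carrier_vec n" for u
  proof -
   have Bc: "B : sqm n" "M : sqm n" "M * B = 1m n" using B unfolding inv_pair_def by auto
   have "M *v (B *v u) = u" using assoc_mult_mat_vec[OF Bc(2,1) u] Bc(3) u by simp
   moreover have "B *v u : carrier_vec k" using Bc u \<open>k = n\<close> by auto
   ultimately show ?thesis using M(2)[of u] by metis
  qed
  thus False using W sW unfolding subsp_def by blast
 qed
 show ?thesis using k0 kn M by blast
qed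

text \<open>An eigenspace of a nonscalar member is a proper nonzero subspace that the commuting
  family preserves; the induction continues there.\<close>

lemma common_eigen:
 fixes f :: "'b => complex mat"
 assumes "n > 0" "!!a. a : A ==> f a : sqm n"
  "!!a b. a : A ==> b : A ==> f a * f b = f b * f a"
 shows "EX w v. v : wspace n f A w & v ~= 0v n"
 using assms
proof (induction n arbitrary: f rule: less_induct)
 case (less n)
 show ?case
 proof (cases "ALL a:A. scalar_mat n (f a)")
  case True
  then obtain w where w: "!!a. a : A ==> f a = w a *m 1m n" unfolding scalar_mat_def by metis
  have "unit_vec n 0 ~= (0v n :: complex vec)" using less.prems(1) by simp
  moreover have "unit_vec n 0 : wspace n f A w" unfolding wspace_def using w by (simp add: smult_one_mult_vec)
  ultimately show ?thesis by blast
 next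
  case False
  then obtain b where b: "b : A" "~ scalar_mat n (f b)" by blast
  have fb: "f b : sqm n" using less.prems(2) b by blast
  obtain c v where cv: "v : carrier_vec n" "v ~= 0v n" "f b *v v = c *s v"
   using eigen_exists[OF fb less.prems(1)] by blast
  define W where "W = wspace n f {b} (%_. c)"
  have sW: "subsp n W" unfolding W_def using fb by (intro subsp_wspace) auto
  have vW: "v : W" unfolding W_def wspace_def using cv by simp
  have "W ~= carrier_vec n"
  proof
   assume "W = carrier_vec n"
   hence "f b = c *m 1m n" using fb by (intro scalar_matI) (auto simp: W_def wspace_def)
   thus False using b(2) unfolding scalar_mat_def by blast
  qed
  then obtain k M where kn: "0 < k" "k < n" and M: "mat_inj n k M" "!!v. v : W <-> (EX w:carrier_vec k. v = M *v w)"
   using proper_subspace_basis[OF sW vW cv(2)] by blast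
  have Mc: "M : carrier_mat n k" using M unfolding mat_inj_def by blast
  have "EX B:sqm k. f a * M = M * B" if a: "a : A" for a
  proof (rule mat_inj_image_subset[OF M(1)])
   show fa: "f a : sqm n" using less.prems(2) a by blast
   fix w :: "complex vec" assume w: "w : carrier_vec k"
   define u where "u = M *v w"
   have u: "u : W" "u : carrier_vec n" using M(2) w Mc unfolding u_def by auto
   have "f b *v (f a *v u) = f a *v (f b *v u)"
    using assoc_mult_mat_vec[OF fb fa u(2)] assoc_mult_mat_vec[OF fa fb u(2)] less.prems(3)[OF b(1) a] by simp
   also have "f b *v u = c *s u" using u(1) unfolding W_def wspace_def by simp
   also have "f a *v (c *s u) = c *s (f a *v u)" using fa u(2) by (simp add: mult_mat_vec[of _ n n])
   finally have "f a *v u : W" unfolding W_def wspace_def using fa u(2) by auto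
   thus "EX v:carrier_vec k. f a *v (M *v w) = M *v v" using M(2) unfolding u_def by blast
  qed
  then obtain f' where f': "!!a. a : A ==> f' a : sqm k" "!!a. a : A ==> f a * M = M * f' a" by metis
  have "f' a * f' b = f' b * f' a" if ab: "a : A" "b : A" for a b
  proof (rule mat_inj_cancel[OF M(1)])
   have c: "f a : sqm n" "f b : sqm n" using less.prems(2) ab by auto
   have *: "M * (f' a * f' b) = f a * f b * M" if "a : A" "b : A" "f a : sqm n" "f b : sqm n" for a b
   proof -
    have "M * (f' a * f' b) = M * f' a * f' b" by (rule assoc_mult_mat[symmetric, OF Mc f'(1)[OF that(1)] f'(1)[OF that(2)]])
    also have "... = f a * (M * f' b)" unfolding f'(2)[OF that(1), symmetric]
     by (rule assoc_mult_mat[OF that(3) Mc f'(1)[OF that(2)]])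
    also have "... = f a * f b * M" unfolding f'(2)[OF that(2), symmetric]
     by (rule assoc_mult_mat[symmetric, OF that(3,4) Mc])
    finally show ?thesis .
   qed
   show "M * (f' a * f' b) = M * (f' b * f' a)" using *[OF ab c] *[OF ab(2,1) c(2,1)] less.prems(3)[OF ab] by simp
   show "f' a * f' b : sqm k" "f' b * f' a : sqm k" using f'(1) ab by (meson mult_carrier_mat)+
  qed
  with less.IH[OF kn(2,1), of f'] f' obtain w v' where v': "v' : wspace k f' A w" "v' ~= 0v k" by blast
  have v'c: "v' : carrier_vec k" using v' unfolding wspace_def by simp
  have "M *v v' : wspace n f A w" unfolding wspace_def
  proof (intro CollectI conjI ballI)
   show "M *v v' : carrier_vec n" using Mc v'c by simp
   fix a assume a: "a : A"
   have fa: "f a : sqm n" using less.prems(2) a by blast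
   have "f a *v (M *v v') = (f a * M) *v v'" by (rule assoc_mult_mat_vec[symmetric, OF fa Mc v'c])
   also have "... = M *v (f' a *v v')" unfolding f'(2)[OF a] by (rule assoc_mult_mat_vec[OF Mc f'(1)[OF a] v'c])
   also have "f' a *v v' = w a *s v'" using v' a unfolding wspace_def by simp
   also have "M *v (w a *s v') = w a *s (M *v v')" using Mc v'c by (simp add: mult_mat_vec[of _ n k])
   finally show "f a *v (M *v v') = w a *s (M *v v')" .
  qed
  moreover have "M *v v' ~= 0v n" using M(1) v'c v'(2) unfolding mat_inj_def by blast
  ultimately show ?thesis by blast
 qed
qed

section \<open>Subgroups of finite index and representations\<close>

context group
begin

definition fin_idx :: "'a set => 'a set => bool" where
 "fin_idx K H <-> subgroup K G & subgroup H G & K <= H &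
   (EX R. finite R & R <= H & (ALL x:H. EX r:R. x ** inv r : K))"

lemma fin_idx_refl: "subgroup H G ==> fin_idx H H"
 unfolding fin_idx_def by (intro conjI exI[of _ "{\<one>}"]) (auto simp: subgroup.one_closed subgroup.mem_carrier)

lemma fin_idx_trans:
 assumes "fin_idx K H" "fin_idx H T"
 shows "fin_idx K T"
proof -
 obtain R S where R: "finite R" "R <= H" "!!x. x : H ==> EX r:R. x ** inv r : K"
  and S: "finite S" "S <= T" "!!x. x : T ==> EX s:S. x ** inv s : H"
  using assms unfolding fin_idx_def by metis
 have sub: "subgroup K G" "subgroup H G" "subgroup T G" "K <= H" "H <= T" using assms unfolding fin_idx_def by auto
 interpret H: subgroup H G by (rule sub)
 interpret T: subgroup T G by (rule sub)
 have "EX r:(%(r, s). r ** s) ` (R \<times> S). x ** inv r : K" if x: "x : T" for x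
 proof -
  obtain s where s: "s : S" "x ** inv s : H" using S(3)[OF x] by blast
  obtain r where r: "r : R" "x ** inv s ** inv r : K" using R(3)[OF s(2)] by blast
  have "x : carrier G" "s : carrier G" "r : carrier G" using x s r S(2) R(2) by auto
  hence "x ** inv (r ** s) : K" using r(2) by (simp add: inv_mult_group m_assoc)
  thus ?thesis using r s by force
 qed
 moreover have "finite ((%(r, s). r ** s) ` (R \<times> S))" using R(1) S(1) by blast
 moreover have "(%(r, s). r ** s) ` (R \<times> S) <= T" using R(2) S(2) sub(5) by auto
 ultimately show ?thesis unfolding fin_idx_def using sub by blast
qed

lemma fin_idx_fibres:
 assumes sub: "subgroup K G" "subgroup H G" "K <= H" and fin: "finite (f ` H)"
  and fib: "!!x y. x : H ==> y : H ==> f x = f y ==> x ** inv y : K"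
 shows "fin_idx K H"
proof -
 let ?R = "inv_into H f ` f ` H"
 have "EX r:?R. x ** inv r : K" if "x : H" for x
  using that fib[of x "inv_into H f (f x)"] by (auto simp: f_inv_into_f inv_into_into)
 moreover have "?R <= H" by (auto intro: inv_into_into)
 ultimately show ?thesis unfolding fin_idx_def using sub fin by blast
qed

text \<open>Orbit and stabiliser: by \<open>act\<close>, right multiplication acts on the finite set
  of values of \<open>f\<close>.\<close>

lemma fin_idx_stabiliser:
 assumes T: "subgroup T G" and fin: "finite (f ` T)"
  and act: "!!x y z. x : T ==> y : T ==> z : T ==> f x = f y ==> f (x ** z) = f (y ** z)"
 shows "fin_idx {t : T. f t = f \<one>} T" (is "fin_idx ?K T")
proof -
 interpret T: subgroup T G by (rule T)
 have "subgroup ?K G"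
 proof (rule subgroupI)
  show "?K <= carrier G" by auto
  show "?K ~= {}" using T.one_closed by blast
  fix x y assume x: "x : ?K" and y: "y : ?K"
  show "inv x : ?K" using act[of x \<one> "inv x"] x by simp
  show "x ** y : ?K" using act[of x \<one> y] x y by simp
 qed
 thus ?thesis
 proof (rule fin_idx_fibres[OF _ T _ fin])
  show "x ** inv y : ?K" if "x : T" "y : T" "f x = f y" for x y using act[of x y "inv y"] that by simp
 qed auto
qed

definition rep :: "nat => 'a set => ('a => 'c :: field mat) => bool" where
 "rep n T \<rho> <-> subgroup T G & (ALL x:T. \<rho> x : sqm n) &
   (ALL x:T. ALL y:T. \<rho> (x ** y) = \<rho> x * \<rho> y) & \<rho> \<one> = 1m n"

lemma repD:
 assumes "rep n T \<rho>"
 shows "subgroup T G" "x : T ==> \<rho> x : sqm n" "x : T ==> y : T ==> \<rho> (x ** y) = \<rho> x * \<rho> y"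
  "\<rho> \<one> = 1m n" "x : T ==> \<rho> x * \<rho> (inv x) = 1m n" "x : T ==> \<rho> (inv x) * \<rho> x = 1m n"
proof -
 show T: "subgroup T G" using assms unfolding rep_def by blast
 interpret T: subgroup T G by (rule T)
 show m: "\<rho> (x ** y) = \<rho> x * \<rho> y" if "x : T" "y : T" for x y using assms that unfolding rep_def by blast
 show o: "\<rho> \<one> = 1m n" using assms unfolding rep_def by blast
 show "x : T ==> \<rho> x : sqm n" using assms unfolding rep_def by blast
 show "x : T ==> \<rho> x * \<rho> (inv x) = 1m n" using m[of x "inv x"] o by simp
 show "x : T ==> \<rho> (inv x) * \<rho> x = 1m n" using m[of "inv x" x] o by simp
qed

lemma rep_mono: "rep n T \<rho> ==> subgroup K G ==> K <= T ==> rep n K \<rho>"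
 unfolding rep_def by blast

lemma rep_vec:
 assumes "rep n T \<rho>" "x : T" "y : T" "v : carrier_vec n"
 shows "\<rho> (x ** y) *v v = \<rho> x *v (\<rho> y *v v)"
 using repD[OF assms(1)] assms(2-4) by (simp add: assoc_mult_mat_vec[of _ n n _ n])

lemma rep_vec_eq_0:
 assumes "rep n T \<rho>" "x : T" "v : carrier_vec n" "\<rho> x *v v = 0v n"
 shows "v = 0v n"
proof -
 interpret T: subgroup T G using repD(1)[OF assms(1)] .
 have "v = \<rho> (inv x ** x) *v v" using assms repD(4)[OF assms(1)] by simp
 also have "... = \<rho> (inv x) *v (\<rho> x *v v)" using assms by (intro rep_vec) auto
 also have "... = 0v n" unfolding assms(4) using repD(2)[OF assms(1), of "inv x"] assms(2) by (simp add: mult_mat_zero_vec)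
 finally show ?thesis .
qed

lemma sub_rep:
 fixes \<rho> :: "'a => 'c :: field mat"
 assumes R: "rep n T \<rho>" and M: "mat_inj n k M"
  and inv: "!!x w. x : T ==> w : carrier_vec k ==> EX u:carrier_vec k. \<rho> x *v (M *v w) = M *v u"
 shows "EX \<rho>'. rep k T \<rho>' & (ALL x:T. \<rho> x * M = M * \<rho>' x)"
proof -
 note rD = repD[OF R]
 interpret T: subgroup T G by (rule rD)
 have Mc: "M : carrier_mat n k" using M unfolding mat_inj_def by blast
 have "EX B:sqm k. \<rho> x * M = M * B" if "x : T" for x
  using mat_inj_image_subset[OF M rD(2)[OF that] inv[OF that]] by blast
 then obtain r where r: "!!x. x : T ==> r x : sqm k" "!!x. x : T ==> \<rho> x * M = M * r x" by metis
 have "r (x ** y) = r x * r y" if xy: "x : T" "y : T" for x y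
 proof (rule mat_inj_cancel[OF M])
  have "M * (r x * r y) = M * r x * r y" by (rule assoc_mult_mat[symmetric, OF Mc r(1)[OF xy(1)] r(1)[OF xy(2)]])
  also have "... = \<rho> x * (M * r y)" unfolding r(2)[OF xy(1), symmetric]
   by (rule assoc_mult_mat[OF rD(2)[OF xy(1)] Mc r(1)[OF xy(2)]])
  also have "... = \<rho> x * \<rho> y * M" unfolding r(2)[OF xy(2), symmetric]
   by (rule assoc_mult_mat[symmetric, OF rD(2)[OF xy(1)] rD(2)[OF xy(2)] Mc])
  also have "... = M * r (x ** y)" using r(2)[of "x ** y"] xy rD(3)[OF xy] by simp
  finally show "M * r (x ** y) = M * (r x * r y)" by simp
  show "r (x ** y) : sqm k" "r x * r y : sqm k"
   using r(1) xy by (simp_all add: mult_carrier_mat[of _ k k])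
 qed
 moreover have "r \<one> = 1m k"
 proof (rule mat_inj_cancel[OF M])
  show "M * r \<one> = M * 1m k" using r(2)[of \<one>] rD(4) Mc by simp
  show "r \<one> : sqm k" "1m k : sqm k" using r(1) by simp_all
 qed
 ultimately have "rep k T r" unfolding rep_def using rD(1) r(1) by blast
 thus ?thesis using r(2) by blast
qed

end

context group
begin

lemma rep_commute_iff:
 assumes R: "rep n T \<rho>" and xy: "x : T" "y : T"
 shows "\<rho> (x ** y ** inv x) = \<rho> y <-> \<rho> x * \<rho> y = \<rho> y * \<rho> x"
proof -
 note rD = repD[OF R]
 interpret T: subgroup T G by (rule rD)
 have c: "x : carrier G" "y : carrier G" using xy by auto
 have e: "\<rho> x * \<rho> y = \<rho> (x ** y ** inv x) * \<rho> x"
  using rD(3)[of "x ** y ** inv x" x] rD(3)[of x y] xy c by (simp add: m_assoc)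
 have "\<rho> (x ** y ** inv x) = \<rho> y" if "\<rho> x * \<rho> y = \<rho> y * \<rho> x"
 proof -
  have "\<rho> (x ** y ** inv x) = \<rho> x * \<rho> y * \<rho> (inv x)" using xy rD(3) by simp
  also have "... = \<rho> y * (\<rho> x * \<rho> (inv x))"
   unfolding that using rD(2) xy by (simp add: assoc_mult_mat[of _ n n _ n _ n])
  finally show ?thesis using rD(5)[OF xy(1)] rD(2)[OF xy(2)] by simp
 qed
 thus ?thesis using e by auto
qed

lemma weight_closure:
 fixes u :: "'j => 'c :: field vec"
 assumes A: "A : sqm n" and u: "!!j. j : F ==> u j : carrier_vec n"
  "!!j. j : F ==> A *v u j = w j *s u j"
  and rel: "ALL i:{..<n}. (SUM j:F. c j * u j $ i) = 0"
 shows "ALL i:{..<n}. (SUM j:F. c j * w j * u j $ i) = 0"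
proof
 fix i assume i: "i : {..<n}"
 have "(SUM j:F. c j * w j * u j $ i) = (SUM j:F. c j * (A *v u j) $ i)"
 proof (rule sum.cong)
  fix j assume j: "j : F"
  have "(A *v u j) $ i = w j * u j $ i" unfolding u(2)[OF j] using u(1)[OF j] i by simp
  thus "c j * w j * u j $ i = c j * (A *v u j) $ i" by simp
 qed simp
 also have "... = (SUM j:F. SUM k<n. A $$ (i, k) * (c j * u j $ k))"
  using mult_mat_vec_index[OF A u(1)] i by (intro sum.cong) (auto simp: sum_distrib_left algebra_simps simp del: index_mult_mat_vec)
 also have "... = (SUM k<n. A $$ (i, k) * (SUM j:F. c j * u j $ k))"
  unfolding sum_distrib_left by (rule sum.swap)
 also have "... = 0" using rel by (intro sum.neutral) auto
 finally show "(SUM j:F. c j * w j * u j $ i) = 0" .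
qed

text \<open>Irreducibility for all subgroups of finite index at once, tested only on common weight
  spaces, the subspaces that arise in the argument. If it fails, the induction on the dimension
  continues in such a weight space.\<close>

definition strongly_irred :: "nat => 'a set => ('a => 'c :: field mat) => bool" where
 "strongly_irred n T \<rho> <-> (ALL K A w. fin_idx K T --> A <= T --> (EX v:wspace n \<rho> A w. v ~= 0v n) -->
   (ALL x:K. ALL v:wspace n \<rho> A w. \<rho> x *v v : wspace n \<rho> A w) --> wspace n \<rho> A w = carrier_vec n)"

lemma strongly_irred_scalar:
 assumes "strongly_irred n T \<rho>" "rep n T \<rho>" "fin_idx K T" "A <= T" "v : wspace n \<rho> A w" "v ~= 0v n"
  "!!x v. x : K ==> v : wspace n \<rho> A w ==> \<rho> x *v v : wspace n \<rho> A w" "a : A"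
 shows "scalar_mat n (\<rho> a)"
proof -
 have "wspace n \<rho> A w = carrier_vec n" using assms(1,3-7) unfolding strongly_irred_def by blast
 hence "\<rho> a = w a *m 1m n"
  using assms(4,8) repD(2)[OF assms(2)] by (intro scalar_matI) (auto simp: wspace_def)
 thus ?thesis unfolding scalar_mat_def by blast
qed

text \<open>Clifford's argument: \<open>T\<close> permutes the weights in the orbit of
  \<open>w\<close>, and there are only finitely many. The stabiliser of one weight has finite index
  and preserves its weight space, which is therefore the whole space.\<close>

lemma abelian_normal_scalar:
 fixes \<rho> :: "'a => complex mat"
 assumes R: "rep n T \<rho>" and n: "n > 0" and irr: "strongly_irred n T \<rho>"
  and A: "A <= T" "!!t a. t : T ==> a : A ==> t ** a ** inv t : A"
  and comm: "!!a b. a : A ==> b : A ==> \<rho> a * \<rho> b = \<rho> b * \<rho> a"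
  and a: "a : A"
 shows "scalar_mat n (\<rho> a)"
proof -
 note rD = repD[OF R]
 interpret T: subgroup T G by (rule rD)
 have Tc: "x : carrier G" if "x : T" for x using that by auto
 have Ac: "x : carrier G" if "x : A" for x using that A(1) by auto
 obtain w v where v: "v : wspace n \<rho> A w" "v ~= 0v n"
  using common_eigen[OF n, of A \<rho>] rD(2) A(1) comm by blast
 \<comment> \<open>The weight \<open>w\<close> moved by \<open>t\<close>. The fixed value outside
   \<open>A\<close> makes weights that agree on \<open>A\<close> equal as functions.\<close>
 define f where "f t = (%a. if a : A then w (t ** a ** inv t) else 0)" for t
 have trans: "\<rho> x *v u : wspace n \<rho> A w'"
  if x: "x : T" and u: "u : wspace n \<rho> A w0" and w: "!!a. a : A ==> w0 (inv x ** a ** x) = w' a" for x u w0 w'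
  unfolding wspace_def
 proof (intro CollectI conjI ballI)
  have uc: "u : carrier_vec n" using u unfolding wspace_def by simp
  show "\<rho> x *v u : carrier_vec n" by (rule mult_mat_vec_carrier[OF rD(2)[OF x] uc])
  fix a assume a: "a : A"
  have ia: "inv x ** a ** x : A" using A(2)[of "inv x" a] x a Tc by simp
  have aT: "a : T" "inv x ** a ** x : T" using a ia A(1) by auto
  have "\<rho> a *v (\<rho> x *v u) = \<rho> (a ** x) *v u" using rep_vec[OF R aT(1) x uc] by simp
  also have "a ** x = x ** (inv x ** a ** x)" using x aT by (simp add: m_assoc inv_cancel Tc)
  also have "\<rho> (x ** (inv x ** a ** x)) *v u = \<rho> x *v (\<rho> (inv x ** a ** x) *v u)"
   by (rule rep_vec[OF R x aT(2) uc])
  also have "\<rho> (inv x ** a ** x) *v u = w' a *s u" using u ia w[OF a] unfolding wspace_def by simp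
  also have "\<rho> x *v (w' a *s u) = w' a *s (\<rho> x *v u)" using rD(2)[OF x] uc by (simp add: mult_mat_vec[of _ n n])
  finally show "\<rho> a *v (\<rho> x *v u) = w' a *s (\<rho> x *v u)" .
 qed
 have vc: "v : carrier_vec n" using v unfolding wspace_def by simp
 have "EX u. u : wspace n \<rho> A \<chi> & u ~= 0v n" if chi: "\<chi> : f ` T" for \<chi>
 proof -
  obtain t where t: "t : T" "\<chi> = f t" using chi by blast
  have "\<rho> (inv t) *v v : wspace n \<rho> A \<chi>"
   using t v(1) Tc[OF t(1)] by (intro trans[of _ _ w]) (auto simp: f_def)
  moreover have "\<rho> (inv t) *v v ~= 0v n" using rep_vec_eq_0[OF R _ vc, of "inv t"] t v(2) by blast
  ultimately show ?thesis by blast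
 qed
 then obtain u where u: "!!\<chi>. \<chi> : f ` T ==> u \<chi> : wspace n \<rho> A \<chi>" "!!\<chi>. \<chi> : f ` T ==> u \<chi> ~= 0v n" by metis
 have uc: "u \<chi> : carrier_vec n" if "\<chi> : f ` T" for \<chi> using u(1)[OF that] unfolding wspace_def by simp
 have fin: "finite (f ` T)"
 proof (rule weights_finite[of "{..<n}" "f ` T" "%\<chi> i. u \<chi> $ i" A "%\<chi> a. \<chi> a"])
  fix \<chi> assume "\<chi> : f ` T"
  thus "EX i:{..<n}. u \<chi> $ i ~= 0" using u(2)[of \<chi>] uc[of \<chi>] by (metis eq_vecI carrier_vecD index_zero_vec lessThan_iff)
 next
  fix \<chi> \<chi>' assume "\<chi> : f ` T" "\<chi>' : f ` T" "\<chi> ~= \<chi>'"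
  thus "EX a:A. \<chi> a ~= \<chi>' a" unfolding f_def by fastforce
 next
  fix F c a assume F: "F <= f ` T" "finite F" "a : A" "ALL i:{..<n}. (SUM \<chi>:F. c \<chi> * u \<chi> $ i) = 0"
  show "ALL i:{..<n}. (SUM \<chi>:F. c \<chi> * \<chi> a * u \<chi> $ i) = 0"
  proof (rule weight_closure[of "\<rho> a"])
   show "\<rho> a : sqm n" using F(3) A(1) rD(2) by blast
   fix \<chi> assume "\<chi> : F"
   hence "\<chi> : f ` T" using F(1) by blast
   thus "u \<chi> : carrier_vec n" "\<rho> a *v u \<chi> = \<chi> a *s u \<chi>" using uc u(1)[of \<chi>] F(3) unfolding wspace_def by auto
  qed (rule F(4))
 qed simp
 have fz: "f (x ** z) = (%a. if a : A then f x (z ** a ** inv z) else 0)" if "x : T" "z : T" for x z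
 proof
  have "(x ** z) ** a ** inv (x ** z) = x ** (z ** a ** inv z) ** inv x" if "a : A" for a
   using that \<open>x : T\<close> \<open>z : T\<close> Ac Tc by (simp add: m_assoc inv_mult_group)
  thus "f (x ** z) a = (if a : A then f x (z ** a ** inv z) else 0)" for a
   using A(2)[OF that(2)] unfolding f_def by simp
 qed
 have fi: "fin_idx {t : T. f t = f \<one>} T" (is "fin_idx ?K T")
 proof (rule fin_idx_stabiliser[OF rD(1) fin])
  show "f (x ** z) = f (y ** z)" if "x : T" "y : T" "z : T" "f x = f y" for x y z
   unfolding fz[OF that(1,3)] fz[OF that(2,3)] that(4) ..
 qed
 show ?thesis
 proof (rule strongly_irred_scalar[OF irr R fi A(1) v _ a])
  fix x u assume x: "x : ?K" and u: "u : wspace n \<rho> A w"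
  have "subgroup ?K G" using fi unfolding fin_idx_def by blast
  from subgroup.m_inv_closed[OF this x] have fx: "f (inv x) = f \<one>" by blast
  have xT: "x : T" using x by blast
  have "w (inv x ** a ** x) = w a" if "a : A" for a
   using fun_cong[OF fx, of a] that Tc[OF xT] Ac[OF that] unfolding f_def by simp
  thus "\<rho> x *v u : wspace n \<rho> A w" by (intro trans[OF xT u])
 qed
qed

end

context group
begin

text \<open>Conjugation inside \<open>B\<close> multiplies each matrix of the image by a scalar.
  These matrices are thus weight vectors in the space of all matrices, and only finitely many
  weights occur. Hence the image of \<open>B\<close> is finite modulo scalars,
  \<open>\<rho> b\<close> has finitely many conjugates, and a subgroup of finite index commutes with
  it and preserves its eigenspaces.\<close>

lemma scalar_commutator_scalar:
 fixes \<rho> :: "'a => complex mat"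
 assumes R: "rep n T \<rho>" and n: "n > 0" and irr: "strongly_irred n T \<rho>"
  and B: "subgroup B G" "B <= T" "!!t a. t : T ==> a : B ==> t ** a ** inv t : B"
  and comm: "!!x y. x : B ==> y : B ==> scalar_mat n (\<rho> (x ** y ** inv x ** inv y))"
  and b: "b : B"
 shows "scalar_mat n (\<rho> b)"
proof -
 note rD = repD[OF R]
 interpret T: subgroup T G by (rule rD)
 interpret B: subgroup B G by (rule B)
 have Tc: "x : carrier G" if "x : T" for x using that by auto
 have BT: "x : T" if "x : B" for x using that B(2) by auto
 have "EX c. \<rho> (x ** y ** inv x) = c *m \<rho> y" if xy: "x : B" "y : B" for x y
 proof -
  obtain c where c: "\<rho> (x ** y ** inv x ** inv y) = c *m 1m n" using comm[OF xy] unfolding scalar_mat_def by blast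
  have "\<rho> (x ** y ** inv x) = \<rho> ((x ** y ** inv x ** inv y) ** y)" using xy by (simp add: m_assoc)
  also have "... = (c *m 1m n) * \<rho> y" unfolding c[symmetric] using BT xy by (intro rD(3)) auto
  also have "... = c *m \<rho> y" using rD(2)[OF BT[OF xy(2)]] by (simp add: mult_smult_assoc_mat[of _ n n _ n])
  finally show ?thesis by blast
 qed
 then obtain c where c: "!!x y. x : B ==> y : B ==> \<rho> (x ** y ** inv x) = c x y *m \<rho> y" by metis
 \<comment> \<open>The elements whose image is central in that of \<open>B\<close>. They form a set
   normal in \<open>T\<close> with commuting images, so \<open>abelian_normal_scalar\<close>
   applies.\<close>
 define Z where "Z = {z : B. ALL x:B. \<rho> (x ** z ** inv x) = \<rho> z}"
 have Zs: "scalar_mat n (\<rho> z)" if z: "z : Z" for z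
 proof (rule abelian_normal_scalar[OF R n irr, of Z])
  show "Z <= T" "z : Z" using BT z unfolding Z_def by auto
  fix t z assume t: "t : T" and z: "z : Z"
  have zB: "z : B" and zZ: "!!x. x : B ==> \<rho> (x ** z ** inv x) = \<rho> z"
   using z unfolding Z_def by simp_all
  have "\<rho> (x ** (t ** z ** inv t) ** inv x) = \<rho> (t ** z ** inv t)" if x: "x : B" for x
  proof -
   let ?x = "inv t ** x ** inv (inv t)"
   have x': "?x : B" using B(3)[of "inv t" x] t x by blast
   have e: "x ** (t ** z ** inv t) ** inv x = t ** (?x ** z ** inv ?x) ** inv t"
    using t zB x Tc by (simp add: m_assoc inv_mult_group inv_cancel)
   have "\<rho> (t ** (?x ** z ** inv ?x) ** inv t) = \<rho> t * \<rho> (?x ** z ** inv ?x) * \<rho> (inv t)"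
    using rD(3) t BT zB x' by simp
   thus ?thesis unfolding e zZ[OF x'] using rD(3) t BT zB by simp
  qed
  thus "t ** z ** inv t : Z" unfolding Z_def using B(3)[OF t zB] by blast
 next
  fix x y assume "x : Z" "y : Z"
  thus "\<rho> x * \<rho> y = \<rho> y * \<rho> x" using rep_commute_iff[OF R BT BT, of x y] unfolding Z_def by simp
 qed
 \<comment> \<open>The scalars by which conjugation acts on \<open>\<rho> y\<close>. Elements with
   equal \<open>wt\<close> differ by an element of \<open>Z\<close>, hence their images by a
   scalar.\<close>
 define wt where "wt y = (%x. if x : B then c x y else 0)" for y
 have same: "EX s. \<rho> y = s *m \<rho> y'" if y: "y : B" "y' : B" "wt y = wt y'" for y y'
 proof -
  have "y ** inv y' : Z" unfolding Z_def
  proof (intro CollectI conjI ballI)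
   show zB: "y ** inv y' : B" using y by simp
   fix x assume x: "x : B"
   let ?z = "y ** inv y'" and ?w = "x ** y' ** inv x"
   have wB: "?w : B" "x ** ?z ** inv x : B" using x y zB by simp_all
   have zy: "\<rho> y = \<rho> ?z * \<rho> y'" using rD(3)[of ?z y'] BT y zB by (simp add: m_assoc)
   have "\<rho> (x ** ?z ** inv x) * \<rho> ?w = \<rho> (x ** y ** inv x)"
    using rD(3)[OF BT[OF wB(2)] BT[OF wB(1)]] x y by (simp add: m_assoc inv_cancel)
   also have "... = c x y *m \<rho> y" using c x y by simp
   also have "c x y = c x y'" using fun_cong[OF y(3), of x] x unfolding wt_def by simp
   also have "c x y' *m \<rho> y = \<rho> ?z * (c x y' *m \<rho> y')"
    unfolding zy using rD(2)[OF BT] zB y by (simp add: mult_smult_distrib[of _ n n _ n])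
   also have "... = \<rho> ?z * \<rho> ?w" using c[OF x y(2)] by simp
   finally have e: "\<rho> (x ** ?z ** inv x) * \<rho> ?w = \<rho> ?z * \<rho> ?w" .
   have canc: "\<rho> u * \<rho> ?w * \<rho> (inv ?w) = \<rho> u" if u: "u : B" for u
   proof -
    have "\<rho> u * \<rho> ?w * \<rho> (inv ?w) = \<rho> (u ** ?w ** inv ?w)"
     using rD(3) BT[OF u] BT[OF wB(1)] by simp
    also have "u ** ?w ** inv ?w = u" using u wB(1) by (simp add: m_assoc)
    finally show ?thesis .
   qed
   show "\<rho> (x ** ?z ** inv x) = \<rho> ?z"
    using canc[OF wB(2)] canc[OF zB] unfolding e by (rule trans[OF sym])
  qed
  then obtain s where s: "\<rho> (y ** inv y') = s *m 1m n" using Zs unfolding scalar_mat_def by blast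
  have "\<rho> y = \<rho> (y ** inv y') * \<rho> y'" using rD(3)[of "y ** inv y'" y'] BT y by (simp add: m_assoc)
  also have "... = s *m \<rho> y'" unfolding s using rD(2)[OF BT[OF y(2)]] by (simp add: mult_smult_assoc_mat[of _ n n _ n])
  finally show ?thesis by blast
 qed
 define yy where "yy = inv_into B wt"
 have yy: "yy \<chi> : B" "wt (yy \<chi>) = \<chi>" if "\<chi> : wt ` B" for \<chi>
  using that unfolding yy_def by (auto simp: inv_into_into f_inv_into_f)
 \<comment> \<open>One matrix for each weight, read as a vector of length \<open>n * n\<close>:
   conjugation by \<open>x\<close> acts on it linearly with eigenvalue
   \<open>\<chi> x\<close>.\<close>
 have fin: "finite (wt ` B)"
 proof (rule weights_finite[of "{..<n} \<times> {..<n}" "wt ` B" "%\<chi> i. \<rho> (yy \<chi>) $$ i" B "%\<chi> a. \<chi> a"])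
  fix \<chi> assume chi: "\<chi> : wt ` B"
  have yT: "yy \<chi> : T" using yy(1)[OF chi] BT by blast
  show "EX i:{..<n} \<times> {..<n}. \<rho> (yy \<chi>) $$ i ~= 0"
  proof (rule ccontr)
   assume "~ ?thesis"
   hence "\<rho> (yy \<chi>) = 0m n n" using rD(2)[OF yT] by (intro eq_matI) auto
   hence "1m n = (0m n n :: complex mat)" using rD(5)[OF yT] rD(2)[of "inv (yy \<chi>)"] yT by (simp add: left_mult_zero_mat[of _ n n])
   hence "(1m n :: complex mat) $$ (0, 0) = 0m n n $$ (0, 0)" by simp
   thus False using n by simp
  qed
 next
  fix \<chi> \<chi>' assume "\<chi> : wt ` B" "\<chi>' : wt ` B" "\<chi> ~= \<chi>'"
  thus "EX a:B. \<chi> a ~= \<chi>' a" unfolding wt_def by fastforce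
 next
  fix F d x assume F: "F <= wt ` B" "finite F" "x : B" "ALL i:{..<n} \<times> {..<n}. (SUM \<chi>:F. d \<chi> * \<rho> (yy \<chi>) $$ i) = 0"
  show "ALL i:{..<n} \<times> {..<n}. (SUM \<chi>:F. d \<chi> * \<chi> x * \<rho> (yy \<chi>) $$ i) = 0"
  proof
   fix i :: "nat \<times> nat" assume i: "i : {..<n} \<times> {..<n}"
   then obtain i1 i2 where i12: "i = (i1, i2)" "i1 < n" "i2 < n" by auto
   have ix: "inv x : T" "x : T" using BT F(3) by auto
   have "\<chi> x * \<rho> (yy \<chi>) $$ i = (SUM m<n. SUM l<n. \<rho> x $$ (i1, l) * \<rho> (inv x) $$ (m, i2) * \<rho> (yy \<chi>) $$ (l, m))"
    (is "_ = ?e \<chi>") if chi: "\<chi> : F" for \<chi>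
   proof -
    have chi': "\<chi> : wt ` B" using chi F(1) by blast
    have "\<chi> x = wt (yy \<chi>) x" using yy(2)[OF chi'] by simp
    hence y: "yy \<chi> : B" "yy \<chi> : T" "\<chi> x = c x (yy \<chi>)" using yy(1)[OF chi'] F(3) BT
     by (simp_all add: wt_def)
    have "\<chi> x * \<rho> (yy \<chi>) $$ i = \<rho> (x ** yy \<chi> ** inv x) $$ i"
     unfolding c[OF F(3) y(1)] using rD(2)[OF y(2)] i12 y(3) by simp
    also have "\<rho> (x ** yy \<chi> ** inv x) = \<rho> x * \<rho> (yy \<chi>) * \<rho> (inv x)" using rD(3) ix y by simp
    also have "... $$ i = (SUM m<n. (SUM l<n. \<rho> x $$ (i1, l) * \<rho> (yy \<chi>) $$ (l, m)) * \<rho> (inv x) $$ (m, i2))"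
     unfolding i12(1) using mat_mult_index[OF mult_carrier_mat[OF rD(2)[OF ix(2)] rD(2)[OF y(2)]] rD(2)[OF ix(1)] i12(2,3)]
      mat_mult_index[OF rD(2)[OF ix(2)] rD(2)[OF y(2)] i12(2)] by simp
    finally show ?thesis unfolding sum_distrib_right by (simp add: mult_ac)
   qed
   hence "d \<chi> * \<chi> x * \<rho> (yy \<chi>) $$ i = d \<chi> * ?e \<chi>" if "\<chi> : F" for \<chi>
    using that by (simp only: mult.assoc)
   hence "(SUM \<chi>:F. d \<chi> * \<chi> x * \<rho> (yy \<chi>) $$ i) = (SUM \<chi>:F. d \<chi> * ?e \<chi>)" by (intro sum.cong) auto
   also have "... = (SUM \<chi>:F. SUM m<n. SUM l<n. (\<rho> x $$ (i1, l) * \<rho> (inv x) $$ (m, i2)) * (d \<chi> * \<rho> (yy \<chi>) $$ (l, m)))"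
    unfolding sum_distrib_left by (simp only: mult_ac)
   also have "... = (SUM m<n. SUM \<chi>:F. SUM l<n. (\<rho> x $$ (i1, l) * \<rho> (inv x) $$ (m, i2)) * (d \<chi> * \<rho> (yy \<chi>) $$ (l, m)))"
    by (rule sum.swap)
   also have "... = (SUM m<n. SUM l<n. SUM \<chi>:F. (\<rho> x $$ (i1, l) * \<rho> (inv x) $$ (m, i2)) * (d \<chi> * \<rho> (yy \<chi>) $$ (l, m)))"
    by (intro sum.cong refl sum.swap)
   also have "... = 0" unfolding sum_distrib_left[symmetric] using F(4) by (intro sum.neutral) auto
   finally show "(SUM \<chi>:F. d \<chi> * \<chi> x * \<rho> (yy \<chi>) $$ i) = 0" .
  qed
 qed simp
 define Y where "Y = yy ` wt ` B"
 have Y: "finite Y" "Y <= B" using fin yy(1) unfolding Y_def by auto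
 have YB: "EX y':Y. EX s. \<rho> y = s *m \<rho> y'" if "y : B" for y
  using same[OF that yy(1)[of "wt y"]] yy(2)[of "wt y"] that unfolding Y_def by auto
 have "EX l v. v : carrier_vec n & v ~= 0v n & \<rho> y *v v = l *s v" if "y : B" for y
  using eigen_exists[OF rD(2)[OF BT[OF that]] n] by blast
 then obtain l v where lv: "!!y. y : B ==> v y : carrier_vec n" "!!y. y : B ==> v y ~= 0v n"
  "!!y. y : B ==> \<rho> y *v v y = l y *s v y" by metis
 have l0: "l y ~= 0" if "y : B" for y
 proof
  assume "l y = 0"
  hence "\<rho> y *v v y = 0v n" using lv(1,3)[OF that] by (auto intro!: eq_vecI)
  thus False using rep_vec_eq_0[OF R BT[OF that] lv(1)[OF that]] lv(2)[OF that] by blast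
 qed
 \<comment> \<open>A conjugate of \<open>b\<close> is a scalar times one of finitely many matrices.
   The scalar takes finitely many values because the conjugate has the same eigenvalues as
   \<open>\<rho> b\<close>.\<close>
 define Eig where "Eig = {c. EX v. v : carrier_vec n & v ~= 0v n & \<rho> b *v v = c *s v}"
 have Eig: "finite Eig" unfolding Eig_def by (rule eigen_finite[OF rD(2)[OF BT[OF b]]])
 define f where "f t = \<rho> (inv t ** b ** t)" for t
 have conjB: "inv t ** b ** t : B" if "t : T" for t
  using B(3)[of "inv t" b] that b Tc by simp
 have "f t : (%(y, \<mu>). (\<mu> / l y) *m \<rho> y) ` (Y \<times> Eig)" if t: "t : T" for t
 proof -
  obtain y s where y: "y : Y" "f t = s *m \<rho> y" using YB[OF conjB[OF t]] unfolding f_def by blast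
  have yB: "y : B" "y : T" using y(1) Y(2) BT by auto
  let ?u = "\<rho> t *v v y"
  have vc: "v y : carrier_vec n" by (rule lv(1)[OF yB(1)])
  have uc: "?u : carrier_vec n" by (rule mult_mat_vec_carrier[OF rD(2)[OF t] vc])
  have u0: "?u ~= 0v n" using rep_vec_eq_0[OF R t vc] lv(2)[OF yB(1)] by blast
  have "\<rho> b *v ?u = \<rho> (b ** t) *v v y" using rep_vec[OF R BT[OF b] t vc] by simp
  also have "b ** t = t ** (inv t ** b ** t)" using t b Tc by (simp add: m_assoc inv_cancel)
  also have "\<rho> ... *v v y = \<rho> t *v (f t *v v y)" unfolding f_def using rep_vec[OF R t BT[OF conjB[OF t]] vc] .
  also have "f t *v v y = (s * l y) *s v y"
  proof -
   have "f t *v v y = s *s (\<rho> y *v v y)" unfolding y(2)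
    using rD(2)[OF yB(2)] vc by (intro eq_vecI) (auto simp: scalar_prod_def sum_distrib_left mult.assoc)
   thus ?thesis unfolding lv(3)[OF yB(1)] by (simp add: smult_smult_assoc)
  qed
  also have "\<rho> t *v ((s * l y) *s v y) = (s * l y) *s ?u" using mult_mat_vec[OF rD(2)[OF t] vc] .
  finally have "s * l y : Eig" unfolding Eig_def using uc u0 by blast
  moreover have "f t = (s * l y / l y) *m \<rho> y" using y(2) l0[OF yB(1)] by simp
  ultimately show ?thesis using y(1) by (intro image_eqI[of _ _ "(y, s * l y)"]) auto
 qed
 hence "f ` T <= (%(y, \<mu>). (\<mu> / l y) *m \<rho> y) ` (Y \<times> Eig)" by blast
 hence ffin: "finite (f ` T)" by (rule finite_subset) (use Y Eig in simp)
 have bT: "b : T" "b : carrier G" using BT b Tc by auto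
 have fz: "f (x ** z) = \<rho> (inv z) * f x * \<rho> z" if "x : T" "z : T" for x z
 proof -
  have "f (x ** z) = \<rho> (inv z ** (inv x ** b ** x) ** z)"
   unfolding f_def using that bT Tc by (simp add: m_assoc inv_mult_group)
  thus ?thesis unfolding f_def using that bT rD(3) by simp
 qed
 have fi: "fin_idx {t : T. f t = f \<one>} T"
  by (rule fin_idx_stabiliser[OF rD(1) ffin]) (simp add: fz)
 have vW: "v b : wspace n \<rho> {b} (%_. l b)" unfolding wspace_def using lv[OF b] by simp
 show ?thesis
 proof (rule strongly_irred_scalar[OF irr R fi _ vW lv(2)[OF b]])
  show "{b} <= T" "b : {b}" using bT by auto
  fix x u assume x: "x : {t : T. f t = f \<one>}" and u: "u : wspace n \<rho> {b} (%_. l b)"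
  have uc: "u : carrier_vec n" "\<rho> b *v u = l b *s u" using u unfolding wspace_def by auto
  have xT: "x : T" "\<rho> (inv x ** b ** x) = \<rho> b" using x bT unfolding f_def by simp_all
  have "\<rho> b *v (\<rho> x *v u) = \<rho> (b ** x) *v u" using rep_vec[OF R bT(1) xT(1) uc(1)] by simp
  also have "b ** x = x ** (inv x ** b ** x)" using xT bT Tc by (simp add: m_assoc inv_cancel)
  also have "\<rho> ... *v u = \<rho> x *v (\<rho> (inv x ** b ** x) *v u)" using xT bT by (intro rep_vec[OF R _ _ uc(1)]) auto
  also have "... = l b *s (\<rho> x *v u)" unfolding xT(2) uc(2) by (rule mult_mat_vec[OF rD(2)[OF xT(1)] uc(1)])
  finally show "\<rho> x *v u : wspace n \<rho> {b} (%_. l b)"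
   unfolding wspace_def using mult_mat_vec_carrier[OF rD(2)[OF xT(1)] uc(1)] by simp
 qed
qed

end

context group
begin

lemma exp_derived_conj_closed:
 assumes T: "subgroup T G" and t: "t : T" and a: "a : (derived G ^^ j) T"
 shows "t ** a ** inv t : (derived G ^^ j) T"
 using a
proof (induction j arbitrary: a)
 case 0
 interpret T: subgroup T G by (rule T)
 show ?case using 0 t by simp
next
 case (Suc j)
 interpret T: subgroup T G by (rule T)
 let ?D = "(derived G ^^ j) T"
 interpret D: subgroup ?D G by (rule exp_of_derived_is_subgroup[OF T])
 have tc: "t : carrier G" using t by simp
 have "a : generate G (derived_set G ?D)" using Suc.prems unfolding derived_def[of G ?D, symmetric] by simp
 hence "t ** a ** inv t : generate G (derived_set G ?D)"
 proof (induction rule: generate.induct)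
  case one
  show ?case using tc generate.one by simp
 next
  case (incl h)
  then obtain x y where xy: "x : ?D" "y : ?D" "h = x ** y ** inv x ** inv y" by auto
  let ?x = "t ** x ** inv t" and ?y = "t ** y ** inv t"
  have "t ** h ** inv t = ?x ** ?y ** inv ?x ** inv ?y"
   using xy tc by (simp add: m_assoc inv_mult_group inv_cancel)
  thus ?case using Suc.IH[OF xy(1)] Suc.IH[OF xy(2)] by (intro generate.incl) auto
 next
  case (inv h)
  then obtain x y where xy: "x : ?D" "y : ?D" "h = x ** y ** inv x ** inv y" by auto
  let ?x = "t ** x ** inv t" and ?y = "t ** y ** inv t"
  have "t ** inv h ** inv t = inv (?x ** ?y ** inv ?x ** inv ?y)"
   using xy tc by (simp add: m_assoc inv_mult_group inv_cancel)
  thus ?case using Suc.IH[OF xy(1)] Suc.IH[OF xy(2)] by (auto intro!: generate.inv)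
 next
  case (eng h1 h2)
  have c: "h1 : carrier G" "h2 : carrier G"
   using eng.hyps generate_in_carrier[OF derived_set_in_carrier[OF D.subset]] by auto
  have "t ** (h1 ** h2) ** inv t = (t ** h1 ** inv t) ** (t ** h2 ** inv t)"
   using c tc by (simp add: m_assoc inv_cancel)
  thus ?case using generate.eng[OF eng.IH] by simp
 qed
 thus ?case unfolding derived_def[of G ?D, symmetric] by simp
qed

text \<open>Scalarity climbs the derived series from its trivial end: commutators of one term lie in
  the next, where it is already known.\<close>

lemma solvable_scalar:
 fixes \<rho> :: "'a => complex mat"
 assumes R: "rep n T \<rho>" and n: "n > 0" and irr: "strongly_irred n T \<rho>"
  and l: "(derived G ^^ l) T = {\<one>}" and x: "x : T"
 shows "scalar_mat n (\<rho> x)"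
proof -
 note rD = repD[OF R]
 have D: "subgroup ((derived G ^^ j) T) G" "(derived G ^^ j) T <= T" for j
 proof -
  show "subgroup ((derived G ^^ j) T) G" by (rule exp_of_derived_is_subgroup[OF rD(1)])
  show "(derived G ^^ j) T <= T"
   by (induction j) (auto dest: subsetD[OF derived_incl[OF _ rD(1)]])
 qed
 have "ALL b:(derived G ^^ (l - i)) T. scalar_mat n (\<rho> b)" if "i <= l" for i
  using that
 proof (induction i)
  case 0
  have "1m n = 1 *m (1m n :: complex mat)" by (intro eq_matI) auto
  thus ?case using l rD(4) unfolding scalar_mat_def by auto
 next
  case (Suc i)
  define j where "j = l - Suc i"
  have j: "l - i = Suc j" using Suc.prems unfolding j_def by simp
  have IH: "!!b. b : derived G ((derived G ^^ j) T) ==> scalar_mat n (\<rho> b)" using Suc j by simp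
  show ?case unfolding j_def[symmetric]
  proof
   fix b assume b: "b : (derived G ^^ j) T"
   show "scalar_mat n (\<rho> b)"
    by (rule scalar_commutator_scalar[OF R n irr D exp_derived_conj_closed[OF rD(1)] IH b])
     (auto simp: derived_def intro!: generate.incl)
  qed
 qed
 from this[of l] x show ?thesis by simp
qed

lemma fin_idx_derived:
 assumes "fin_idx K T" "(derived G ^^ l) T = {\<one>}"
 shows "(derived G ^^ l) K = {\<one>}"
proof -
 have K: "subgroup K G" "K <= T" using assms unfolding fin_idx_def by auto
 have "(derived G ^^ l) K <= {\<one>}" using mono_exp_of_derived[OF K(2), of l] assms(2) by simp
 moreover have "\<one> : (derived G ^^ l) K" by (rule subgroup.one_closed[OF exp_of_derived_is_subgroup[OF K(1)]])
 ultimately show ?thesis by blast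
qed

text \<open>In the strongly irreducible case every vector is an eigenvector. Otherwise a proper
  weight space is stable under a subgroup of finite index, and restricting to both lowers the
  dimension.\<close>

lemma common_eigen_solvable:
 fixes \<rho> :: "'a => complex mat"
 assumes "rep n T \<rho>" "n > 0" "(derived G ^^ l) T = {\<one>}"
 shows "EX K v. fin_idx K T & v : carrier_vec n & v ~= 0v n & (ALL x:K. EX c. \<rho> x *v v = c *s v)"
 using assms
proof (induction n arbitrary: T \<rho> rule: less_induct)
 case (less n)
 note R = less.prems(1)
 note rD = repD[OF R]
 show ?case
 proof (cases "strongly_irred n T \<rho>")
  case True
  have "unit_vec n 0 ~= (0v n :: complex vec)" using less.prems(2) by simp
  moreover have "EX c. \<rho> x *v unit_vec n 0 = c *s unit_vec n 0" if "x : T" for x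
   using solvable_scalar[OF R less.prems(2) True less.prems(3) that] unfolding scalar_mat_def
   by (auto simp: smult_one_mult_vec)
  ultimately show ?thesis using fin_idx_refl[OF rD(1)] by (intro exI[of _ T] exI[of _ "unit_vec n 0"]) simp
 next
  case False
  then obtain K A w where K: "fin_idx K T" "A <= T" and "EX v:wspace n \<rho> A w. v ~= 0v n"
   and inv: "ALL x:K. ALL v:wspace n \<rho> A w. \<rho> x *v v : wspace n \<rho> A w"
   and ne: "wspace n \<rho> A w ~= carrier_vec n"
   unfolding strongly_irred_def not_all not_imp by (elim exE conjE) (rule that)
  then obtain u where u: "u : wspace n \<rho> A w" "u ~= 0v n" by blast
  have "subsp n (wspace n \<rho> A w)" using rD(2) K(2) by (intro subsp_wspace) auto
  from proper_subspace_basis[OF this u ne] obtain k M where k: "0 < k" "k < n" "mat_inj n k M"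
   and M: "!!v. v : wspace n \<rho> A w <-> (EX w:carrier_vec k. v = M *v w)" by auto
  have Mc: "M : carrier_mat n k" using k unfolding mat_inj_def by simp
  have K': "subgroup K G" "K <= T" using K(1) unfolding fin_idx_def by auto
  have RK: "rep n K \<rho>" by (rule rep_mono[OF R K'])
  have "EX z:carrier_vec k. \<rho> x *v (M *v w') = M *v z" if "x : K" "w' : carrier_vec k" for x w'
  proof -
   have "M *v w' : wspace n \<rho> A w" using M that(2) by auto
   thus ?thesis using inv that(1) M by simp
  qed
  from sub_rep[OF RK k(3) this] obtain \<rho>' where r: "rep k K \<rho>'" "!!x. x : K ==> \<rho> x * M = M * \<rho>' x" by auto
  obtain L v where L: "fin_idx L K" "v : carrier_vec k" "v ~= 0v k" "!!x. x : L ==> EX c. \<rho>' x *v v = c *s v"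
   using less.IH[OF k(2) r(1) k(1) fin_idx_derived[OF K(1) less.prems(3)]] by auto
  have LK: "L <= K" using L(1) unfolding fin_idx_def by simp
  have "EX c. \<rho> x *v (M *v v) = c *s (M *v v)" if x: "x : L" for x
  proof -
   have xK: "x : K" using x LK by blast
   obtain c where c: "\<rho>' x *v v = c *s v" using L(4)[OF x] by blast
   have "\<rho> x *v (M *v v) = (\<rho> x * M) *v v" by (rule assoc_mult_mat_vec[symmetric, OF repD(2)[OF RK xK] Mc L(2)])
   also have "... = M *v (c *s v)" unfolding r(2)[OF xK] c[symmetric] by (rule assoc_mult_mat_vec[OF Mc repD(2)[OF r(1) xK] L(2)])
   finally show ?thesis using mult_mat_vec[OF Mc L(2)] by auto
  qed
  moreover have "M *v v ~= 0v n" using k(3) L(2,3) unfolding mat_inj_def by blast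
  ultimately show ?thesis using fin_idx_trans[OF L(1) K(1)] mult_mat_vec_carrier[OF Mc L(2)]
   by (intro exI[of _ L] exI[of _ "M *v v"]) simp
 qed
qed

text \<open>Each common eigenvector may cost a further passage to a subgroup of finite index, but
  only \<open>n\<close> of them are split off.\<close>

lemma malcev:
 fixes \<rho> :: "'a => complex mat"
 assumes "rep n T \<rho>" "(derived G ^^ l) T = {\<one>}"
 shows "EX K g h. fin_idx K T & inv_pair n g h & (ALL x:K. utri n (g * \<rho> x * h))"
 using assms
proof (induction n arbitrary: T \<rho>)
 case 0
 have "inv_pair 0 (1m 0) (1m 0 :: complex mat)" unfolding inv_pair_def by auto
 moreover have "utri 0 (1m 0 * \<rho> x * 1m 0)" if "x : T" for x
  using repD(2)[OF 0(1) that] unfolding utri_def by simp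
 ultimately show ?case using fin_idx_refl[OF repD(1)[OF 0(1)]] by blast
next
 case (Suc n)
 obtain K v where K: "fin_idx K T" and v: "v : carrier_vec (Suc n)" "v ~= 0v (Suc n)"
  "!!x. x : K ==> EX c. \<rho> x *v v = c *s v"
  using common_eigen_solvable[OF Suc.prems(1) _ Suc.prems(2)] by auto
 have K': "subgroup K G" "K <= T" using K(1) unfolding fin_idx_def by auto
 have RK: "rep (Suc n) K \<rho>" by (rule rep_mono[OF Suc.prems(1) K'])
 note rD = repD[OF RK]
 obtain g h where gh: "inv_pair (Suc n) g h" and c0: "!!A. A : sqm (Suc n) ==>
  EX c. A *v v = c *s v ==> col0 n (g * A * h)"
  using deflate[OF v(1,2)] by metis
 have ghc: "g : sqm (Suc n)" "h : sqm (Suc n)" "g * h = 1m (Suc n)" "h * g = 1m (Suc n)"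
  using gh unfolding inv_pair_def by auto
 have c0': "col0 n (g * \<rho> x * h)" if "x : K" for x using c0[OF rD(2)[OF that] v(3)[OF that]] .
 define \<sigma> where "\<sigma> x = low n (g * \<rho> x * h)" for x
 have "rep n K \<sigma>" unfolding rep_def
 proof (intro conjI ballI)
  show "subgroup K G" by (rule K')
  show "\<sigma> \<one> = 1m n" unfolding \<sigma>_def rD(4) using ghc by (simp add: low_one)
  fix x assume x: "x : K"
  show "\<sigma> x : sqm n" unfolding \<sigma>_def by simp
  fix y assume y: "y : K"
  have "(g * \<rho> x * h) * (g * \<rho> y * h) = g * \<rho> x * (h * g) * \<rho> y * h"
   using ghc(1,2) rD(2)[OF x] rD(2)[OF y] by (simp add: assoc_mult_mat[of _ "Suc n" "Suc n" _ "Suc n" _ "Suc n"] mult_carrier_mat[of _ "Suc n" "Suc n" _ "Suc n"])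
  also have "... = g * \<rho> (x ** y) * h" unfolding ghc(4)
   using ghc(1,2) rD(2)[OF x] rD(2)[OF y] rD(3)[OF x y] by (simp add: assoc_mult_mat[of _ "Suc n" "Suc n" _ "Suc n" _ "Suc n"] mult_carrier_mat[of _ "Suc n" "Suc n" _ "Suc n"])
  finally show "\<sigma> (x ** y) = \<sigma> x * \<sigma> y" unfolding \<sigma>_def using low_mult(1)[OF c0'[OF x] c0'[OF y]] by simp
 qed
 from Suc.IH[OF this fin_idx_derived[OF K Suc.prems(2)]] obtain L g' h'
  where L: "fin_idx L K" "inv_pair n g' h'" "!!x. x : L ==> utri n (g' * \<sigma> x * h')" by auto
 have LK: "x : K" if "x : L" for x using L(1) that unfolding fin_idx_def by auto
 have "utri (Suc n) ((emb n g' * g) * \<rho> x * (h * emb n h'))" if "x : L" for x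
  using col0_utri[OF c0'[OF LK[OF that]] L(2)] L(3)[OF that] conj_conj[OF gh inv_pair_emb[OF L(2)] rD(2)[OF LK[OF that]]]
  unfolding \<sigma>_def by simp
 moreover have "inv_pair (Suc n) (emb n g' * g) (h * emb n h')"
  by (rule inv_pair_mult[OF inv_pair_emb[OF L(2)] gh])
 ultimately show ?case using fin_idx_trans[OF L(1) K] by blast
qed

lemma solvable_derived_trivial:
 assumes N: "subgroup N G" and sol: "solvable (G(|carrier := N|))"
 shows "EX l. (derived G ^^ l) N = {\<one>}"
proof -
 interpret N: group "G(|carrier := N|)" by (rule subgroup_imp_group[OF N])
 obtain l where l: "(derived (G(|carrier := N|)) ^^ l) N = {\<one>}"
  using sol unfolding N.solvable_iff_trivial_derived_seq by auto
 have "(derived (G(|carrier := N|)) ^^ j) N = (derived G ^^ j) N & (derived G ^^ j) N <= N" for j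
  by (induction j) (use derived_consistent[OF _ N] derived_incl[OF _ N] in auto)
 thus ?thesis using l by auto
qed

end

subsection \<open>Algebraic integers and eigenvalues\<close>

definition int_mat :: "'a :: ring_1 mat => bool" where
 "int_mat A <-> (ALL i<dim_row A. ALL j<dim_col A. A $$ (i, j) : \<int>)"

lemma algebraic_int_eigenvalue:
 assumes A: "A : sqm n" "int_mat A" and l: "eigenvalue A (l :: complex)"
 shows "algebraic_int l"
proof -
 define B where "B = map_mat floor (map_mat Re A)"
 have B: "B : sqm n" using A unfolding B_def by simp
 have AB: "A = map_mat of_int B"
 proof (rule eq_matI)
  fix i j assume "i < dim_row (map_mat of_int B)" "j < dim_col (map_mat of_int B)"
  hence ij: "i < n" "j < n" using B by auto
  hence "A $$ (i, j) : \<int>" using A unfolding int_mat_def by simp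
  then obtain z where "A $$ (i, j) = of_int z" by (rule Ints_cases)
  thus "A $$ (i, j) = map_mat of_int B $$ (i, j)" using ij A unfolding B_def by simp
 qed (use A B in auto)
 have "poly (char_poly A) l = 0" using l eigenvalue_root_char_poly[OF A(1)] by simp
 hence "poly (map_poly of_int (char_poly B)) l = 0" unfolding AB of_int_hom.char_poly_hom[OF B] .
 moreover have "lead_coeff (char_poly B) = 1" using degree_monic_char_poly[OF B] by simp
 ultimately show ?thesis unfolding algebraic_int_altdef_ipoly by blast
qed

text \<open>\<open>v\<close> is an eigenvector of an integral matrix for the eigenvalue
  \<open>z\<close>.\<close>

lemma algebraic_int_family:
 fixes v :: "'i => complex"
 assumes I: "finite I" and nz: "EX i:I. v i ~= 0"
  and C: "!!i. i : I ==> z * v i = (SUM j:I. C i j * v j)" "!!i j. C i j : \<int>"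
 shows "algebraic_int z"
proof -
 define n where "n = card I"
 obtain e where e: "bij_betw e {..<n} I"
  using ex_bij_betw_nat_finite[OF I] unfolding n_def by (auto simp: atLeast0LessThan)
 define A where "A = mat n n (%(i, j). C (e i) (e j))"
 define w where "w = vec n (%i. v (e i))"
 have A: "A : sqm n" and w: "w : carrier_vec n" unfolding A_def w_def by auto
 have eI: "e i : I" if "i < n" for i using e that unfolding bij_betw_def by auto
 have "A *v w = z *s w"
 proof (rule eq_vecI)
  fix i assume "i < dim_vec (z *s w)"
  hence i: "i < n" using w by simp
  have "(A *v w) $ i = (SUM j<n. C (e i) (e j) * v (e j))"
   unfolding mult_mat_vec_index[OF A w i] using i unfolding A_def w_def by simp
  also have "... = (SUM j:I. C (e i) j * v j)" by (rule sum.reindex_bij_betw[OF e])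
  also have "... = z * v (e i)" using C(1)[OF eI[OF i]] by simp
  finally show "(A *v w) $ i = (z *s w) $ i" using i unfolding w_def by simp
 qed (use A w in auto)
 moreover have "w ~= 0v n"
 proof
  assume w0: "w = 0v n"
  obtain i where i: "i : I" "v i ~= 0" using nz by blast
  obtain k where k: "k < n" "e k = i" using e i(1) unfolding bij_betw_def by auto
  have "w $ k = 0" using w0 k by simp
  thus False using i k unfolding w_def by simp
 qed
 ultimately have "eigenvalue A z" using w A unfolding eigenvalue_def eigenvector_def by auto
 moreover have "int_mat A" unfolding int_mat_def A_def using C(2) by simp
 ultimately show ?thesis using algebraic_int_eigenvalue[OF A] by blast
qed

lemma algebraic_int_powers:
 assumes "algebraic_int (x :: complex)"
 shows "EX a C. a > 0 & (ALL i<a. x * x ^ i = (SUM j<a. C i j * x ^ j)) & (ALL i j. C i j : \<int>)"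
proof -
 from assms obtain p where p: "lead_coeff p = 1" "!!i. coeff p i : \<int>" "poly p x = 0"
  by (auto elim: algebraic_int.cases)
 define a where "a = degree p"
 have a: "a > 0"
 proof (rule ccontr)
  assume "~ a > 0"
  hence "p = [:1:]" using p(1) degree_0_id[of p] unfolding a_def by simp
  thus False using p(3) by simp
 qed
 \<comment> \<open>The companion matrix: multiplication by \<open>x\<close> shifts the powers, and
   the top power is rewritten by the monic equation.\<close>
 define C where "C i j = (if Suc i = a then - coeff p j else if j = Suc i then 1 else 0)" for i j
 have "x * x ^ i = (SUM j<a. C i j * x ^ j)" if i: "i < a" for i
 proof (cases "Suc i = a")
  case True
  have "0 = (SUM j<=a. coeff p j * x ^ j)" using p(3) unfolding poly_altdef a_def by simp
  also have "... = x ^ a + (SUM j<a. coeff p j * x ^ j)"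
   using p(1) unfolding lessThan_Suc_atMost[symmetric] a_def by simp
  finally have "x ^ a = - (SUM j<a. coeff p j * x ^ j)" by (simp add: eq_neg_iff_add_eq_0)
  thus ?thesis using True unfolding C_def by (auto simp: sum_negf)
 next
  case False
  hence "(SUM j<a. C i j * x ^ j) = (SUM j<a. if j = Suc i then x ^ j else 0)"
   unfolding C_def by (intro sum.cong) auto
  also have "... = x ^ Suc i" using i False by (subst sum.delta) auto
  finally show ?thesis by simp
 qed
 moreover have "C i j : \<int>" for i j using p(2) unfolding C_def by simp
 ultimately show ?thesis using a by blast
qed

text \<open>The products \<open>x ^ i * y ^ j\<close> form a family on which \<open>x + y\<close>
  and \<open>x * y\<close> act with integral coefficients built from the two companion
  matrices.\<close>

lemma algebraic_int_plus_times:
 assumes "algebraic_int (x :: complex)" "algebraic_int y"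
 shows "algebraic_int (x + y)" "algebraic_int (x * y)"
proof -
 obtain a C where a: "a > 0" "!!i. i < a ==> x * x ^ i = (SUM j<a. C i j * x ^ j)" "!!i j. C i j : \<int>"
  using algebraic_int_powers[OF assms(1)] by blast
 obtain b D where b: "b > 0" "!!i. i < b ==> y * y ^ i = (SUM j<b. D i j * y ^ j)" "!!i j. D i j : \<int>"
  using algebraic_int_powers[OF assms(2)] by blast
 let ?I = "{..<a} \<times> {..<b}"
 define v where "v p = x ^ fst p * y ^ snd p" for p
 have nz: "EX p:?I. v p ~= 0" using a(1) b(1) by (intro bexI[of _ "(0, 0)"]) (auto simp: v_def)
 show "algebraic_int (x * y)"
 proof (rule algebraic_int_family[of ?I v _ "%p q. C (fst p) (fst q) * D (snd p) (snd q)"])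
  fix p assume p: "p : ?I"
  have "x * y * v p = (x * x ^ fst p) * (y * y ^ snd p)" unfolding v_def by simp
  also have "... = (SUM i<a. SUM j<b. (C (fst p) i * x ^ i) * (D (snd p) j * y ^ j))"
   using p a(2)[of "fst p"] b(2)[of "snd p"] by (auto simp: sum_product)
  also have "... = (SUM q:?I. C (fst p) (fst q) * D (snd p) (snd q) * v q)"
   unfolding sum.cartesian_product v_def by (intro sum.cong) auto
  finally show "x * y * v p = ..." .
 qed (use nz a(3) b(3) in auto)
 show "algebraic_int (x + y)"
 proof (rule algebraic_int_family[of ?I v _ "%p q. (if snd q = snd p then C (fst p) (fst q) else 0) +
   (if fst q = fst p then D (snd p) (snd q) else 0)"])
  fix p assume p: "p : ?I"
  have pe: "fst p < a" "snd p < b" using p by auto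
  have "(SUM q:?I. ((if snd q = snd p then C (fst p) (fst q) else 0) + (if fst q = fst p then D (snd p) (snd q) else 0)) * v q)
   = (SUM i<a. SUM j<b. (if j = snd p then C (fst p) i * x ^ i * y ^ j else 0)) +
    (SUM i<a. SUM j<b. (if i = fst p then D (snd p) j * x ^ i * y ^ j else 0))"
   unfolding sum.cartesian_product sum.distrib[symmetric] v_def by (intro sum.cong) (auto simp: algebra_simps)
  also have "(SUM i<a. SUM j<b. (if j = snd p then C (fst p) i * x ^ i * y ^ j else 0)) = x * v p"
   unfolding v_def using pe a(2)[OF pe(1)] by (simp add: sum.delta sum_distrib_right mult.assoc[symmetric])
  also have "(SUM i<a. SUM j<b. (if i = fst p then D (snd p) j * x ^ i * y ^ j else 0)) =
    (SUM j<b. D (snd p) j * x ^ fst p * y ^ j)"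
   by (subst sum.swap) (use pe in "simp add: sum.delta")
  also have "... = x ^ fst p * (SUM j<b. D (snd p) j * y ^ j)" by (simp add: sum_distrib_left mult_ac)
  also have "... = y * v p" unfolding b(2)[OF pe(2), symmetric] v_def by simp
  finally show "(x + y) * v p = (SUM q:?I. ((if snd q = snd p then C (fst p) (fst q) else 0) + (if fst q = fst p then D (snd p) (snd q) else 0)) * v q)"
   by (simp add: algebra_simps)
 qed (use nz a(3) b(3) in auto)
qed

lemma algebraic_int_sum_list: "(!!x. x : set xs ==> algebraic_int (f x :: complex)) ==> algebraic_int (SUM x<-xs. f x)"
 by (induction xs) (auto intro: algebraic_int_plus_times)

lemma algebraic_int_power: "algebraic_int (x :: complex) ==> algebraic_int (x ^ k)"
 by (induction k) (auto intro: algebraic_int_plus_times int_imp_algebraic_int)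

lemma algebraic_int_of_power:
 assumes "algebraic_int ((x :: complex) ^ m)" "m > 0"
 shows "algebraic_int x"
proof (rule algebraic_int_root[OF assms(1), of "monom 1 m"])
 show "poly (monom 1 m) x = x ^ m" by (simp add: poly_monom)
 show "ALL i. coeff (monom 1 m :: complex poly) i : \<int>" by simp
 show "lead_coeff (monom 1 m :: complex poly) = 1" "degree (monom 1 m :: complex poly) > 0"
  using assms(2) by (simp_all add: degree_monom_eq)
qed

definition mtr :: "nat => 'a :: comm_ring_1 mat => 'a" where
 "mtr n A = (SUM i<n. A $$ (i, i))"

lemma mtr_comm:
 assumes "A : sqm n" "B : sqm n"
 shows "mtr n (A * B) = mtr n (B * A)"
proof -
 have "mtr n (A * B) = (SUM i<n. SUM k<n. A $$ (i, k) * B $$ (k, i))"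
  unfolding mtr_def using assms by (intro sum.cong refl mat_mult_index) auto
 also have "... = (SUM k<n. SUM i<n. B $$ (k, i) * A $$ (i, k))"
  by (subst sum.swap) (simp add: mult.commute)
 also have "... = mtr n (B * A)"
  unfolding mtr_def using assms by (intro sum.cong refl mat_mult_index[symmetric]) auto
 finally show ?thesis .
qed

lemma utri_mult:
 assumes "utri n A" "utri n B"
 shows "utri n (A * B)" "i < n ==> (A * B) $$ (i, i) = A $$ (i, i) * B $$ (i, i)"
proof -
 have c: "A : sqm n" "B : sqm n" using assms unfolding utri_def by auto
 have z: "A $$ (i, k) * B $$ (k, j) = 0" if "i < n" "k < n" "j < n" "j <= i" "k ~= i | j < i" for i j k
  using assms that unfolding utri_def by (cases "k < i") (auto simp: not_less)
 show "utri n (A * B)" unfolding utri_def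
 proof (intro conjI allI impI)
  fix i j assume "i < n" "j < i"
  thus "(A * B) $$ (i, j) = 0" using mat_mult_index[OF c, of i j] z[of i _ j] by (simp add: sum.neutral)
 qed (use c in simp)
 assume i: "i < n"
 have "(A * B) $$ (i, i) = (SUM k<n. if k = i then A $$ (i, i) * B $$ (i, i) else 0)"
  unfolding mat_mult_index[OF c i i] using z[OF i _ i] by (intro sum.cong) auto
 thus "(A * B) $$ (i, i) = A $$ (i, i) * B $$ (i, i)" using i by simp
qed

lemma utri_one: "utri n (1m n)" unfolding utri_def by auto

lemma utri_pow:
 assumes "utri n A"
 shows "utri n (A ^m k) & (ALL i<n. (A ^m k) $$ (i, i) = A $$ (i, i) ^ k)"
proof (induction k)
 case 0
 show ?case using utri_one assms by (auto simp: utri_def)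
next
 case (Suc k)
 thus ?case using utri_mult[of n "A ^m k" A] assms by simp
qed

text \<open>Schur's triangular form lists the eigenvalues with multiplicity, and the trace of a
  power is a power sum of its diagonal.\<close>

lemma eigenvalue_list:
 assumes A: "A : sqm n"
 shows "EX es. length es = n & (ALL l. eigenvalue A (l :: complex) <-> l : set es) &
  (ALL k. mtr n (A ^m k) = (SUM l<-es. l ^ k))"
proof -
 obtain es where es: "char_poly A = (PROD a<-es. [:- a, 1:])" "length es = n"
  using char_poly_factorized[OF A] by blast
 obtain B P Q where "schur_decomposition A es = (B, P, Q)" by (metis prod_cases3)
 from schur_decomposition[OF A es(1) this]
 have w: "similar_mat_wit A B P Q" "upper_triangular B" "diag_mat B = es" by auto
 note wD = similar_mat_witD2[OF A w(1)]
 have B: "utri n B" using w(2) wD(5) unfolding utri_def upper_triangular_def by auto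
 have "mtr n (A ^m k) = (SUM l<-es. l ^ k)" for k
 proof -
  have Bk: "B ^m k : sqm n" using wD(5) by simp
  have "A ^m k = P * (B ^m k) * Q" by (rule similar_mat_wit_pow_id[OF w(1)])
  hence "mtr n (A ^m k) = mtr n (Q * (P * (B ^m k)))"
   using mtr_comm[of "P * (B ^m k)" n Q] wD Bk by simp
  also have "Q * (P * (B ^m k)) = B ^m k"
   using assoc_mult_mat[OF wD(7,6) Bk, symmetric] wD(2) left_mult_one_mat[OF Bk] by simp
  also have "mtr n (B ^m k) = (SUM i<n. B $$ (i, i) ^ k)"
   unfolding mtr_def using utri_pow[OF B, of k] by simp
  also have "... = (SUM l<-es. l ^ k)"
   unfolding w(3)[symmetric] diag_mat_def using wD(5) by (simp add: interv_sum_list_conv_sum_set_nat atLeast0LessThan comp_def)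
  finally show ?thesis .
 qed
 moreover have "eigenvalue A l <-> l : set es" for l
  unfolding eigenvalue_root_char_poly[OF A] es(1) by (induction es) auto
 ultimately show ?thesis using es(2) by blast
qed

lemma utri_eigenvalue:
 assumes "inv_pair n g h" "A : sqm n" "utri n (g * A * h)"
 shows "eigenvalue A (l :: complex) <-> (EX i<n. l = (g * A * h) $$ (i, i))"
proof -
 let ?B = "g * A * h"
 have c: "g : sqm n" "h : sqm n" "g * h = 1m n" "h * g = 1m n" using assms(1) unfolding inv_pair_def by auto
 have B: "?B : sqm n" using c assms(2) by simp
 have "similar_mat_wit ?B A g h" unfolding similar_mat_wit_def Let_def using c assms(2) by auto
 hence "similar_mat ?B A" unfolding similar_mat_def by blast
 hence "char_poly A = char_poly ?B" by (simp add: char_poly_similar)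
 also have "... = (PROD a<-diag_mat ?B. [:- a, 1:])"
  by (rule char_poly_upper_triangular[OF B]) (use assms(3) B in "auto simp: utri_def")
 finally have e: "char_poly A = (PROD a<-diag_mat ?B. [:- a, 1:])" .
 have "poly (PROD a<-es. [:- a, 1:]) l = 0 <-> l : set es" for es by (induction es) auto
 hence "eigenvalue A l <-> l : set (diag_mat ?B)" unfolding eigenvalue_root_char_poly[OF assms(2)] e .
 also have "... <-> (EX i<n. l = ?B $$ (i, i))" unfolding diag_mat_def carrier_matD[OF B] by auto
 finally show ?thesis .
qed

section \<open>Simultaneous approximation and bounds on heights\<close>

lemma same_div_close:
 assumes "a div M = b div M" "(M :: int) > 0"
 shows "\<bar>b - a\<bar> < M"
proof -
 have "b - a = b mod M - a mod M" using assms(1) by (metis add_diff_cancel_left mult_div_mod_eq)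
 thus ?thesis using pos_mod_bound[OF assms(2), of a] pos_mod_bound[OF assms(2), of b]
  pos_mod_sign[OF assms(2), of a] pos_mod_sign[OF assms(2), of b] by linarith
qed

text \<open>Approximation of the fractions \<open>p ! i / M\<close> with a common multiplier,
  cleared of denominators. Among the multiples \<open>0\<close> to \<open>Q ^ length p\<close> two
  lie in the same box; \<open>F\<close> is the difference of their multipliers.\<close>

lemma dirichlet:
 fixes p :: "int list" and M :: int and Q :: nat
 assumes M: "M > 0" and Q: "Q > 0"
 shows "EX F g. 1 <= F & F <= int Q ^ length p & length g = length p &
  (ALL i<length p. int Q * \<bar>F * p ! i - M * g ! i\<bar> < M)"
proof -
 \<comment> \<open>In each coordinate, the index among \<open>Q\<close> equal intervals of the
   fractional part of \<open>q * x / M\<close>.\<close>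
 define f where "f q = map (%x. nat (int Q * ((int q * x) mod M) div M)) p" for q :: nat
 have "f q : {xs. set xs <= {..<Q} & length xs = length p}" for q
 proof -
  have "nat (int Q * (y mod M) div M) < Q" for y
  proof -
   have "int Q * (y mod M) < M * int Q" using M Q by (simp add: mult.commute)
   hence "int Q * (y mod M) div M < int Q"
    using M mult_div_mod_eq[of M "int Q * (y mod M)"] pos_mod_sign[OF M, of "int Q * (y mod M)"]
    by (metis add.commute add_strict_increasing2 le_add_same_cancel1 mult_less_cancel_left_pos order_le_less_trans)
   thus ?thesis using Q by (simp add: nat_less_iff)
  qed
  thus ?thesis unfolding f_def by auto
 qed
 hence "card (f ` {..Q ^ length p}) <= Q ^ length p"
  using card_mono[of "{xs. set xs <= {..<Q} & length xs = length p}" "f ` {..Q ^ length p}"]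
  by (simp add: card_lists_length_eq finite_lists_length_eq image_subset_iff)
 hence "~ inj_on f {..Q ^ length p}" by (intro pigeonhole) simp
 then obtain a b where "a <= Q ^ length p" "b <= Q ^ length p" "a ~= b" "f a = f b"
  unfolding inj_on_def by auto
 then obtain a b where ab: "a < b" "b <= Q ^ length p" "f a = f b" by (metis nat_neq_iff)
 let ?F = "int b - int a" and ?g = "map (%x. (int b * x) div M - (int a * x) div M) p"
 have "int Q * \<bar>?F * p ! i - M * ?g ! i\<bar> < M" if i: "i < length p" for i
 proof -
  let ?x = "(int a * p ! i) mod M" and ?y = "(int b * p ! i) mod M"
  have "nat (int Q * ?x div M) = nat (int Q * ?y div M)"
   using arg_cong[OF ab(3), of "%l. l ! i"] i unfolding f_def by simp
  moreover have "int Q * ?x div M >= 0" "int Q * ?y div M >= 0"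
   using M by (auto intro!: div_int_pos_iff[THEN iffD2])
  ultimately have e: "int Q * ?x div M = int Q * ?y div M" by linarith
  have "\<bar>int Q * ?y - int Q * ?x\<bar> < M"
   by (rule same_div_close[OF e M])
  moreover have "?F * p ! i - M * ?g ! i = ?y - ?x"
  proof -
   have "?F * p ! i - M * ?g ! i = (int b * p ! i - M * (int b * p ! i div M)) - (int a * p ! i - M * (int a * p ! i div M))"
    using i by (simp add: algebra_simps)
   thus ?thesis by (simp add: minus_mult_div_eq_mod)
  qed
  ultimately show ?thesis by (simp add: right_diff_distrib[symmetric] abs_mult)
 qed
 moreover have "?F <= int Q ^ length p"
 proof -
  have "int b - int a <= int (Q ^ length p)" using ab by linarith
  thus ?thesis unfolding of_nat_power .
 qed
 ultimately show ?thesis using ab(1) by (intro exI[of _ ?F] exI[of _ ?g]) auto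
qed

text \<open>Denominators and row sums are bounded in such a way that the bounds multiply along
  products; \<open>k\<close> plays the role of a word length in generators with constant
  \<open>D\<close>.\<close>

definition bnd :: "nat => nat => nat => complex mat => bool" where
 "bnd n D k A <-> A : sqm n & int_mat (of_nat D ^ k *m A) &
   (ALL i<n. (SUM j<n. cmod (A $$ (i, j))) <= real (n * D) ^ k)"

lemma bndD:
 assumes "bnd n D k A"
 shows "A : sqm n" "i < n ==> j < n ==> of_nat D ^ k * A $$ (i, j) : \<int>"
  "i < n ==> (SUM j<n. cmod (A $$ (i, j))) <= real (n * D) ^ k"
 using assms unfolding bnd_def int_mat_def by auto

lemma bnd_one: "bnd n D 0 (1m n)"
proof -
 have "(SUM j<n. cmod ((1m n :: complex mat) $$ (i, j))) = (SUM j<n. if j = i then 1 else 0)" if "i < n" for i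
  using that by (intro sum.cong) auto
 thus ?thesis unfolding bnd_def int_mat_def by auto
qed

lemma bnd_mult:
 assumes A: "bnd n D k A" and B: "bnd n D l B"
 shows "bnd n D (k + l) (A * B)"
proof -
 note a = bndD[OF A] and b = bndD[OF B]
 have "of_nat D ^ (k + l) * (A * B) $$ (i, j) : \<int>" if ij: "i < n" "j < n" for i j
 proof -
  have "of_nat D ^ (k + l) * (A * B) $$ (i, j) = (SUM m<n. (of_nat D ^ k * A $$ (i, m)) * (of_nat D ^ l * B $$ (m, j)))"
   unfolding mat_mult_index[OF a(1) b(1) ij] by (simp add: sum_distrib_left power_add mult_ac)
  also have "... : \<int>" by (intro Ints_sum Ints_mult[OF a(2) b(2)]) (use ij in auto)
  finally show ?thesis .
 qed
 moreover have "(SUM j<n. cmod ((A * B) $$ (i, j))) <= real (n * D) ^ (k + l)" if i: "i < n" for i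
 proof -
  have "(SUM j<n. cmod ((A * B) $$ (i, j))) <= (SUM j<n. SUM m<n. cmod (A $$ (i, m)) * cmod (B $$ (m, j)))"
   using mat_mult_index[OF a(1) b(1) i]
   by (intro sum_mono) (auto intro!: order_trans[OF norm_sum] simp: norm_mult)
  also have "... = (SUM m<n. cmod (A $$ (i, m)) * (SUM j<n. cmod (B $$ (m, j))))"
   by (subst sum.swap) (simp add: sum_distrib_left)
  also have "... <= (SUM m<n. cmod (A $$ (i, m)) * real (n * D) ^ l)"
   using b(3) by (intro sum_mono mult_left_mono) auto
  also have "... = (SUM m<n. cmod (A $$ (i, m))) * real (n * D) ^ l" by (simp add: sum_distrib_right)
  also have "... <= real (n * D) ^ k * real (n * D) ^ l" using a(3)[OF i] by (intro mult_right_mono) auto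
  finally show ?thesis by (simp add: power_add)
 qed
 ultimately show ?thesis using a(1) b(1) unfolding bnd_def int_mat_def by auto
qed

text \<open>The modulus is estimated at a coordinate of the eigenvector of largest modulus;
  integrality comes from the same eigenvector relations with denominators cleared.\<close>

lemma bnd_eigenvalue:
 assumes A: "bnd n D k A" and l: "eigenvalue A l"
 shows "cmod l <= real (n * D) ^ k" "algebraic_int (of_nat D ^ k * l)"
proof -
 note a = bndD[OF A]
 obtain v where v: "v : carrier_vec n" "v ~= 0v n" "A *v v = l *s v"
  using l a(1) unfolding eigenvalue_def eigenvector_def by auto
 have ev: "l * v $ i = (SUM j<n. A $$ (i, j) * v $ j)" if "i < n" for i
  using mult_mat_vec_index[OF a(1) v(1) that] v(1,3) that by simp
 obtain i0 where "i0 < n" "v $ i0 ~= 0" using v(1,2) by (metis eq_vecI carrier_vecD index_zero_vec)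
 define S where "S = (%i. cmod (v $ i)) ` {..<n}"
 have S: "finite S" "S ~= {}" using \<open>i0 < n\<close> unfolding S_def by auto
 obtain i where i: "i < n" "cmod (v $ i) = Max S" using Max_in[OF S] unfolding S_def by auto
 have "cmod (v $ j) <= cmod (v $ i)" if "j < n" for j
  unfolding i(2) using that by (intro Max_ge[OF S(1)]) (auto simp: S_def)
 note i = i(1) this
 have pos: "cmod (v $ i) > 0" by (rule order.strict_trans2[OF _ i(2)[OF \<open>i0 < n\<close>]]) (use \<open>v $ i0 ~= 0\<close> in simp)
 have "cmod l * cmod (v $ i) = cmod (SUM j<n. A $$ (i, j) * v $ j)"
  unfolding ev[OF i(1), symmetric] by (simp add: norm_mult)
 also have "... <= (SUM j<n. cmod (A $$ (i, j)) * cmod (v $ i))"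
  using i(2) by (intro order_trans[OF norm_sum] sum_mono) (auto simp: norm_mult intro!: mult_left_mono)
 also have "... = (SUM j<n. cmod (A $$ (i, j))) * cmod (v $ i)" by (simp add: sum_distrib_right)
 also have "... <= real (n * D) ^ k * cmod (v $ i)" using a(3)[OF i(1)] by (intro mult_right_mono) auto
 finally show "cmod l <= real (n * D) ^ k" using pos by simp
 show "algebraic_int (of_nat D ^ k * l)"
 proof (rule algebraic_int_family[of "{..<n}" "%i. v $ i" _ "%i j. if i < n & j < n then of_nat D ^ k * A $$ (i, j) else 0"])
  fix i assume "i : {..<n}"
  thus "of_nat D ^ k * l * v $ i = (SUM j<n. (if i < n & j < n then of_nat D ^ k * A $$ (i, j) else 0) * v $ j)"
   using ev[of i] by (simp add: mult.assoc sum_distrib_left)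
 qed (use a(2) \<open>i0 < n\<close> \<open>v $ i0 ~= 0\<close> in auto)
qed

text \<open>Since \<open>f / m\<close> is at most \<open>r / Q\<close>, taking \<open>m\<close>-th
  roots of the bounds for \<open>l ^ m\<close> brings them close to 1. The first factor
  \<open>n\<close> of \<open>Q\<close> is spent on \<open>(1 + 1/n) ^ n >= 2\<close>, the factor
  \<open>n * D * r * J\<close> on absorbing \<open>R ^ (r * J)\<close> into a power of 2.\<close>

lemma torus_trace:
 fixes n D r J j m f :: nat
 defines "Q \<equiv> n * (n * D * r * J)"
 assumes pos: "n > 0" "D > 0" "r > 0" "m > 0" and j: "0 < j" "j <= J"
  and c: "c : sqm n" and rat: "mtr n (c ^m j) : \<rat>"
  and f: "Q * f <= r * m"
  and W: "!!l. eigenvalue c l ==> EX W. bnd n D f W & eigenvalue W (l ^ m)"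
 shows "mtr n (c ^m j) : \<int> & cmod (mtr n (c ^m j)) <= real n"
proof -
 define R where "R = real (n * D)"
 have R1: "R >= 1" using pos unfolding R_def by (simp add: Suc_le_eq flip: of_nat_mult)
 have J: "J > 0" using j by simp
 have "R < 2 ^ (n * D)" unfolding R_def by (rule of_nat_less_two_power)
 hence "R ^ (r * m * J) < (2 ^ (n * D)) ^ (r * m * J)" using R1 pos J by (intro power_strict_mono) auto
 also have "... = 2 ^ (m * (n * D * r * J))" by (simp add: power_mult[symmetric] mult_ac)
 \<comment> \<open>Both the estimate of the size and that of the denominator end in a contradiction
   to this strict inequality.\<close>
 finally have key: "R ^ (r * m * J) < 2 ^ (m * (n * D * r * J))" .
 have fjQ: "f * j * Q <= r * m * J" using mult_mono[OF f j(2)] by (simp add: mult_ac)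
 obtain es where es: "length es = n" "!!l. eigenvalue c l <-> l : set es"
  "!!k. mtr n (c ^m k) = (SUM l<-es. l ^ k)" using eigenvalue_list[OF c] by blast
 have small: "cmod (l ^ j) < 1 + 1 / real n" if l: "l : set es" for l
 proof (rule ccontr)
  assume "~ ?thesis"
  hence a: "1 + 1 / real n <= cmod l ^ j" by (simp add: norm_power)
  obtain W where W: "bnd n D f W" "eigenvalue W (l ^ m)" using W es(2) l by blast
  have lm: "cmod l ^ m <= R ^ f" using bnd_eigenvalue(1)[OF W] unfolding R_def by (simp add: norm_power)
  \<comment> \<open>Bernoulli's inequality gives \<open>(1 + 1/n) ^ n >= 2\<close>.\<close>
  have "(2::real) ^ (m * (n * D * r * J)) <= ((1 + 1 / real n) ^ n) ^ (m * (n * D * r * J))"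
   using Bernoulli_inequality[of "1 / real n" n] order_trans[of "- 1" 0 "1 / real n"] pos by (intro power_mono) auto
  also have "... = (1 + 1 / real n) ^ (m * Q)" unfolding Q_def by (simp add: power_mult[symmetric] mult_ac)
  also have "... <= (cmod l ^ j) ^ (m * Q)" using a by (intro power_mono) auto
  also have "... = (cmod l ^ m) ^ (j * Q)" by (simp add: power_mult[symmetric] mult_ac)
  also have "... <= (R ^ f) ^ (j * Q)" using lm by (intro power_mono) auto
  also have "... = R ^ (f * j * Q)" by (simp add: power_mult[symmetric] mult_ac)
  also have "... <= R ^ (r * m * J)" using R1 fjQ by (intro power_increasing) auto
  finally show False using key by simp
 qed
 let ?t = "mtr n (c ^m j)"
 have "cmod (SUM l<-xs. l ^ j) <= (SUM l<-xs. cmod (l ^ j))" for xs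
  by (induction xs) (auto intro: order_trans[OF norm_triangle_ineq])
 hence "cmod ?t <= (SUM l<-es. cmod (l ^ j))" unfolding es(3) by blast
 also have "... < real (length es) * (1 + 1 / real n)"
 proof -
  have "(SUM l<-xs. cmod (l ^ j)) < real (length xs) * (1 + 1 / real n)" if "xs ~= []" "set xs <= set es" for xs
   using that
  proof (induction xs rule: list_nonempty_induct)
   case (cons x xs)
   thus ?case using small[of x] by (simp add: algebra_simps)
  qed (use small in auto)
  thus ?thesis using es(1) pos by auto
 qed
 also have "... = real n + 1" unfolding es(1) using pos by (simp add: field_simps)
 finally have t: "cmod ?t < real n + 1" .
 \<comment> \<open>The \<open>m\<close>-th root of the number that clears the denominator of
   \<open>l ^ (m * j)\<close>. It is the same for all eigenvalues, so it makes their sum an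
   algebraic integer, and its own \<open>m\<close>-th power is rational.\<close>
 define d where "d = complex_of_real (root m (real D ^ (f * j)))"
 have dm: "d ^ m = of_nat D ^ (f * j)"
 proof -
  have "d ^ m = complex_of_real (root m (real D ^ (f * j)) ^ m)" unfolding d_def by simp
  also have "... = of_nat D ^ (f * j)" using pos by simp
  finally show ?thesis .
 qed
 have "algebraic_int (d * l ^ j)" if l: "l : set es" for l
 proof -
  obtain W where W: "bnd n D f W" "eigenvalue W (l ^ m)" using W es(2) l by blast
  have "(d * l ^ j) ^ m = (of_nat D ^ f * l ^ m) ^ j"
   by (simp add: power_mult_distrib dm power_mult[symmetric] mult.commute)
  moreover have "algebraic_int ((of_nat D ^ f * l ^ m) ^ j)" by (rule algebraic_int_power[OF bnd_eigenvalue(2)[OF W]])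
  ultimately have "algebraic_int ((d * l ^ j) ^ m)" by simp
  thus ?thesis using pos(4) by (rule algebraic_int_of_power)
 qed
 hence "algebraic_int (SUM l<-es. d * l ^ j)" by (rule algebraic_int_sum_list)
 hence "algebraic_int (d * ?t)" unfolding es(3) sum_list_const_mult .
 hence "algebraic_int ((d * ?t) ^ m)" by (rule algebraic_int_power)
 hence "algebraic_int (of_nat D ^ (f * j) * ?t ^ m)" by (simp add: power_mult_distrib dm)
 moreover have "of_nat D ^ (f * j) * ?t ^ m : \<rat>" using rat by auto
 ultimately have "of_nat D ^ (f * j) * ?t ^ m : \<int>" by (rule rational_algebraic_int_is_int)
 then obtain z where z: "of_nat D ^ (f * j) * ?t ^ m = of_int z" by (rule Ints_cases)
 obtain u v where uv: "v > 0" "coprime u v" "?t = of_int u / of_int v" using rat by (rule Rats_cases')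
 have "of_nat D ^ (f * j) * (of_int u ^ m) = of_int z * (of_int v :: complex) ^ m"
  using z uv(1) unfolding uv(3) by (simp add: field_simps)
 hence "of_int (int D ^ (f * j) * u ^ m) = (of_int (z * v ^ m) :: complex)" by simp
 hence "int D ^ (f * j) * u ^ m = z * v ^ m" by (simp only: of_int_eq_iff)
 hence "v ^ m dvd int D ^ (f * j) * u ^ m" by simp
 moreover have "coprime (v ^ m) (u ^ m)" using uv(2) by (simp add: coprime_commute)
 ultimately have "v ^ m dvd int D ^ (f * j)" by (simp add: coprime_dvd_mult_left_iff)
 hence le: "v ^ m <= int D ^ (f * j)" using pos by (intro zdvd_imp_le) auto
 \<comment> \<open>With a denominator of at least 2, \<open>2 ^ m\<close> would be at most
   \<open>D ^ (f * j)\<close>, which \<open>key\<close> excludes.\<close>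
 have "v = 1"
 proof (rule ccontr)
  assume "v ~= 1"
  hence v2: "v >= 2" using uv(1) by simp
  have "(2::real) ^ (m * (n * D * r * J)) <= 2 ^ (m * Q)" unfolding Q_def using pos by (intro power_increasing) auto
  also have "... <= of_int v ^ (m * Q)" using v2 by (intro power_mono) auto
  also have "... = of_int (v ^ m) ^ Q" by (simp add: power_mult)
  also have "... <= of_int (int D ^ (f * j)) ^ Q" using le uv(1) by (intro power_mono) (auto simp del: of_int_power)
  also have "... = real D ^ (f * j * Q)" by (simp add: power_mult)
  also have "... <= R ^ (f * j * Q)" unfolding R_def using pos by (intro power_mono) auto
  also have "... <= R ^ (r * m * J)" using R1 fjQ by (intro power_increasing) auto
  finally show False using key by simp
 qed
 hence ti: "?t = of_int u" using uv(3) by simp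
 have "real_of_int \<bar>u\<bar> < real n + 1" using t unfolding ti by simp
 hence "\<bar>u\<bar> <= int n" by linarith
 hence "cmod ?t <= real n" unfolding ti by simp
 thus ?thesis using ti by simp
qed

text \<open>By the pigeonhole principle two windows of consecutive power sums agree; then a Vandermonde
 argument applies.\<close>

lemma kronecker_traces:
 "EX J>0. ALL es :: complex list. length es = n --> 0 ~: set es -->
   (ALL j. 0 < j --> j <= J --> (SUM l<-es. l ^ j) : \<int> & cmod (SUM l<-es. l ^ j) <= real n) -->
   (EX \<delta>>0. ALL l:set es. l ^ \<delta> = 1)"
proof (rule exI[of _ "(2 * n + 1) ^ n + n + 1"], intro conjI allI impI)
 \<comment> \<open>A window of \<open>n\<close> sums takes at most \<open>B\<close> values, as each
   sum is an integer between \<open>- n\<close> and \<open>n\<close>. So two of the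
   \<open>B + 1\<close> windows agree, and no index in them exceeds \<open>B + n\<close>.\<close>
 define B where "B = (2 * n + 1) ^ n"
 fix es :: "complex list"
 assume len: "length es = n" and nz: "0 ~: set es"
  and "ALL j. 0 < j --> j <= (2 * n + 1) ^ n + n + 1 --> (SUM l<-es. l ^ j) : \<int> & cmod (SUM l<-es. l ^ j) <= real n"
 hence tr: "(SUM l<-es. l ^ j) : of_int ` {- int n..int n}" if "0 < j" "j <= B + n" for j
 proof -
  have a: "(SUM l<-es. l ^ j) : \<int>" "cmod (SUM l<-es. l ^ j) <= real n"
   using that \<open>ALL j. _ j\<close> unfolding B_def by auto
  obtain z where z: "(SUM l<-es. l ^ j) = of_int z" using a(1) by (rule Ints_cases)
  have "real_of_int \<bar>z\<bar> <= real n" using a(2) unfolding z by simp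
  hence "z : {- int n..int n}" by auto
  thus ?thesis unfolding z by blast
 qed
 define T where "T = (of_int :: int => complex) ` {- int n..int n}"
 have T: "finite T" "card T <= 2 * n + 1"
  unfolding T_def using card_image_le[of "{- int n..int n}" "of_int :: int => complex"] by simp_all
 define w where "w a = map (%i. SUM l<-es. l ^ (a + Suc i)) [0..<n]" for a
 have "w ` {..B} <= {xs. set xs <= T & length xs = n}"
 proof (intro subsetI, elim imageE, intro CollectI conjI)
  fix x a assume a: "x = w a" "a : {..B}"
  show "length x = n" unfolding a w_def by simp
  show "set x <= T"
  proof
   fix y assume "y : set x"
   then obtain i where "i < n" "y = (SUM l<-es. l ^ (a + Suc i))" unfolding a w_def by auto
   thus "y : T" unfolding T_def using tr[of "a + Suc i"] a(2) by simp
  qed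
 qed
 hence "card (w ` {..B}) <= card {xs. set xs <= T & length xs = n}"
  by (rule card_mono[OF finite_lists_length_eq[OF T(1)]])
 also have "... <= B" unfolding card_lists_length_eq[OF T(1)] B_def by (rule power_mono[OF T(2)]) simp
 finally have "~ inj_on w {..B}" by (intro pigeonhole) simp
 then obtain a b where "a ~= b" "w a = w b" unfolding inj_on_def by auto
 then obtain a b where ab: "a < b" "w a = w b" by (metis nat_neq_iff)
 have win: "(SUM l<-es. (l ^ b - l ^ a) * l * l ^ i) = 0" if i: "i < n" for i
 proof -
  have "(SUM l<-es. l ^ (a + Suc i)) = (SUM l<-es. l ^ (b + Suc i))"
   using arg_cong[OF ab(2), of "%l. l ! i"] i unfolding w_def by simp
  hence "(SUM l<-es. l ^ (b + Suc i) - l ^ (a + Suc i)) = 0" by (simp add: sum_list_subtractf)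
  moreover have "l ^ (b + Suc i) - l ^ (a + Suc i) = (l ^ b - l ^ a) * l * l ^ i" for l :: complex
   by (simp add: power_add algebra_simps)
  ultimately show ?thesis by simp
 qed
 have pol: "(SUM l<-es. (l ^ b - l ^ a) * l * poly q l) = 0" if q: "degree q < n" for q
 proof -
  have "(SUM l<-es. (l ^ b - l ^ a) * l * poly q l) = (SUM l<-es. SUM i<=degree q. coeff q i * ((l ^ b - l ^ a) * l * l ^ i))"
   unfolding poly_altdef by (simp add: sum_distrib_left mult_ac)
  also have "... = (SUM i<=degree q. SUM l<-es. coeff q i * ((l ^ b - l ^ a) * l * l ^ i))"
   by (induction es) (auto simp: sum.distrib)
  also have "... = (SUM i<=degree q. coeff q i * (SUM l<-es. (l ^ b - l ^ a) * l * l ^ i))"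
   by (simp only: sum_list_const_mult)
  also have "... = 0" using win q by (intro sum.neutral) auto
  finally show ?thesis .
 qed
 have "l0 ^ (b - a) = 1" if l0: "l0 : set es" for l0
 proof -
  \<comment> \<open>\<open>q\<close> vanishes at all members of \<open>es\<close> other than
    \<open>l0\<close>, so only the terms of \<open>l0\<close> survive in the sum; its degree is
    below \<open>n\<close>, the width of a window.\<close>
  define q where "q = (PROD m:set es - {l0}. [:- m, 1:])"
  have "degree q = card (set es - {l0})" unfolding q_def by (subst degree_prod_eq_sum_degree) auto
  also have "... < card (set es)" using l0 by (intro psubset_card_mono) auto
  also have "... <= n" using card_length[of es] len by simp
  finally have "(SUM l<-es. (l ^ b - l ^ a) * l * poly q l) = 0" by (rule pol)
  also have "(SUM l<-es. (l ^ b - l ^ a) * l * poly q l) = (SUM l<-es. if l = l0 then (l0 ^ b - l0 ^ a) * l0 * poly q l0 else 0)"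
  proof (rule arg_cong[of _ _ sum_list], rule map_cong)
   fix l assume "l : set es"
   hence "poly q l = 0" if "l ~= l0" unfolding q_def poly_prod using that by (auto intro!: prod_zero)
   thus "(l ^ b - l ^ a) * l * poly q l = (if l = l0 then (l0 ^ b - l0 ^ a) * l0 * poly q l0 else 0)" by auto
  qed simp
  also have "... = of_nat (count_list es l0) * ((l0 ^ b - l0 ^ a) * l0 * poly q l0)"
   by (induction es) (auto simp: algebra_simps)
  finally have "(l0 ^ b - l0 ^ a) * l0 * poly q l0 = 0"
   using l0 by (auto simp: count_list_0_iff)
  moreover have "poly q l0 ~= 0" unfolding q_def poly_prod by auto
  moreover have "l0 ~= 0" using l0 nz by blast
  ultimately have "l0 ^ b = l0 ^ a" by simp
  moreover have "l0 ^ b = l0 ^ (b - a) * l0 ^ a" using ab(1) by (simp flip: power_add)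
  ultimately show ?thesis using \<open>l0 ~= 0\<close> by simp
 qed
 thus "EX \<delta>>0. ALL l:set es. l ^ \<delta> = 1" using ab(1) by (intro exI[of _ "b - a"]) auto
qed simp

section \<open>From triangular forms to certificates in the group\<close>

abbreviation cmat :: "rat mat => complex mat" where "cmat \<equiv> map_mat of_rat"

lemma cmat_mult: "A : sqm n ==> B : sqm n ==> cmat (A * B) = cmat A * cmat B"
 by (rule of_rat_hom.mat_hom_mult)

lemma cmat_pow: "A : sqm n ==> cmat (A ^m k) = cmat A ^m k"
 by (rule of_rat_hom.mat_hom_pow)

lemma mtr_cmat: "A : sqm n ==> mtr n (cmat A) = of_rat (mtr n A)"
 unfolding mtr_def by (simp add: of_rat_sum)

lemma strict_foldr:
 fixes As :: "'a :: comm_ring_1 mat list"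
 assumes "set As <= sqm n" "!!A i j. A : set As ==> i < n ==> j <= i ==> A $$ (i, j) = 0"
 shows "foldr (*) As (1m n) : sqm n &
  (ALL i<n. ALL j<n. j < i + length As --> foldr (*) As (1m n) $$ (i, j) = 0)"
 using assms
proof (induction As)
 case (Cons A As)
 let ?P = "foldr (*) As (1m n)"
 have A: "A : sqm n" and P: "?P : sqm n" using Cons by auto
 have "(A * ?P) $$ (i, j) = 0" if ij: "i < n" "j < n" "j < i + Suc (length As)" for i j
  unfolding mat_mult_index[OF A P ij(1,2)]
 proof (rule sum.neutral, rule ballI)
  fix k assume "k : {..<n}"
  hence k: "k < n" by simp
  show "A $$ (i, k) * ?P $$ (k, j) = 0"
  proof (cases "k <= i")
   case True
   thus ?thesis using Cons.prems(2)[of A i k] ij by simp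
  next
   case False
   thus ?thesis using Cons k ij by simp
  qed
 qed
 thus ?case using A P by simp
qed auto

context group
begin

lemma rep_cmat: "rep n T \<phi> ==> rep n T (%x. cmat (\<phi> x))"
 unfolding rep_def using cmat_mult by (auto simp: of_rat_hom.mat_hom_one)

lemma fin_idx_normal:
 assumes N: "N \<lhd> G" and fin: "finite (rcosets N)"
 shows "fin_idx N (carrier G)"
proof (rule fin_idx_fibres[of _ _ "%x. N #> x"])
 interpret N: normal N G by fact
 show "subgroup N G" ..
 show "subgroup (carrier G) G" by (rule subgroup_self)
 show "N <= carrier G" by (rule N.subset)
 have "(%x. N #> x) ` carrier G = rcosets N" unfolding RCOSETS_def by auto
 thus "finite ((%x. N #> x) ` carrier G)" using fin by simp
 fix x y assume xy: "x : carrier G" "y : carrier G" "N #> x = N #> y"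
 have "x : N #> y" using rcos_self[OF xy(1) N.subgroup_axioms] xy(3) by simp
 then obtain n where n: "n : N" "x = n ** y" unfolding r_coset_def by auto
 thus "x ** inv y : N" using xy by (simp add: m_assoc N.mem_carrier)
qed

lemma fin_idx_pow:
 assumes K: "fin_idx K (carrier G)" and Y: "finite Y" "Y <= carrier G"
 shows "EX s>0. ALL x:Y. x [^] (s::nat) : K"
 using Y
proof (induction Y)
 case (insert a Y)
 obtain s where s: "s > 0" "!!x. x : Y ==> x [^] (s::nat) : K" using insert by auto
 obtain R where R: "subgroup K G" "finite R" "R <= carrier G" "!!x. x : carrier G ==> EX r:R. x ** inv r : K"
  using K unfolding fin_idx_def by auto
 have ac: "a : carrier G" using insert by simp
 obtain m where m: "m > 0" "a [^] (m::nat) : K" using fin_index_pow[OF R ac] by auto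
 have "x [^] (s * m) : K" if "x : insert a Y" for x
 proof (cases "x = a")
  case True
  have "a [^] (m * s) : K" using subgroup_nat_pow[OF R(1) m(2), of s] ac by (simp add: nat_pow_pow)
  thus ?thesis using True by (simp add: mult.commute)
 next
  case False
  hence "x : carrier G" "x [^] s : K" using that insert s by auto
  thus ?thesis using subgroup_nat_pow[OF R(1), of "x [^] s" m] by (simp add: nat_pow_pow)
 qed
 thus ?case using s m by (intro exI[of _ "s * m"]) auto
qed (intro exI[of _ 1], simp)

text \<open>The characters are the diagonal entries of the triangular form. Eigenvalues and
  vanishing products do not depend on the basis, so the complex base change disappears and the last
  statement concerns rational matrices.\<close>

lemma malcev_characters:
 fixes \<phi> :: "'a => rat mat"
 assumes sf: "solvable_by_finite G" and R: "rep n (carrier G) \<phi>"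
 shows "EX K \<chi>. fin_idx K (carrier G) & (ALL k<n. ALL x:K. ALL y:K. \<chi> k (x ** y) = \<chi> k x * \<chi> k y) &
  (ALL x:K. ALL l. eigenvalue (cmat (\<phi> x)) l <-> (EX k<n. l = \<chi> k x)) &
  (ALL xs. set xs <= {x : K. ALL k<n. \<chi> k x = 1} --> length xs = n -->
    foldr (*) (map (%x. \<phi> x - 1m n) xs) (1m n) = 0m n n)"
proof -
 obtain N where N: "N \<lhd> G" "solvable (G(|carrier := N|))" "finite (rcosets N)"
  using sf unfolding solvable_by_finite_def by auto
 have Ns: "subgroup N G" by (rule normal_imp_subgroup[OF N(1)])
 obtain l where l: "(derived G ^^ l) N = {\<one>}" using solvable_derived_trivial[OF Ns N(2)] by auto
 have fN: "fin_idx N (carrier G)" by (rule fin_idx_normal[OF N(1,3)])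
 define \<rho> where "\<rho> x = cmat (\<phi> x)" for x
 have R': "rep n (carrier G) \<rho>" unfolding \<rho>_def by (rule rep_cmat[OF R])
 obtain K g h where K: "fin_idx K N" "inv_pair n g h" "!!x. x : K ==> utri n (g * \<rho> x * h)"
  using malcev[OF rep_mono[OF R' Ns subgroup.subset[OF Ns]] l] by auto
 have fK: "fin_idx K (carrier G)" by (rule fin_idx_trans[OF K(1) fN])
 have Kc: "x : carrier G" if "x : K" for x using fK that unfolding fin_idx_def by auto
 have gh: "g : sqm n" "h : sqm n" "g * h = 1m n" "h * g = 1m n" using K(2) unfolding inv_pair_def by auto
 note rD = repD[OF R']
 define \<chi> where "\<chi> k x = (g * \<rho> x * h) $$ (k, k)" for k x
 have "\<chi> k (x ** y) = \<chi> k x * \<chi> k y" if "k < n" "x : K" "y : K" for k x y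
 proof -
  have "g * \<rho> (x ** y) * h = (g * \<rho> x * h) * (g * \<rho> y * h)"
   using conj_mult[OF gh(1,2,4) rD(2)[OF Kc[OF that(2)]] rD(2)[OF Kc[OF that(3)]]] rD(3) Kc that by simp
  thus ?thesis unfolding \<chi>_def using utri_mult(2)[OF K(3)[OF that(2)] K(3)[OF that(3)] that(1)] by simp
 qed
 moreover have "eigenvalue (cmat (\<phi> x)) l <-> (EX k<n. l = \<chi> k x)" if "x : K" for x l
  using utri_eigenvalue[OF K(2) rD(2)[OF Kc[OF that]] K(3)[OF that]] unfolding \<chi>_def \<rho>_def .
 moreover have "foldr (*) (map (%x. \<phi> x - 1m n) xs) (1m n) = 0m n n"
  if xs: "set xs <= {x : K. ALL k<n. \<chi> k x = 1}" "length xs = n" for xs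
 proof -
  have xc: "\<phi> x : sqm n" if "x : set xs" for x using repD(2)[OF R] Kc xs(1) that by auto
  define As where "As = map (%x. \<rho> x - 1m n) xs"
  have As: "set As <= sqm n" unfolding As_def \<rho>_def by auto
  define Bs where "Bs = map (%A. g * A * h) As"
  have Bs: "set Bs <= sqm n" unfolding Bs_def using As gh by auto
  have Bz: "B $$ (i, j) = 0" if Bij: "B : set Bs" "i < n" "j <= i" for B i j
  proof -
   obtain x where x: "x : set xs" "B = g * (\<rho> x - 1m n) * h" using Bij(1) unfolding Bs_def As_def set_map by blast
   have rx: "\<rho> x : sqm n" using xc[OF x(1)] unfolding \<rho>_def by simp
   have "B = g * \<rho> x * h - g * 1m n * h" unfolding x(2)
    using gh rx by (simp add: mult_minus_distrib_mat[of _ n n] minus_mult_distrib_mat[of _ n n])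
   also have "... = g * \<rho> x * h - 1m n" using gh by simp
   finally have B: "B = g * \<rho> x * h - 1m n" .
   have "x : K" "ALL k<n. \<chi> k x = 1" using xs(1) x(1) by auto
   thus ?thesis unfolding B using K(3)[of x] that(2,3) gh rx
    by (cases "j = i") (auto simp: utri_def \<chi>_def)
  qed
  have "foldr (*) Bs (1m n) = 0m n n"
   using strict_foldr[OF Bs Bz] xs(2) by (intro eq_matI) (auto simp: Bs_def As_def)
  moreover have pc: "foldr (*) Bs (1m n) = g * foldr (*) As (1m n) * h & foldr (*) As (1m n) : sqm n"
   unfolding Bs_def by (rule prod_conj[OF K(2) As])
  ultimately have z: "g * foldr (*) As (1m n) * h = 0m n n" by simp
  have "h * (g * foldr (*) As (1m n) * h) * g = (h * g) * foldr (*) As (1m n) * (h * g)"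
   by (rule conj_conj[OF K(2) inv_pair_sym[OF K(2)]]) (use pc in simp)
  moreover have "(1m n) * foldr (*) As (1m n) * (1m n) = foldr (*) As (1m n)"
   using pc by (metis left_mult_one_mat right_mult_one_mat)
  moreover have "h * (0m n n) * g = 0m n n" using gh by simp
  ultimately have z': "foldr (*) As (1m n) = 0m n n" unfolding z gh(4) by simp
  have "cmat (foldr (*) (map (%x. \<phi> x - 1m n) ys) (1m n)) = foldr (*) (map (%x. \<rho> x - 1m n) ys) (1m n) &
   foldr (*) (map (%x. \<phi> x - 1m n) ys) (1m n) : sqm n" if "set ys <= set xs" for ys
   using that
  proof (induction ys)
   case Nil
   show ?case by (simp add: of_rat_hom.mat_hom_one)
  next
   case (Cons y ys)
   have y: "\<phi> y : sqm n" "\<phi> y - 1m n : sqm n" using xc Cons.prems by auto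
   have "cmat (\<phi> y - 1m n) = \<rho> y - 1m n" unfolding \<rho>_def using y(1)
    by (intro eq_matI) (auto simp: of_rat_diff)
   thus ?case using Cons y(2) cmat_mult[OF y(2)] by simp
  qed
  from this[of xs] have "cmat (foldr (*) (map (%x. \<phi> x - 1m n) xs) (1m n)) = 0m n n"
   and c: "foldr (*) (map (%x. \<phi> x - 1m n) xs) (1m n) : sqm n" using z' unfolding As_def by auto
  show ?thesis
  proof (rule eq_matI)
   fix i j assume ij: "i < dim_row (0m n n :: rat mat)" "j < dim_col (0m n n :: rat mat)"
   have "cmat (foldr (*) (map (%x. \<phi> x - 1m n) xs) (1m n)) $$ (i, j) = 0" unfolding \<open>cmat _ = _\<close> using ij by simp
   thus "foldr (*) (map (%x. \<phi> x - 1m n) xs) (1m n) $$ (i, j) = 0m n n $$ (i, j)" using c ij by simp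
  qed (use c in auto)
 qed
 ultimately show ?thesis using fK by (intro exI[of _ K] exI[of _ \<chi>] conjI allI impI ballI) auto
qed

end

context abelian_mod
begin

lemma pow_in: "x : T ==> x [^] (m::nat) : T" "x : T ==> x [^] (k::int) : T"
 using subgroup_nat_pow[OF sub(2)] subgroup_int_pow_closed[OF sub(2)] by auto

lemma eqv_pow_mult:
 assumes "x : T" "y : T"
 shows "(x ** y) [^] (m::nat) \<doteq> x [^] m ** y [^] m"
proof (induction m)
 case (Suc m)
 have "(x ** y) [^] Suc m \<doteq> (x [^] m ** y [^] m) ** (x ** y)"
  unfolding nat_pow_Suc using assms pow_in Suc by (intro eqv_mult eqv_refl) auto
 also have "... \<doteq> (x [^] m ** x) ** (y [^] m ** y)" using assms pow_in by (intro eqv_4) auto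
 finally show ?case using assms pow_in by simp
qed auto

lemma eqv_in_N:
 assumes "x \<doteq> y" "x : T" "y : T"
 shows "x : N <-> y : N"
proof -
 have "x ** inv y : N" using assms unfolding eqv_def by simp
 moreover have "x = (x ** inv y) ** y" "y = inv (x ** inv y) ** x"
  using assms by (simp_all add: m_assoc inv_mult_group)
 ultimately show ?thesis by (metis N.m_closed N.m_inv_closed)
qed

lemma torsion_subgroup: "subgroup {x : T. EX m::nat. m > 0 & x [^] m : N} G"
proof (rule subgroupI)
 have "\<one> : {x : T. EX m::nat. m > 0 & x [^] m : N}" by auto
 thus "{x : T. EX m::nat. m > 0 & x [^] m : N} ~= {}" by blast
 fix a assume "a : {x : T. EX m::nat. m > 0 & x [^] m : N}"
 then obtain m :: nat where a: "a : T" "m > 0" "a [^] m : N" by auto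
 have "inv a [^] m : N" using N.m_inv_closed[OF a(3)] a(1) by (simp add: nat_pow_inv)
 thus "inv a : {x : T. EX m::nat. m > 0 & x [^] m : N}" using a by auto
 fix b assume "b : {x : T. EX m::nat. m > 0 & x [^] m : N}"
 then obtain k :: nat where b: "b : T" "k > 0" "b [^] k : N" by auto
 have "a [^] (m * k) : N" using subgroup_nat_pow[OF sub(1) a(3), of k] a(1) by (simp add: nat_pow_pow)
 moreover have "b [^] (m * k) : N" using subgroup_nat_pow[OF sub(1) b(3), of m] b(1) by (simp add: nat_pow_pow mult.commute)
 ultimately have "a [^] (m * k) ** b [^] (m * k) : N" by simp
 moreover have "(a ** b) [^] (m * k) \<doteq> a [^] (m * k) ** b [^] (m * k)" by (rule eqv_pow_mult[OF a(1) b(1)])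
 ultimately have "(a ** b) [^] (m * k) : N" using eqv_in_N pow_in a(1) b(1) by simp
 thus "a ** b : {x : T. EX m::nat. m > 0 & x [^] m : N}" using a b by (auto intro!: exI[of _ "m * k"])
qed auto

lemma prod_pow_scale:
 assumes ds: "set ds <= T" "length es = length ds"
 shows "prod_pow ds es [^] (m::nat) \<doteq> prod_pow ds (map (%e. int m * e) es)"
 using assms(2,1)
proof (induction es ds rule: list_induct2)
 case (Cons e es d ds)
 have c: "prod_pow ds k : T" "d [^] (k' :: int) : T" for k k' using Cons.prems pow_in prod_pow_closed[OF sub(2), of ds] by auto
 have "(d [^] e ** prod_pow ds es) [^] m \<doteq> (d [^] e) [^] m ** prod_pow ds es [^] m" by (rule eqv_pow_mult[OF c(2,1)])
 also have "... \<doteq> d [^] (int m * e) ** prod_pow ds (map (%e. int m * e) es)"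
 proof (intro eqv_mult)
  have "(d [^] e) [^] m = d [^] (int m * e)" using Cons.prems by (simp add: int_pow_pow mult.commute flip: int_pow_int)
  thus "(d [^] e) [^] m \<doteq> d [^] (int m * e)" using eqv_refl[OF c(2)] by simp
  show "prod_pow ds es [^] m \<doteq> prod_pow ds (map (%e. int m * e) es)" using Cons by simp
 qed (use c pow_in in auto)
 finally show ?case using c pow_in by simp
qed auto

end

context group
begin

text \<open>Modulo the normal subgroup \<open>N\<close>, commuting with a fixed element passes from
  generators to products and inverses; this is applied to each argument in turn.\<close>

lemma abelian_mod_generate:
 assumes gen: "Ts <= carrier G" "nrm N (generate G Ts)"
  and comm: "!!t t'. t : Ts ==> t' : Ts ==> t ** t' ** inv t ** inv t' : N"
 shows "abelian_mod G N (generate G Ts)"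
proof
 let ?T = "generate G Ts"
 show "nrm N ?T" by fact
 have s: "subgroup N G" "subgroup ?T G" "N <= ?T" using gen(2) unfolding nrm_def by auto
 interpret N: subgroup N G by (rule s)
 interpret T: subgroup ?T G by (rule s)
 have cj: "h ** k ** inv h : N" if "h : ?T" "k : N" for h k using gen(2) that unfolding nrm_def by auto
 have gc: "x : carrier G" if "x : ?T" for x using that by simp
 have step: "x ** y ** inv x ** inv y : N" if y: "y : ?T" and x: "x : ?T"
  and gens: "!!t. t : Ts ==> t ** y ** inv t ** inv y : N" for x y
  using x
 proof (induction rule: generate.induct)
  case one
  show ?case using y by simp
 next
  case (incl h)
  thus ?case by (rule gens)
 next
  case (inv h)
  have h: "h : ?T" "h : carrier G" using inv generate.incl[of h Ts G] gc by auto
  have "inv h ** inv (h ** y ** inv h ** inv y) ** inv (inv h) : N"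
   by (rule cj) (use h(1) gens[OF inv] in auto)
  thus ?case using h(2) gc[OF y] by (simp add: inv_mult_group m_assoc inv_cancel)
 next
  case (eng x x')
  have c: "x : carrier G" "x' : carrier G" using eng.hyps gc by auto
  have "(x ** (x' ** y ** inv x' ** inv y) ** inv x) ** (x ** y ** inv x ** inv y) : N"
   using cj[OF eng.hyps(1) eng.IH(2)] eng.IH(1) by simp
  thus ?case using c gc[OF y] by (simp add: inv_mult_group m_assoc inv_cancel)
 qed
 have symm: "y ** x ** inv y ** inv x : N" if "x ** y ** inv x ** inv y : N" "x : ?T" "y : ?T" for x y
  using N.m_inv_closed[OF that(1)] that(2,3) by (simp add: inv_mult_group m_assoc)
 fix x y assume xy: "x : ?T" "y : ?T"
 show "x ** y ** inv x ** inv y : N"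
 proof (rule step[OF xy(2,1)])
  fix t assume t: "t : Ts"
  have tT: "t : ?T" by (rule generate.incl[OF t])
  show "t ** y ** inv t ** inv y : N"
   by (rule symm[OF step[OF tT xy(2)] xy(2) tT]) (use comm t in auto)
 qed
qed

lemma rep_pow: "rep n T \<phi> ==> x : T ==> \<phi> (x [^] (k::nat)) = \<phi> x ^m k"
proof (induction k)
 case 0
 thus ?case using repD(2,4)[OF 0(1)] by (auto dest: carrier_matD)
next
 case (Suc k)
 thus ?case using repD(3)[OF Suc.prems(1), of "x [^] k" x] subgroup_nat_pow[OF repD(1)[OF Suc.prems(1)]] by simp
qed

lemma subgroup_preimage:
 assumes R: "rep n T \<phi>" and E: "matgrp n E"
 shows "subgroup {x : T. \<phi> x : E} G"
proof (rule subgroupI)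
 note rD = repD[OF R]
 interpret T: subgroup T G by (rule rD)
 show "{x : T. \<phi> x : E} <= carrier G" by auto
 have "\<one> : {x : T. \<phi> x : E}" using rD(4) E unfolding matgrp_def by simp
 thus "{x : T. \<phi> x : E} ~= {}" by blast
 fix x assume "x : {x : T. \<phi> x : E}"
 hence x: "x : T" "\<phi> x : E" by auto
 obtain y where y: "y : E" "\<phi> x * y = 1m n" using E x(2) unfolding matgrp_def by blast
 have yc: "y : sqm n" using y E unfolding matgrp_def by blast
 have ic: "\<phi> (inv x) : sqm n" using rD(2) x(1) by simp
 have "\<phi> (inv x) * (\<phi> x * y) = (\<phi> (inv x) * \<phi> x) * y"
  by (rule assoc_mult_mat[symmetric, OF ic rD(2)[OF x(1)] yc])
 hence "\<phi> (inv x) = y" using y(2) rD(6)[OF x(1)] ic yc by simp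
 thus "inv x : {x : T. \<phi> x : E}" using x y by simp
 fix z assume "z : {x : T. \<phi> x : E}"
 thus "x ** z : {x : T. \<phi> x : E}" using x rD(3) matgrp_mult[OF E] by auto
qed

text \<open>On the hull, the entry at the leading position of \<open>b\<close> is a homomorphism to
  the rationals whose kernel is the hull of the later elements. Scaled to the value 1 at
  \<open>b\<close>, it contributes exactly one to the rank.\<close>

lemma ser_hull:
 assumes R: "rep n T \<phi>" and inj: "inj_on \<phi> T"
 shows "mbasis n q (map \<phi> bs) ==> set bs <= T ==> ser {\<one>} {x : T. \<phi> x : rhull n (map \<phi> bs)} (length bs)"
proof (induction bs arbitrary: q)
 case Nil
 note rD = repD[OF R]
 interpret T: subgroup T G by (rule rD)
 have "x = \<one>" if "x : T" "\<phi> x = 1m n" for x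
  by (rule inj_onD[OF inj]) (use that rD(4) in auto)
 hence "{x : T. \<phi> x : rhull n (map \<phi> [])} = {\<one>}" using rD(4) by auto
 thus ?case using ser.ser_refl[OF triv_subgroup] by simp
next
 case (Cons b bs)
 let ?b = "\<phi> b"
 obtain p where p: "?b : unitri n p" "entry_at n p ?b ~= 0" "mbasis n (Suc p) (map \<phi> bs)" using Cons.prems(1) by auto
 have bT: "b : T" using Cons.prems by simp
 have mb: "mbasis n p (map \<phi> (b # bs))" using Cons.prems(1) p by auto
 note H = mbasis_hull[OF mb] and H' = mbasis_hull[OF p(3)]
 define F where "F = rhull n (map \<phi> (b # bs))"
 define E where "E = rhull n (map \<phi> bs)"
 have b0: "?b : unitri n 0" using p(1) unitri_mono[of 0 p n] by auto
 have ent: "entry_at n p u = 0 <-> u : E" if u: "u : F" for u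
 proof -
  obtain x e where xe: "u = upow n ?b x * e" "e : E" using u unfolding F_def E_def by auto
  have e: "e : unitri n p" "entry_at n p e = 0" "e : sqm n"
   using xe(2) H'(3) unfolding E_def by (auto simp: unitri_Suc dest: unitri_carrier)
  have "entry_at n p u = x * entry_at n p ?b"
   unfolding xe(1) using entry_at_mult[OF upow_unitri[OF p(1)] e(1)] e(2) entry_at_upow[OF p(1)] by simp
  moreover have "u = e" if "x = 0" using that xe(1) e(3) upow_0[OF b0] by simp
  moreover have "entry_at n p u = 0" if "u : E" using that H'(3) unfolding E_def by (auto simp: unitri_Suc)
  ultimately show ?thesis using xe(2) p(2) by auto
 qed
 have EF: "e : F" if "e : E" for e
 proof -
  have "e = upow n ?b 0 * e" using that H'(1) upow_0[OF b0] unfolding E_def matgrp_def by auto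
  thus ?thesis using that unfolding F_def E_def by auto
 qed
 have Fu: "\<phi> x : unitri n p" if "\<phi> x : F" for x using H(3) that unfolding F_def by auto
 have "ser {x : T. \<phi> x : E} {x : T. \<phi> x : F} 1"
 proof (rule ser_hom_rat[of _ "%x. entry_at n p (\<phi> x) / entry_at n p ?b" _ b])
  show "subgroup {x : T. \<phi> x : F} G" using subgroup_preimage[OF R] H(1) unfolding F_def by blast
  show "ALL x:{x : T. \<phi> x : F}. ALL y:{x : T. \<phi> x : F}. entry_at n p (\<phi> (x ** y)) / entry_at n p ?b =
   entry_at n p (\<phi> x) / entry_at n p ?b + entry_at n p (\<phi> y) / entry_at n p ?b"
   using repD(3)[OF R] entry_at_mult[OF Fu Fu] by (auto simp: add_divide_distrib)
  show "{x : T. \<phi> x : E} = {x : {x : T. \<phi> x : F}. entry_at n p (\<phi> x) / entry_at n p ?b = 0}"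
   using p(2) ent EF by auto
  have "upow n ?b 1 : F" using H(5)[of ?b 1] unfolding F_def by simp
  thus "b : {x : T. \<phi> x : F}" using bT upow_1[OF b0] by simp
 qed (use p in simp)
 moreover have "ser {\<one>} {x : T. \<phi> x : E} (length bs)" unfolding E_def using Cons.IH[OF p(3)] Cons.prems by simp
 ultimately have "ser {\<one>} {x : T. \<phi> x : F} (length bs + 1)" by (rule ser_trans)
 thus ?case unfolding F_def by simp
qed

lemma bnd_prod_pow:
 assumes R: "rep n (carrier G) \<phi>" and ds: "set ds <= carrier G"
  and b: "!!d. d : set ds ==> bnd n D 1 (cmat (\<phi> d)) & bnd n D 1 (cmat (\<phi> (inv d)))"
 shows "length es = length ds ==> bnd n D (SUM e<-es. nat \<bar>e\<bar>) (cmat (\<phi> (prod_pow ds es)))"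
 using ds b
proof (induction ds arbitrary: es)
 case Nil
 thus ?case using repD(4)[OF R] bnd_one[of n D] by (simp add: of_rat_hom.mat_hom_one)
next
 case (Cons d ds)
 note rD = repD[OF R]
 obtain e fs where es: "es = e # fs" using Cons.prems(1) by (cases es) auto
 have d: "d : carrier G" using Cons.prems by simp
 have pw: "bnd n D k (cmat (\<phi> (x [^] k)))" if x: "x : carrier G" "bnd n D 1 (cmat (\<phi> x))" for x and k :: nat
 proof (induction k)
  case 0
  show ?case using rD(4) bnd_one[of n D] by (simp add: of_rat_hom.mat_hom_one)
 next
  case (Suc k)
  thus ?case using bnd_mult[OF Suc x(2)] rD(3)[of "x [^] k" x] x(1) cmat_mult[OF rD(2) rD(2), of "x [^] k" x] by simp
 qed
 have "bnd n D (nat \<bar>e\<bar>) (cmat (\<phi> (d [^] e)))"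
 proof (cases "e >= 0")
  case True
  hence "d [^] e = d [^] nat e" using int_pow_int[of G d "nat e"] by simp
  thus ?thesis using True pw[OF d, of "nat e"] Cons.prems by simp
 next
  case False
  hence "d [^] e = inv (d [^] nat (- e))" unfolding int_pow_def2[of G d e] by (simp only: not_le if_True)
  also have "... = inv d [^] nat (- e)" using d by (simp add: nat_pow_inv)
  finally show ?thesis using False pw[of "inv d" "nat (- e)"] d Cons.prems by simp
 qed
 moreover have "bnd n D (SUM e<-fs. nat \<bar>e\<bar>) (cmat (\<phi> (prod_pow ds fs)))" using Cons es by simp
 moreover have c: "prod_pow ds fs : carrier G" "d [^] e : carrier G"
  using prod_pow_closed[OF subgroup_self, of ds] Cons.prems d by auto
 ultimately show ?case unfolding es prod_pow.simps
  using bnd_mult[of n D _ "cmat (\<phi> (d [^] e))"] rD(3)[OF c(2,1)] cmat_mult[OF rD(2)[OF c(2)] rD(2)[OF c(1)]] by simp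
qed

lemma prod_pow_scale_in:
 assumes "subgroup K G" "set ds <= carrier G" "!!d. d : set ds ==> d [^] (s::nat) : K"
 shows "length es = length ds ==> prod_pow ds (map (%e. int s * e) es) : K"
 using assms(2,3)
proof (induction ds arbitrary: es)
 case Nil
 thus ?case using subgroup.one_closed[OF assms(1)] by simp
next
 case (Cons d ds)
 obtain e fs where es: "es = e # fs" using Cons.prems(1) by (cases es) auto
 have "d [^] (int s * e) = (d [^] s) [^] e" using Cons.prems by (simp add: int_pow_pow flip: int_pow_int)
 hence "d [^] (int s * e) : K" using subgroup_int_pow_closed[OF assms(1)] Cons.prems by simp
 thus ?case using Cons es subgroup.m_closed[OF assms(1)] by simp
qed

end

text \<open>\<open>Q ^ r\<close> for the \<open>Q\<close> of \<open>torus_trace\<close>: the range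
  of the multiplier \<open>F\<close> in \<open>dirichlet\<close>, which also bounds the exponents in
  \<open>g\<close>.\<close>

definition box_size :: "nat => nat => nat => nat => nat" where
 "box_size n D J r = (n * (n * D * r * J)) ^ r"

definition small_traces :: "nat => nat => rat mat => bool" where
 "small_traces n J A <-> (ALL j. 0 < j --> j <= J --> mtr n (A ^m j) : \<int> & \<bar>mtr n (A ^m j)\<bar> <= of_nat n)"

context group
begin

text \<open>A relation \<open>p\<close> of any size is approximated by a small multiple of a vector \<open>g\<close> in the box, so
 that the eigenvalues of the product belonging to \<open>g\<close> are roots of numbers of small height.\<close>

lemma box_independent:
 fixes \<phi> :: "'a => rat mat"
 assumes sf: "solvable_by_finite G" and R: "rep n (carrier G) \<phi>" and n: "n > 0"
  and ab: "abelian_mod G N T" and N: "!!x. x : N ==> \<phi> x : unitri n 0"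
  and ds: "set ds <= T" and DJ: "D > 0" "J > 0"
  and b: "!!d. d : set ds ==> bnd n D 1 (cmat (\<phi> d)) & bnd n D 1 (cmat (\<phi> (inv d)))"
  and box: "!!p. length p = length ds ==> (EX e:set p. e ~= 0) ==>
   (ALL e:set p. \<bar>e\<bar> <= int (box_size n D J (length ds))) ==> ~ small_traces n J (\<phi> (prod_pow ds p))"
  and p: "length p = length ds" "prod_pow ds p : N"
 shows "ALL e:set p. e = 0"
proof (rule ccontr)
 assume "~ ?thesis"
 then obtain e0 where e0: "e0 : set p" "e0 ~= 0" by blast
 interpret A: abelian_mod G N T by (rule ab)
 note rD = repD[OF R]
 define r where "r = length ds"
 have r: "r > 0" using e0 p unfolding r_def by (cases p) auto
 define Q where "Q = n * (n * D * r * J)"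
 have Q: "Q > 0" using n r DJ unfolding Q_def by simp
 define M where "M = Max (abs ` set p)"
 have fin: "finite (abs ` set p)" "abs ` set p ~= {}" using e0 by auto
 have Mle: "\<bar>e\<bar> <= M" if "e : set p" for e unfolding M_def using that by (intro Max_ge) auto
 have M: "M > 0" using Mle[OF e0(1)] e0(2) by linarith
 obtain i0 where i0: "i0 < length p" "\<bar>p ! i0\<bar> = M"
  using Max_in[OF fin] unfolding M_def[symmetric] by (auto simp: in_set_conv_nth)
 obtain F g where F: "1 <= F" "F <= int Q ^ length p" and g: "length g = length p"
  "!!i. i < length p ==> int Q * \<bar>F * p ! i - M * g ! i\<bar> < M"
  using dirichlet[OF M Q, of p] by auto
 have g1: "\<bar>F * p ! i - M * g ! i\<bar> < M" if "i < length p" for i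
 proof -
  have "1 * \<bar>F * p ! i - M * g ! i\<bar> <= int Q * \<bar>F * p ! i - M * g ! i\<bar>"
   using Q by (intro mult_right_mono) auto
  from order.strict_trans1[OF this g(2)[OF that]] show ?thesis by simp
 qed
 have gbox: "\<bar>e\<bar> <= int (box_size n D J (length ds))" if "e : set g" for e
 proof -
  obtain i where i: "i < length p" "e = g ! i" using \<open>e : set g\<close> g(1) by (auto simp: in_set_conv_nth)
  have "\<bar>F * p ! i\<bar> <= F * M" using Mle[of "p ! i"] i F by (auto simp: abs_mult intro!: mult_left_mono)
  hence "\<bar>M * g ! i\<bar> < M * (F + 1)" using g1[OF i(1)] by (simp add: algebra_simps)
  hence "M * \<bar>g ! i\<bar> < M * (F + 1)" using M by (simp add: abs_mult)
  hence "\<bar>g ! i\<bar> < F + 1" using M by simp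
  thus ?thesis using F(2) i p(1) unfolding box_size_def Q_def r_def by simp
 qed
 \<comment> \<open>At an exponent of \<open>p\<close> of largest modulus, an approximation by 0
   would contradict \<open>F >= 1\<close>.\<close>
 have "g ! i0 ~= 0"
 proof
  assume "g ! i0 = 0"
  hence "F * M < M" using g1[OF i0(1)] F(1) M i0(2) by (simp add: abs_mult)
  thus False using F(1) M by simp
 qed
 hence gnz: "EX e:set g. e ~= 0" using i0(1) g(1) by auto
 define c where "c = prod_pow ds g"
 have pT: "prod_pow ds es : T" for es by (rule prod_pow_closed[OF A.sub(2) ds])
 have dsc: "set ds <= carrier G" using ds A.T.subset by auto
 have "~ small_traces n J (\<phi> c)" unfolding c_def by (rule box) (use g p gnz gbox in auto)
 then obtain j where j: "0 < j" "j <= J"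
  "~ (mtr n (\<phi> c ^m j) : \<int> & \<bar>mtr n (\<phi> c ^m j)\<bar> <= of_nat n)"
  unfolding small_traces_def by auto
 obtain K \<chi> where K: "fin_idx K (carrier G)"
  and chi: "!!k x y. k < n ==> x : K ==> y : K ==> \<chi> k (x ** y) = \<chi> k x * \<chi> k y"
  "!!x l. x : K ==> eigenvalue (cmat (\<phi> x)) l <-> (EX k<n. l = \<chi> k x)"
  using malcev_characters[OF sf R] by blast
 have Ks: "subgroup K G" using K unfolding fin_idx_def by simp
 interpret K: subgroup K G by (rule Ks)
 have cc: "c : T" "c : carrier G" using pT unfolding c_def by auto
 obtain s where s: "s > 0" "!!x. x : insert c (set ds) ==> x [^] (s::nat) : K"
  using fin_idx_pow[OF K, of "insert c (set ds)"] cc dsc by auto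
 \<comment> \<open>\<open>s\<close> brings powers into \<open>K\<close>, where the characters live.
   Modulo \<open>N\<close>, \<open>c [^] m\<close> has the exponents
   \<open>int s * M * g ! i\<close>; subtracting \<open>int s * F\<close> times the relation
   \<open>p\<close> leaves the small exponents of \<open>w\<close>.\<close>
 define m where "m = s * nat M"
 have m: "m > 0" "int m = int s * M" using s(1) M unfolding m_def by auto
 define es where "es = map (%i. M * g ! i - F * p ! i) [0..<length p]"
 define w where "w = prod_pow ds (map (%e. int s * e) es)"
 have wK: "w : K" unfolding w_def by (rule prod_pow_scale_in[OF Ks dsc s(2)]) (use p in "auto simp: es_def")
 have wT: "w : T" unfolding w_def by (rule pT)
 have cmK: "c [^] m : K" using subgroup_nat_pow[OF Ks s(2)[of c], of "nat M"] cc unfolding m_def by (simp add: nat_pow_pow)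
 have cmT: "c [^] m : T" by (rule A.pow_in[OF cc(1)])
 define p' where "p' = map (%e. int (s * nat F) * e) p"
 have p'N: "prod_pow ds p' : N"
 proof -
  have "prod_pow ds p [^] (s * nat F) : N" by (rule subgroup_nat_pow[OF A.sub(1) p(2)])
  thus ?thesis using A.eqv_in_N[OF A.prod_pow_scale[OF ds p(1)] A.pow_in(1)[OF pT] pT] unfolding p'_def by blast
 qed
 have "A.eqv (c [^] m) (prod_pow ds (map (%e. int m * e) g))"
  unfolding c_def by (rule A.prod_pow_scale[OF ds]) (use g p in simp)
 also have "map (%e. int m * e) g = map2 (+) (map (%e. int s * e) es) p'"
  using g(1) F(1) m(2) by (intro nth_equalityI) (auto simp: es_def p'_def algebra_simps)
 finally have e1: "A.eqv (c [^] m) (prod_pow ds (map2 (+) (map (%e. int s * e) es) p'))" .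
 have e2: "A.eqv (w ** prod_pow ds p') (prod_pow ds (map2 (+) (map (%e. int s * e) es) p'))"
  unfolding w_def by (rule A.prod_pow_add[OF ds]) (use p in "auto simp: es_def p'_def")
 have e3: "A.eqv (w ** prod_pow ds p') (w ** \<one>)"
  by (rule A.eqv_mult) (use wT pT p'N A.eqv_one A.eqv_refl in auto)
 have cl: "w ** prod_pow ds p' : T" using wT pT by simp
 have "A.eqv (c [^] m) w"
  using A.eqv_trans[OF A.eqv_trans[OF e1 A.eqv_sym[OF cl pT e2] cmT pT cl] e3 cmT cl] wT by simp
 hence u: "c [^] m ** inv w : N" unfolding A.eqv_def .
 have uK: "c [^] m ** inv w : K" using cmK wK by simp
 define u0 where "u0 = c [^] m ** inv w"
 \<comment> \<open>An element of \<open>N\<close> has only the eigenvalue 1. Hence the characters do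
   not distinguish \<open>c [^] m\<close> from \<open>w\<close>, and the eigenvalues of
   \<open>c [^] m\<close> inherit the small height of \<open>w\<close>.\<close>
 have chi_u: "\<chi> k u0 = 1" if k: "k < n" for k
 proof -
  have uu: "\<phi> u0 : unitri n 0" using N[OF u] unfolding u0_def .
  have "utri n (cmat (\<phi> u0))" using uu unfolding utri_def unitri_def by auto
  moreover have cu: "cmat (\<phi> u0) : sqm n" using unitri_carrier[OF uu] by simp
  moreover have "inv_pair n (1m n) (1m n :: complex mat)" unfolding inv_pair_def by simp
  moreover have e: "1m n * cmat (\<phi> u0) * 1m n = cmat (\<phi> u0)" using cu by simp
  ultimately have "eigenvalue (cmat (\<phi> u0)) (\<chi> k u0) <-> (EX i<n. \<chi> k u0 = cmat (\<phi> u0) $$ (i, i))"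
   using utri_eigenvalue[of n "1m n" "1m n" "cmat (\<phi> u0)"] by simp
  moreover have "eigenvalue (cmat (\<phi> u0)) (\<chi> k u0)" using chi(2)[of u0] uK k unfolding u0_def by auto
  ultimately show ?thesis using uu unfolding unitri_def by auto
 qed
 have chi_c: "\<chi> k (c [^] m) = \<chi> k w" if k: "k < n" for k
 proof -
  have "c [^] m = u0 ** w" unfolding u0_def using cc wK by (simp add: m_assoc)
  thus ?thesis using chi(1)[OF k, of u0 w] chi_u[OF k] uK wK unfolding u0_def by simp
 qed
 define f where "f = (SUM e<-map (%e. int s * e) es. nat \<bar>e\<bar>)"
 have bw: "bnd n D f (cmat (\<phi> w))" unfolding f_def w_def
  by (rule bnd_prod_pow[OF R dsc b]) (use p in "auto simp: es_def")
 \<comment> \<open>By the quality of the approximation, each of the \<open>r\<close> exponents of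
   \<open>w\<close> is at most \<open>m / Q\<close> in absolute value.\<close>
 have fQ: "Q * f <= r * m"
 proof -
  have "Q * (SUM e<-map (%e. int s * e) xs. nat \<bar>e\<bar>) <= length xs * m" if "!!e. e : set xs ==> int Q * \<bar>e\<bar> < M" for xs
   using that
  proof (induction xs)
   case (Cons e xs)
   have "int s * (int Q * \<bar>e\<bar>) <= int s * M" using Cons.prems[of e] by (intro mult_left_mono) auto
   hence "int (Q * nat \<bar>int s * e\<bar>) <= int m" unfolding m(2) by (simp add: abs_mult mult_ac)
   hence "Q * nat \<bar>int s * e\<bar> <= m" by (simp only: of_nat_le_iff)
   thus ?case using Cons by (simp add: algebra_simps)
  qed simp
  moreover have "int Q * \<bar>e\<bar> < M" if "e : set es" for e
   using that g(2) unfolding es_def by (auto simp: abs_minus_commute)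
  ultimately have "Q * f <= length es * m" unfolding f_def by blast
  thus ?thesis using p(1) unfolding es_def r_def by simp
 qed
 have pc: "\<phi> c : sqm n" using rD(2) cc by simp
 have "mtr n (cmat (\<phi> c) ^m j) : \<int> & cmod (mtr n (cmat (\<phi> c) ^m j)) <= real n"
 proof (rule torus_trace[of n D r m j J _ f])
  show "mtr n (cmat (\<phi> c) ^m j) : \<rat>"
   unfolding cmat_pow[OF pc, symmetric] mtr_cmat[OF pow_carrier_mat[OF pc]] by simp
  fix l assume "eigenvalue (cmat (\<phi> c)) l"
  then obtain v where "eigenvector (cmat (\<phi> c)) v l" unfolding eigenvalue_def by blast
  hence v: "v : carrier_vec n" "v ~= 0v n" "(cmat (\<phi> c) ^m m) *v v = l ^ m *s v"
   using eigenvector_pow[of "cmat (\<phi> c)" n v l m] pc unfolding eigenvector_def by auto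
  have "cmat (\<phi> c) ^m m = cmat (\<phi> (c [^] m))" using rep_pow[OF R cc(2)] cmat_pow[OF pc] by simp
  hence "eigenvalue (cmat (\<phi> (c [^] m))) (l ^ m)"
   using v rD(2)[of "c [^] m"] cc unfolding eigenvalue_def eigenvector_def by auto
  then obtain k where "k < n" "l ^ m = \<chi> k (c [^] m)" using chi(2)[OF cmK] by blast
  hence "eigenvalue (cmat (\<phi> w)) (l ^ m)" using chi(2)[OF wK] chi_c by auto
  thus "EX W. bnd n D f W & eigenvalue W (l ^ m)" using bw by blast
 qed (use n DJ r m j fQ pc in "auto simp: Q_def")
 hence t: "mtr n (cmat (\<phi> c ^m j)) : \<int>" "cmod (mtr n (cmat (\<phi> c ^m j))) <= real n"
  unfolding cmat_pow[OF pc] by auto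
 let ?t = "mtr n (\<phi> c ^m j)"
 have tt: "mtr n (cmat (\<phi> c ^m j)) = of_rat ?t" by (rule mtr_cmat[OF pow_carrier_mat[OF pc]])
 obtain z where "of_rat ?t = complex_of_int z" using t(1) unfolding tt by (rule Ints_cases)
 hence "(of_rat ?t :: complex) = of_rat (of_int z)" by simp
 hence tz: "?t = of_int z" by (simp only: of_rat_eq_iff)
 have "real_of_int \<bar>z\<bar> <= real n" using t(2) unfolding tt tz by simp
 hence "\<bar>z\<bar> <= int n" by linarith
 hence "of_int \<bar>z\<bar> <= (of_int (int n) :: rat)" by (simp only: of_int_le_iff)
 hence "\<bar>?t\<bar> <= of_nat n" unfolding tz by simp
 thus False using j(3) tz by simp
qed

text \<open>The list \<open>ts\<close> generates a subgroup \<open>T\<close> of finite index, as Schreier's condition on the candidate coset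
 representatives \<open>rs\<close> shows; \<open>bs\<close> is a basis of a hull of a unipotent normal subgroup \<open>N\<close> of \<open>T\<close>; the
 elements \<open>ds\<close> generate \<open>T / N\<close> up to torsion and are independent. \<open>D\<close> bounds denominators and entries of
 \<open>ds\<close>, and \<open>J\<close> is the number of power traces inspected.\<close>

definition hcert :: "nat => ('a => rat mat) => 'a set => 'a list => 'a list => 'a list => 'a list => nat => nat => bool" where
 "hcert n \<phi> S ts rs bs ds D J <->
  set ts <= carrier G & (ALL t:set ts. inv t : set ts) &
  set rs <= carrier G & \<one> : set rs & (ALL r:set rs. ALL s:S. EX t:set ts. EX r':set rs. r ** s = t ** r') &
  set bs <= generate G (set ts) & mbasis n 0 (map \<phi> bs) &
  (ALL t:set ts. ALL b:set bs. \<phi> (t ** b ** inv t) : rhull n (map \<phi> bs)) &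
  (ALL t:set ts. ALL t':set ts. \<phi> (t ** t' ** inv t ** inv t') : rhull n (map \<phi> bs)) &
  set ds <= set ts & D > 0 & J > 0 &
  (ALL d:set ds. bnd n D 1 (cmat (\<phi> d)) & bnd n D 1 (cmat (\<phi> (inv d)))) &
  (ALL p. length p = length ds --> (EX e:set p. e ~= 0) --> (ALL e:set p. \<bar>e\<bar> <= int (box_size n D J (length ds))) -->
    ~ small_traces n J (\<phi> (prod_pow ds p))) &
  (ALL t:set ts. EX m>0. EX es. length es = length ds & \<phi> (t [^] (m::nat) ** prod_pow ds es) : rhull n (map \<phi> bs))"

lemma rep_conj:
 assumes R: "rep N (carrier G) \<phi>0" and gh: "inv_pair N g h"
 shows "rep N (carrier G) (%x. g * \<phi>0 x * h)"
 unfolding rep_def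
proof (intro conjI ballI)
 note r0 = repD[OF R]
 have ghc: "g : sqm N" "h : sqm N" "g * h = 1m N" "h * g = 1m N" using gh unfolding inv_pair_def by auto
 show "subgroup (carrier G) G" by (rule subgroup_self)
 show "g * \<phi>0 \<one> * h = 1m N" unfolding r0(4) using ghc by simp
 fix x assume x: "x : carrier G"
 show "g * \<phi>0 x * h : sqm N" using ghc r0(2)[OF x] by simp
 fix y assume y: "y : carrier G"
 show "g * \<phi>0 (x ** y) * h = (g * \<phi>0 x * h) * (g * \<phi>0 y * h)"
  unfolding r0(3)[OF x y] by (rule conj_mult[OF ghc(1,2,4) r0(2)[OF x] r0(2)[OF y]])
qed

lemma rep_right_inverse:
 assumes R: "rep N (carrier G) \<phi>" and x: "x : carrier G" and A: "A : sqm N" "\<phi> x * A = 1m N"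
 shows "A = \<phi> (inv x)"
proof -
 note r = repD(2)[OF R]
 have "\<phi> (inv x) * (\<phi> x * A) = A" using assoc_mult_mat[OF r r A(1), of "inv x" x] repD(6)[OF R x] A(1) x by simp
 thus ?thesis using A(2) r[of "inv x"] x by simp
qed

text \<open>Any \<open>D\<close> and \<open>J\<close> that pass the finite check prove independence,
  so a certificate can be trusted whatever its origin.\<close>

lemma hcert_sound:
 fixes \<phi> :: "'a => rat mat"
 assumes sf: "solvable_by_finite G" and R: "rep n (carrier G) \<phi>" and inj: "inj_on \<phi> (carrier G)" and n: "n > 0"
  and S: "S <= carrier G" "carrier G = generate G S" "!!s. s : S ==> inv s : S"
  and cert: "hcert n \<phi> S ts rs bs ds D J"
 shows "ser {\<one>} (carrier G) (length bs + length ds)"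
proof -
 define T where "T = generate G (set ts)"
 define E where "E = rhull n (map \<phi> bs)"
 note C = cert[unfolded hcert_def, folded T_def E_def]
 have Crs: "ALL r:set rs. ALL s:S. EX t:set ts. EX r':set rs. r ** s = t ** r'"
  and Ctor: "ALL t:set ts. EX m>0. EX es. length es = length ds & \<phi> (t [^] (m::nat) ** prod_pow ds es) : E"
  and Cone: "\<one> : set rs"
  using C by - (elim conjE, assumption)+
 have ts: "set ts <= carrier G" using C by simp
 have Ts: "subgroup T G" unfolding T_def by (rule generate_is_subgroup[OF ts])
 interpret T: subgroup T G by (rule Ts)
 have tsT: "t : T" if "t : set ts" for t unfolding T_def by (rule generate.incl[OF that])
 have bsT: "set bs <= T" and mb: "mbasis n 0 (map \<phi> bs)" using C by simp_all
 note H = mbasis_hull[OF mb, folded E_def]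
 note rD = repD[OF R]
 have RT: "rep n T \<phi>" by (rule rep_mono[OF R Ts T.subset])
 \<comment> \<open>The full preimage of the hull in \<open>T\<close>. It may be larger than the
   subgroup generated by \<open>bs\<close>, but its rank is still the length of
   \<open>bs\<close>.\<close>
 define N where "N = {x : T. \<phi> x : E}"
 have Ns: "subgroup N G" unfolding N_def by (rule subgroup_preimage[OF RT H(1)])
 interpret N: subgroup N G by (rule Ns)
 have cjt: "t ** x ** inv t : N" if t: "t : set ts" and x: "x : N" for t x
 proof -
  have tc: "t : carrier G" "t : T" "x : carrier G" "x : T" using t ts tsT x unfolding N_def by auto
  have r3: "\<phi> (t ** y ** inv t) = \<phi> t * \<phi> y * \<phi> (inv t)" if "y : carrier G" for y using that tc rD(3) by simp
  have "\<phi> t * \<phi> x * \<phi> (inv t) : E & \<phi> x : sqm n"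
  proof (rule hull_conj[OF H(1,2), of "\<phi> t" "\<phi> (inv t)" "map \<phi> bs"])
   show "\<phi> t : sqm n" "\<phi> (inv t) : sqm n" "\<phi> (inv t) * \<phi> t = 1m n" "\<phi> t * \<phi> (inv t) = 1m n"
    using rD tc by auto
   show "\<phi> x : rhull n (map \<phi> bs)" using x unfolding N_def E_def by simp
   fix b assume b: "b : set (map \<phi> bs)"
   show "b : unitri n 0" by (rule H(4)[OF b])
   obtain y where y: "y : set bs" "b = \<phi> y" using b by auto
   have "\<phi> (t ** y ** inv t) : E" using C t y(1) by simp
   thus "\<phi> t * b * \<phi> (inv t) : E" using r3[of y] y bsT T.subset by auto
  qed
  thus ?thesis using r3[OF tc(3)] tc unfolding N_def by simp
 qed
 have cj: "h ** x ** inv h : N" if "h : T" "x : N" for h x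
  using that unfolding T_def
 proof (induction arbitrary: x rule: generate.induct)
  case (eng h1 h2)
  have "h1 : carrier G" "h2 : carrier G" "x : carrier G"
   using eng.hyps generate_in_carrier[OF ts] eng.prems by auto
  thus ?case using eng.IH(1)[OF eng.IH(2)[OF eng.prems]] by (simp add: m_assoc inv_mult_group)
 next
  case (inv h)
  have "inv h : set ts" using C inv by simp
  thus ?case using cjt[of "inv h" x] inv by simp
 qed (use cjt in auto)
 have nN: "nrm N T" by (rule nrmI[OF Ns Ts]) (use cj in "auto simp: N_def")
 have ab: "abelian_mod G N T" unfolding T_def
 proof (rule abelian_mod_generate[OF ts nN[unfolded T_def]])
  fix t t' assume t: "t : set ts" "t' : set ts"
  hence "\<phi> (t ** t' ** inv t ** inv t') : E" using C by simp
  thus "t ** t' ** inv t ** inv t' : N" using t tsT unfolding N_def by simp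
 qed
 interpret A: abelian_mod G N T by (rule ab)
 have dsT: "set ds <= T" using C tsT by auto
 have s1: "ser {\<one>} N (length bs)"
  unfolding N_def E_def by (rule ser_hull[OF RT inj_on_subset[OF inj T.subset] mb bsT])
 have s2: "ser N T (length ds)"
 proof (rule A.ser_abelian[OF dsT])
  fix es assume es: "length es = length ds" "prod_pow ds es : N"
  show "ALL e:set es. e = 0"
  proof (rule box_independent[OF sf R n ab _ dsT, of D J])
   show "\<phi> x : unitri n 0" if "x : N" for x using that H(3) unfolding N_def by auto
  qed (use C es in auto)
 next
  note sp = A.spn_subgroup[OF dsT]
  interpret B: abelian_mod G "A.spn ds" T
  proof
   show "nrm (A.spn ds) T" by (rule A.nrm_between) (use sp A.sub in auto)
   show "x ** y ** inv x ** inv y : A.spn ds" if "x : T" "y : T" for x y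
    using A.comm[OF that] sp(2) by blast
  qed
  \<comment> \<open>The torsion elements modulo the span form a subgroup, so periodicity is checked
    on the generators alone.\<close>
  have "T <= {x : T. EX m::nat. m > 0 & x [^] m : A.spn ds}"
  proof -
   have "generate G (set ts) <= {x : T. EX m::nat. m > 0 & x [^] m : A.spn ds}"
   proof (rule generate_subgroup_incl[OF _ B.torsion_subgroup], rule subsetI)
   fix t assume t: "t : set ts"
   obtain m es where m: "m > (0::nat)" "length es = length ds" "\<phi> (t [^] m ** prod_pow ds es) : E"
    using Ctor t by blast
   let ?P = "prod_pow ds es"
   have P: "?P : T" by (rule prod_pow_closed[OF Ts dsT])
   have "?P : A.spn ds" unfolding A.spn_def using P m(2) by auto
   moreover have tm: "t [^] m : T" by (rule subgroup_nat_pow[OF Ts tsT[OF t]])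
   moreover have "t [^] m ** ?P : A.spn ds" using m(3) tm P sp(2) unfolding N_def by auto
   ultimately have "(t [^] m ** ?P) ** inv ?P : A.spn ds"
    using sp(1) by (meson subgroup.m_closed subgroup.m_inv_closed)
   hence "t [^] m : A.spn ds" using tm P by (simp add: m_assoc)
   thus "t : {x : T. EX m::nat. m > 0 & x [^] m : A.spn ds}"
    using tsT[OF t] m(1) by auto
   qed
   thus ?thesis unfolding T_def .
  qed
  thus "per (A.spn ds) T" unfolding per_def by auto
 qed
 have rsc: "set rs <= carrier G" using C by simp
 \<comment> \<open>The claim for every starting representative, as in Schreier's method, lets a word
   be processed letter by letter.\<close>
 have cov: "ALL r:set rs. EX r':set rs. r ** x ** inv r' : T" if "x : carrier G" for x
  using that unfolding S(2)
 proof (induction rule: generate.induct)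
  case one
  show ?case using rsc by (auto intro!: bexI T.one_closed)
 next
  case (eng x y)
  show ?case
  proof
   fix r assume r: "r : set rs"
   obtain r' where r': "r' : set rs" "r ** x ** inv r' : T" using eng.IH(1) r by blast
   obtain r'' where r'': "r'' : set rs" "r' ** y ** inv r'' : T" using eng.IH(2) r'(1) by blast
   have c: "x : carrier G" "y : carrier G" "r : carrier G" "r' : carrier G" "r'' : carrier G"
    using eng.hyps S(2) r r'(1) r''(1) rsc by auto
   have "(r ** x ** inv r') ** (r' ** y ** inv r'') : T" using r'(2) r''(2) by (rule T.m_closed)
   also have "(r ** x ** inv r') ** (r' ** y ** inv r'') = r ** (x ** y) ** inv r''"
    using c by (simp add: m_assoc inv_cancel)
   finally show "EX r':set rs. r ** (x ** y) ** inv r' : T" using r'' by blast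
  qed
 next
  case (incl s)
  show ?case
  proof
   fix r assume r: "r : set rs"
   obtain t r' where t: "t : set ts" "r' : set rs" "r ** s = t ** r'" using Crs incl r by blast
   have "t : carrier G" "r' : carrier G" using t ts rsc by auto
   hence "r ** s ** inv r' = t" unfolding t(3) by (simp add: m_assoc)
   thus "EX r':set rs. r ** s ** inv r' : T" using tsT[OF t(1)] t(2) by (intro bexI[of _ r']) simp_all
  qed
 next
  case (inv s)
  show ?case
  proof
   fix r assume r: "r : set rs"
   obtain t r' where t: "t : set ts" "r' : set rs" "r ** inv s = t ** r'" using Crs S(3)[OF inv] r by blast
   have "t : carrier G" "r' : carrier G" using t ts rsc by auto
   hence "r ** inv s ** inv r' = t" unfolding t(3) by (simp add: m_assoc)
   thus "EX r':set rs. r ** inv s ** inv r' : T" using tsT[OF t(1)] t(2) by (intro bexI[of _ r']) simp_all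
  qed
 qed
 have "ser {\<one>} T (length ds + length bs)" using ser_trans[OF s2 s1] by (simp add: add.commute)
 hence "ser {\<one>} (carrier G) (length ds + length bs)"
 proof (rule ser_fin_index)
  show "\<one> : set rs" by (rule Cone)
  fix x assume x: "x : carrier G"
  have "EX r':set rs. \<one> ** x ** inv r' : T" using cov[OF x] Cone by blast
  thus "EX r:set rs. x ** inv r : T" using x by simp
 qed (use rsc in auto)
 thus ?thesis by (simp add: add.commute)
qed

end

lemma of_real_of_rat: "of_real (of_rat q) = (of_rat q :: complex)"
 by (cases q) (simp add: of_rat_rat)

lemma common_denominator:
 assumes "finite Q"
 shows "EX D>0. ALL q:Q. of_nat D * q : \<int> & \<bar>q\<bar> <= (of_nat D :: rat)"
 using assms
proof (induction Q)
 case (insert q Q)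
 obtain D :: nat where D: "D > 0" "!!q. q : Q ==> of_nat D * q : \<int> & \<bar>q\<bar> <= (of_nat D :: rat)" using insert by auto
 obtain a b where ab: "q = of_int a / of_int b" "b > 0"
  by (metis quotient_of_denom_pos quotient_of_div surj_pair)
 \<comment> \<open>The factor \<open>nat b\<close> clears the denominator of \<open>q\<close>, and
   the factor \<open>nat \<bar>a\<bar> + 1\<close> makes the new bound dominate
   \<open>\<bar>q\<bar>\<close> and keeps it positive.\<close>
 define D' where "D' = D * (nat b * (nat \<bar>a\<bar> + 1))"
 have "of_nat D' * q' : \<int> & \<bar>q'\<bar> <= of_nat D'" if "q' : insert q Q" for q'
 proof (cases "q' = q")
  case True
  have e: "of_nat D' * q = of_int (int D * (\<bar>a\<bar> + 1) * a)" unfolding D'_def ab(1) using ab(2) by (simp add: field_simps)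
  have "\<bar>q\<bar> <= of_int \<bar>a\<bar>"
  proof -
   have "\<bar>of_int a\<bar> / of_int b <= \<bar>of_int a\<bar> / (1::rat)" using ab(2) by (intro divide_left_mono) auto
   thus ?thesis unfolding ab(1) using ab(2) by simp
  qed
  also have "\<bar>a\<bar> <= int D'"
  proof -
   have "1 * (1 * \<bar>a\<bar>) <= int D * (b * (\<bar>a\<bar> + 1))" using D(1) ab(2) by (intro mult_mono) auto
   thus ?thesis unfolding D'_def using ab(2) by (simp add: distrib_left)
  qed
  hence "(of_int \<bar>a\<bar> :: rat) <= of_int (int D')" by (simp only: of_int_le_iff)
  finally have "\<bar>q\<bar> <= of_nat D'" by simp
  moreover have "of_nat D' * q : \<int>" unfolding e by (rule Ints_of_int)
  ultimately show ?thesis using True by simp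
 next
  case False
  hence q': "of_nat D * q' : \<int>" "\<bar>q'\<bar> <= (of_nat D :: rat)" using D(2) that by auto
  have e: "of_nat D' * q' = of_nat (nat b * (nat \<bar>a\<bar> + 1)) * (of_nat D * q')" unfolding D'_def of_nat_mult by (simp only: mult_ac)
  have "of_nat D' * q' : \<int>" unfolding e by (rule Ints_mult[OF Ints_of_nat q'(1)])
  moreover have "D * 1 <= D'" unfolding D'_def using ab(2) by (intro mult_le_mono2) simp
  hence "(of_nat D :: rat) <= of_nat D'" by simp
  ultimately show ?thesis using q'(2) by linarith
 qed
 moreover have "D' > 0" unfolding D'_def using D(1) ab(2) by simp
 ultimately show ?case by blast
qed (intro exI[of _ 1], simp)

lemma bnd_exists:
 assumes "finite F" "F <= sqm n"
 shows "EX D>0. ALL A:F. bnd n D 1 (cmat A)"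
proof -
 let ?Q = "(%(A, i, j). A $$ (i, j)) ` (F \<times> {..<n} \<times> {..<n})"
 have "finite ?Q" using assms(1) by simp
 from common_denominator[OF this]
 obtain D where D: "D > 0" "ALL q:?Q. of_nat D * q : \<int> & \<bar>q\<bar> <= (of_nat D :: rat)" by blast
 have "bnd n D 1 (cmat A)" if A: "A : F" for A
 proof -
  have c: "A : sqm n" using A assms(2) by blast
  have e: "of_nat D * A $$ (i, j) : \<int>" "\<bar>A $$ (i, j)\<bar> <= of_nat D" if "i < n" "j < n" for i j
  proof -
   have "A $$ (i, j) : ?Q" using A that by force
   thus "of_nat D * A $$ (i, j) : \<int>" "\<bar>A $$ (i, j)\<bar> <= of_nat D" using bspec[OF D(2)] by blast+
  qed
  have "of_nat D * (of_rat (A $$ (i, j)) :: complex) : \<int>" if ij: "i < n" "j < n" for i j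
  proof -
   obtain z where "of_nat D * A $$ (i, j) = of_int z" using e(1)[OF ij] by (rule Ints_cases)
   hence "of_rat (of_nat D * A $$ (i, j)) = (of_rat (of_int z) :: complex)" by simp
   thus ?thesis by (simp add: of_rat_mult)
  qed
  moreover have "(SUM j<n. cmod (of_rat (A $$ (i, j)))) <= real n * real D" if i: "i < n" for i
  proof -
   have "cmod (of_rat (A $$ (i, j))) <= real D" if "j < n" for j
   proof -
    have "cmod (of_rat (A $$ (i, j))) = cmod (of_real (of_rat (A $$ (i, j))))" by (simp only: of_real_of_rat)
    also have "... = \<bar>of_rat (A $$ (i, j))\<bar>" by (rule norm_of_real)
    also have "... = of_rat \<bar>A $$ (i, j)\<bar>" by simp
    also have "... <= of_rat (of_nat D)" using e(2)[OF i that] by (simp only: of_rat_less_eq)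
    finally show ?thesis by simp
   qed
   hence "(SUM j<n. cmod (of_rat (A $$ (i, j)))) <= (SUM j<n. real D)" by (intro sum_mono) auto
   thus ?thesis by simp
  qed
  ultimately show ?thesis using c unfolding bnd_def int_mat_def by auto
 qed
 thus ?thesis using D(1) by blast
qed

text \<open>A triangular matrix whose \<open>n\<close>-th power vanishes has zero diagonal.\<close>

lemma unitri_if_nilpotent:
 assumes A: "A : sqm n" and gh: "inv_pair n g h" and u: "utri n (g * (A - 1m n) * h)"
  and nil: "foldr (*) (replicate n (A - 1m n)) (1m n) = 0m n n"
 shows "g * A * h : unitri n 0"
proof -
 have c: "g : sqm n" "h : sqm n" "g * h = 1m n" using gh unfolding inv_pair_def by auto
 let ?B = "g * (A - 1m n) * h"
 have Ac: "A - 1m n : sqm n" using A by (intro minus_carrier_mat) simp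
 have "foldr (*) (map (%A. g * A * h) (replicate n (A - 1m n))) (1m n) =
   g * foldr (*) (replicate n (A - 1m n)) (1m n) * h"
  by (rule conjunct1[OF prod_conj[OF gh]]) (use Ac in auto)
 hence z: "foldr (*) (replicate n ?B) (1m n) = 0m n n" unfolding nil map_replicate using c by (simp del: foldr_replicate)
 have "utri n (foldr (*) (replicate k ?B) (1m n)) &
  (ALL i<n. foldr (*) (replicate k ?B) (1m n) $$ (i, i) = ?B $$ (i, i) ^ k)" for k
 proof (induction k)
  case 0
  show ?case using utri_one by simp
 next
  case (Suc k)
  have "foldr (*) (replicate (Suc k) ?B) (1m n) = ?B * foldr (*) (replicate k ?B) (1m n)" by simp
  thus ?case using utri_mult[OF u, of "foldr (*) (replicate k ?B) (1m n)"] Suc by (simp del: foldr_replicate)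
 qed
 hence "?B $$ (i, i) ^ n = 0" if "i < n" for i using z that by (metis index_zero_mat(1))
 hence B0: "?B $$ (i, i) = 0" if "i < n" for i using that by simp
 have "g * (A - 1m n) * h = g * A * h - g * 1m n * h"
  using c A by (simp add: mult_minus_distrib_mat[of _ n n] minus_mult_distrib_mat[of _ n n])
 also have "... = g * A * h - 1m n" using c by simp
 finally have e: "?B = g * A * h - 1m n" .
 have C: "g * A * h : sqm n" using c A by simp
 have "(g * A * h) $$ (i, j) = ?B $$ (i, j) + 1m n $$ (i, j)" if "i < n" "j < n" for i j
  unfolding e using C that by simp
 thus ?thesis using C u B0 unfolding unitri_def utri_def by auto
qed

lemma mtr_conj:
 assumes A: "A : sqm n" and gh: "inv_pair n g h"
 shows "mtr n ((g * A * h) ^m j) = mtr n (A ^m j)"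
proof -
 have c: "g : sqm n" "h : sqm n" "g * h = 1m n" "h * g = 1m n" using gh unfolding inv_pair_def by auto
 have Aj: "A ^m j : sqm n" using A by simp
 have "mtr n ((g * A * h) ^m j) = mtr n ((g * A ^m j) * h)" using conj_pow_mat[OF c(1,2,4,3) A] by simp
 also have "... = mtr n (h * (g * A ^m j))" by (rule mtr_comm) (use c Aj in auto)
 also have "h * (g * A ^m j) = (h * g) * A ^m j" by (rule assoc_mult_mat[symmetric, OF c(2,1) Aj])
 also have "... = A ^m j" unfolding c(4) by (rule left_mult_one_mat[OF Aj])
 finally show ?thesis .
qed

context abelian_mod
begin

text \<open>Equivalent to the absence of relations modulo \<open>N\<close>, because exponents can be
  scaled. This form fits the completeness proof, where small traces yield a power of the product
  that lies in \<open>N\<close>.\<close>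

definition indep :: "'a list => bool" where
 "indep ds <-> (ALL p. length p = length ds --> (EX \<delta>>0. prod_pow ds p [^] (\<delta>::nat) : N) --> (ALL e:set p. e = 0))"

text \<open>Greedy choice from the end of the list: an element with no positive power in the span of
  those already chosen can be added without losing independence.\<close>

lemma independent_sublist:
 "set ts <= T ==> EX ds. set ds <= set ts & indep ds &
   (ALL t:set ts. EX m>0. EX es. length es = length ds & t [^] (m::nat) ** prod_pow ds es : N)"
proof (induction ts)
 case Nil
 show ?case unfolding indep_def by (intro exI[of _ "[]"]) auto
next
 case (Cons t ts)
 then obtain ds where ds: "set ds <= set ts" "indep ds"
  "!!t. t : set ts ==> EX m>0. EX es. length es = length ds & t [^] (m::nat) ** prod_pow ds es : N" by auto
 have tT: "t : T" and dsT: "set ds <= T" using Cons.prems ds(1) by auto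
 show ?case
 proof (cases "EX m>0. EX es. length es = length ds & t [^] (m::nat) ** prod_pow ds es : N")
  case True
  thus ?thesis using ds by (intro exI[of _ ds]) auto
 next
  case False
  have c: "prod_pow ds es : T" for es by (rule prod_pow_closed[OF sub(2) dsT])
  have "indep (t # ds)" unfolding indep_def
  proof (intro allI impI)
   fix p :: "int list" assume p: "length p = length (t # ds)" "EX \<delta>>0. prod_pow (t # ds) p [^] (\<delta>::nat) : N"
   obtain e es where e: "p = e # es" "length es = length ds" using p(1) by (cases p) auto
   obtain \<delta> :: nat where d: "\<delta> > 0" "prod_pow (t # ds) p [^] \<delta> : N" using p(2) by auto
   have "set (t # ds) <= T" using tT dsT by simp
   hence *: "prod_pow (t # ds) (map (%x. int \<delta> * x) p) : N"
    using d(2) eqv_in_N[OF prod_pow_scale[OF _ p(1)] pow_in(1)] prod_pow_closed[OF sub(2), of "t # ds"] by blast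
   have e0: "e = 0"
   proof (rule ccontr)
    assume "e ~= 0"
    define m where "m = nat \<bar>int \<delta> * e\<bar>"
    have m: "m > 0" using \<open>e ~= 0\<close> d(1) unfolding m_def by simp
    have "EX fs. length fs = length ds & t [^] m ** prod_pow ds fs : N"
    proof (cases "e > 0")
     case True
     hence "t [^] (int \<delta> * e) = t [^] m" unfolding m_def by (simp flip: int_pow_int)
     thus ?thesis using * e by (intro exI[of _ "map (%x. int \<delta> * x) es"]) simp
    next
     case False
     \<comment> \<open>A negative coefficient of \<open>t\<close> is turned into a positive exponent
       by inverting the relation.\<close>
     define q where "q = map uminus (map (%x. int \<delta> * x) p)"
     have P: "prod_pow (t # ds) k : T" for k by (rule prod_pow_closed[OF sub(2)]) (use tT dsT in auto)
     have "prod_pow (t # ds) (map (%x. int \<delta> * x) p) ** prod_pow (t # ds) q : N"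
      unfolding q_def by (rule prod_pow_neg) (use tT dsT p in auto)
     hence "inv (prod_pow (t # ds) (map (%x. int \<delta> * x) p)) ** (prod_pow (t # ds) (map (%x. int \<delta> * x) p) ** prod_pow (t # ds) q) : N"
      by (rule N.m_closed[OF N.m_inv_closed[OF *]])
     moreover have "inv (prod_pow (t # ds) (map (%x. int \<delta> * x) p)) ** (prod_pow (t # ds) (map (%x. int \<delta> * x) p) ** prod_pow (t # ds) q) = prod_pow (t # ds) q"
      by (rule inv_cancel(1)) (use P[THEN T.mem_carrier] in blast)+
     ultimately have "prod_pow (t # ds) q : N" by (simp only:)
     moreover have "t [^] (- (int \<delta> * e)) = t [^] m"
     proof -
      have "- (int \<delta> * e) = int m" unfolding m_def using False mult_nonneg_nonpos[of "int \<delta>" e] by simp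
      thus ?thesis by (simp only: int_pow_int)
     qed
     ultimately show ?thesis using e unfolding q_def by (intro exI[of _ "map uminus (map (%x. int \<delta> * x) es)"]) simp
    qed
    thus False using False m by blast
   qed
   have "prod_pow ds es [^] \<delta> : N" using d(2) e e0 c[THEN T.mem_carrier] by simp
   hence "ALL e:set es. e = 0" using ds(2) e(2) d(1) unfolding indep_def by blast
   thus "ALL e:set p. e = 0" using e e0 by simp
  qed
  moreover have "EX m>0. EX es. length es = length (t # ds) & t' [^] (m::nat) ** prod_pow (t # ds) es : N"
   if t': "t' : set (t # ds @ ts)" "t' : set (t # ts)" for t'
  proof (cases "t' = t")
   case True
   have z: "prod_pow ds (map (%_. 0) ds) = \<one>" using dsT by (induction ds) auto
   have "t [^] (1::nat) ** prod_pow (t # ds) ((- 1) # map (%_. 0) ds) : N"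
    using tT z by (simp add: int_pow_neg)
   thus ?thesis using True by (intro exI[of _ "1::nat"] conjI exI[of _ "(- 1) # map (%_. 0) ds"]) auto
  next
   case False
   then obtain m es where m: "m > 0" "length es = length ds" "t' [^] (m::nat) ** prod_pow ds es : N" using ds(3)[of t'] t'(2) by auto
   hence "t' [^] m ** prod_pow (t # ds) (0 # es) : N" using c[THEN T.mem_carrier] by simp
   thus ?thesis using m by (intro exI[of _ m] conjI exI[of _ "0 # es"]) auto
  qed
  ultimately show ?thesis using ds(1) by (intro exI[of _ "t # ds"]) auto
 qed
qed

end

context group
begin

lemma hcert_complete:
 fixes \<phi>0 :: "'a => rat mat"
 assumes sf: "solvable_by_finite G" and R0: "rep n (carrier G) \<phi>0" and S: "finite S" "S <= carrier G"
 shows "EX g h ts rs bs ds D J. inv_pair n g h & hcert n (%x. g * \<phi>0 x * h) S ts rs bs ds D J"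
proof -
 from malcev_characters[OF sf R0] obtain K \<chi> where K: "fin_idx K (carrier G)"
  and M: "ALL k<n. ALL x:K. ALL y:K. \<chi> k (x ** y) = \<chi> k x * \<chi> k y"
  "ALL x:K. ALL l. eigenvalue (cmat (\<phi>0 x)) l <-> (EX k<n. l = \<chi> k x)"
  "ALL xs. set xs <= {x : K. ALL k<n. \<chi> k x = 1} --> length xs = n -->
    foldr (*) (map (%x. \<phi>0 x - 1m n) xs) (1m n) = 0m n n"
  by (elim exE conjE) (rule that)
 have chi: "\<chi> k (x ** y) = \<chi> k x * \<chi> k y" if "k < n" "x : K" "y : K" for k x y
  using M(1) that by simp
 have chi_ev: "eigenvalue (cmat (\<phi>0 x)) l <-> (EX k<n. l = \<chi> k x)" if "x : K" for x l
  using M(2) that by simp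
 have nil: "foldr (*) (map (%x. \<phi>0 x - 1m n) xs) (1m n) = 0m n n"
  if "set xs <= {x : K. ALL k<n. \<chi> k x = 1}" "length xs = n" for xs
  by (rule M(3)[rule_format, OF that])
 note r0 = repD[OF R0]
 have Ks: "subgroup K G" using K unfolding fin_idx_def by simp
 interpret K: subgroup K G by (rule Ks)
 \<comment> \<open>Multiplicativity would also allow the value 0 here; the eigenvalues of the
   identity matrix exclude it.\<close>
 have chi1: "\<chi> k \<one> = 1" if k: "k < n" for k
 proof -
  have "eigenvalue (cmat (\<phi>0 \<one>)) (\<chi> k \<one>)" using chi_ev[of \<one>] k by auto
  then obtain v where v: "v : carrier_vec n" "v ~= 0v n" "1m n *v v = \<chi> k \<one> *s v"
   unfolding eigenvalue_def eigenvector_def r0(4) by (auto simp: of_rat_hom.mat_hom_one)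
  obtain i where i: "i < n" "v $ i ~= 0" using v(1,2) by (metis eq_vecI carrier_vecD index_zero_vec)
  have "v $ i = \<chi> k \<one> * v $ i" using arg_cong[OF v(3), of "%u. vec_index u i"] v(1) i(1) by simp
  thus ?thesis using i(2) by simp
 qed
 have chi0: "\<chi> k x ~= 0" if "k < n" "x : K" for k x
 proof
  assume "\<chi> k x = 0"
  hence "\<chi> k (x ** inv x) = 0" using chi[of k x "inv x"] that by simp
  thus False using chi1 that by simp
 qed
 have chi_inv: "\<chi> k (inv x) = inverse (\<chi> k x)" if "k < n" "x : K" for k x
  using chi[of k x "inv x"] chi1[of k] chi0[of k x] that by (simp add: field_simps)
 have chi_pow: "\<chi> k (x [^] (m::nat)) = \<chi> k x ^ m" if "k < n" "x : K" for k x m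
  using that chi1 chi subgroup_nat_pow[OF Ks] by (induction m) auto
 from kronecker_traces[of n] obtain J where J0: "J > 0" and J1: "ALL es :: complex list. length es = n --> 0 ~: set es -->
   (ALL j. 0 < j --> j <= J --> (SUM l<-es. l ^ j) : \<int> & cmod (SUM l<-es. l ^ j) <= real n) -->
   (EX \<delta>>0. ALL l:set es. l ^ \<delta> = 1)" by (elim exE conjE) (rule that)
 obtain R where R: "finite R" "R <= carrier G" "!!x. x : carrier G ==> EX r:R. x ** inv r : K"
  using K unfolding fin_idx_def by auto
 then obtain rp where rp: "!!x. x : carrier G ==> rp x : R" "!!x. x : carrier G ==> x ** inv (rp x) : K" by metis
 obtain rs where rs: "set rs = insert \<one> R" using R(1) by (meson finite.insertI finite_list)
 have rsc: "set rs <= carrier G" using rs R(2) by simp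
 \<comment> \<open>Schreier generators. As \<open>S\<close> is finite, they give a finitely
   generated subgroup of \<open>K\<close> that satisfies Schreier's condition by
   construction.\<close>
 define Y where "Y = (%(r, s). r ** s ** inv (rp (r ** s))) ` (set rs \<times> S)"
 have Y: "finite Y" "Y <= K" using S rsc rp(2) unfolding Y_def by (auto simp: subset_iff)
 have "finite (Y \<union> (%x. inv x) ` Y)" using Y by simp
 then obtain ts where ts: "set ts = Y \<union> (%x. inv x) ` Y" by (meson finite_list)
 have tsK: "set ts <= K" using ts Y by auto
 have tsc: "set ts <= carrier G" using tsK K.subset by blast
 define T where "T = generate G (set ts)"
 have Ts: "subgroup T G" unfolding T_def by (rule generate_is_subgroup[OF tsc])
 interpret T: subgroup T G by (rule Ts)
 have TK: "T <= K" unfolding T_def by (rule generate_subgroup_incl[OF tsK Ks])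
 have TK': "x : K" if "x : T" for x using TK that by blast
 have tsT: "t : T" if "t : set ts" for t unfolding T_def by (rule generate.incl[OF that])
 \<comment> \<open>The common kernel of the characters: it contains all commutators of
   \<open>T\<close>, and its image is unipotent.\<close>
 define U where "U = {x : T. ALL k<n. \<chi> k x = 1}"
 have UT: "x : T" if "x : U" for x using that unfolding U_def by simp
 have Us: "subgroup U G"
 proof (rule subgroupI)
  show "U <= carrier G" unfolding U_def by auto
  have "\<one> : U" unfolding U_def using chi1 by simp
  thus "U ~= {}" by blast
  fix x y assume xy: "x : U" "y : U"
  thus "x ** y : U" unfolding U_def using chi TK' by simp
  show "inv x : U" using xy(1) chi_inv TK' unfolding U_def by simp
 qed
 have mult3: "\<chi> k (x ** y ** inv x) = \<chi> k y" if "k < n" "x : T" "y : T" for k x y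
  using that chi chi_inv chi0 TK' by simp
 have ab: "abelian_mod G U T"
 proof
  show "nrm U T"
  proof (rule nrmI[OF Us Ts])
   show "U <= T" using UT by blast
   fix x y assume "x : T" "y : U"
   thus "x ** y ** inv x : U" using mult3[of _ x y] unfolding U_def by simp
  qed
  fix x y assume xy: "x : T" "y : T"
  have "\<chi> k (x ** y ** inv x ** inv y) = 1" if "k < n" for k
   using chi[OF that, of "x ** y ** inv x" "inv y"] mult3[OF that xy] chi_inv[OF that] chi0[OF that] TK' xy by simp
  thus "x ** y ** inv x ** inv y : U" unfolding U_def using xy by simp
 qed
 interpret A: abelian_mod G U T by (rule ab)
 have Uc: "\<phi>0 u : sqm n" if "u : U" for u using r0(2)[of u] UT[OF that] by simp
 \<comment> \<open>Mal'cev's basis is complex. That products of \<open>n\<close> matrices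
   \<open>\<phi>0 u - 1m n\<close> vanish is a statement over the rationals, and it yields a
   rational basis in which \<open>U\<close> is unitriangular.\<close>
 obtain g h where gh: "inv_pair n g h" and tri: "!!A. A : (%u. \<phi>0 u - 1m n) ` U ==> utri n (g * A * h)"
 proof -
  have "(%u. \<phi>0 u - 1m n) ` U <= sqm n" by (auto intro!: minus_carrier_mat)
  moreover have "foldr (*) As (1m n) = 0m n n" if As: "set As <= (%u. \<phi>0 u - 1m n) ` U" "length As = n" for As
  proof -
   have "As : map (%u. \<phi>0 u - 1m n) ` lists U" unfolding lists_image[symmetric] using As(1) by (auto simp: lists_eq_set)
   then obtain xs where xs: "set xs <= U" "As = map (%u. \<phi>0 u - 1m n) xs" by (auto simp: lists_eq_set)
   have "x : {x : K. ALL k<n. \<chi> k x = 1}" if "x : U" for x using that TK'[OF UT[OF that]] unfolding U_def by simp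
   hence "set xs <= {x : K. ALL k<n. \<chi> k x = 1}" using xs(1) by blast
   thus ?thesis unfolding xs(2) by (rule nil) (use xs(2) As(2) in simp)
  qed
  ultimately have "EX g h. inv_pair n g h & (ALL A:(%u. \<phi>0 u - 1m n) ` U. utri n (g * A * h))" by (rule nil_triangular)
  then obtain g h where "inv_pair n g h" "ALL A:(%u. \<phi>0 u - 1m n) ` U. utri n (g * A * h)" by (elim exE conjE)
  thus ?thesis by (intro that) auto
 qed
 have ghc: "g : sqm n" "h : sqm n" "g * h = 1m n" "h * g = 1m n" using gh unfolding inv_pair_def by auto
 define \<phi> where "\<phi> x = g * \<phi>0 x * h" for x
 have R1: "rep n (carrier G) \<phi>" unfolding \<phi>_def by (rule rep_conj[OF R0 gh])
 note rD = repD[OF R1]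
 have Uu: "\<phi> u : unitri n 0" if u: "u : U" for u unfolding \<phi>_def
 proof (rule unitri_if_nilpotent[OF Uc[OF u] gh])
  show "utri n (g * (\<phi>0 u - 1m n) * h)" using tri u by blast
  have "u : {x : K. ALL k<n. \<chi> k x = 1}" using u TK'[OF UT[OF u]] unfolding U_def by simp
  hence "set (replicate n u) <= {x : K. ALL k<n. \<chi> k x = 1}" unfolding set_replicate_conv_if by simp
  hence "foldr (*) (map (%x. \<phi>0 x - 1m n) (replicate n u)) (1m n) = 0m n n"
   by (rule nil) simp
  thus "foldr (*) (replicate n (\<phi>0 u - 1m n)) (1m n) = 0m n n" by (simp only: map_replicate)
 qed
 have mg: "matgrp n (\<phi> ` U)" unfolding matgrp_def
 proof (intro conjI ballI)
  show "\<phi> ` U <= sqm n" using rD(2) UT by auto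
  have "\<phi> \<one> : \<phi> ` U" by (rule imageI[OF subgroup.one_closed[OF Us]])
  thus "1m n : \<phi> ` U" unfolding rD(4) .
 next
  fix x y assume "x : \<phi> ` U" "y : \<phi> ` U"
  then obtain a b where ab: "a : U" "x = \<phi> a" "b : U" "y = \<phi> b" by auto
  have "x * y = \<phi> (a ** b)" unfolding ab(2,4) using UT[OF ab(1)] UT[OF ab(3)] by (intro rD(3)[symmetric]) auto
  thus "x * y : \<phi> ` U" using subgroup.m_closed[OF Us ab(1,3)] by blast
 next
  fix x assume "x : \<phi> ` U"
  then obtain a where a: "a : U" "x = \<phi> a" by auto
  have "a : carrier G" using UT[OF a(1)] by simp
  thus "EX y:\<phi> ` U. x * y = 1m n & y * x = 1m n"
   unfolding a(2) by (intro bexI[OF _ imageI[OF subgroup.m_inv_closed[OF Us a(1)]]] conjI rD(5,6))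
 qed
 obtain bsm where bsm: "mbasis n 0 bsm" "set bsm <= \<phi> ` U" "\<phi> ` U \<inter> unitri n 0 <= rhull n bsm"
  using mbasis_exists[OF mg, of 0] Uu by auto
 have "bsm : map \<phi> ` lists U" unfolding lists_image[symmetric] using bsm(2) by (auto simp: lists_eq_set)
 then obtain bs where bs: "set bs <= U" "bsm = map \<phi> bs" by (auto simp: lists_eq_set)
 have hull: "\<phi> u : rhull n (map \<phi> bs)" if "u : U" for u using bsm(3) Uu[OF that] that bs(2) by blast
 obtain ds where ds: "set ds <= set ts" "A.indep ds"
  "!!t. t : set ts ==> EX m>0. EX es. length es = length ds & t [^] (m::nat) ** prod_pow ds es : U"
  using A.independent_sublist[of ts] tsT by (metis subsetI)
 have dsc: "set ds <= carrier G" "set ds <= T" using ds(1) tsc tsT by auto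
 obtain D where D: "D > 0" "!!A. A : \<phi> ` (set ds \<union> (%d. inv d) ` set ds) ==> bnd n D 1 (cmat A)"
 proof -
  have "\<phi> ` (set ds \<union> (%d. inv d) ` set ds) <= sqm n" using rD(2) dsc by auto
  from bnd_exists[OF _ this] obtain D where "D > 0" "ALL A:\<phi> ` (set ds \<union> (%d. inv d) ` set ds). bnd n D 1 (cmat A)" by auto
  from this(1) bspec[OF this(2)] show ?thesis by (rule that)
 qed
 \<comment> \<open>This holds for every nonzero \<open>p\<close>, inside the box or not: small
   traces make all eigenvalues of \<open>c\<close> roots of unity of a common exponent
   \<open>\<delta>\<close>, so the characters are trivial on \<open>c [^] \<delta>\<close>, against
   independence.\<close>
 have box: "~ small_traces n J (\<phi> (prod_pow ds p))" if p: "length p = length ds" "EX e:set p. e ~= 0" for p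
 proof
  assume sm: "small_traces n J (\<phi> (prod_pow ds p))"
  define c where "c = prod_pow ds p"
  have cT: "c : T" unfolding c_def by (rule prod_pow_closed[OF Ts dsc(2)])
  have c0: "\<phi>0 c : sqm n" using r0(2)[of c] cT by simp
  have "cmat (\<phi>0 c) : sqm n" using c0 by simp
  from eigenvalue_list[OF this] obtain es where es: "length es = n" "!!l. eigenvalue (cmat (\<phi>0 c)) l <-> l : set es"
   "!!k. mtr n (cmat (\<phi>0 c) ^m k) = (SUM l<-es. l ^ k)" by blast
  have tr: "(SUM l<-es. l ^ j) = of_rat (mtr n (\<phi> c ^m j))" for j
   unfolding es(3)[symmetric] cmat_pow[OF c0, symmetric] mtr_cmat[OF pow_carrier_mat[OF c0]] \<phi>_def mtr_conj[OF c0 gh] ..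
  have "EX \<delta>>0. ALL l:set es. l ^ \<delta> = 1"
  proof (rule J1[rule_format, OF es(1)])
   show "0 ~: set es"
   proof
    assume "0 : set es"
    then obtain k where "k < n" "0 = \<chi> k c" using es(2)[of 0] chi_ev[OF TK'[OF cT]] by auto
    thus False using chi0[OF _ TK'[OF cT]] by metis
   qed
   fix j :: nat assume j: "0 < j" "j <= J"
   hence t: "mtr n (\<phi> c ^m j) : \<int>" "\<bar>mtr n (\<phi> c ^m j)\<bar> <= of_nat n" using sm unfolding small_traces_def c_def by auto
   obtain z where z: "mtr n (\<phi> c ^m j) = of_int z" using t(1) by (rule Ints_cases)
   have "(of_int \<bar>z\<bar> :: rat) <= of_int (int n)" using t(2) unfolding z by simp
   hence "\<bar>z\<bar> <= int n" by (simp only: of_int_le_iff)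
   hence "real_of_int \<bar>z\<bar> <= real n" by linarith
   thus "(SUM l<-es. l ^ j) : \<int> & cmod (SUM l<-es. l ^ j) <= real n" unfolding tr z by simp
  qed
  then obtain \<delta> where d: "\<delta> > 0" "!!l. l : set es ==> l ^ \<delta> = 1" by auto
  have "\<chi> k (c [^] \<delta>) = 1" if "k < n" for k
   using chi_pow[OF that TK'[OF cT]] d(2)[of "\<chi> k c"] es(2) chi_ev[OF TK'[OF cT]] that by auto
  hence "c [^] \<delta> : U" unfolding U_def using subgroup_nat_pow[OF Ts cT] by simp
  hence "ALL e:set p. e = 0" using ds(2) p(1) d(1) unfolding A.indep_def c_def by blast
  thus False using p(2) by blast
 qed
 have "hcert n \<phi> S ts rs bs ds D J" unfolding hcert_def T_def[symmetric]
 proof (intro conjI)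
  show "set ts <= carrier G" "set rs <= carrier G" by fact+
  show "\<one> : set rs" using rs by simp
  have "inv (inv x) = x" if "x : Y" for x using that Y K.subset by auto
  thus "ALL t:set ts. inv t : set ts" unfolding ts by auto
  show "ALL r:set rs. ALL s:S. EX t:set ts. EX r':set rs. r ** s = t ** r'"
  proof (intro ballI)
   fix r s assume r: "r : set rs" and s: "s : S"
   have c: "r : carrier G" "s : carrier G" using r s rsc S by auto
   have rpc: "rp (r ** s) : R" "rp (r ** s) : carrier G" using rp(1)[of "r ** s"] R(2) c by auto
   have "r ** s ** inv (rp (r ** s)) : set ts" unfolding ts Y_def using r s by force
   moreover have "r ** s = (r ** s ** inv (rp (r ** s))) ** rp (r ** s)" using c rpc by (simp add: m_assoc)
   ultimately show "EX t:set ts. EX r':set rs. r ** s = t ** r'" using rpc(1) rs by blast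
  qed
  show "set bs <= T" using bs(1) UT by blast
  show "mbasis n 0 (map \<phi> bs)" using bsm(1) bs(2) by simp
  show "ALL t:set ts. ALL b:set bs. \<phi> (t ** b ** inv t) : rhull n (map \<phi> bs)"
   using hull A.conj_N tsT bs(1) by blast
  show "ALL t:set ts. ALL t':set ts. \<phi> (t ** t' ** inv t ** inv t') : rhull n (map \<phi> bs)"
   using hull A.comm tsT by blast
  show "set ds <= set ts" "D > 0" "J > 0" using ds(1) D(1) J0 by simp_all
  show "ALL d:set ds. bnd n D 1 (cmat (\<phi> d)) & bnd n D 1 (cmat (\<phi> (inv d)))"
   using D(2) by auto
  show "ALL p. length p = length ds --> (EX e:set p. e ~= 0) --> (ALL e:set p. \<bar>e\<bar> <= int (box_size n D J (length ds))) -->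
    ~ small_traces n J (\<phi> (prod_pow ds p))" using box by blast
  show "ALL t:set ts. EX m>0. EX es. length es = length ds & \<phi> (t [^] (m::nat) ** prod_pow ds es) : rhull n (map \<phi> bs)"
  proof
   fix t assume "t : set ts"
   then obtain m es where "m > 0" "length es = length ds" "t [^] (m::nat) ** prod_pow ds es : U" using ds(3) by blast
   thus "EX m>0. EX es. length es = length ds & \<phi> (t [^] (m::nat) ** prod_pow ds es) : rhull n (map \<phi> bs)"
    using hull by blast
  qed
 qed
 thus ?thesis using gh unfolding \<phi>_def by blast
qed

end

section \<open>The matrix group over a number field\<close>

lemma rat_adjoin_closed:
 fixes \<alpha> :: complex
 shows "1 : rat_adjoin \<alpha>" "0 : rat_adjoin \<alpha>"
  "x : rat_adjoin \<alpha> ==> y : rat_adjoin \<alpha> ==> x + y : rat_adjoin \<alpha>"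
  "x : rat_adjoin \<alpha> ==> y : rat_adjoin \<alpha> ==> x * y : rat_adjoin \<alpha>"
proof -
 let ?R = "ring_of_type_algebra :: complex ring"
 interpret R: ring ?R by (rule ring_from_type_algebra)
 have r: "\<one>\<^bsub>?R\<^esub> = 1" "\<zero>\<^bsub>?R\<^esub> = 0" "x \<oplus>\<^bsub>?R\<^esub> y = x + y" "x \<otimes>\<^bsub>?R\<^esub> y = x * y" "carrier ?R = UNIV" for x y
  unfolding ring_of_type_algebra_def by auto
 show o: "1 : rat_adjoin \<alpha>" using generate_field.one[of ?R] unfolding rat_adjoin_def r .
 show a: "x : rat_adjoin \<alpha> ==> y : rat_adjoin \<alpha> ==> x + y : rat_adjoin \<alpha>" for x y
  using generate_field.eng_add[of x ?R _ y] unfolding rat_adjoin_def r .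
 show "x : rat_adjoin \<alpha> ==> y : rat_adjoin \<alpha> ==> x * y : rat_adjoin \<alpha>"
  using generate_field.eng_mult[of x ?R _ y] unfolding rat_adjoin_def r .
 have "\<ominus>\<^bsub>?R\<^esub> 1 : rat_adjoin \<alpha>" using generate_field.a_inv[of 1 ?R] o unfolding rat_adjoin_def .
 from a[OF o this] have "1 \<oplus>\<^bsub>?R\<^esub> (\<ominus>\<^bsub>?R\<^esub> 1) : rat_adjoin \<alpha>" unfolding r .
 moreover have "1 \<oplus>\<^bsub>?R\<^esub> (\<ominus>\<^bsub>?R\<^esub> 1) = \<zero>\<^bsub>?R\<^esub>" by (rule R.r_neg) (simp add: r)
 ultimately show "0 : rat_adjoin \<alpha>" unfolding r by simp
qed

lemma mat_monoid_rat_adjoin: "monoid (mat_monoid n (rat_adjoin \<alpha>))"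
proof (rule monoidI)
 let ?P = "rat_adjoin \<alpha>" and ?M = "mat_monoid n (rat_adjoin \<alpha>)"
 have el: "elements_mat A <= ?P <-> (ALL i<n. ALL j<n. A $$ (i, j) : ?P)" if A: "A : sqm n" for A
 proof
  show "ALL i<n. ALL j<n. A $$ (i, j) : ?P" if "elements_mat A <= ?P" using that elements_matI[OF A] by blast
  show "elements_mat A <= ?P" if "ALL i<n. ALL j<n. A $$ (i, j) : ?P" using that A by (auto dest!: elements_matD)
 qed
 have s: "(SUM k:K. f k) : ?P" if "!!k. k : K ==> f k : ?P" for f and K :: "nat set"
  using that by (induction K rule: infinite_finite_induct) (auto intro: rat_adjoin_closed)
 have c: "carrier ?M = {A : sqm n. ALL i<n. ALL j<n. A $$ (i, j) : ?P}"
  unfolding mat_monoid_def using el by auto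
 have [simp]: "x \<otimes>\<^bsub>?M\<^esub> y = x * y" "\<one>\<^bsub>?M\<^esub> = 1m n" for x y unfolding mat_monoid_def by auto
 show "\<one>\<^bsub>?M\<^esub> : carrier ?M" unfolding c by (auto intro: rat_adjoin_closed)
 fix x y assume x: "x : carrier ?M" and y: "y : carrier ?M"
 have xc: "x : sqm n" "y : sqm n" using x y unfolding c by auto
 have "(x * y) $$ (i, j) : ?P" if ij: "i < n" "j < n" for i j
  unfolding mat_mult_index[OF xc ij] using x y ij unfolding c by (intro s rat_adjoin_closed) auto
 thus "x \<otimes>\<^bsub>?M\<^esub> y : carrier ?M" using xc unfolding c by auto
 show "\<one>\<^bsub>?M\<^esub> \<otimes>\<^bsub>?M\<^esub> x = x" "x \<otimes>\<^bsub>?M\<^esub> \<one>\<^bsub>?M\<^esub> = x" using xc by auto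
 fix z assume "z : carrier ?M"
 thus "x \<otimes>\<^bsub>?M\<^esub> y \<otimes>\<^bsub>?M\<^esub> z = x \<otimes>\<^bsub>?M\<^esub> (y \<otimes>\<^bsub>?M\<^esub> z)" using xc unfolding c by (auto simp: assoc_mult_mat[of _ n n])
qed

lemma GL_group: "group (GL n (rat_adjoin \<alpha>))"
 unfolding GL_def by (rule monoid.units_group[OF mat_monoid_rat_adjoin])

lemma GL_simps [simp]: "x \<otimes>\<^bsub>GL n P\<^esub> y = x * y" "\<one>\<^bsub>GL n P\<^esub> = 1m n"
 unfolding GL_def mat_monoid_def by (auto simp: units_of_mult units_of_one)

lemma GL_carrier: "x : carrier (GL n P) ==> x : sqm n"
 unfolding GL_def units_of_carrier Units_def mat_monoid_def by auto

subsection \<open>Restriction of scalars\<close>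

definition peval :: "complex => nat => rat list => complex" where
 "peval \<alpha> d v = (SUM a<d. of_rat (nth_default 0 v a) * \<alpha> ^ a)"

text \<open>Multiplication by \<open>\<alpha>\<close> on coefficient lists, with \<open>mc\<close> the coefficients of its monic minimal polynomial.\<close>

definition mulx :: "nat => rat list => rat list => rat list" where
 "mulx d mc v = map (%a. (if a = 0 then 0 else nth_default 0 v (a - 1)) -
   nth_default 0 v (d - 1) * nth_default 0 mc a) [0..<d]"

definition powx :: "nat => rat list => nat => rat list => rat list" where
 "powx d mc k v = rec_nat v (%i u. mulx d mc u) k"

text \<open>Multiplication by \<open>M\<close> in rational coordinates: the entry in row
  \<open>i * d + a\<close> and column \<open>j * d + b\<close> is the coefficient of
  \<open>\<alpha> ^ a\<close> in \<open>\<alpha> ^ b\<close> times the entry of \<open>M\<close> in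
  row \<open>i\<close> and column \<open>j\<close>.\<close>

definition blockL :: "nat => rat list => nat => rat list list list => rat list list" where
 "blockL d mc N M = map (%x. map (%y. nth_default 0 (powx d mc (y mod d)
   (nth_default [] (nth_default [] M (x div d)) (y div d))) (x mod d)) [0..<N]) [0..<N]"

lemma nth_default_mulx: "a < d ==> nth_default 0 (mulx d mc v) a =
  (if a = 0 then 0 else nth_default 0 v (a - 1)) - nth_default 0 v (d - 1) * nth_default 0 mc a"
 unfolding mulx_def by (simp add: nth_default_nth)

lemma mat_mult_index_rect:
 assumes "A : carrier_mat n k" "B : carrier_mat k l" "i < n" "j < l"
 shows "(A * B) $$ (i, j) = (SUM x<k. A $$ (i, x) * B $$ (x, j))"
 using assms by (simp add: scalar_prod_def atLeast0LessThan)

lemma eval_rat_poly_sum: "degree q < d ==> eval_rat_poly \<alpha> q = (SUM a<d. of_rat (coeff q a) * \<alpha> ^ a)"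
proof -
 assume d: "degree q < d"
 have "eval_rat_poly \<alpha> q = (SUM a<=degree q. of_rat (coeff q a) * \<alpha> ^ a)"
  unfolding eval_rat_poly_def by (simp add: poly_altdef coeff_map_poly degree_map_poly)
 also have "... = (SUM a<d. of_rat (coeff q a) * \<alpha> ^ a)"
  using d by (intro sum.mono_neutral_left) (auto simp: coeff_eq_0)
 finally show ?thesis .
qed

lemma peval_coeffs: "degree q < d ==> peval \<alpha> d (coeffs q) = eval_rat_poly \<alpha> q"
 unfolding peval_def by (simp add: eval_rat_poly_sum nth_default_coeffs_eq)

context
 fixes m :: "rat poly" and \<alpha> :: complex and d :: nat
 assumes min: "minimal_polynomial m \<alpha>"
 defines "d \<equiv> degree m"
begin

lemma deg_pos: "d > 0"
proof (rule ccontr)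
 assume "~ d > 0"
 hence "m = [:1:]" using min degree_0_id[of m] unfolding d_def minimal_polynomial_def by simp
 thus False using min unfolding minimal_polynomial_def eval_rat_poly_def by simp
qed

lemma alpha_pow: "(SUM a<d. of_rat (coeff m a) * \<alpha> ^ a) = - (\<alpha> ^ d)"
proof -
 have "eval_rat_poly \<alpha> m = (SUM a<Suc d. of_rat (coeff m a) * \<alpha> ^ a)"
  by (rule eval_rat_poly_sum) (simp add: d_def)
 hence "(SUM a<d. of_rat (coeff m a) * \<alpha> ^ a) + \<alpha> ^ d = 0"
  using min unfolding minimal_polynomial_def d_def by simp
 thus ?thesis by (simp add: eq_neg_iff_add_eq_0)
qed

lemma alpha_independent:
 assumes "(SUM a<d. of_rat (c a) * \<alpha> ^ a) = 0" "a < d"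
 shows "c a = 0"
proof -
 define q where "q = Poly (map c [0..<d])"
 have cq: "coeff q a = (if a < d then c a else 0)" for a unfolding q_def by (simp add: nth_default_def)
 have q0: "q = 0"
 proof (rule ccontr)
  assume "q ~= 0"
  have "degree q < d" using deg_pos \<open>q ~= 0\<close> cq by (metis leading_coeff_0_iff)
  moreover have "eval_rat_poly \<alpha> q = 0" unfolding eval_rat_poly_sum[OF calculation] using assms(1) by (simp add: cq)
  ultimately show False using min \<open>q ~= 0\<close> unfolding minimal_polynomial_def d_def by (metis not_le)
 qed
 show ?thesis using cq[of a] assms(2) q0 by simp
qed

lemma peval_mulx: "peval \<alpha> d (mulx d (coeffs m) v) = \<alpha> * peval \<alpha> d v"
proof -
 let ?v = "%a. of_rat (nth_default 0 v a) :: complex"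
 obtain e where e: "d = Suc e" using deg_pos by (cases d) auto
 have "peval \<alpha> d (mulx d (coeffs m) v) = (SUM a<d. (if a = 0 then 0 else ?v (a - 1)) * \<alpha> ^ a) -
   ?v e * (SUM a<d. of_rat (coeff m a) * \<alpha> ^ a)"
  unfolding peval_def sum_distrib_left sum_subtractf[symmetric] using e
  by (intro sum.cong) (auto simp: nth_default_mulx nth_default_coeffs_eq of_rat_diff of_rat_mult algebra_simps)
 also have "(SUM a<d. (if a = 0 then 0 else ?v (a - 1)) * \<alpha> ^ a) = (SUM a<e. ?v a * \<alpha> ^ Suc a)"
  unfolding e sum.lessThan_Suc_shift by simp
 also have "(SUM a<e. ?v a * \<alpha> ^ Suc a) - ?v e * (SUM a<d. of_rat (coeff m a) * \<alpha> ^ a) = (SUM a<d. ?v a * \<alpha> ^ Suc a)"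
  unfolding alpha_pow unfolding e by simp
 also have "... = \<alpha> * peval \<alpha> d v" unfolding peval_def sum_distrib_left by (simp add: mult_ac)
 finally show ?thesis .
qed

lemma peval_powx: "peval \<alpha> d (powx d (coeffs m) k v) = \<alpha> ^ k * peval \<alpha> d v"
 unfolding powx_def by (induction k) (simp_all add: peval_mulx)

text \<open>The map from rational coordinates to vectors over the number field. An equation
  \<open>x * A0 n = A0 n * cmat Y\<close> says that \<open>Y\<close> is \<open>x\<close> in rational
  coordinates, without a vector space structure over the rationals.\<close>

definition A0 :: "nat => complex mat" where
 "A0 n = mat n (n * d) (%(i, y). if i = y div d then \<alpha> ^ (y mod d) else 0)"

lemma A0_carrier [simp]: "A0 n : carrier_mat n (n * d)" unfolding A0_def by simp

lemma blk: "a < d ==> i < n ==> i * d + a < n * d"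
proof -
 assume a: "a < d" "i < n"
 have "i * d + a < Suc i * d" using a by simp
 also have "... <= n * d" using a by (intro mult_le_mono1) simp
 finally show ?thesis .
qed

lemma A0_mult:
 assumes Y: "Y : carrier_mat (n * d) k" and iy: "i < n" "y < k"
 shows "(A0 n * Y) $$ (i, y) = (SUM a<d. \<alpha> ^ a * Y $$ (i * d + a, y))"
proof -
 have "(A0 n * Y) $$ (i, y) = (SUM x<n * d. A0 n $$ (i, x) * Y $$ (x, y))"
  by (rule mat_mult_index_rect[OF A0_carrier Y iy])
 also have "... = (SUM x:(%a. i * d + a) ` {..<d}. A0 n $$ (i, x) * Y $$ (x, y))"
 proof (rule sum.mono_neutral_right)
  show "(%a. i * d + a) ` {..<d} <= {..<n * d}" using blk iy by auto
  show "ALL x:{..<n * d} - (%a. i * d + a) ` {..<d}. A0 n $$ (i, x) * Y $$ (x, y) = 0"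
  proof
   fix x assume x: "x : {..<n * d} - (%a. i * d + a) ` {..<d}"
   have "i ~= x div d"
   proof
    assume "i = x div d"
    hence "x = i * d + x mod d" by simp
    moreover have "x mod d : {..<d}" using deg_pos by simp
    ultimately show False using x by blast
   qed
   thus "A0 n $$ (i, x) * Y $$ (x, y) = 0" using x iy unfolding A0_def by simp
  qed
 qed simp
 also have "... = (SUM a<d. A0 n $$ (i, i * d + a) * Y $$ (i * d + a, y))" by (subst sum.reindex) (auto simp: inj_on_def)
 also have "... = (SUM a<d. \<alpha> ^ a * Y $$ (i * d + a, y))"
  unfolding A0_def using blk iy by (intro sum.cong) auto
 finally show ?thesis .
qed

text \<open>Within each block of coordinates, the powers of \<open>\<alpha>\<close> below the degree
  are independent over the rationals.\<close>

lemma A0_inj: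
 assumes X: "Y : carrier_mat (n * d) k" "Z : carrier_mat (n * d) k" and eq: "A0 n * cmat Y = A0 n * cmat Z"
 shows "Y = Z"
proof (rule eq_matI)
 fix x y assume "x < dim_row Z" "y < dim_col Z"
 hence xy: "x < n * d" "y < k" using X by auto
 let ?i = "x div d"
 have i: "?i < n" using xy(1) by (simp add: less_mult_imp_div_less)
 have c: "cmat Y : carrier_mat (n * d) k" "cmat Z : carrier_mat (n * d) k" using X by auto
 have e: "(SUM a<d. \<alpha> ^ a * cmat Y $$ (?i * d + a, y)) = (SUM a<d. \<alpha> ^ a * cmat Z $$ (?i * d + a, y))"
  using A0_mult[OF c(1) i xy(2)] A0_mult[OF c(2) i xy(2)] eq by simp
 have "\<alpha> ^ a * cmat Y $$ (?i * d + a, y) - \<alpha> ^ a * cmat Z $$ (?i * d + a, y) =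
   of_rat (Y $$ (?i * d + a, y) - Z $$ (?i * d + a, y)) * \<alpha> ^ a" if "a < d" for a
  using X blk[OF that i] xy(2) by (simp add: of_rat_diff algebra_simps)
 hence "(SUM a<d. of_rat (Y $$ (?i * d + a, y) - Z $$ (?i * d + a, y)) * \<alpha> ^ a) =
   (SUM a<d. \<alpha> ^ a * cmat Y $$ (?i * d + a, y)) - (SUM a<d. \<alpha> ^ a * cmat Z $$ (?i * d + a, y))"
  unfolding sum_subtractf[symmetric] by (intro sum.cong) auto
 hence "(SUM a<d. of_rat (Y $$ (?i * d + a, y) - Z $$ (?i * d + a, y)) * \<alpha> ^ a) = 0" unfolding e by simp
 from alpha_independent[OF this, of "x mod d"] show "Y $$ (x, y) = Z $$ (x, y)" using deg_pos by simp
qed (use X in auto)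

lemma A0_right_inj:
 assumes x: "x : sqm n" "y : sqm n" and eq: "x * A0 n = y * A0 n"
 shows "x = y"
proof (rule eq_matI)
 fix i j assume "i < dim_row y" "j < dim_col y"
 hence ij: "i < n" "j < n" using x by auto
 have jd: "j * d < n * d" using ij(2) deg_pos by simp
 \<comment> \<open>Column \<open>j * d\<close> of \<open>A0 n\<close> is a unit vector, since the
   power of \<open>\<alpha>\<close> there is 1.\<close>
 have *: "(z * A0 n) $$ (i, j * d) = z $$ (i, j)" if z: "z : sqm n" for z
 proof -
  have "(z * A0 n) $$ (i, j * d) = (SUM k<n. z $$ (i, k) * A0 n $$ (k, j * d))"
   by (rule mat_mult_index_rect[OF z A0_carrier ij(1) jd])
  also have "... = (SUM k<n. if k = j then z $$ (i, k) else 0)"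
   unfolding A0_def using jd deg_pos by (intro sum.cong) auto
  finally show ?thesis using ij by simp
 qed
 show "x $$ (i, j) = y $$ (i, j)" using *[OF x(1)] *[OF x(2)] eq by simp
qed (use x in auto)

lemma block_mult:
 assumes M: "M : sqm n" "!!q. q : elements_mat M ==> degree q < d"
 defines "B \<equiv> mat (n * d) (n * d) (%(x, y). nth_default 0 (nth_default [] (blockL d (coeffs m) (n * d) (map (map coeffs) (mat_to_list M))) x) y)"
 shows "map_mat (eval_rat_poly \<alpha>) M * A0 n = A0 n * cmat B"
proof (rule eq_matI)
 have B: "B : carrier_mat (n * d) (n * d)" unfolding B_def by simp
 hence cB: "cmat B : carrier_mat (n * d) (n * d)" by simp
 fix i y assume "i < dim_row (A0 n * cmat B)" "y < dim_col (A0 n * cmat B)"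
 hence iy: "i < n" "y < n * d" using B A0_carrier[of n] by auto
 have yd: "y div d < n" using iy(2) by (simp add: less_mult_imp_div_less)
 let ?q = "M $$ (i, y div d)"
 have q: "degree ?q < d" using M(1) iy yd by (intro M(2) elements_matI[OF M(1)]) auto
 have "(map_mat (eval_rat_poly \<alpha>) M * A0 n) $$ (i, y) = (SUM k<n. map_mat (eval_rat_poly \<alpha>) M $$ (i, k) * A0 n $$ (k, y))"
  by (rule mat_mult_index_rect[OF _ A0_carrier iy]) (use M(1) in simp)
 also have "... = (SUM k<n. if k = y div d then eval_rat_poly \<alpha> ?q * \<alpha> ^ (y mod d) else 0)"
  unfolding A0_def using iy M(1) by (intro sum.cong) auto
 also have "... = \<alpha> ^ (y mod d) * peval \<alpha> d (coeffs ?q)" using yd by (simp add: peval_coeffs[OF q])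
 also have "... = peval \<alpha> d (powx d (coeffs m) (y mod d) (coeffs ?q))" by (simp add: peval_powx)
 also have "... = (SUM a<d. \<alpha> ^ a * cmat B $$ (i * d + a, y))"
  unfolding peval_def
 proof (rule sum.cong)
  fix a assume "a : {..<d}"
  hence a: "a < d" by simp
  have x: "i * d + a < n * d" by (rule blk[OF a iy(1)])
  have "nth_default [] (nth_default [] (map (map coeffs) (mat_to_list M)) i) (y div d) = coeffs ?q"
   unfolding mat_to_list_def using M(1) iy yd by (simp add: nth_default_nth)
  hence "B $$ (i * d + a, y) = nth_default 0 (powx d (coeffs m) (y mod d) (coeffs ?q)) a"
   unfolding B_def blockL_def using x iy a by (simp add: nth_default_nth)
  thus "of_rat (nth_default 0 (powx d (coeffs m) (y mod d) (coeffs ?q)) a) * \<alpha> ^ a = \<alpha> ^ a * cmat B $$ (i * d + a, y)"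
   using x iy B by simp
 qed simp
 also have "... = (A0 n * cmat B) $$ (i, y)" by (rule A0_mult[OF cB iy, symmetric])
 finally show "(map_mat (eval_rat_poly \<alpha>) M * A0 n) $$ (i, y) = (A0 n * cmat B) $$ (i, y)" .
qed (use M in "auto simp: B_def A0_def")

end

text \<open>With default 0 every list of lists, whatever its shape, stands for a matrix of each
  size; matrices are therefore compared by \<open>eqL\<close>, not by equality of lists.\<close>

definition entL :: "rat list list => nat => nat => rat" where
 "entL A i j = nth_default 0 (nth_default [] A i) j"

definition toM :: "nat => rat list list => rat mat" where
 "toM N A = mat N N (%(i, j). entL A i j)"

lemma toM_carrier [simp]: "toM N A : sqm N"
 unfolding toM_def by simp

lemma cmat_mult_rect: "A : carrier_mat n k ==> B : carrier_mat k l ==> cmat (A * B) = cmat A * cmat B"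
 by (rule of_rat_hom.mat_hom_mult)

lemma rat_inverse_exists:
 assumes "mat_inj n n (A :: rat mat)" "A : sqm n"
 shows "EX B. inv_pair n A B"
 using assms unfolding mat_inj_def by (intro inv_pair_exists) auto

lemma scalar_embedding:
 assumes min: "minimal_polynomial m \<alpha>" and S: "S <= carrier (GL n (rat_adjoin \<alpha>))"
  and pres: "presents_matrices m \<alpha> n Ms S"
 defines "G \<equiv> subgroup_generated (GL n (rat_adjoin \<alpha>)) S" and "N \<equiv> n * degree m"
 shows "group G" "S <= carrier G" "carrier G = generate G S"
  "EX \<phi>. group.rep G N (carrier G) \<phi> & inj_on \<phi> (carrier G) &
   (ALL M:set Ms. \<phi> (map_mat (eval_rat_poly \<alpha>) M) =
     toM N (blockL (degree m) (coeffs m) N (map (map coeffs) (mat_to_list M))))"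
proof -
 let ?L = "GL n (rat_adjoin \<alpha>)"
 interpret L: group ?L by (rule GL_group)
 show gG: "group G" unfolding G_def by (rule L.group_subgroup_generated)
 interpret G: group G by (rule gG)
 show SG: "S <= carrier G" unfolding G_def using L.subgroup_generated_subset_carrier_subset[OF S] .
 have "carrier G = carrier (subgroup_generated G S)" unfolding G_def L.subgroup_generated2 ..
 thus gen: "carrier G = generate G S" unfolding carrier_subgroup_generated using SG by (simp add: Int_absorb1)
 have mul: "x \<otimes>\<^bsub>G\<^esub> y = x * y" "\<one>\<^bsub>G\<^esub> = 1m n" for x y unfolding G_def by simp_all
 have Gc: "x : sqm n" if "x : carrier G" for x
  using that L.carrier_subgroup_generated_subset[of S] GL_carrier unfolding G_def by blast
 define B where "B M = toM N (blockL (degree m) (coeffs m) N (map (map coeffs) (mat_to_list M)))" for M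
 let ?A = "A0 m \<alpha> n"
 have Ac: "?A : carrier_mat n N" unfolding N_def by (rule A0_carrier[OF min])
 have bm: "map_mat (eval_rat_poly \<alpha>) M * ?A = ?A * cmat (B M)" if "M : set Ms" for M
  using block_mult[OF min, of M n] pres that unfolding presents_matrices_def B_def toM_def entL_def N_def by auto
 have "EX Y:sqm N. x * ?A = ?A * cmat Y" if "x : carrier G" for x
  using that unfolding gen
 proof (induction rule: generate.induct)
  case one
  show ?case using Ac by (intro bexI[of _ "1m N"]) (auto simp: mul of_rat_hom.mat_hom_one)
 next
  case (incl s)
  then obtain M where "M : set Ms" "s = map_mat (eval_rat_poly \<alpha>) M" using pres unfolding presents_matrices_def by auto
  thus ?case using bm[of M] by (intro bexI[of _ "B M"]) (auto simp: B_def)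
 next
  case (inv s)
  then obtain M where M: "M : set Ms" "s = map_mat (eval_rat_poly \<alpha>) M" using pres unfolding presents_matrices_def by auto
  have sG: "s : carrier G" "inv\<^bsub>G\<^esub> s : carrier G" using inv SG by auto
  note sc = Gc[OF sG(1)] Gc[OF sG(2)]
  have iss: "inv\<^bsub>G\<^esub> s * s = 1m n" using G.l_inv[OF sG(1)] unfolding mul .
  define C where "C = B M"
  have C: "C : sqm N" "s * ?A = ?A * cmat C" unfolding C_def using bm[OF M(1)] M(2) by (auto simp: B_def)
  have cC: "cmat C : sqm N" using C by simp
  \<comment> \<open>If \<open>C\<close> kills \<open>v\<close>, then \<open>s\<close> kills the
    image of \<open>v\<close> under \<open>A0 m \<alpha> n\<close>. As \<open>s\<close> is
    invertible and this map is injective on rational vectors, \<open>v\<close> is 0.\<close>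
  have "mat_inj N N C" unfolding mat_inj_def
  proof (intro conjI ballI impI)
   show "C : sqm N" by (rule C)
   fix v assume v: "v : carrier_vec N" "C *v v = 0v N"
   define V where "V = mat N 1 (%(i, j). v $ i)"
   have V: "V : carrier_mat N 1" "cmat V : carrier_mat N 1" unfolding V_def by auto
   have CV: "C * V = 0m N 1"
   proof (rule eq_matI)
    fix i j assume "i < dim_row (0m N 1 :: rat mat)" "j < dim_col (0m N 1 :: rat mat)"
    hence ij: "i < N" "j < 1" by auto
    have "(C * V) $$ (i, j) = (SUM k<N. C $$ (i, k) * v $ k)"
     unfolding mat_mult_index_rect[OF C(1) V(1) ij] unfolding V_def using ij by (intro sum.cong) auto
    also have "... = (C *v v) $ i" by (rule mult_mat_vec_index[OF C(1) v(1) ij(1), symmetric])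
    finally show "(C * V) $$ (i, j) = 0m N 1 $$ (i, j)" using v(2) ij by simp
   qed (use C V in auto)
   have z: "cmat (0m N 1) = 0m N 1" by (intro eq_matI) auto
   have "?A * cmat V = (inv\<^bsub>G\<^esub> s * s) * (?A * cmat V)" unfolding iss using Ac V by simp
   also have "... = inv\<^bsub>G\<^esub> s * ((s * ?A) * cmat V)"
    using sc Ac V by (simp add: assoc_mult_mat[of _ n n _ n _ 1] assoc_mult_mat[of _ n n _ N _ 1])
   also have "(s * ?A) * cmat V = ?A * (cmat C * cmat V)" unfolding C(2) by (rule assoc_mult_mat[OF Ac cC V(2)])
   also have "cmat C * cmat V = 0m N 1"
    using cmat_mult_rect[OF C(1) V(1)] unfolding CV z by simp
   also have "inv\<^bsub>G\<^esub> s * (?A * 0m N 1) = ?A * cmat (0m N 1)" unfolding z using sc Ac by simp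
   finally have V0: "V = 0m N 1" by (intro A0_inj[OF min, of V n 1 "0m N 1"]) (use V in "auto simp: N_def")
   have "v $ i = 0" if "i < N" for i using arg_cong[OF V0, of "%A. A $$ (i, 0)"] that unfolding V_def by simp
   thus "v = 0v N" using v(1) by (intro eq_vecI) auto
  qed
  from rat_inverse_exists[OF this C(1)] obtain D where D: "inv_pair N C D" ..
  have Dc: "D : sqm N" "C * D = 1m N" using D unfolding inv_pair_def by auto
  have cD: "cmat D : sqm N" using Dc by simp
  have "cmat C * cmat D = 1m N" using cmat_mult[OF C(1) Dc(1)] Dc(2) by (simp add: of_rat_hom.mat_hom_one)
  hence "(s * ?A) * cmat D = ?A" unfolding C(2) assoc_mult_mat[OF Ac cC cD] using Ac by simp
  hence "inv\<^bsub>G\<^esub> s * ?A = inv\<^bsub>G\<^esub> s * (s * (?A * cmat D))"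
   using assoc_mult_mat[OF sc(1) Ac cD] by simp
  also have "... = (inv\<^bsub>G\<^esub> s * s) * (?A * cmat D)"
   by (rule assoc_mult_mat[symmetric, OF sc(2,1) mult_carrier_mat[OF Ac cD]])
  also have "... = ?A * cmat D" unfolding iss using Ac cD by simp
  finally show ?case using Dc(1) by blast
 next
  case (eng x y)
  have xy: "x : sqm n" "y : sqm n" using eng.hyps Gc gen by auto
  obtain Y Z where Y: "Y : sqm N" "x * ?A = ?A * cmat Y" and Z: "Z : sqm N" "y * ?A = ?A * cmat Z"
   using eng.IH by blast
  have c: "cmat Y : sqm N" "cmat Z : sqm N" using Y Z by auto
  have "(x * y) * ?A = x * (y * ?A)" by (rule assoc_mult_mat[OF xy Ac])
  also have "... = (x * ?A) * cmat Z" unfolding Z(2) by (rule assoc_mult_mat[symmetric, OF xy(1) Ac c(2)])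
  also have "... = ?A * (cmat Y * cmat Z)" unfolding Y(2) by (rule assoc_mult_mat[OF Ac c])
  also have "cmat Y * cmat Z = cmat (Y * Z)" by (rule cmat_mult[symmetric, OF Y(1) Z(1)])
  finally show ?case unfolding mul using Y(1) Z(1) by (intro bexI[of _ "Y * Z"]) auto
 qed
 then obtain \<phi> where phi: "!!x. x : carrier G ==> \<phi> x : sqm N" "!!x. x : carrier G ==> x * ?A = ?A * cmat (\<phi> x)" by metis
 \<comment> \<open>Uniqueness makes the chosen matrices multiplicative and identifies them with the
   blocks of the input.\<close>
 have uniq: "\<phi> x = Y" if "x : carrier G" "Y : sqm N" "x * ?A = ?A * cmat Y" for x Y
  using A0_inj[OF min, of "\<phi> x" n N Y] phi[OF that(1)] that(2,3) unfolding N_def by simp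
 have "G.rep N (carrier G) \<phi>" unfolding G.rep_def
 proof (intro conjI ballI)
  show "subgroup (carrier G) G" by (rule G.subgroup_self)
  show "\<phi> x : sqm N" if "x : carrier G" for x by (rule phi(1)[OF that])
  show "\<phi> \<one>\<^bsub>G\<^esub> = 1m N"
  proof (rule uniq[OF G.one_closed one_carrier_mat])
   show "\<one>\<^bsub>G\<^esub> * ?A = ?A * cmat (1m N)" unfolding mul(2) of_rat_hom.mat_hom_one using Ac by simp
  qed
  fix x y assume x: "x : carrier G" and y: "y : carrier G"
  note xy = Gc[OF x] Gc[OF y]
  have c: "cmat (\<phi> x) : sqm N" "cmat (\<phi> y) : sqm N" using phi(1) x y by auto
  have "(x * y) * ?A = x * (y * ?A)" by (rule assoc_mult_mat[OF xy Ac])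
  also have "... = (x * ?A) * cmat (\<phi> y)" unfolding phi(2)[OF y] by (rule assoc_mult_mat[symmetric, OF xy(1) Ac c(2)])
  also have "... = ?A * (cmat (\<phi> x) * cmat (\<phi> y))" unfolding phi(2)[OF x] by (rule assoc_mult_mat[OF Ac c])
  also have "cmat (\<phi> x) * cmat (\<phi> y) = cmat (\<phi> x * \<phi> y)" by (rule cmat_mult[symmetric, OF phi(1)[OF x] phi(1)[OF y]])
  finally have "(x \<otimes>\<^bsub>G\<^esub> y) * ?A = ?A * cmat (\<phi> x * \<phi> y)" unfolding mul .
  thus "\<phi> (x \<otimes>\<^bsub>G\<^esub> y) = \<phi> x * \<phi> y"
   by (rule uniq[OF G.m_closed[OF x y] mult_carrier_mat[OF phi(1)[OF x] phi(1)[OF y]]])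
 qed
 moreover have "inj_on \<phi> (carrier G)"
 proof (rule inj_onI)
  fix x y assume x: "x : carrier G" and y: "y : carrier G" and e: "\<phi> x = \<phi> y"
  have "x * ?A = y * ?A" using phi(2)[OF x] phi(2)[OF y] e by simp
  thus "x = y" by (rule A0_right_inj[OF min Gc[OF x] Gc[OF y]])
 qed
 moreover have "\<phi> (map_mat (eval_rat_poly \<alpha>) M) = B M" if M: "M : set Ms" for M
 proof (rule uniq)
  show "map_mat (eval_rat_poly \<alpha>) M : carrier G" using M pres SG unfolding presents_matrices_def by auto
 qed (use bm[OF M] in "auto simp: B_def")
 ultimately show "EX \<phi>. group.rep G N (carrier G) \<phi> & inj_on \<phi> (carrier G) &
   (ALL M:set Ms. \<phi> (map_mat (eval_rat_poly \<alpha>) M) =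
     toM N (blockL (degree m) (coeffs m) N (map (map coeffs) (mat_to_list M))))"
  unfolding B_def by blast
qed

section \<open>Matrices as lists of lists\<close>

type_synonym lmat = "rat list list"

definition sumL :: "(nat => rat) => nat => rat" where
 "sumL f n = rec_nat 0 (%k s. s + f k) n"

lemma sumL_eq: "sumL f n = (SUM k<n. f k)"
 unfolding sumL_def by (induction n) auto

lemma tcomp_sumL [tc]:
 "tcomp n ==> tcomp (%p. f (fst p) (snd p)) ==> tcomp (%x. sumL (f x) (n x))"
proof -
 assume n: "tcomp n" and f: "tcomp (%p. f (fst p) (snd p))"
 have "tcomp (%p :: 'a \<times> nat \<times> rat. (%p. f (fst p) (snd p)) (fst p, fst (snd p)))"
  by (rule tcomp_comp[OF f]) (intro tc)
 hence "tcomp (%x. rec_nat 0 (%k s. s + f x k) (n x))" by (intro tcomp_rec_nat n tc) simp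
 thus ?thesis unfolding sumL_def .
qed

definition idL :: "nat => lmat" where
 "idL N = map (%i. map (%j. if i = j then 1 else 0) [0..<N]) [0..<N]"

definition mulL :: "nat => lmat => lmat => lmat" where
 "mulL N A B = map (%i. map (%j. sumL (%k. entL A i k * entL B k j) N) [0..<N]) [0..<N]"

definition powL :: "nat => lmat => nat => lmat" where
 "powL N A k = rec_nat (idL N) (%_ R. mulL N R A) k"

definition prodL :: "nat => lmat list => lmat" where
 "prodL N As = fold (%A R. mulL N R A) As (idL N)"

definition eqL :: "nat => lmat => lmat => bool" where
 "eqL N A B <-> (ALL i<N. ALL j<N. entL A i j = entL B i j)"

definition uniL :: "nat => nat => lmat => bool" where
 "uniL N p A <-> (ALL i<N. entL A i i = 1) & (ALL i<N. ALL j<i. entL A i j = 0) &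
   (ALL j<N. ALL i<j. (j - i) * N + i < p --> entL A i j = 0)"

definition eatL :: "nat => nat => lmat => rat" where
 "eatL N p A = (if 0 < p div N & p mod N + p div N < N then entL A (p mod N) (p mod N + p div N) else 0)"

definition absR :: "rat => rat" where "absR x = (if 0 <= x then x else 0 - x)"

definition bndL :: "nat => nat => lmat => bool" where
 "bndL N D A <-> (ALL i<N. ALL j<N. rat_of_int (int D) * entL A i j : \<int>) &
   (ALL i<N. sumL (%j. absR (entL A i j)) N <= rat_of_int (int (N * D)))"

text \<open>The index is shifted by one: \<open>Suc j\<close> for \<open>j < J\<close> runs over the
  exponents from 1 to \<open>J\<close>.\<close>

definition smallL :: "nat => nat => lmat => bool" where
 "smallL N J A <-> (ALL j<J. sumL (%i. entL (powL N A (Suc j)) i i) N : \<int> &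
   absR (sumL (%i. entL (powL N A (Suc j)) i i) N) <= rat_of_int (int N))"

definition wordL :: "nat => lmat list => nat list => lmat" where
 "wordL N As w = prodL N (map (nth_default (idL N) As) w)"

definition boxL :: "nat => nat => int list list" where
 "boxL B r = rec_nat [[]] (%_ L. concat (map (%v. map (%x. (int x - int B) # v) [0..<2 * B + 1]) L)) r"

text \<open>Each element is paired with its inverse, which serves for negative exponents.\<close>

definition ppL :: "nat => (lmat \<times> lmat) list => int list => lmat" where
 "ppL N ds p = prodL N (map (%i. if 0 <= nth_default 0 p i
   then powL N (fst (nth_default ([], []) ds i)) (nat (nth_default 0 p i))
   else powL N (snd (nth_default ([], []) ds i)) (nat (- nth_default 0 p i))) [0..<length ds])"

text \<open>\<open>hull_witness\<close> with each factor, its basis element and both exponents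
  gathered in one tuple, so that a single existential quantifier precedes a decidable
  condition.\<close>

definition hullL :: "nat => lmat list => lmat => bool" where
 "hullL N bs u <-> (EX ws :: (lmat \<times> lmat \<times> nat \<times> nat) list. eqL N u (prodL N (map fst ws)) &
   (ALL w:set ws. uniL N 0 (fst w) & (EX b:set bs. fst (snd w) = b) & 0 < fst (snd (snd w)) &
    (eqL N (powL N (fst w) (fst (snd (snd w)))) (powL N (fst (snd w)) (snd (snd (snd w)))) |
    eqL N (mulL N (powL N (fst w) (fst (snd (snd w)))) (powL N (fst (snd w)) (snd (snd (snd w))))) (idL N))))"

lemma tcomp_entL [tc]: "tcomp A ==> tcomp i ==> tcomp j ==> tcomp (%x. entL (A x) (i x) (j x))"
 unfolding entL_def by (intro tc)

lemma tcomp_idL [tc]: "tcomp N ==> tcomp (%x. idL (N x))"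
proof -
 have "tcomp idL" unfolding idL_def by (intro tc)
 thus "tcomp N ==> tcomp (%x. idL (N x))" by (rule tcomp_comp)
qed

text \<open>Reduces an operation to its action on plain tuples, so that unfolding its definition
  does not involve the argument functions.\<close>

lemma tcomp2: "tcomp (%p. f (fst p) (snd p)) ==> tcomp a ==> tcomp b ==> tcomp (%x. f (a x) (b x))"
 using tcomp_comp[of "%p. f (fst p) (snd p)" "%x. (a x, b x)"] by (simp add: tc)

lemma tcomp3: "tcomp (%p. f (fst p) (fst (snd p)) (snd (snd p))) ==> tcomp a ==> tcomp b ==> tcomp c ==>
 tcomp (%x. f (a x) (b x) (c x))"
 using tcomp_comp[of "%p. f (fst p) (fst (snd p)) (snd (snd p))" "%x. (a x, b x, c x)"] by (simp add: tc)

lemma tcomp_mulL [tc]: "tcomp N ==> tcomp A ==> tcomp B ==> tcomp (%x. mulL (N x) (A x) (B x))"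
 by (rule tcomp3[where f = mulL], unfold mulL_def, intro tc)

lemma tcomp_powL [tc]: "tcomp N ==> tcomp A ==> tcomp k ==> tcomp (%x. powL (N x) (A x) (k x))"
 by (rule tcomp3[where f = powL], unfold powL_def, intro tcomp_rec_nat tc)

lemma tcomp_prodL [tc]: "tcomp N ==> tcomp As ==> tcomp (%x. prodL (N x) (As x))"
 by (rule tcomp2[where f = prodL], unfold prodL_def, intro tcomp_fold tc)

lemma tcomp_eqL [tc]: "tcomp N ==> tcomp A ==> tcomp B ==> tcomp (%x. eqL (N x) (A x) (B x))"
 by (rule tcomp3[where f = eqL], unfold eqL_def, intro tc)

lemma tcomp_uniL [tc]: "tcomp N ==> tcomp p ==> tcomp A ==> tcomp (%x. uniL (N x) (p x) (A x))"
 by (rule tcomp3[where f = uniL], unfold uniL_def, intro tc)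

lemma tcomp_eatL [tc]: "tcomp N ==> tcomp p ==> tcomp A ==> tcomp (%x. eatL (N x) (p x) (A x))"
 unfolding eatL_def by (intro tc)

lemma tcomp_absR [tc]: "tcomp f ==> tcomp (%x. absR (f x))"
 unfolding absR_def by (intro tc)

lemma tcomp_bndL [tc]: "tcomp N ==> tcomp p ==> tcomp A ==> tcomp (%x. bndL (N x) (p x) (A x))"
 by (rule tcomp3[where f = bndL], unfold bndL_def, intro tc)

lemma tcomp_smallL [tc]: "tcomp N ==> tcomp p ==> tcomp A ==> tcomp (%x. smallL (N x) (p x) (A x))"
 by (rule tcomp3[where f = smallL], unfold smallL_def, intro tc)

lemma tcomp_wordL [tc]: "tcomp N ==> tcomp p ==> tcomp A ==> tcomp (%x. wordL (N x) (p x) (A x))"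
 by (rule tcomp3[where f = wordL], unfold wordL_def, intro tc)

lemma tcomp_boxL [tc]: "tcomp B ==> tcomp r ==> tcomp (%x. boxL (B x) (r x))"
 by (rule tcomp2[where f = boxL], unfold boxL_def, intro tcomp_rec_nat tc)

lemma tcomp_ppL [tc]: "tcomp N ==> tcomp p ==> tcomp A ==> tcomp (%x. ppL (N x) (p x) (A x))"
 by (rule tcomp3[where f = ppL], unfold ppL_def, intro tc)

lemma re_hullL: "tcomp N ==> tcomp bs ==> tcomp u ==> re (%x. hullL (N x) (bs x) (u x))"
proof -
 have b: "re (%p :: nat \<times> lmat list \<times> lmat. hullL (fst p) (fst (snd p)) (snd (snd p)))"
  unfolding hullL_def by (rule re_ex, rule re_tcomp) (intro tc)
 assume "tcomp N" "tcomp bs" "tcomp u"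
 thus ?thesis using re_comp[OF b, of "%x. (N x, bs x, u x)"] by (simp add: tc)
qed

lemma entL_map: "i < N ==> j < N ==> entL (map (%i. map (f i) [0..<N]) [0..<N]) i j = f i j"
 unfolding entL_def by (simp add: nth_default_nth)

lemma toM_index: "i < N ==> j < N ==> toM N A $$ (i, j) = entL A i j"
 unfolding toM_def by simp

lemma toM_dim [simp]: "dim_row (toM N A) = N" "dim_col (toM N A) = N"
 unfolding toM_def by simp_all

lemma toM_idL [simp]: "toM N (idL N) = 1m N"
 by (rule eq_matI) (auto simp: toM_index idL_def entL_map)

lemma toM_mulL [simp]: "toM N (mulL N A B) = toM N A * toM N B"
proof (rule eq_matI)
 fix i j assume "i < dim_row (toM N A * toM N B)" "j < dim_col (toM N A * toM N B)"
 hence ij: "i < N" "j < N" by auto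
 show "toM N (mulL N A B) $$ (i, j) = (toM N A * toM N B) $$ (i, j)"
  unfolding mat_mult_index[OF toM_carrier toM_carrier ij] toM_index[OF ij] mulL_def entL_map[OF ij] sumL_eq
  using ij by (intro sum.cong) (auto simp: toM_index)
qed auto

lemma toM_powL [simp]: "toM N (powL N A k) = toM N A ^m k"
 unfolding powL_def by (induction k) simp_all

lemma toM_prodL [simp]: "toM N (prodL N As) = foldr (*) (map (toM N) As) (1m N)"
proof -
 have c: "foldr (*) (map (toM N) As) (1m N) : sqm N" for As
  by (induction As) (auto simp: mult_carrier_mat[of _ N N])
 have "toM N (fold (%A R. mulL N R A) As R) = toM N R * foldr (*) (map (toM N) As) (1m N)" for R
 proof (induction As arbitrary: R)
  case Nil
  show ?case using right_mult_one_mat[OF toM_carrier] by simp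
 next
  case (Cons A As)
  show ?case using Cons[of "mulL N R A"] assoc_mult_mat[OF toM_carrier toM_carrier c] by simp
 qed
 thus ?thesis unfolding prodL_def using left_mult_one_mat[OF c] by simp
qed

lemma eqL_iff [simp]: "eqL N A B <-> toM N A = toM N B"
proof
 assume "toM N A = toM N B"
 thus "eqL N A B" unfolding eqL_def by (metis toM_index)
qed (auto simp: eqL_def toM_index intro!: eq_matI)

lemma uniL_iff [simp]: "uniL N p A <-> toM N A : unitri N p"
 unfolding uniL_def unitri_def using less_trans by (fastforce simp: toM_index)

lemma eatL_eq [simp]: "eatL N p A = entry_at N p (toM N A)"
 unfolding eatL_def entry_at_def by (auto simp: toM_index)

lemma absR_eq [simp]: "absR x = \<bar>x\<bar>" unfolding absR_def by simp

lemma hullL_iff [simp]: "hullL N bs u <-> hull_witness N (map (toM N) bs) (toM N u)"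
proof
 assume "hullL N bs u"
 then obtain ws where ws: "toM N u = foldr (*) (map (toM N) (map fst ws)) (1m N)"
  "!!w b m e. (w, b, m, e) : set ws ==> toM N w : unitri N 0 & b : set bs & 0 < m &
   (toM N w ^m m = toM N b ^m e | toM N w ^m m * toM N b ^m e = 1m N)"
  unfolding hullL_def by force
 have "w : unitri N 0 & (EX b:set (map (toM N) bs). EX m>0. EX e. w ^m m = b ^m e | w ^m m * b ^m e = 1m N)"
  if w: "w : set (map (toM N) (map fst ws))" for w
 proof -
  obtain w0 b m e where w0: "(w0, b, m, e) : set ws" "w = toM N w0" using w by auto
  from ws(2)[OF w0(1)] show ?thesis unfolding w0(2) by auto
 qed
 thus "hull_witness N (map (toM N) bs) (toM N u)" unfolding hull_witness_def using ws(1) by blast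
next
 assume "hull_witness N (map (toM N) bs) (toM N u)"
 then obtain ws where ws: "toM N u = foldr (*) ws (1m N)" and w: "!!w. w : set ws ==> w : unitri N 0 &
   (EX b:set (map (toM N) bs). EX m>0. EX e. w ^m m = b ^m e | w ^m m * b ^m e = 1m N)"
  unfolding hull_witness_def by blast
 have "EX b m e. b : set bs & 0 < m & (w ^m m = toM N b ^m e | w ^m m * toM N b ^m e = 1m N)"
  if "w : set ws" for w using w[OF that] by auto
 then obtain b m e where bme: "!!w. w : set ws ==> b w : set bs & 0 < m w &
  (w ^m (m w) = toM N (b w) ^m (e w) | w ^m (m w) * toM N (b w) ^m (e w) = 1m N)" by metis
 have tl: "toM N (mat_to_list w) = w" if "w : set ws" for w
  using unitri_carrier[of w N 0] w[OF that] unfolding mat_to_list_def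
  by (intro eq_matI) (auto simp: toM_index entL_def nth_default_nth)
 define ws' where "ws' = map (%w. (mat_to_list w, b w, m w, e w)) ws"
 have "map (toM N) (map fst ws') = ws" unfolding ws'_def using tl by (simp add: map_idI)
 moreover have "ALL w:set ws'. toM N (fst w) : unitri N 0 & (EX b:set bs. fst (snd w) = b) & 0 < fst (snd (snd w)) &
    (toM N (fst w) ^m (fst (snd (snd w))) = toM N (fst (snd w)) ^m (snd (snd (snd w))) |
    toM N (fst w) ^m (fst (snd (snd w))) * toM N (fst (snd w)) ^m (snd (snd (snd w))) = 1m N)"
  unfolding ws'_def using tl bme w by auto
 ultimately show "hullL N bs u" unfolding hullL_def using ws by (intro exI[of _ ws']) simp
qed

lemma toM_mat_to_list [simp]: "A : sqm N ==> toM N (mat_to_list A) = A"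
 unfolding mat_to_list_def by (intro eq_matI) (auto simp: toM_index entL_def nth_default_nth)

lemma bndL_iff [simp]: "bndL N D A <-> bnd N D 1 (cmat (toM N A))"
proof -
 have "rat_of_int (int D) * x : \<int> <-> (of_nat D * of_rat x :: complex) : \<int>" for x
 proof -
  have e: "(of_nat D * of_rat x :: complex) = of_rat (rat_of_int (int D) * x)" by (simp add: of_rat_mult)
  have "(of_rat y :: complex) : \<int> <-> y : \<int>" for y
  proof
   assume "(of_rat y :: complex) : \<int>"
   then obtain z where "(of_rat y :: complex) = of_int z" by (rule Ints_cases)
   hence "(of_rat y :: complex) = of_rat (of_int z)" by simp
   hence "y = of_int z" by (simp only: of_rat_eq_iff)
   thus "y : \<int>" by simp
  qed (auto elim!: Ints_cases)
  thus ?thesis unfolding e by simp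
 qed
 moreover have "(SUM j<N. \<bar>f j\<bar>) <= rat_of_int (int (N * D)) <-> (SUM j<N. cmod (of_rat (f j))) <= real (N * D) ^ 1" for f
 proof -
  have "cmod (of_rat x) = real_of_rat \<bar>x\<bar>" for x
   unfolding of_real_of_rat[symmetric] norm_of_real by simp
  hence "(SUM j<N. cmod (of_rat (f j))) = real_of_rat (SUM j<N. \<bar>f j\<bar>)" by (simp add: of_rat_sum)
  moreover have "real (N * D) ^ 1 = real_of_rat (rat_of_int (int (N * D)))" by (simp add: of_rat_mult)
  ultimately show ?thesis by (simp only: of_rat_less_eq)
 qed
 ultimately show ?thesis unfolding bndL_def bnd_def int_mat_def sumL_eq absR_eq by (auto simp: toM_index)
qed

lemma smallL_iff [simp]: "smallL N J A <-> small_traces N J (toM N A)"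
proof -
 have "sumL (%i. entL (powL N A (Suc j)) i i) N = mtr N (toM N A ^m Suc j)" for j
  unfolding sumL_eq mtr_def toM_powL[symmetric] by (intro sum.cong) (simp_all only: lessThan_iff toM_index)
 hence "smallL N J A <-> (ALL j<J. mtr N (toM N A ^m Suc j) : \<int> & \<bar>mtr N (toM N A ^m Suc j)\<bar> <= of_nat N)"
  unfolding smallL_def absR_eq by simp
 also have "... <-> small_traces N J (toM N A)" unfolding small_traces_def
  by (metis Suc_le_eq Suc_pred zero_less_Suc)
 finally show ?thesis .
qed

lemma set_boxL: "set (boxL B r) = {p. length p = r & (ALL e:set p. \<bar>e\<bar> <= int B)}"
proof (induction r)
 case 0
 show ?case unfolding boxL_def by auto
next
 case (Suc r)
 have "set (boxL B (Suc r)) = (UN v:set (boxL B r). (%x. (int x - int B) # v) ` {0..<2 * B + 1})"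
  unfolding boxL_def by (simp del: upt_Suc)
 also have "... = {p. length p = Suc r & (ALL e:set p. \<bar>e\<bar> <= int B)}" unfolding Suc
 proof (intro equalityI subsetI)
  fix p assume "p : {p. length p = Suc r & (ALL e:set p. \<bar>e\<bar> <= int B)}"
  then obtain e v where p: "p = e # v" "length v = r" "\<bar>e\<bar> <= int B" "ALL e:set v. \<bar>e\<bar> <= int B" by (cases p) auto
  have x: "nat (e + int B) : {0..<2 * B + 1}" "e = int (nat (e + int B)) - int B" using p(3) by auto
  have "p = (int (nat (e + int B)) - int B) # v" using p(1) x(2) by (simp only:)
  hence "p : (%x. (int x - int B) # v) ` {0..<2 * B + 1}" using x(1) by (rule image_eqI)
  thus "p : (UN v:{p. length p = r & (ALL e:set p. \<bar>e\<bar> <= int B)}. (%x. (int x - int B) # v) ` {0..<2 * B + 1})"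
   by (rule UN_I[rotated]) (use p in simp)
 qed auto
 finally show ?case .
qed

section \<open>Certificates as finite data\<close>

type_synonym cert_data = "lmat \<times> lmat \<times> lmat list \<times> lmat list \<times> lmat list \<times>
 (lmat \<times> lmat \<times> nat) list \<times> (lmat \<times> lmat) list \<times> nat \<times> nat"

text \<open>The inverse and the leading position travel with each basis element. A position below
  all later ones lets \<open>mbasis\<close> be rebuilt from the end of the list.\<close>

definition bstepL :: "nat => lmat \<times> lmat \<times> nat => (lmat \<times> lmat \<times> nat) list => bool" where
 "bstepL N x L <-> uniL N (snd (snd x)) (fst x) & eatL N (snd (snd x)) (fst x) ~= 0 &
  eqL N (mulL N (fst x) (fst (snd x))) (idL N) & eqL N (mulL N (fst (snd x)) (fst x)) (idL N) &
  (ALL c:set L. snd (snd x) < snd (snd c) &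
   hullL N (map fst L) (mulL N (mulL N (fst x) (fst c)) (fst (snd x))) &
   hullL N (map fst L) (mulL N (mulL N (fst (snd x)) (fst c)) (fst x)))"

definition basisL :: "nat => (lmat \<times> lmat \<times> nat) list => bool" where
 "basisL N L <-> (ALL i:set [0..<length L]. bstepL N (nth_default ([], [], 0) L i) (drop (Suc i) L))"

definition gensL :: "nat => lmat => lmat => lmat list => lmat list" where
 "gensL N g h gens = map (%s. mulL N (mulL N g s) h) gens"

text \<open>\<open>hcert\<close> for matrices given as lists. Membership in a generated subgroup is
  shown by words, inverses are listed and verified by products, and an implication with decidable
  premise is written as a disjunction, because semidecidable predicates are closed under disjunction
  but not under implication.\<close>

definition cert :: "nat => lmat list => nat => lmat => lmat => lmat list => lmat list => lmat list =>
  (lmat \<times> lmat \<times> nat) list => (lmat \<times> lmat) list => nat => nat => bool" where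
 "cert N gens k g h is ts rs bs ds D J <->
  eqL N (mulL N g h) (idL N) & eqL N (mulL N h g) (idL N) &
  (ALL s:set (gensL N g h gens). EX s':set is. eqL N (mulL N s s') (idL N)) &
  (ALL s':set is. EX s:set (gensL N g h gens). eqL N (mulL N s s') (idL N)) &
  (ALL t:set ts. EX w. eqL N t (wordL N (gensL N g h gens @ is) w)) &
  (ALL t:set rs. EX w. eqL N t (wordL N (gensL N g h gens @ is) w)) &
  (ALL b:set bs. EX w. eqL N (fst b) (wordL N ts w)) &
  (ALL t:set ts. EX t':set ts. eqL N (mulL N t t') (idL N)) &
  (EX r:set rs. eqL N r (idL N)) &
  (ALL r:set rs. ALL s:set (gensL N g h gens @ is). EX t:set ts. EX r':set rs. eqL N (mulL N r s) (mulL N t r')) &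
  basisL N bs &
  (ALL t:set ts. ALL t':set ts. ~ eqL N (mulL N t t') (idL N) |
   (ALL b:set bs. hullL N (map fst bs) (mulL N (mulL N t (fst b)) t'))) &
  (ALL t:set ts. ALL t':set ts. ALL u:set ts. ALL u':set ts. ~ eqL N (mulL N t t') (idL N) | ~ eqL N (mulL N u u') (idL N) |
   hullL N (map fst bs) (mulL N (mulL N (mulL N t u) t') u')) &
  (ALL d:set ds. (EX t:set ts. fst d = t) & eqL N (mulL N (fst d) (snd d)) (idL N) & bndL N D (fst d) & bndL N D (snd d)) &
  0 < D & 0 < J &
  (ALL p:set (boxL (box_size N D J (length ds)) (length ds)). (ALL e:set p. e = 0) | ~ smallL N J (ppL N ds p)) &
  (ALL t:set ts. EX m. EX es. 0 < m & length es = length ds &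
   hullL N (map fst bs) (mulL N (powL N t m) (ppL N ds es))) &
  k = length bs + length ds"

definition certified :: "nat => lmat list => nat => bool" where
 "certified N gens k <-> (EX c :: cert_data. cert N gens k (fst c) (fst (snd c)) (fst (snd (snd c)))
   (fst (snd (snd (snd c)))) (fst (snd (snd (snd (snd c))))) (fst (snd (snd (snd (snd (snd c))))))
   (fst (snd (snd (snd (snd (snd (snd c))))))) (fst (snd (snd (snd (snd (snd (snd (snd c))))))))
   (snd (snd (snd (snd (snd (snd (snd (snd c)))))))))"

lemma certifiedI: "cert N gens k g h is ts rs bs ds D J ==> certified N gens k"
 unfolding certified_def by (rule exI[of _ "(g, h, is, ts, rs, bs, ds, D, J)"]) simp

lemma re_basisL: "tcomp N ==> tcomp L ==> re (%x. basisL (N x) (L x))"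
proof -
 have b: "re (%p :: nat \<times> (lmat \<times> lmat \<times> nat) list. basisL (fst p) (snd p))"
  unfolding basisL_def bstepL_def
  apply (intro re_conj re_ball_list re_hullL)
  apply (rule re_tcomp | (intro tc))+
  done
 assume "tcomp N" "tcomp L"
 thus ?thesis using re_comp[OF b, of "%x. (N x, L x)"] by (simp add: tc)
qed

lemma tcomp_gensL [tc]: "tcomp N ==> tcomp g ==> tcomp h ==> tcomp s ==> tcomp (%x. gensL (N x) (g x) (h x) (s x))"
proof -
 have b: "tcomp (%p :: nat \<times> lmat \<times> lmat \<times> lmat list. gensL (fst p) (fst (snd p)) (fst (snd (snd p))) (snd (snd (snd p))))"
  unfolding gensL_def by (intro tc)
 assume "tcomp N" "tcomp g" "tcomp h" "tcomp s"
 thus ?thesis using tcomp_comp[OF b, of "%x. (N x, g x, h x, s x)"] by (simp add: tc)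
qed

lemma tcomp_box_size [tc]: "tcomp n ==> tcomp D ==> tcomp J ==> tcomp r ==> tcomp (%x. box_size (n x) (D x) (J x) (r x))"
 unfolding box_size_def by (intro tc)

lemma re_certified: "re (%p :: nat \<times> lmat list \<times> nat. certified (fst p) (fst (snd p)) (snd (snd p)))"
 unfolding certified_def cert_def
 apply (rule re_ex)
 apply (intro re_conj re_ball_list re_disj re_ex re_hullL re_basisL)
 apply (rule re_tcomp | (intro tc))+
 done

subsection \<open>Certificates determine the rank\<close>

lemma basisL_Cons: "basisL N (x # L) <-> bstepL N x L & basisL N L"
proof -
 have s: "(ALL i:set [0..<n]. Q i) <-> (ALL i<n. Q i)" for n and Q :: "nat => bool" by auto
 show ?thesis unfolding basisL_def s length_Cons All_less_Suc2 by simp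
qed

lemma upow_inverse:
 assumes b: "b : unitri N 0" and b': "b' : sqm N" "b * b' = 1m N"
 shows "upow N b (- 1) = b'"
proof -
 have "upow N b (- 1) * (b * b') = (upow N b (- 1) * b) * b'"
  by (rule assoc_mult_mat[symmetric, OF upow_carrier unitri_carrier[OF b] b'(1)])
 moreover have "upow N b (- 1) * b = 1m N" using upow_minus[OF b, of 1] upow_1[OF b] by auto
 ultimately show ?thesis using b' by simp
qed

lemma basisL_mbasis:
 "basisL N L ==> (!!x. x : set L ==> q <= snd (snd x)) ==> mbasis N q (map (%x. toM N (fst x)) L)"
proof (induction L arbitrary: q)
 case (Cons x L)
 obtain b b' p where x: "x = (b, b', p)" by (cases x)
 note B = Cons.prems(1)[unfolded basisL_Cons bstepL_def x, simplified]
 have mb: "mbasis N (Suc p) (map (%x. toM N (fst x)) L)" using B by (intro Cons.IH) auto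
 have bu: "toM N b : unitri N p" using B by simp
 have b0: "toM N b : unitri N 0" using bu unitri_mono[of 0 p N] by auto
 have ui: "upow N (toM N b) (- 1) = toM N b'" by (rule upow_inverse[OF b0]) (use B in simp_all)
 show ?case unfolding list.map mbasis.simps
 proof (intro exI[of _ p] conjI ballI)
  show "p >= q" using Cons.prems(2)[of x] x by simp
  show "toM N (fst x) : unitri N p" "entry_at N p (toM N (fst x)) ~= 0" using B x by simp_all
  show "mbasis N (Suc p) (map (%x. toM N (fst x)) L)" by (rule mb)
  fix c assume "c : set (map (%x. toM N (fst x)) L)"
  then obtain y where y: "y : set L" "c = toM N (fst y)" by auto
  show "toM N (fst x) * c * upow N (toM N (fst x)) (- 1) : rhull N (map (%x. toM N (fst x)) L)"
   "upow N (toM N (fst x)) (- 1) * c * toM N (fst x) : rhull N (map (%x. toM N (fst x)) L)"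
   using B y unfolding hull_witness_iff[OF mb, symmetric] by (auto simp: x ui comp_def)
 qed
qed simp

lemma mbasis_basisL:
 "mbasis N q (map (toM N) bs) ==> EX L. map fst L = bs & basisL N L & (ALL x:set L. q <= snd (snd x))"
proof (induction bs arbitrary: q)
 case Nil
 show ?case unfolding basisL_def by (intro exI[of _ "[]"]) simp
next
 case (Cons b bs)
 from Cons.prems obtain p where p: "p >= q" "toM N b : unitri N p" "entry_at N p (toM N b) ~= 0" "mbasis N (Suc p) (map (toM N) bs)"
  and cj: "!!b'. b' : set (map (toM N) bs) ==> toM N b * b' * upow N (toM N b) (-1) : rhull N (map (toM N) bs)"
  "!!b'. b' : set (map (toM N) bs) ==> upow N (toM N b) (-1) * b' * toM N b : rhull N (map (toM N) bs)"
  unfolding list.map mbasis.simps by blast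
 obtain L where L: "map fst L = bs" "basisL N L" "!!x. x : set L ==> Suc p <= snd (snd x)" using Cons.IH[OF p(4)] by auto
 have b0: "toM N b : unitri N 0" using p(2) unitri_mono[of 0 p N] by auto
 define b' where "b' = mat_to_list (upow N (toM N b) (-1))"
 have b': "toM N b' = upow N (toM N b) (-1)" unfolding b'_def by simp
 have inv: "toM N b * toM N b' = 1m N" "toM N b' * toM N b = 1m N"
  unfolding b' using upow_minus[OF b0, of 1] upow_1[OF b0] by auto
 have "toM N (fst c) : set (map (toM N) bs)" if "c : set L" for c using that L(1) by auto
 note cj' = cj(1)[OF this] cj(2)[OF this]
 have "basisL N ((b, b', p) # L)"
  unfolding basisL_Cons bstepL_def using p inv L cj' hull_witness_iff[OF p(4)]
  by (auto simp: b' Suc_le_eq)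
 thus ?case using L p(1) by (intro exI[of _ "(b, b', p) # L"]) (auto dest: L(3))
qed

lemma wordL_Nil [simp]: "toM N (wordL N As []) = 1m N"
 unfolding wordL_def by simp

lemma wordL_Cons [simp]: "toM N (wordL N As (i # w)) = toM N (nth_default (idL N) As i) * toM N (wordL N As w)"
 unfolding wordL_def by simp

lemma wordL_append: "toM N (wordL N As (v @ w)) = toM N (wordL N As v) * toM N (wordL N As w)"
 by (induction v) (simp_all add: left_mult_one_mat[OF toM_carrier] assoc_mult_mat[OF toM_carrier toM_carrier toM_carrier])

lemma ppL_Cons:
 "toM N (ppL N (d # ds) (e # p)) = (if 0 <= e then toM N (fst d) ^m nat e else toM N (snd d) ^m nat (- e)) * toM N (ppL N ds p)"
proof -
 have "map f [0..<length (d # ds)] = f 0 # map (%i. f (Suc i)) [0..<length ds]" for f :: "nat => lmat"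
  unfolding length_Cons by (rule map_upt_Suc)
 thus ?thesis unfolding ppL_def by (simp add: comp_def del: upt_Suc cong: if_cong)
qed

context group
begin

lemma rep_wordL:
 assumes R: "rep N (carrier G) \<phi>" and H: "subgroup H G" and As: "!!a. a : set As ==> toM N a : \<phi> ` H"
 shows "toM N (wordL N As w) : \<phi> ` H"
proof (induction w)
 case Nil
 have "1m N = \<phi> \<one>" using repD(4)[OF R] by simp
 thus ?case using subgroup.one_closed[OF H] by simp
next
 case (Cons i w)
 have "toM N (nth_default (idL N) As i) : \<phi> ` H"
 proof (cases "i < length As")
  case True
  thus ?thesis using As[of "As ! i"] by (simp add: nth_default_nth)
 next
  case False
  have "1m N = \<phi> \<one>" using repD(4)[OF R] by simp
  thus ?thesis using False subgroup.one_closed[OF H] by (simp add: nth_default_beyond)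
 qed
 then obtain x y where xy: "x : H" "toM N (nth_default (idL N) As i) = \<phi> x" "y : H" "toM N (wordL N As w) = \<phi> y"
  using Cons by auto
 have "\<phi> x * \<phi> y = \<phi> (x ** y)" using repD(3)[OF R] subgroup.mem_carrier[OF H] xy by simp
 thus ?case using xy subgroup.m_closed[OF H xy(1,3)] by simp
qed

lemma rep_ppL:
 assumes R: "rep N (carrier G) \<phi>"
 shows "length p = length xs ==> (!!x. x : set xs ==> f x : carrier G & \<phi> (f x) = toM N (fst (l x)) & \<phi> (inv (f x)) = toM N (snd (l x))) ==>
  \<phi> (prod_pow (map f xs) p) = toM N (ppL N (map l xs) p)"
proof (induction p xs rule: list_induct2)
 case Nil
 show ?case using repD(4)[OF R] unfolding ppL_def by (simp add: prodL_def)
next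
 case (Cons e p d xs)
 have d: "f d : carrier G" "\<phi> (f d) = toM N (fst (l d))" "\<phi> (inv (f d)) = toM N (snd (l d))" using Cons.prems by auto
 have "set (map f xs) <= carrier G" using Cons.prems by auto
 hence c: "prod_pow (map f xs) p : carrier G" by (rule prod_pow_closed[OF subgroup_self])
 have "\<phi> (f d [^] e) = (if 0 <= e then toM N (fst (l d)) ^m nat e else toM N (snd (l d)) ^m nat (- e))"
 proof (cases "0 <= e")
  case True
  then obtain n where e: "e = int n" by (rule nonneg_int_cases)
  show ?thesis unfolding e int_pow_int using rep_pow[OF R d(1), of n] d(2) by simp
 next
  case False
  define n where "n = nat (- e)"
  have e: "e = - int n" using False unfolding n_def by simp
  have "f d [^] e = inv (f d) [^] n" unfolding e using d(1) by (simp add: int_pow_neg int_pow_int nat_pow_inv)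
  thus ?thesis using False rep_pow[OF R, of "inv (f d)" n] d(1,3) n_def by simp
 qed
 moreover have "\<phi> (f d [^] e ** prod_pow (map f xs) p) = \<phi> (f d [^] e) * \<phi> (prod_pow (map f xs) p)"
  using c d by (intro repD(3)[OF R]) auto
 ultimately show ?case using Cons.IH Cons.prems unfolding list.map ppL_Cons by simp
qed

lemma inj_conj:
 assumes R: "rep N (carrier G) \<phi>0" and inj: "inj_on \<phi>0 (carrier G)" and gh: "inv_pair N g h"
 shows "inj_on (%x. g * \<phi>0 x * h) (carrier G)"
proof (rule inj_onI)
 fix x y assume x: "x : carrier G" and y: "y : carrier G" and e: "g * \<phi>0 x * h = g * \<phi>0 y * h"
 have u: "h * (g * A * h) * g = A" if A: "A : sqm N" for A
 proof -
  have "h * (g * A * h) * g = (h * g) * A * (h * g)" by (rule conj_conj[OF gh inv_pair_sym[OF gh] A])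
  thus ?thesis using gh A unfolding inv_pair_def by simp
 qed
 have "\<phi>0 x = \<phi>0 y" using u[OF repD(2)[OF R x]] unfolding e u[OF repD(2)[OF R y]] by (rule sym)
 thus "x = y" by (rule inj_onD[OF inj _ x y])
qed

lemma symmetric_generators:
 assumes "S <= carrier G" "carrier G = generate G S"
 defines "S' \<equiv> S \<union> (%x. inv x) ` S"
 shows "S' <= carrier G" "carrier G = generate G S'" "!!s. s : S' ==> inv s : S'"
proof -
 show c: "S' <= carrier G" using assms(1) unfolding S'_def by auto
 have "generate G S <= generate G S'" by (rule mono_generate) (auto simp: S'_def)
 moreover have "generate G S' <= carrier G" by (rule generate_incl[OF c])
 ultimately show "carrier G = generate G S'" using assms(2) by blast
 have "inv (inv s) = s" if "s : S" for s using that assms(1) by auto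
 thus "!!s. s : S' ==> inv s : S'" unfolding S'_def by auto
qed

lemma certified_sound:
 assumes sf: "solvable_by_finite G" and R0: "rep N (carrier G) \<phi>0" and inj0: "inj_on \<phi>0 (carrier G)" and N: "N > 0"
  and S: "S <= carrier G" "carrier G = generate G S" and gens: "toM N ` set gens = \<phi>0 ` S"
  and cert: "certified N gens k"
 shows "ser {\<one>} (carrier G) k"
proof -
 from cert obtain g h si ts rs bs ds D J where C: "cert N gens k g h si ts rs bs ds D J"
  unfolding certified_def by blast
 note C' = C[unfolded cert_def eqL_iff hullL_iff toM_mulL toM_idL toM_powL bndL_iff smallL_iff]
 have C1: "toM N g * toM N h = 1m N" "toM N h * toM N g = 1m N"
  and Cg1: "ALL s:set (gensL N g h gens). EX s':set si. toM N s * toM N s' = 1m N"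
  and Cg2: "ALL s':set si. EX s:set (gensL N g h gens). toM N s * toM N s' = 1m N"
  and Cts: "ALL t:set ts. EX w. toM N t = toM N (wordL N (gensL N g h gens @ si) w)"
  and Crs: "ALL t:set rs. EX w. toM N t = toM N (wordL N (gensL N g h gens @ si) w)"
  and Cbs: "ALL b:set bs. EX w. toM N (fst b) = toM N (wordL N ts w)"
  and Cinv: "ALL t:set ts. EX t':set ts. toM N t * toM N t' = 1m N"
  and Cone: "EX r:set rs. toM N r = 1m N"
  and Csch: "ALL r:set rs. ALL s:set (gensL N g h gens @ si). EX t:set ts. EX r':set rs. toM N r * toM N s = toM N t * toM N r'"
  and Cbas: "basisL N bs"
  and Cconj: "ALL t:set ts. ALL t':set ts. toM N t * toM N t' ~= 1m N |
   (ALL b:set bs. hull_witness N (map (toM N) (map fst bs)) (toM N t * toM N (fst b) * toM N t'))"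
  and Ccomm: "ALL t:set ts. ALL t':set ts. ALL u:set ts. ALL u':set ts. toM N t * toM N t' ~= 1m N | toM N u * toM N u' ~= 1m N |
   hull_witness N (map (toM N) (map fst bs)) (toM N t * toM N u * toM N t' * toM N u')"
  and Cds: "ALL d:set ds. (EX t:set ts. fst d = t) & toM N (fst d) * toM N (snd d) = 1m N &
   bnd N D 1 (cmat (toM N (fst d))) & bnd N D 1 (cmat (toM N (snd d)))"
  and CDJ: "0 < D" "0 < J"
  and Cbox: "ALL p:set (boxL (box_size N D J (length ds)) (length ds)). (ALL e:set p. e = 0) | ~ small_traces N J (toM N (ppL N ds p))"
  and Ctor: "ALL t:set ts. EX m. EX es. 0 < m & length es = length ds &
   hull_witness N (map (toM N) (map fst bs)) (toM N t ^m m * toM N (ppL N ds es))"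
  and Ck: "k = length bs + length ds"
  using C' by - (elim conjE, assumption)+
 define \<phi> where "\<phi> x = toM N g * \<phi>0 x * toM N h" for x
 have gh: "inv_pair N (toM N g) (toM N h)" unfolding inv_pair_def using C1 by simp
 have R: "rep N (carrier G) \<phi>" unfolding \<phi>_def by (rule rep_conj[OF R0 gh])
 have inj: "inj_on \<phi> (carrier G)" unfolding \<phi>_def by (rule inj_conj[OF R0 inj0 gh])
 note rD = repD[OF R]
 define S' where "S' = S \<union> (%x. inv x) ` S"
 note S' = symmetric_generators[OF S, folded S'_def]
 \<comment> \<open>By injectivity of \<open>\<phi>\<close>, a listed matrix that is a word in the
   generators and their inverses belongs to exactly one group element.\<close>
 define \<psi> where "\<psi> A = inv_into (carrier G) \<phi> (toM N A)" for A
 have psi: "\<psi> A : carrier G" "\<phi> (\<psi> A) = toM N A" if "toM N A : \<phi> ` carrier G" for A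
  using that unfolding \<psi>_def by (auto simp: inv_into_into f_inv_into_f)
 have psi_eq: "\<psi> A = x" if "x : carrier G" "\<phi> x = toM N A" for A x
  unfolding \<psi>_def that(2)[symmetric] by (rule inv_into_f_f[OF inj that(1)])
 have inv_eq: "y = inv x" if "x : carrier G" "y : carrier G" "\<phi> x * \<phi> y = 1m N" for x y
 proof -
  have "\<phi> (x ** y) = \<phi> \<one>" using rD(3,4) that by simp
  hence "x ** y = \<one>" by (rule inj_onD[OF inj]) (use that in auto)
  from inv_equality[OF inv_comm[OF this that(1,2)] that(1,2)] show ?thesis by (rule sym)
 qed
 let ?SS = "gensL N g h gens @ si"
 have gen_img: "toM N ` set (gensL N g h gens) = \<phi> ` S"
 proof -
  have "toM N ` set (gensL N g h gens) = (%A. toM N g * A * toM N h) ` (toM N ` set gens)"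
   unfolding gensL_def by (auto simp: image_image)
  thus ?thesis unfolding gens \<phi>_def by (simp add: image_image)
 qed
 have SS1: "toM N a : \<phi> ` S'" if a: "a : set ?SS" for a
 proof (cases "a : set (gensL N g h gens)")
  case True
  thus ?thesis using gen_img unfolding S'_def by blast
 next
  case False
  hence "a : set si" using a by simp
  then obtain s where s: "s : set (gensL N g h gens)" "toM N s * toM N a = 1m N" using Cg2 by blast
  obtain x where x: "x : S" "toM N s = \<phi> x" using gen_img s(1) by blast
  have xc: "x : carrier G" using x(1) S(1) by blast
  have "toM N a = \<phi> (inv x)" using rep_right_inverse[OF R xc toM_carrier] s(2) unfolding x(2) .
  thus ?thesis using x(1) unfolding S'_def by blast
 qed
 have SS2: "EX a:set ?SS. toM N a = \<phi> s" if s: "s : S'" for s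
 proof (cases "s : S")
  case True
  hence "\<phi> s : toM N ` set (gensL N g h gens)" using gen_img by blast
  thus ?thesis by auto
 next
  case False
  then obtain x where x: "x : S" "s = inv x" using s unfolding S'_def by blast
  have xc: "x : carrier G" using x(1) S(1) by blast
  have "\<phi> x : toM N ` set (gensL N g h gens)" using gen_img x(1) by blast
  then obtain a where a: "a : set (gensL N g h gens)" "toM N a = \<phi> x" by auto
  then obtain b where b: "b : set si" "toM N a * toM N b = 1m N" using Cg1 by blast
  have "toM N b = \<phi> (inv x)" using rep_right_inverse[OF R xc toM_carrier] b(2) unfolding a(2) .
  thus ?thesis using b(1) x(2) by auto
 qed
 have SSG: "toM N a : \<phi> ` carrier G" if "a : set ?SS" for a using SS1[OF that] S'(1) by blast
 have tsI: "toM N t : \<phi> ` carrier G" if t: "t : set ts" for t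
 proof -
  obtain w where w: "toM N t = toM N (wordL N ?SS w)" using bspec[OF Cts t] by blast
  show ?thesis unfolding w by (rule rep_wordL[OF R subgroup_self SSG])
 qed
 have rsI: "toM N t : \<phi> ` carrier G" if t: "t : set rs" for t
 proof -
  obtain w where w: "toM N t = toM N (wordL N ?SS w)" using bspec[OF Crs t] by blast
  show ?thesis unfolding w by (rule rep_wordL[OF R subgroup_self SSG])
 qed
 note tsp = psi[OF tsI] and rsp = psi[OF rsI]
 define T where "T = generate G (\<psi> ` set ts)"
 have tsc: "\<psi> ` set ts <= carrier G" using tsp(1) by blast
 have Ts: "subgroup T G" unfolding T_def by (rule generate_is_subgroup[OF tsc])
 have TG: "T <= carrier G" by (rule subgroup.subset[OF Ts])
 have tsT: "toM N t : \<phi> ` T" if "t : set ts" for t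
 proof -
  have "\<psi> t : T" unfolding T_def using that by (intro generate.incl) auto
  from imageI[OF this, of \<phi>] show ?thesis unfolding tsp(2)[OF that] .
 qed
 have bsT: "toM N (fst b) : \<phi> ` T" if b: "b : set bs" for b
 proof -
  obtain w where w: "toM N (fst b) = toM N (wordL N ts w)" using bspec[OF Cbs b] by blast
  show ?thesis unfolding w by (rule rep_wordL[OF R Ts tsT])
 qed
 have bsI: "toM N (fst b) : \<phi> ` carrier G" if "b : set bs" for b using bsT[OF that] TG by blast
 have bspT: "\<psi> (fst b) : T" if "b : set bs" for b
 proof -
  obtain x where "x : T" "toM N (fst b) = \<phi> x" using bsT[OF \<open>b : set bs\<close>] by blast
  thus ?thesis using psi_eq[of x "fst b"] TG by auto
 qed
 define bs' where "bs' = map (%b. \<psi> (fst b)) bs"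
 have bsm: "map \<phi> bs' = map (toM N) (map fst bs)" unfolding bs'_def using psi(2)[OF bsI] by simp
 have mb: "mbasis N 0 (map (toM N) (map fst bs))" using basisL_mbasis[OF Cbas, of 0] by (simp add: comp_def)
 let ?E = "rhull N (map (toM N) (map fst bs))"
 note hw = hull_witness_iff[OF mb]
 have invt: "EX t':set ts. inv (\<psi> t) = \<psi> t' & toM N t * toM N t' = 1m N" if t: "t : set ts" for t
 proof -
  obtain t' where t': "t' : set ts" "toM N t * toM N t' = 1m N" using Cinv t by blast
  have "\<psi> t' = inv (\<psi> t)" by (rule inv_eq) (use tsp t t' in auto)
  thus ?thesis using t' by (intro bexI[of _ t']) simp_all
 qed
 define ds' where "ds' = map (%d. \<psi> (fst d)) ds"
 have dsp: "\<psi> (fst d) : carrier G & \<phi> (\<psi> (fst d)) = toM N (fst d) & \<phi> (inv (\<psi> (fst d))) = toM N (snd d)" if d: "d : set ds" for d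
 proof -
  have t: "fst d : set ts" "toM N (fst d) * toM N (snd d) = 1m N" using Cds d by auto
  let ?x = "\<psi> (fst d)"
  have xc: "?x : carrier G" and xp: "\<phi> ?x = toM N (fst d)" using tsp[OF t(1)] by auto
  have "toM N (snd d) = \<phi> (inv ?x)" using rep_right_inverse[OF R xc toM_carrier] t(2) unfolding xp .
  thus ?thesis using xc xp by simp
 qed
 have pp: "\<phi> (prod_pow ds' p) = toM N (ppL N ds p)" if "length p = length ds" for p
  using rep_ppL[OF R that, of "%d. \<psi> (fst d)" "%d. d"] dsp unfolding ds'_def by simp
 have ds'c: "set ds' <= carrier G" unfolding ds'_def using dsp by auto
 have "hcert N \<phi> S' (map \<psi> ts) (map \<psi> rs) bs' ds' D J"
  unfolding hcert_def bsm
 proof (intro conjI)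
  show "set (map \<psi> ts) <= carrier G" "set (map \<psi> rs) <= carrier G" using tsp(1) rsp(1) by auto
  show "ALL t:set (map \<psi> ts). inv t : set (map \<psi> ts)" using invt by fastforce
  obtain r where r: "r : set rs" "toM N r = 1m N" using Cone by blast
  have "\<psi> r = \<one>" by (rule psi_eq) (use r(2) rD(4) in simp_all)
  thus "\<one> : set (map \<psi> rs)" using r(1) by force
  show "ALL r:set (map \<psi> rs). ALL s:S'. EX t:set (map \<psi> ts). EX r':set (map \<psi> rs). r ** s = t ** r'"
  proof (intro ballI)
   fix x s assume "x : set (map \<psi> rs)" and s: "s : S'"
   then obtain r where r: "r : set rs" "x = \<psi> r" by auto
   obtain a where a: "a : set ?SS" "toM N a = \<phi> s" using SS2[OF s] by blast
   obtain t r' where t: "t : set ts" "r' : set rs" "toM N r * toM N a = toM N t * toM N r'" using Csch r(1) a(1) by blast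
   have c: "\<psi> r : carrier G" "s : carrier G" "\<psi> t : carrier G" "\<psi> r' : carrier G"
    using rsp(1) tsp(1) r t s S'(1) by auto
   have "\<phi> (\<psi> r ** s) = \<phi> (\<psi> t ** \<psi> r')"
    unfolding rD(3)[OF c(1,2)] rD(3)[OF c(3,4)] rsp(2)[OF r(1)] tsp(2)[OF t(1)] rsp(2)[OF t(2)] a(2)[symmetric] by (rule t(3))
   hence "\<psi> r ** s = \<psi> t ** \<psi> r'" by (rule inj_onD[OF inj]) (use c in auto)
   thus "EX t:set (map \<psi> ts). EX r':set (map \<psi> rs). x ** s = t ** r'" using t(1,2) r(2) by auto
  qed
  show "set bs' <= generate G (set (map \<psi> ts))" unfolding bs'_def using bspT unfolding T_def by auto
  show "mbasis N 0 (map (toM N) (map fst bs))" by (rule mb)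
  show "ALL t:set (map \<psi> ts). ALL b:set bs'. \<phi> (t ** b ** inv t) : ?E"
  proof (intro ballI)
   fix x y assume "x : set (map \<psi> ts)" "y : set bs'"
   then obtain t b where tb: "t : set ts" "x = \<psi> t" "b : set bs" "y = \<psi> (fst b)" unfolding bs'_def by auto
   obtain t' where t': "t' : set ts" "inv (\<psi> t) = \<psi> t'" "toM N t * toM N t' = 1m N" using invt[OF tb(1)] by blast
   have "toM N t * toM N (fst b) * toM N t' : ?E"
    using Cconj tb(1,3) t'(1,3) hw by blast
   moreover have "\<phi> (\<psi> t ** \<psi> (fst b) ** \<psi> t') = toM N t * toM N (fst b) * toM N t'"
    using rD(3) tsp[OF tb(1)] tsp[OF t'(1)] psi[OF bsI[OF tb(3)]] by simp
   ultimately show "\<phi> (x ** y ** inv x) : ?E" using tb t'(2) by simp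
  qed
  show "ALL t:set (map \<psi> ts). ALL t':set (map \<psi> ts). \<phi> (t ** t' ** inv t ** inv t') : ?E"
  proof (intro ballI)
   fix x y assume "x : set (map \<psi> ts)" "y : set (map \<psi> ts)"
   then obtain t u where tu: "t : set ts" "x = \<psi> t" "u : set ts" "y = \<psi> u" by auto
   obtain t' where t': "t' : set ts" "inv (\<psi> t) = \<psi> t'" "toM N t * toM N t' = 1m N" using invt[OF tu(1)] by blast
   obtain u' where u': "u' : set ts" "inv (\<psi> u) = \<psi> u'" "toM N u * toM N u' = 1m N" using invt[OF tu(3)] by blast
   have "toM N t * toM N u * toM N t' * toM N u' : ?E"
    using Ccomm tu(1,3) t'(1,3) u'(1,3) hw by blast
   moreover have "\<phi> (\<psi> t ** \<psi> u ** \<psi> t' ** \<psi> u') = toM N t * toM N u * toM N t' * toM N u'"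
    using rD(3) tsp[OF tu(1)] tsp[OF tu(3)] tsp[OF t'(1)] tsp[OF u'(1)] by simp
   ultimately show "\<phi> (x ** y ** inv x ** inv y) : ?E" using tu t'(2) u'(2) by simp
  qed
  show "set ds' <= set (map \<psi> ts)" unfolding ds'_def using Cds by auto
  show "0 < D" "0 < J" by (rule CDJ)+
  show "ALL d:set ds'. bnd N D 1 (cmat (\<phi> d)) & bnd N D 1 (cmat (\<phi> (inv d)))"
   unfolding ds'_def using Cds dsp by auto
  show "ALL p. length p = length ds' --> (EX e:set p. e ~= 0) --> (ALL e:set p. \<bar>e\<bar> <= int (box_size N D J (length ds'))) -->
    ~ small_traces N J (\<phi> (prod_pow ds' p))"
  proof (intro allI impI)
   fix p :: "int list" assume p: "length p = length ds'" "EX e:set p. e ~= 0" "ALL e:set p. \<bar>e\<bar> <= int (box_size N D J (length ds'))"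
   have l: "length ds' = length ds" unfolding ds'_def by simp
   have "p : set (boxL (box_size N D J (length ds)) (length ds))" unfolding set_boxL using p l by simp
   thus "~ small_traces N J (\<phi> (prod_pow ds' p))" using Cbox p(2) pp[of p] p(1) l by auto
  qed
  show "ALL t:set (map \<psi> ts). EX m>0. EX es. length es = length ds' & \<phi> (t [^] (m::nat) ** prod_pow ds' es) : ?E"
  proof
   fix x assume "x : set (map \<psi> ts)"
   then obtain t where t: "t : set ts" "x = \<psi> t" by auto
   obtain m es where m: "0 < m" "length es = length ds"
    "hull_witness N (map (toM N) (map fst bs)) (toM N t ^m m * toM N (ppL N ds es))" using Ctor t(1) by blast
   have "prod_pow ds' es : carrier G" by (rule prod_pow_closed[OF subgroup_self ds'c])
   hence "\<phi> (x [^] m ** prod_pow ds' es) = toM N t ^m m * toM N (ppL N ds es)"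
    using rD(3)[of "x [^] m"] rep_pow[OF R tsp(1)[OF t(1)], of m] tsp[OF t(1)] pp[OF m(2)] t(2) by simp
   hence "\<phi> (x [^] m ** prod_pow ds' es) : ?E" using m(3) hw by simp
   thus "EX m>0. EX es. length es = length ds' & \<phi> (x [^] (m::nat) ** prod_pow ds' es) : ?E"
    using m(1,2) unfolding ds'_def by auto
  qed
 qed
 from hcert_sound[OF sf R inj N S' this] show ?thesis unfolding Ck bs'_def ds'_def by simp
qed

end

lemma neq_disjI: "(x = y ==> Q) ==> x ~= y | Q"
 by blast

context group
begin

lemma generate_word:
 assumes R: "rep N (carrier G) \<phi>" and Y: "Y <= carrier G"
  and As: "!!s. s : Y ==> EX a:set As. toM N a = \<phi> s" "!!s. s : Y ==> EX a:set As. toM N a = \<phi> (inv s)"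
  and x: "x : generate G Y"
 shows "EX w. \<phi> x = toM N (wordL N As w)"
 using x
proof (induction rule: generate.induct)
 case one
 show ?case using repD(4)[OF R] by (intro exI[of _ "[]"]) simp
next
 case (incl s)
 obtain a where a: "a : set As" "toM N a = \<phi> s" using As(1)[OF incl] by blast
 obtain i where "i < length As" "As ! i = a" using a(1) by (auto simp: in_set_conv_nth)
 thus ?case using a(2) right_mult_one_mat[OF toM_carrier[of N a]] by (intro exI[of _ "[i]"]) (simp add: nth_default_nth)
next
 case (inv s)
 obtain a where a: "a : set As" "toM N a = \<phi> (inv s)" using As(2)[OF inv] by blast
 obtain i where "i < length As" "As ! i = a" using a(1) by (auto simp: in_set_conv_nth)
 thus ?case using a(2) right_mult_one_mat[OF toM_carrier[of N a]] by (intro exI[of _ "[i]"]) (simp add: nth_default_nth)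
next
 case (eng x y)
 obtain v w where vw: "\<phi> x = toM N (wordL N As v)" "\<phi> y = toM N (wordL N As w)" using eng.IH by blast
 have "x : carrier G" "y : carrier G" using eng.hyps generate_in_carrier[OF Y] by auto
 hence "\<phi> (x ** y) = toM N (wordL N As (v @ w))" using repD(3)[OF R] unfolding wordL_append vw[symmetric] by simp
 thus ?case by blast
qed

text \<open>A certificate in the group is transcribed: the words come from generation by
  \<open>S'\<close>, the inverses and leading positions of the basis from
  \<open>mbasis_basisL\<close>.\<close>

lemma certified_complete:
 assumes sf: "solvable_by_finite G" and R0: "rep N (carrier G) \<phi>0"
  and S: "finite S" "S <= carrier G" "carrier G = generate G S" and gens: "toM N ` set gens = \<phi>0 ` S"
 shows "EX k. certified N gens k"
proof -
 define S' where "S' = S \<union> (%x. inv x) ` S"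
 note S' = symmetric_generators[OF S(2,3), folded S'_def]
 have "finite S'" using S(1) unfolding S'_def by simp
 from hcert_complete[OF sf R0 this S'(1)] obtain g h ts rs bs ds D J
  where gh: "inv_pair N g h" and C: "hcert N (%x. g * \<phi>0 x * h) S' ts rs bs ds D J" by blast
 define \<phi> where "\<phi> x = g * \<phi>0 x * h" for x
 have R: "rep N (carrier G) \<phi>" unfolding \<phi>_def by (rule rep_conj[OF R0 gh])
 note rD = repD[OF R]
 note C' = C[folded \<phi>_def, unfolded hcert_def]
 have tsc: "set ts <= carrier G"
  and Cinv: "ALL t:set ts. inv t : set ts"
  and rsc: "set rs <= carrier G"
  and Cone: "\<one> : set rs"
  and Csch: "ALL r:set rs. ALL s:S'. EX t:set ts. EX r':set rs. r ** s = t ** r'"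
  and bsT: "set bs <= generate G (set ts)"
  and mb: "mbasis N 0 (map \<phi> bs)"
  and Cconj: "ALL t:set ts. ALL b:set bs. \<phi> (t ** b ** inv t) : rhull N (map \<phi> bs)"
  and Ccomm: "ALL t:set ts. ALL t':set ts. \<phi> (t ** t' ** inv t ** inv t') : rhull N (map \<phi> bs)"
  and dst: "set ds <= set ts"
  and CD: "0 < D"
  and CJ: "0 < J"
  and Cds: "ALL d:set ds. bnd N D 1 (cmat (\<phi> d)) & bnd N D 1 (cmat (\<phi> (inv d)))"
  and Cbox: "ALL p. length p = length ds --> (EX e:set p. e ~= 0) --> (ALL e:set p. \<bar>e\<bar> <= int (box_size N D J (length ds))) -->
    ~ small_traces N J (\<phi> (prod_pow ds p))"
  and Ctor: "ALL t:set ts. EX m>0. EX es. length es = length ds & \<phi> (t [^] (m::nat) ** prod_pow ds es) : rhull N (map \<phi> bs)"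
  using C' by - (elim conjE, assumption)+
 define L where "L x = mat_to_list (\<phi> x)" for x
 have L: "toM N (L x) = \<phi> x" if "x : carrier G" for x unfolding L_def by (rule toM_mat_to_list[OF rD(2)[OF that]])
 have ghc: "g : sqm N" "h : sqm N" "g * h = 1m N" "h * g = 1m N" using gh unfolding inv_pair_def by auto
 define gl hl where "gl = mat_to_list g" and "hl = mat_to_list h"
 have ghl: "toM N gl = g" "toM N hl = h" unfolding gl_def hl_def using ghc by simp_all
 obtain sl where sl: "set sl = S" using finite_list[OF S(1)] by blast
 define si where "si = map (%s. L (inv s)) sl"
 let ?SS = "gensL N gl hl gens @ si"
 have Sc: "s : carrier G" if "s : S" for s using that S(2) by blast
 have gen_img: "toM N ` set (gensL N gl hl gens) = \<phi> ` S"
 proof -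
  have "toM N ` set (gensL N gl hl gens) = (%A. g * A * h) ` (toM N ` set gens)"
   unfolding gensL_def by (auto simp: image_image ghl)
  thus ?thesis unfolding gens \<phi>_def by (simp add: image_image)
 qed
 have si_img: "toM N ` set si = (%s. \<phi> (inv s)) ` S"
  unfolding si_def set_map sl image_image by (rule image_cong) (use L Sc in auto)
 have SS_img: "toM N ` set ?SS = \<phi> ` S'" unfolding set_append image_Un gen_img si_img S'_def by (simp add: image_Un image_image)
 have w_SS: "EX w. \<phi> x = toM N (wordL N ?SS w)" if "x : carrier G" for x
 proof (rule generate_word[OF R S'(1)])
  have *: "EX a:set ?SS. toM N a = \<phi> s" if "s : S'" for s
  proof -
   have "\<phi> s : toM N ` set ?SS" unfolding SS_img using that by (rule imageI)
   thus ?thesis by (auto simp del: set_append)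
  qed
  show "EX a:set ?SS. toM N a = \<phi> s" if "s : S'" for s by (rule *[OF that])
  show "EX a:set ?SS. toM N a = \<phi> (inv s)" if "s : S'" for s by (rule *[OF S'(3)[OF that]])
  show "x : generate G S'" using that S'(2) by simp
 qed
 have tc: "t : carrier G" "inv t : set ts" if "t : set ts" for t using that tsc Cinv by auto
 have rc: "r : carrier G" if "r : set rs" for r using that rsc by auto
 have bc: "b : carrier G" if "b : set bs" for b using that bsT generate_in_carrier[OF tsc] by blast
 have inv1: "\<phi> x * \<phi> y = 1m N <-> \<phi> y = \<phi> (inv x)" if x: "x : carrier G" and y: "y : carrier G" for x y
 proof
  assume e: "\<phi> x * \<phi> y = 1m N"
  have "\<phi> (inv x) * (\<phi> x * \<phi> y) = (\<phi> (inv x) * \<phi> x) * \<phi> y"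
   by (rule assoc_mult_mat[symmetric, OF rD(2)[OF inv_closed[OF x]] rD(2)[OF x] rD(2)[OF y]])
  thus "\<phi> y = \<phi> (inv x)" unfolding e rD(6)[OF x] right_mult_one_mat[OF rD(2)[OF inv_closed[OF x]]] left_mult_one_mat[OF rD(2)[OF y]] by (rule sym)
 next
  assume e: "\<phi> y = \<phi> (inv x)"
  show "\<phi> x * \<phi> y = 1m N" unfolding e by (rule rD(5)[OF x])
 qed
 have mbl: "map (toM N) (map L bs) = map \<phi> bs" using L[OF bc] by simp
 have "mbasis N 0 (map (toM N) (map L bs))" unfolding mbl by (rule mb)
 from mbasis_basisL[OF this] obtain bl where bl: "map fst bl = map L bs" "basisL N bl" by blast
 have lbl: "length bl = length bs" using arg_cong[OF bl(1), of length] by simp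
 have hw: "hull_witness N (map (toM N) (map fst bl)) u <-> u : rhull N (map \<phi> bs)" for u
  unfolding bl(1) mbl by (rule hull_witness_iff[OF mb])
 have blb: "EX b:set bs. fst c = L b" if "c : set bl" for c
 proof -
  have "fst c : set (map fst bl)" using that by simp
  thus ?thesis unfolding bl(1) by auto
 qed
 define dl where "dl = map (%d. (L d, L (inv d))) ds"
 have dc: "d : carrier G" "d : set ts" if "d : set ds" for d using that dst tsc by auto
 have pp: "\<phi> (prod_pow ds p) = toM N (ppL N dl p)" if p: "length p = length ds" for p
  using rep_ppL[OF R p, of "%d. d" "%d. (L d, L (inv d))"] dc(1) L unfolding dl_def by simp
 have "cert N gens (length bl + length dl) gl hl si (map L ts) (map L rs) bl dl D J"
  unfolding cert_def eqL_iff hullL_iff toM_mulL toM_idL toM_powL bndL_iff smallL_iff ghl hw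
 proof (intro conjI)
  show "g * h = 1m N" "h * g = 1m N" by (rule ghc)+
  show "ALL s:set (gensL N gl hl gens). EX s':set si. toM N s * toM N s' = 1m N"
  proof
   fix a assume "a : set (gensL N gl hl gens)"
   then obtain s where s: "s : S" "toM N a = \<phi> s" using gen_img by blast
   have "\<phi> (inv s) : toM N ` set si" unfolding si_img using s(1) by blast
   then obtain b where b: "b : set si" "toM N b = \<phi> (inv s)" by auto
   show "EX s':set si. toM N a * toM N s' = 1m N" by (rule bexI[OF _ b(1)]) (simp add: s(2) b(2) rD(5)[OF Sc[OF s(1)]])
  qed
  show "ALL s':set si. EX s:set (gensL N gl hl gens). toM N s * toM N s' = 1m N"
  proof
   fix b assume "b : set si"
   then obtain s where s: "s : S" "toM N b = \<phi> (inv s)" using si_img by blast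
   have "\<phi> s : toM N ` set (gensL N gl hl gens)" unfolding gen_img using s(1) by blast
   then obtain a where a: "a : set (gensL N gl hl gens)" "toM N a = \<phi> s" by auto
   show "EX s:set (gensL N gl hl gens). toM N s * toM N b = 1m N" by (rule bexI[OF _ a(1)]) (simp add: s(2) a(2) rD(5)[OF Sc[OF s(1)]])
  qed
  show "ALL t:set (map L ts). EX w. toM N t = toM N (wordL N ?SS w)" using w_SS L tc(1) by simp
  show "ALL t:set (map L rs). EX w. toM N t = toM N (wordL N ?SS w)" using w_SS L rc by simp
  show "ALL b:set bl. EX w. toM N (fst b) = toM N (wordL N (map L ts) w)"
  proof
   fix c assume "c : set bl"
   then obtain b where b: "b : set bs" "fst c = L b" using blb by blast
   have "EX w. \<phi> b = toM N (wordL N (map L ts) w)"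
    by (rule generate_word[OF R tsc]) (use L tc b(1) bsT in auto)
   thus "EX w. toM N (fst c) = toM N (wordL N (map L ts) w)" unfolding b(2) L[OF bc[OF b(1)]] .
  qed
  show "ALL t:set (map L ts). EX t':set (map L ts). toM N t * toM N t' = 1m N"
  proof
   fix a assume "a : set (map L ts)"
   then obtain t where t: "t : set ts" "a = L t" by auto
   show "EX t':set (map L ts). toM N a * toM N t' = 1m N"
    by (rule bexI[of _ "L (inv t)"]) (use t L tc rD(5) in auto)
  qed
  show "EX r:set (map L rs). toM N r = 1m N" by (rule bexI[of _ "L \<one>"]) (use L rD(4) Cone in auto)
  show "ALL r:set (map L rs). ALL s:set ?SS. EX t:set (map L ts). EX r':set (map L rs). toM N r * toM N s = toM N t * toM N r'"
  proof (intro ballI)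
   fix a c assume "a : set (map L rs)" and c: "c : set ?SS"
   then obtain r where r: "r : set rs" "a = L r" by auto
   have "toM N c : \<phi> ` S'" unfolding SS_img[symmetric] using c by (rule imageI)
   then obtain s where s: "s : S'" "toM N c = \<phi> s" by blast
   obtain t r' where t: "t : set ts" "r' : set rs" "r ** s = t ** r'" using Csch r(1) s(1) by blast
   have sc: "s : carrier G" using s(1) S'(1) by blast
   have "\<phi> r * \<phi> s = \<phi> t * \<phi> r'" unfolding rD(3)[OF rc[OF r(1)] sc, symmetric] rD(3)[OF tc(1)[OF t(1)] rc[OF t(2)], symmetric] t(3) ..
   hence "toM N a * toM N c = toM N (L t) * toM N (L r')" unfolding r(2) s(2) L[OF rc[OF r(1)]] L[OF tc(1)[OF t(1)]] L[OF rc[OF t(2)]] .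
   thus "EX t:set (map L ts). EX r':set (map L rs). toM N a * toM N c = toM N t * toM N r'" using t(1,2) by (auto simp del: set_append)
  qed
  show "basisL N bl" by (rule bl)
  show "ALL t:set (map L ts). ALL t':set (map L ts). toM N t * toM N t' ~= 1m N |
   (ALL b:set bl. toM N t * toM N (fst b) * toM N t' : rhull N (map \<phi> bs))"
  proof (intro ballI neq_disjI)
   fix a a' c assume "a : set (map L ts)" "a' : set (map L ts)" and c: "c : set bl" and e: "toM N a * toM N a' = 1m N"
   obtain b where b: "b : set bs" "fst c = L b" using blb[OF c] by blast
   from \<open>a : _\<close> \<open>a' : _\<close> b obtain t t' where t: "t : set ts" "a = L t" "t' : set ts" "a' = L t'" "b : set bs" "fst c = L b" by auto
   note cc = tc(1)[OF t(1)] tc(1)[OF t(3)] bc[OF t(5)]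
   have e': "\<phi> t' = \<phi> (inv t)" using e inv1[OF cc(1,2)] unfolding t(2,4) L[OF cc(1)] L[OF cc(2)] by blast
   have "\<phi> (t ** b ** inv t) = \<phi> t * \<phi> b * \<phi> t'" unfolding e' using rD(3) cc by simp
   moreover have "\<phi> (t ** b ** inv t) : rhull N (map \<phi> bs)" using Cconj t(1,5) by blast
   ultimately show "toM N a * toM N (fst c) * toM N a' : rhull N (map \<phi> bs)" unfolding t L[OF cc(1)] L[OF cc(2)] L[OF cc(3)] by simp
  qed
  show "ALL t:set (map L ts). ALL t':set (map L ts). ALL u:set (map L ts). ALL u':set (map L ts). toM N t * toM N t' ~= 1m N | toM N u * toM N u' ~= 1m N |
   toM N t * toM N u * toM N t' * toM N u' : rhull N (map \<phi> bs)"
  proof (intro ballI neq_disjI)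
   fix a a' c c' assume "a : set (map L ts)" "a' : set (map L ts)" "c : set (map L ts)" "c' : set (map L ts)"
    and e: "toM N a * toM N a' = 1m N" and f: "toM N c * toM N c' = 1m N"
   then obtain t t' u u' where t: "t : set ts" "a = L t" "t' : set ts" "a' = L t'" "u : set ts" "c = L u" "u' : set ts" "c' = L u'" by auto
   note cc = tc(1)[OF t(1)] tc(1)[OF t(3)] tc(1)[OF t(5)] tc(1)[OF t(7)]
   have e': "\<phi> t' = \<phi> (inv t)" using e inv1[OF cc(1,2)] unfolding t(2,4) L[OF cc(1)] L[OF cc(2)] by blast
   have f': "\<phi> u' = \<phi> (inv u)" using f inv1[OF cc(3,4)] unfolding t(6,8) L[OF cc(3)] L[OF cc(4)] by blast
   have "\<phi> (t ** u ** inv t ** inv u) = \<phi> t * \<phi> u * \<phi> t' * \<phi> u'" unfolding e' f' using rD(3) cc by simp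
   moreover have "\<phi> (t ** u ** inv t ** inv u) : rhull N (map \<phi> bs)" using Ccomm t(1,5) by blast
   ultimately show "toM N a * toM N c * toM N a' * toM N c' : rhull N (map \<phi> bs)"
    unfolding t L[OF cc(1)] L[OF cc(2)] L[OF cc(3)] L[OF cc(4)] by simp
  qed
  show "ALL d:set dl. (EX t:set (map L ts). fst d = t) & toM N (fst d) * toM N (snd d) = 1m N &
   bnd N D 1 (cmat (toM N (fst d))) & bnd N D 1 (cmat (toM N (snd d)))"
  proof
   fix x assume "x : set dl"
   then obtain d where d: "d : set ds" "x = (L d, L (inv d))" unfolding dl_def by auto
   show "(EX t:set (map L ts). fst x = t) & toM N (fst x) * toM N (snd x) = 1m N &
    bnd N D 1 (cmat (toM N (fst x))) & bnd N D 1 (cmat (toM N (snd x)))"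
    using dc[OF d(1)] Cds d(1) rD(5) unfolding d(2) fst_conv snd_conv L[OF dc(1)[OF d(1)]] L[OF inv_closed[OF dc(1)[OF d(1)]]] by auto
  qed
  show "0 < D" "0 < J" by (rule CD, rule CJ)
  show "ALL p:set (boxL (box_size N D J (length dl)) (length dl)). (ALL e:set p. e = 0) | ~ small_traces N J (toM N (ppL N dl p))"
  proof
   fix p assume "p : set (boxL (box_size N D J (length dl)) (length dl))"
   hence p: "length p = length ds" "ALL e:set p. \<bar>e\<bar> <= int (box_size N D J (length ds))" unfolding set_boxL dl_def by auto
   show "(ALL e:set p. e = 0) | ~ small_traces N J (toM N (ppL N dl p))"
    unfolding pp[OF p(1), symmetric] using Cbox p by blast
  qed
  show "ALL t:set (map L ts). EX m es. 0 < m & length es = length dl & toM N t ^m m * toM N (ppL N dl es) : rhull N (map \<phi> bs)"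
  proof
   fix a assume "a : set (map L ts)"
   then obtain t where t: "t : set ts" "a = L t" by auto
   obtain m es where m: "m > (0::nat)" "length es = length ds" "\<phi> (t [^] m ** prod_pow ds es) : rhull N (map \<phi> bs)" using Ctor t(1) by blast
   have pc: "prod_pow ds es : carrier G" by (rule prod_pow_closed[OF subgroup_self]) (use dc in auto)
   have "\<phi> (t [^] m ** prod_pow ds es) = \<phi> t ^m m * toM N (ppL N dl es)"
    using rD(3)[OF nat_pow_closed[OF tc(1)[OF t(1)]] pc] rep_pow[OF R tc(1)[OF t(1)]] pp[OF m(2)] by simp
   thus "EX m es. 0 < m & length es = length dl & toM N a ^m m * toM N (ppL N dl es) : rhull N (map \<phi> bs)"
    using m unfolding t(2) L[OF tc(1)[OF t(1)]] dl_def by auto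
  qed
  show "length bl + length dl = length bl + length dl" ..
 qed
 thus ?thesis by (blast intro: certifiedI)
qed

end

section \<open>The program\<close>

definition input_dim :: "rat list => nat => nat" where
 "input_dim mc n = n * (length mc - 1)"

definition input_gens :: "rat list => nat => rat list list list list => lmat list" where
 "input_gens mc n Ms = map (blockL (length mc - 1) mc (input_dim mc n)) Ms"

lemma tcomp_powx [tc]: "tcomp d ==> tcomp mc ==> tcomp k ==> tcomp v ==> tcomp (%x. powx (d x) (mc x) (k x) (v x))"
proof -
 have b: "tcomp (%p :: nat \<times> rat list \<times> nat \<times> rat list. powx (fst p) (fst (snd p)) (fst (snd (snd p))) (snd (snd (snd p))))"
  unfolding powx_def mulx_def by (intro tcomp_rec_nat tc)
 assume "tcomp d" "tcomp mc" "tcomp k" "tcomp v"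
 thus ?thesis using tcomp_comp[OF b, of "%x. (d x, mc x, k x, v x)"] by (simp add: tc)
qed

lemma tcomp_input_gens:
 "tcomp (%p :: rat list \<times> nat \<times> rat list list list list. input_gens (fst p) (fst (snd p)) (snd (snd p)))"
 unfolding input_gens_def blockL_def input_dim_def by (intro tc)

lemma search_program:
 "EX p. ALL mc n Ms k. certified (input_dim mc n) (input_gens mc n Ms) k -->
   (ALL j. certified (input_dim mc n) (input_gens mc n Ms) j --> j = k) -->
   evaluates p [enc mc, n, enc Ms] k"
proof -
 let ?P = "%x :: (rat list \<times> nat \<times> rat list list list list) \<times> nat.
  certified (input_dim (fst (fst x)) (fst (snd (fst x)))) (input_gens (fst (fst x)) (fst (snd (fst x))) (snd (snd (fst x)))) (snd x)"
 have "tcomp (%x :: (rat list \<times> nat \<times> rat list list list list) \<times> nat.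
  (input_dim (fst (fst x)) (fst (snd (fst x))), input_gens (fst (fst x)) (fst (snd (fst x))) (snd (snd (fst x))), snd x))"
  unfolding input_dim_def by (intro tc tcomp_comp[OF tcomp_input_gens, of fst])
 from re_comp[OF re_certified this] have "re ?P" by simp
 from re_search[OF this] obtain p where p0: "ALL x k. ?P (x, k) --> (ALL j. ?P (x, j) --> j = k) --> evaluates p [enc x] k" ..
 \<comment> \<open>The three arguments of the input list are packed into the single tuple code that
   the search expects.\<close>
 have "rf 3 (%xs. prod_encode (xs ! 0, prod_encode (xs ! 1, xs ! 2)))" by (intro rf_prod_encode rf_proj) auto
 then obtain q where q: "ALL xs. length xs = 3 --> evaluates q xs (prod_encode (xs ! 0, prod_encode (xs ! 1, xs ! 2)))"
  unfolding rf_def ..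
 have "evaluates (Comp p [q]) [enc mc, n, enc Ms] k"
  if that: "certified (input_dim mc n) (input_gens mc n Ms) k" "ALL j. certified (input_dim mc n) (input_gens mc n Ms) j --> j = k" for mc n Ms k
 proof (rule evaluates.comp)
  show "evaluates p [enc (mc, n, Ms)] k"
   by (rule p0[rule_format, of "(mc, n, Ms)" k]) (simp_all only: fst_conv snd_conv that(1) that(2)[rule_format])
  show "list_all2 (%g y. evaluates g [enc mc, n, enc Ms] y) [q] [enc (mc, n, Ms)]"
   using q[rule_format, of "[enc mc, n, enc Ms]"] by (simp add: enc_prod_def enc_nat_def numeral_2_eq_2)
 qed
 thus ?thesis by (intro exI[of _ "Comp p [q]"] allI impI)
qed

text \<open>An identity of lists of numbers, because \<open>enc\<close> was defined to extend the
  encoding of the input.\<close>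

lemma encode_input_eq: "encode_input m n Ms = [enc (coeffs m), n, enc (map (%M. map (map coeffs) (mat_to_list M)) Ms)]"
 unfolding encode_input_def encode_poly_def encode_mat_def enc_list_def by (simp add: comp_def enc_rat_def[abs_def] enc_list_def[abs_def])

theorem mainTheorem6:
  shows "\<exists>HirschNumber :: recf.
    \<forall>(\<alpha> :: complex) (P :: complex set) (m :: rat poly) (n :: nat)
      (S :: complex mat set) (Ms :: rat poly mat list).
      minimal_polynomial m \<alpha> \<longrightarrow>
      P = rat_adjoin \<alpha> \<longrightarrow>
      n \<ge> 1 \<longrightarrow>
      finite S \<longrightarrow>
      S \<subseteq> carrier (GL n P) \<longrightarrow>
      solvable_by_finite (subgroup_generated (GL n P) S) \<longrightarrow>
      presents_matrices m \<alpha> n Ms S \<longrightarrow>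
        finite_torsion_free_rank (subgroup_generated (GL n P) S) \<and>
        evaluates HirschNumber (encode_input m n Ms)
          (hirsch_number (subgroup_generated (GL n P) S))"
proof -
 from search_program obtain p where p: "ALL mc n Ms k. certified (input_dim mc n) (input_gens mc n Ms) k -->
   (ALL j. certified (input_dim mc n) (input_gens mc n Ms) j --> j = k) --> evaluates p [enc mc, n, enc Ms] k" ..
 show ?thesis
 proof (rule exI[of _ p], intro allI impI)
  fix \<alpha> P m n S Ms
  assume min: "minimal_polynomial m \<alpha>" and P: "P = rat_adjoin \<alpha>" and n: "n >= 1" and fin: "finite S"
   and S: "S <= carrier (GL n P)" and sf: "solvable_by_finite (subgroup_generated (GL n P) S)"
   and pres: "presents_matrices m \<alpha> n Ms S"
  define G where "G = subgroup_generated (GL n P) S"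
  define N where "N = n * degree m"
  note E = scalar_embedding[OF min S[unfolded P] pres, folded P, folded G_def N_def]
  interpret G: group G by (rule E(1))
  obtain \<phi> where R: "G.rep N (carrier G) \<phi>" and inj: "inj_on \<phi> (carrier G)"
   and phi: "!!M. M : set Ms ==> \<phi> (map_mat (eval_rat_poly \<alpha>) M) =
     toM N (blockL (degree m) (coeffs m) N (map (map coeffs) (mat_to_list M)))" using E(4) by blast
  define Ls where "Ls = map (%M. map (map coeffs) (mat_to_list M)) Ms"
  \<comment> \<open>\<open>coeffs m\<close> has one entry more than the degree of
    \<open>m\<close>.\<close>
  have dim: "input_dim (coeffs m) n = N" unfolding input_dim_def N_def by (simp add: degree_eq_length_coeffs)
  have "toM N ` set (input_gens (coeffs m) n Ls) = (%M. \<phi> (map_mat (eval_rat_poly \<alpha>) M)) ` set Ms"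
   unfolding input_gens_def dim Ls_def by (auto simp: phi degree_eq_length_coeffs image_image)
  hence gens: "toM N ` set (input_gens (coeffs m) n Ls) = \<phi> ` S"
   using pres unfolding presents_matrices_def by (simp add: image_image)
  have N: "N > 0" unfolding N_def using n deg_pos[OF min] by simp
  have sf': "solvable_by_finite G" using sf unfolding G_def .
  \<comment> \<open>Soundness determines every certified number, which is the uniqueness that the
    search demands.\<close>
  have sound: "finite_torsion_free_rank G & hirsch_number G = k"
   if "certified N (input_gens (coeffs m) n Ls) k" for k
   using G.ser_hirsch_number[OF G.certified_sound[OF sf' R inj N E(2,3) gens that]] by blast
  obtain k where k: "certified N (input_gens (coeffs m) n Ls) k"
   using G.certified_complete[OF sf' R fin E(2,3) gens] by blast
  have "evaluates p [enc (coeffs m), n, enc Ls] k"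
  proof (rule p[rule_format])
   show "certified (input_dim (coeffs m) n) (input_gens (coeffs m) n Ls) k" unfolding dim by (rule k)
   fix j assume "certified (input_dim (coeffs m) n) (input_gens (coeffs m) n Ls) j"
   thus "j = k" using sound[of j] sound[OF k] unfolding dim by simp
  qed
  hence "evaluates p (encode_input m n Ms) (hirsch_number G)"
   using sound[OF k] unfolding encode_input_eq Ls_def by simp
  thus "finite_torsion_free_rank (subgroup_generated (GL n P) S) &
    evaluates p (encode_input m n Ms) (hirsch_number (subgroup_generated (GL n P) S))"
   using sound[OF k] unfolding G_def by blast
 qed
qed

end
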